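(* Let $(A,\{\Delta(\lambda)\}_{\lambda\in\Lambda})$ be a split quasi-hereditary algebra over a commutative Noetherian ring $R$, with costandard modules $\nabla(\lambda)$. Then: (a) Let $M\in\mathcal{F}(\tilde\Delta)$. There is a partial tilting module $T_M$ and a monomorphism $i_M\colon M\to T_M$ such that $\operatorname{coker}i_M\in\mathcal{F}(\Delta)$. (b) Let $\lambda\in\Lambda$. There are a partial tilting module $T(\lambda)$ and exact sequences $$0\to\Delta(\lambda)\to T(\lambda)\to X(\lambda)\to0,\qquad 0\to Y(\lambda)\to T(\lambda)\to\nabla(\lambda)\to0,$$ where $X(\lambda)\in\mathcal{F}(\Delta_{\mu<\lambda})$ and $Y(\lambda)\in\mathcal{F}(\tilde\nabla_{\mu<\lambda})$.
   Context: Let $R$ be a commutative Noetherian ring with identity. A projective Noetherian $R$-algebra is an $R$-algebra that is finitely generated and projective as an $R$-module. $A\text{-mod}$ denotes finitely generated left $A$-modules, $A\text{-proj}$ (resp. $R\text{-proj}$) the finitely generated projective ones, $\operatorname{add}_A M$ the full subcategory of direct summands of finite direct sums of copies of $M$, $D=\operatorname{Hom}_R(-,R)\colon A\text{-mod}\to A^{op}\text{-mod}$. For a set $\theta$ of $A$-modules, $\mathcal{F}(\theta)$ is the full subcategory of $A\text{-mod}$ of modules admitting a finite filtration with successive quotients (isomorphic to modules) in $\theta$ (including the zero module). Split quasi-hereditary: a projective Noetherian $R$-algebra $A$ with a collection $\{\Delta(\lambda)\colon\lambda\in\Lambda\}$ in $A\text{-mod}$ indexed by a finite poset $\Lambda$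 is split quasi-hereditary if: (i) each $\Delta(\lambda)$ is projective over $R$; (ii) $\operatorname{Hom}_A(\Delta(\lambda),\Delta(\mu))\neq0$ implies $\lambda\le\mu$; (iii) $\operatorname{End}_A(\Delta(\lambda))\simeq R$; (iv) for each $\lambda$ there is $P(\lambda)\in A\text{-proj}$ and an exact sequence $0\to C(\lambda)\to P(\lambda)\to\Delta(\lambda)\to0$ such that $C(\lambda)$ has a finite filtration by modules $\Delta(\mu)\otimes_R U_\mu$ with $U_\mu\in R\text{-proj}$, $\mu>\lambda$; (v) $\operatorname{add}_A(\bigoplus_{\lambda}P(\lambda))=A\text{-proj}$. The costandard modules $\{\nabla(\lambda)\}_{\lambda\in\Lambda}$ are the $A$-modules, unique up to isomorphism, such that $(A^{op},\{D\nabla(\lambda)\}_{\lambda\in\Lambda})$ is split quasi-hereditary (same poset) and $\operatorname{Ext}_A^i(\Delta(\lambda),\nabla(\beta))$ is $R$ if $i=0$ and $\lambda=\beta$, and $0$ otherwise. Put $\Delta=\{\Delta(\lambda)\colon\lambda\in\Lambda\}$, $\Delta_{\mu<\lambda}=\{\Delta(\mu)\colon\mu<\lambda\}$, $\tilde{\Delta}=\{\Delta(\lambda)\otimes_R U\colon\lambda\in\Lambda,U\in R\text{-proj}\}$, $\tilde\nabla=\{\nabla(\lambda)\otimes_R U\colon\lambda\in\Lambda,U\in R\text{-proj}\}$, $\tilde\nabla_{\mu<\lambda}=\{\nabla(\mu)\otimes_R U\colon \mu<\lambda, U\in R\text{-proj}\}$. A module $T\in A\text{-mod}$ is (partial) tilting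 if $T\in\mathcal{F}(\tilde\Delta)\cap\mathcal{F}(\tilde\nabla)$. *)

theory Defs
  imports "HOL-Library.Poly_Mapping" "HOL-Algebra.Ring_Divisibility" "HOL-Algebra.Module" "HOL-Algebra.Generated_Groups"
begin

text \<open>
  Modules over a not necessarily commutative ring use the record \<^type>\<open>module\<close> of HOL-Algebra,
  whose ring fields \<open>mult\<close> and \<open>one\<close> carry no information for a module.
  Every finitely generated left \<open>A\<close>-module is isomorphic to a quotient of \<open>A\<^sup>n\<close>, hence to a module
  whose elements are sets of functions \<open>nat \<Rightarrow> 'a\<close>. Quantifiers over finitely generated modules inside
  definitions, and existential ones in general, therefore range over the following type.
\<close>

type_synonym 'a umodule = "('a, (nat \<Rightarrow> 'a) set) module"

locale left_module = A?: ring A + M?: abelian_group M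
  for A :: "('a, 'x) ring_scheme" (structure) and M :: "('a, 'm) module" (structure) +
  assumes smult_closed [simp, intro]:
      "\<lbrakk>a \<in> carrier A; x \<in> carrier M\<rbrakk> \<Longrightarrow> a \<odot>\<^bsub>M\<^esub> x \<in> carrier M"
    and smult_l_distr:
      "\<lbrakk>a \<in> carrier A; b \<in> carrier A; x \<in> carrier M\<rbrakk>
        \<Longrightarrow> (a \<oplus>\<^bsub>A\<^esub> b) \<odot>\<^bsub>M\<^esub> x = a \<odot>\<^bsub>M\<^esub> x \<oplus>\<^bsub>M\<^esub> b \<odot>\<^bsub>M\<^esub> x"
    and smult_r_distr:
      "\<lbrakk>a \<in> carrier A; x \<in> carrier M; y \<in> carrier M\<rbrakk>
        \<Longrightarrow> a \<odot>\<^bsub>M\<^esub> (x \<oplus>\<^bsub>M\<^esub> y) = a \<odot>\<^bsub>M\<^esub> x \<oplus>\<^bsub>M\<^esub> a \<odot>\<^bsub>M\<^esub> y"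
    and smult_assoc:
      "\<lbrakk>a \<in> carrier A; b \<in> carrier A; x \<in> carrier M\<rbrakk>
        \<Longrightarrow> (a \<otimes>\<^bsub>A\<^esub> b) \<odot>\<^bsub>M\<^esub> x = a \<odot>\<^bsub>M\<^esub> (b \<odot>\<^bsub>M\<^esub> x)"
    and smult_one [simp]:
      "x \<in> carrier M \<Longrightarrow> \<one>\<^bsub>A\<^esub> \<odot>\<^bsub>M\<^esub> x = x"

definition fg_module :: "('a, 'x) ring_scheme \<Rightarrow> ('a, 'm) module \<Rightarrow> bool" where
  "fg_module A M \<longleftrightarrow> left_module A M \<and>
     (\<exists>S \<subseteq> carrier M. finite S \<and> (\<forall>N. submodule N A M \<and> S \<subseteq> N \<longrightarrow> N = carrier M))"

text \<open>Homomorphisms are extensional functions, so that equal homomorphisms are equal functions.\<close>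

definition mod_hom ::
  "('a, 'x) ring_scheme \<Rightarrow> ('a, 'm) module \<Rightarrow> ('a, 'n) module \<Rightarrow> ('m \<Rightarrow> 'n) set" where
  "mod_hom A M N = {f \<in> carrier M \<rightarrow>\<^sub>E carrier N.
     (\<forall>x \<in> carrier M. \<forall>y \<in> carrier M. f (x \<oplus>\<^bsub>M\<^esub> y) = f x \<oplus>\<^bsub>N\<^esub> f y) \<and>
     (\<forall>a \<in> carrier A. \<forall>x \<in> carrier M. f (a \<odot>\<^bsub>M\<^esub> x) = a \<odot>\<^bsub>N\<^esub> f x)}"

definition mod_iso ::
  "('a, 'x) ring_scheme \<Rightarrow> ('a, 'm) module \<Rightarrow> ('a, 'n) module \<Rightarrow> bool" where
  "mod_iso A M N \<longleftrightarrow> (\<exists>f \<in> mod_hom A M N. bij_betw f (carrier M) (carrier N))"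

definition mod_ker :: "('a, 'm) module \<Rightarrow> ('a, 'n) module \<Rightarrow> ('m \<Rightarrow> 'n) \<Rightarrow> 'm set" where
  "mod_ker M N f = {x \<in> carrier M. f x = \<zero>\<^bsub>N\<^esub>}"

definition short_exact ::
  "('a, 'x) ring_scheme \<Rightarrow> ('a, 'l) module \<Rightarrow> ('l \<Rightarrow> 'm) \<Rightarrow> ('a, 'm) module \<Rightarrow> ('m \<Rightarrow> 'n)
    \<Rightarrow> ('a, 'n) module \<Rightarrow> bool" where
  "short_exact A L f M g N \<longleftrightarrow> f \<in> mod_hom A L M \<and> g \<in> mod_hom A M N \<and>
     inj_on f (carrier L) \<and> f ` carrier L = mod_ker M N g \<and> g ` carrier M = carrier N"

definition quotient_module :: "('a, 'm) module \<Rightarrow> 'm set \<Rightarrow> ('a, 'm set) module" where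
  "quotient_module M N =
     \<lparr>carrier = a_rcosets\<^bsub>M\<^esub> N, mult = undefined, one = undefined, zero = N, add = set_add M,
      smult = (\<lambda>a C. \<Union>x\<in>C. N +>\<^bsub>M\<^esub> (a \<odot>\<^bsub>M\<^esub> x))\<rparr>"

definition regular_module :: "('a, 'x) ring_scheme \<Rightarrow> ('a, 'a) module" where
  "regular_module A =
     \<lparr>carrier = carrier A, mult = undefined, one = undefined, zero = \<zero>\<^bsub>A\<^esub>, add = add A,
      smult = mult A\<rparr>"

text \<open>The direct sum of a finite family, realised as the product.\<close>

definition dsum :: "'j set \<Rightarrow> ('j \<Rightarrow> ('a, 'm) module) \<Rightarrow> ('a, 'j \<Rightarrow> 'm) module" where
  "dsum J M =
     \<lparr>carrier = (\<Pi>\<^sub>E j\<in>J. carrier (M j)), mult = undefined, one = undefined,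
      zero = (\<lambda>j\<in>J. \<zero>\<^bsub>M j\<^esub>), add = (\<lambda>f g. \<lambda>j\<in>J. f j \<oplus>\<^bsub>M j\<^esub> g j),
      smult = (\<lambda>a f. \<lambda>j\<in>J. a \<odot>\<^bsub>M j\<^esub> f j)\<rparr>"

definition module_power :: "('a, 'm) module \<Rightarrow> nat \<Rightarrow> ('a, nat \<Rightarrow> 'm) module" where
  "module_power M n = dsum {..<n} (\<lambda>_. M)"

abbreviation free_module :: "('a, 'x) ring_scheme \<Rightarrow> nat \<Rightarrow> ('a, nat \<Rightarrow> 'a) module" where
  "free_module A n \<equiv> module_power (regular_module A) n"

definition direct_summand ::
  "('a, 'x) ring_scheme \<Rightarrow> ('a, 'm) module \<Rightarrow> ('a, 'n) module \<Rightarrow> bool" where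
  "direct_summand A X L \<longleftrightarrow> (\<exists>N N'. submodule N A L \<and> submodule N' A L \<and>
     N \<inter> N' = {\<zero>\<^bsub>L\<^esub>} \<and> N <+>\<^bsub>L\<^esub> N' = carrier L \<and> mod_iso A X (L\<lparr>carrier := N\<rparr>))"

definition add_cat ::
  "('a, 'x) ring_scheme \<Rightarrow> ('a, 'n) module \<Rightarrow> ('a, 'm) module set" where
  "add_cat A M = {X. fg_module A X \<and> (\<exists>n. direct_summand A X (module_power M n))}"

text \<open>Finitely generated projective modules are the direct summands of free modules of finite rank.\<close>

definition fg_projective :: "('a, 'x) ring_scheme \<Rightarrow> ('a, 'm) module \<Rightarrow> bool" where
  "fg_projective A P \<longleftrightarrow> fg_module A P \<and> (\<exists>n. direct_summand A P (free_module A n))"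

text \<open>The members of \<open>filt A \<theta>\<close> are the objects of \<open>\<F>(\<theta>)\<close>; length \<open>0\<close> gives the zero module.\<close>

definition filt ::
  "('a, 'x) ring_scheme \<Rightarrow> ('a, 't) module set \<Rightarrow> ('a, 'm) module set" where
  "filt A \<theta> = {M. fg_module A M \<and>
     (\<exists>(n::nat) N. N 0 = {\<zero>\<^bsub>M\<^esub>} \<and> N n = carrier M \<and> (\<forall>i\<le>n. submodule (N i) A M) \<and>
       (\<forall>i<n. N i \<subseteq> N (Suc i) \<and>
         (\<exists>X \<in> \<theta>. mod_iso A (quotient_module (M\<lparr>carrier := N (Suc i)\<rparr>) (N i)) X)))}"

locale r_algebra = module R A + A?: ring A
  for R :: "('r, 'x) ring_scheme" (structure) and A :: "('r, 'a) module" (structure) +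
  assumes smult_mult_left:
      "\<lbrakk>r \<in> carrier R; x \<in> carrier A; y \<in> carrier A\<rbrakk>
        \<Longrightarrow> (r \<odot>\<^bsub>A\<^esub> x) \<otimes>\<^bsub>A\<^esub> y = r \<odot>\<^bsub>A\<^esub> (x \<otimes>\<^bsub>A\<^esub> y)"
    and smult_mult_right:
      "\<lbrakk>r \<in> carrier R; x \<in> carrier A; y \<in> carrier A\<rbrakk>
        \<Longrightarrow> x \<otimes>\<^bsub>A\<^esub> (r \<odot>\<^bsub>A\<^esub> y) = r \<odot>\<^bsub>A\<^esub> (x \<otimes>\<^bsub>A\<^esub> y)"

definition projective_noetherian_algebra :: "('r, 'x) ring_scheme \<Rightarrow> ('r, 'a) module \<Rightarrow> bool" where
  "projective_noetherian_algebra R A \<longleftrightarrow>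
     cring R \<and> noetherian_ring R \<and> r_algebra R A \<and> fg_projective R A"

definition op_algebra :: "('r, 'a) module \<Rightarrow> ('r, 'a) module" where
  "op_algebra A = A\<lparr>mult := (\<lambda>x y. y \<otimes>\<^bsub>A\<^esub> x)\<rparr>"

text \<open>The structure map \<open>R \<rightarrow> A\<close> is \<open>r \<mapsto> r \<odot> \<one>\<close>.\<close>

definition restrict_scalars :: "('r, 'a) module \<Rightarrow> ('a, 'm) module \<Rightarrow> ('r, 'm) module" where
  "restrict_scalars A M =
     \<lparr>carrier = carrier M, mult = undefined, one = undefined, zero = \<zero>\<^bsub>M\<^esub>, add = add M,
      smult = (\<lambda>r x. (r \<odot>\<^bsub>A\<^esub> \<one>\<^bsub>A\<^esub>) \<odot>\<^bsub>M\<^esub> x)\<rparr>"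

definition hom_module ::
  "('r, 'a) module \<Rightarrow> ('a, 'm) module \<Rightarrow> ('a, 'n) module \<Rightarrow> ('r, 'm \<Rightarrow> 'n) module" where
  "hom_module A M N =
     \<lparr>carrier = mod_hom A M N, mult = undefined, one = undefined,
      zero = (\<lambda>x\<in>carrier M. \<zero>\<^bsub>N\<^esub>), add = (\<lambda>f g. \<lambda>x\<in>carrier M. f x \<oplus>\<^bsub>N\<^esub> g x),
      smult = (\<lambda>r f. \<lambda>x\<in>carrier M. (r \<odot>\<^bsub>A\<^esub> \<one>\<^bsub>A\<^esub>) \<odot>\<^bsub>N\<^esub> f x)\<rparr>"

definition end_algebra :: "('r, 'a) module \<Rightarrow> ('a, 'm) module \<Rightarrow> ('r, 'm \<Rightarrow> 'm) module" where
  "end_algebra A M =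
     (hom_module A M M)\<lparr>mult := compose (carrier M), one := (\<lambda>x\<in>carrier M. x)\<rparr>"

text \<open>
  \<open>End\<^sub>A(M) \<simeq> R\<close> as \<open>R\<close>-algebras. An isomorphism of \<open>R\<close>-modules would amount to the same, since
  a generator \<open>f\<close> of \<open>End\<^sub>A(M)\<close> over \<open>R\<close> satisfies \<open>id = r f\<close> and \<open>f\<^sup>2 = s f\<close>, so \<open>r s = 1\<close>.
\<close>

definition end_iso_base :: "('r, 'x) ring_scheme \<Rightarrow> ('r, 'a) module \<Rightarrow> ('a, 'm) module \<Rightarrow> bool" where
  "end_iso_base R A M \<longleftrightarrow> (\<exists>\<phi> \<in> ring_iso R (end_algebra A M).
     \<forall>r \<in> carrier R. \<forall>s \<in> carrier R. \<phi> (r \<otimes>\<^bsub>R\<^esub> s) = r \<odot>\<^bsub>end_algebra A M\<^esub> \<phi> s)"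

text \<open>\<open>D M = Hom\<^sub>R(M, R)\<close> with the action \<open>(a f)(x) = f (a x)\<close>, a left module over the opposite algebra.\<close>

definition dual_module ::
  "('r, 'x) ring_scheme \<Rightarrow> ('r, 'a) module \<Rightarrow> ('a, 'm) module \<Rightarrow> ('a, 'm \<Rightarrow> 'r) module" where
  "dual_module R A M =
     \<lparr>carrier = mod_hom R (restrict_scalars A M) (regular_module R),
      mult = undefined, one = undefined,
      zero = (\<lambda>x\<in>carrier M. \<zero>\<^bsub>R\<^esub>), add = (\<lambda>f g. \<lambda>x\<in>carrier M. f x \<oplus>\<^bsub>R\<^esub> g x),
      smult = (\<lambda>a f. \<lambda>x\<in>carrier M. f (a \<odot>\<^bsub>M\<^esub> x))\<rparr>"

text \<open>
  The free abelian group on \<open>M \<times> U\<close> with the action \<open>a (m, u) = (a m, u)\<close>; it becomes an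
  \<open>A\<close>-module only after passing to the quotient by the bilinearity relations.
\<close>

definition tensor_free ::
  "('a, 'm) module \<Rightarrow> ('r, 'u) module \<Rightarrow> ('a, ('m \<times> 'u) \<Rightarrow>\<^sub>0 int) module" where
  "tensor_free M U =
     \<lparr>carrier = {c. Poly_Mapping.keys c \<subseteq> carrier M \<times> carrier U},
      mult = undefined, one = undefined, zero = 0, add = (+),
      smult = (\<lambda>a. frag_extend (\<lambda>(m, u). frag_of (a \<odot>\<^bsub>M\<^esub> m, u)))\<rparr>"

definition tensor_relations ::
  "('r, 'x) ring_scheme \<Rightarrow> ('r, 'a) module \<Rightarrow> ('a, 'm) module \<Rightarrow> ('r, 'u) module
    \<Rightarrow> (('m \<times> 'u) \<Rightarrow>\<^sub>0 int) set" where
  "tensor_relations R A M U =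
     {frag_of (m \<oplus>\<^bsub>M\<^esub> m', u) - frag_of (m, u) - frag_of (m', u) | m m' u.
        m \<in> carrier M \<and> m' \<in> carrier M \<and> u \<in> carrier U} \<union>
     {frag_of (m, u \<oplus>\<^bsub>U\<^esub> u') - frag_of (m, u) - frag_of (m, u') | m u u'.
        m \<in> carrier M \<and> u \<in> carrier U \<and> u' \<in> carrier U} \<union>
     {frag_of ((r \<odot>\<^bsub>A\<^esub> \<one>\<^bsub>A\<^esub>) \<odot>\<^bsub>M\<^esub> m, u) - frag_of (m, r \<odot>\<^bsub>U\<^esub> u) | r m u.
        r \<in> carrier R \<and> m \<in> carrier M \<and> u \<in> carrier U}"

definition tensor_module ::
  "('r, 'x) ring_scheme \<Rightarrow> ('r, 'a) module \<Rightarrow> ('a, 'm) module \<Rightarrow> ('r, 'u) module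
    \<Rightarrow> ('a, (('m \<times> 'u) \<Rightarrow>\<^sub>0 int) set) module" where
  "tensor_module R A M U =
     quotient_module (tensor_free M U)
       (generate (add_monoid (tensor_free M U)) (tensor_relations R A M U))"

text \<open>\<open>twists R A J M\<close> is \<open>{M j \<otimes> U | j \<in> J, U \<in> R-proj}\<close>.\<close>

definition twists ::
  "('r, 'x) ring_scheme \<Rightarrow> ('r, 'a) module \<Rightarrow> 'i set \<Rightarrow> ('i \<Rightarrow> ('a, 'm) module)
    \<Rightarrow> ('a, (('m \<times> (nat \<Rightarrow> 'r) set) \<Rightarrow>\<^sub>0 int) set) module set" where
  "twists R A J M =
     {tensor_module R A (M j) U | j (U :: 'r umodule). j \<in> J \<and> fg_projective R U}"

text \<open>
  Over a projective Noetherian algebra every finitely generated module has a resolution by free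
  modules \<open>A\<^sup>n\<close> of finite rank, and Ext does not depend on its choice.
\<close>

definition free_resolution ::
  "('a, 'x) ring_scheme \<Rightarrow> ('a, 'm) module \<Rightarrow> (nat \<Rightarrow> nat)
    \<Rightarrow> (nat \<Rightarrow> (nat \<Rightarrow> 'a) \<Rightarrow> (nat \<Rightarrow> 'a)) \<Rightarrow> ((nat \<Rightarrow> 'a) \<Rightarrow> 'm) \<Rightarrow> bool" where
  "free_resolution A M n d e \<longleftrightarrow>
     (\<forall>i. d i \<in> mod_hom A (free_module A (n (Suc i))) (free_module A (n i))) \<and>
     e \<in> mod_hom A (free_module A (n 0)) M \<and>
     e ` carrier (free_module A (n 0)) = carrier M \<and>
     d 0 ` carrier (free_module A (n (Suc 0))) = mod_ker (free_module A (n 0)) M e \<and>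
     (\<forall>i. d (Suc i) ` carrier (free_module A (n (Suc (Suc i)))) =
          mod_ker (free_module A (n (Suc i))) (free_module A (n i)) (d i))"

text \<open>The \<open>i\<close>-th cohomology of the complex \<open>Hom\<^sub>A(A\<^bsup>n 0\<^esup>, N) \<rightarrow> Hom\<^sub>A(A\<^bsup>n 1\<^esup>, N) \<rightarrow> \<dots>\<close>.\<close>

definition hom_cohomology ::
  "('r, 'a) module \<Rightarrow> (nat \<Rightarrow> nat) \<Rightarrow> (nat \<Rightarrow> (nat \<Rightarrow> 'a) \<Rightarrow> (nat \<Rightarrow> 'a))
    \<Rightarrow> ('a, 'n) module \<Rightarrow> nat \<Rightarrow> ('r, ((nat \<Rightarrow> 'a) \<Rightarrow> 'n) set) module" where
  "hom_cohomology A n d N i =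
     (let H = (\<lambda>k. hom_module A (free_module A (n k)) N);
          \<delta> = (\<lambda>k f. compose (carrier (free_module A (n (Suc k)))) f (d k));
          B = (case i of 0 \<Rightarrow> {\<zero>\<^bsub>H 0\<^esub>} | Suc j \<Rightarrow> \<delta> j ` carrier (H j))
      in quotient_module ((H i)\<lparr>carrier := mod_ker (H i) (H (Suc i)) (\<delta> i)\<rparr>) B)"

definition Ext ::
  "('r, 'a) module \<Rightarrow> nat \<Rightarrow> ('a, 'm) module \<Rightarrow> ('a, 'n) module
    \<Rightarrow> ('r, ((nat \<Rightarrow> 'a) \<Rightarrow> 'n) set) module" where
  "Ext A i M N =
     (let (n, d, e) = (SOME (n, d, e). free_resolution A M n d e)
      in hom_cohomology A n d N i)"

text \<open>The finite poset is a finite subset \<open>\<Lambda>\<close> of a partially ordered type.\<close>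

definition split_quasi_hereditary ::
  "('r, 'x) ring_scheme \<Rightarrow> ('r, 'a) module \<Rightarrow> 'i::order set \<Rightarrow> ('i \<Rightarrow> ('a, 'm) module) \<Rightarrow> bool" where
  "split_quasi_hereditary R A \<Lambda> \<Delta> \<longleftrightarrow>
     projective_noetherian_algebra R A \<and> finite \<Lambda> \<and>
     (\<forall>l\<in>\<Lambda>. fg_module A (\<Delta> l)) \<and>
     (\<forall>l\<in>\<Lambda>. fg_projective R (restrict_scalars A (\<Delta> l))) \<and>
     (\<forall>l\<in>\<Lambda>. \<forall>m\<in>\<Lambda>.
        carrier (hom_module A (\<Delta> l) (\<Delta> m)) \<noteq> {\<zero>\<^bsub>hom_module A (\<Delta> l) (\<Delta> m)\<^esub>} \<longrightarrow> l \<le> m) \<and>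
     (\<forall>l\<in>\<Lambda>. end_iso_base R A (\<Delta> l)) \<and>
     (\<exists>P :: 'i \<Rightarrow> 'a umodule.
        (\<forall>l\<in>\<Lambda>. fg_projective A (P l) \<and>
           (\<exists>(C :: 'a umodule) f g. short_exact A C f (P l) g (\<Delta> l) \<and>
              C \<in> filt A (twists R A {m \<in> \<Lambda>. l < m} \<Delta>))) \<and>
        add_cat A (dsum \<Lambda> P) = {X :: 'a umodule. fg_projective A X})"

definition costandard ::
  "('r, 'x) ring_scheme \<Rightarrow> ('r, 'a) module \<Rightarrow> 'i::order set \<Rightarrow> ('i \<Rightarrow> ('a, 'm) module)
    \<Rightarrow> ('i \<Rightarrow> ('a, 'n) module) \<Rightarrow> bool" where
  "costandard R A \<Lambda> \<Delta> nabla \<longleftrightarrow>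
     (\<forall>l\<in>\<Lambda>. fg_module A (nabla l)) \<and>
     split_quasi_hereditary R (op_algebra A) \<Lambda> (\<lambda>l. dual_module R A (nabla l)) \<and>
     (\<forall>l\<in>\<Lambda>. \<forall>b\<in>\<Lambda>. \<forall>i.
        if i = 0 \<and> l = b then mod_iso R (Ext A i (\<Delta> l) (nabla b)) (regular_module R)
        else carrier (Ext A i (\<Delta> l) (nabla b)) = {\<zero>\<^bsub>Ext A i (\<Delta> l) (nabla b)\<^esub>})"

definition partial_tilting ::
  "('r, 'x) ring_scheme \<Rightarrow> ('r, 'a) module \<Rightarrow> 'i set \<Rightarrow> ('i \<Rightarrow> ('a, 'm) module)
    \<Rightarrow> ('i \<Rightarrow> ('a, 'n) module) \<Rightarrow> ('a, 't) module \<Rightarrow> bool" where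
  "partial_tilting R A \<Lambda> \<Delta> nabla T \<longleftrightarrow>
     T \<in> filt A (twists R A \<Lambda> \<Delta>) \<inter> filt A (twists R A \<Lambda> nabla)"

end

theory Submission imports "HOL-Algebra.Free_Abelian_Groups" Defs begin

text \<open>
  Both parts rest on one criterion: a module \<open>T\<close> that is filtered by twisted standard modules
  \<open>\<Delta>(\<mu>) \<otimes> U\<close> is tilting as soon as \<open>Ext\<^sup>1(\<Delta>(\<mu>), T) = 0\<close> for every \<open>\<mu>\<close> (\<open>tilting_criterion\<close>). So
  the task is to kill first extensions while adding only standard factors, and to show that their
  vanishing produces a filtration by twisted costandard modules.

  Killing extensions. Let \<open>0 \<rightarrow> C(\<lambda>) \<rightarrow> P(\<lambda>) \<rightarrow> \<Delta>(\<lambda>) \<rightarrow> 0\<close> be the given sequence. Vanishing of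
  \<open>Ext\<^sup>1(\<Delta>(\<lambda>), T)\<close> means that every map \<open>C(\<lambda>) \<rightarrow> T\<close> extends to \<open>P(\<lambda>)\<close>. The pushout of the sequence
  along one map \<open>C(\<lambda>) \<rightarrow> T\<close> extends that map and enlarges \<open>T\<close> by one factor \<open>\<Delta>(\<lambda>)\<close>. As \<open>R\<close> is
  Noetherian, \<open>Hom(C(\<lambda>), T)\<close> is finitely generated over \<open>R\<close>, so finitely many pushouts suffice for
  one \<open>\<lambda>\<close>. A map \<open>C(\<mu>) \<rightarrow> \<Delta>(\<lambda>)\<close> can be nonzero only if \<open>\<mu> < \<lambda>\<close>; if a weight is treated after all
  larger ones, the new factors \<open>\<Delta>(\<lambda>)\<close> therefore create no new extensions at the weights treated
  before (\<open>universal_extension\<close>). Starting from \<open>M\<close> and treating all weights gives part (a). Starting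
  from \<open>\<Delta>(\<lambda>)\<close> it is enough to treat the weights \<open>\<mu> < \<lambda>\<close>: for all others \<open>Hom(C(\<mu>), T) = 0\<close>, because
  \<open>T\<close> has only factors \<open>\<Delta>(\<nu>)\<close> with \<open>\<nu> \<le> \<lambda>\<close>.

  Costandard filtrations. Let \<open>X\<close> be a submodule of \<open>T\<close> whose first extensions vanish and let
  \<open>\<lambda>\<close> be maximal with \<open>H = Hom(\<Delta>(\<lambda>), X) \<noteq> 0\<close>. Then \<open>X\<close> has the quotient \<open>\<nabla>(\<lambda>) \<otimes> H\<close>, in which every
  nonzero map \<open>\<Delta>(\<lambda>) \<rightarrow> X\<close> stays nonzero, and the kernel again has vanishing first extensions
  (\<open>costandard_quotient\<close>); the kernel receives no maps from \<open>\<Delta>(\<lambda>)\<close>, and the support has become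
  smaller (\<open>costandard_chain\<close>). Three facts make this work over \<open>R\<close>.

  (1) \<open>H\<close> is projective over \<open>R\<close>. It equals \<open>Hom(\<Delta>(\<lambda>), T)\<close>, as maps from the standard modules of the
  remaining weights to \<open>T\<close> land in \<open>X\<close>, and that module is projective by induction from the larger weights down, since
  \<open>0 \<rightarrow> Hom(\<Delta>(\<lambda>), T) \<rightarrow> Hom(P(\<lambda>), T) \<rightarrow> Hom(C(\<lambda>), T) \<rightarrow> 0\<close> is exact (\<open>Rproj_hom_standard\<close>).

  (2) Every \<open>R\<close>-linear functional on \<open>H\<close> is induced by a map \<open>X \<rightarrow> \<nabla>(\<lambda>)\<close> (\<open>coextend\<close>). A map into
  \<open>\<nabla>(\<lambda>)\<close> is determined by its composites with maps from \<open>P(\<lambda>)\<close>, because the modules \<open>P(\<mu>)\<close> generate,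
  have standard filtrations, and only \<open>\<Delta>(\<lambda>)\<close> maps nontrivially to \<open>\<nabla>(\<lambda>)\<close> (\<open>into_V_zero\<close>). The map
  itself is built along the filtration of \<open>P(\<mu>)\<close>, where \<open>Ext\<^sup>1(\<Delta>, \<nabla>) = 0\<close> allows extensions, then
  on \<open>A\<close>, and uniqueness glues the maps attached to the elements of \<open>X\<close>.

  (3) If first extensions of \<open>X\<close> vanish and all maps from standard modules lift along \<open>X \<rightarrow> Y\<close>, then
  \<open>X \<rightarrow> Y\<close> is onto, again because the \<open>P(\<mu>)\<close> generate (\<open>surj_from_standard\<close>).

  For \<open>X = T\<close> in part (b) every map \<open>\<Delta>(\<lambda>) \<rightarrow> T\<close> is a multiple of the inclusion, so \<open>H \<simeq> R\<close> and the first
  quotient is \<open>\<nabla>(\<lambda>)\<close> itself.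

  Twists \<open>\<Delta>(\<lambda>) \<otimes> U\<close> enter only as summands of finite sums of copies of \<open>\<Delta>(\<lambda>)\<close>. Being such a summand
  is expressed by writing the identity as a sum of maps that pass through \<open>\<Delta>(\<lambda>)\<close> (\<open>thru\<close>), which turns
  every argument about summands into an induction over that sum.
\<close>

section \<open>Modules over a ring\<close>

abbreviation restr :: "('a, 'm) module \<Rightarrow> 'm set \<Rightarrow> ('a, 'm) module"  (infixl "\<restriction>" 95) where
  "M \<restriction> N \<equiv> M\<lparr>carrier := N\<rparr>"

locale ring_modules = ring A for A :: "('a, 'x) ring_scheme" (structure)
begin

abbreviation lmod :: "('a, 'm) module \<Rightarrow> bool" where
  "lmod M \<equiv> left_module A M"

abbreviation subm :: "'m set \<Rightarrow> ('a, 'm) module \<Rightarrow> bool" where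
  "subm N M \<equiv> submodule N A M"

definition lin :: "('a, 'm) module \<Rightarrow> ('a, 'n) module \<Rightarrow> ('m \<Rightarrow> 'n) \<Rightarrow> bool" where
  "lin M N f \<longleftrightarrow> (\<forall>x\<in>carrier M. f x \<in> carrier N) \<and>
     (\<forall>x\<in>carrier M. \<forall>y\<in>carrier M. f (x \<oplus>\<^bsub>M\<^esub> y) = f x \<oplus>\<^bsub>N\<^esub> f y) \<and>
     (\<forall>a\<in>carrier A. \<forall>x\<in>carrier M. f (a \<odot>\<^bsub>M\<^esub> x) = a \<odot>\<^bsub>N\<^esub> f x)"

text \<open>The record of a module has no subtraction of its own; multiplying by \<open>- 1\<close> gives one that every
  submodule and every linear map respects.\<close>

definition dif :: "('a, 'm) module \<Rightarrow> 'm \<Rightarrow> 'm \<Rightarrow> 'm" where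
  "dif M x y = x \<oplus>\<^bsub>M\<^esub> (\<ominus> \<one>) \<odot>\<^bsub>M\<^esub> y"

lemma neg_one_closed [simp]: "\<ominus> \<one> \<in> carrier A"
  by simp

lemma lmod_abelian_group: "lmod M \<Longrightarrow> abelian_group M"
  by (rule left_module.axioms(2))

lemma
  assumes "lmod M"
  shows lm_zero [simp]: "\<zero>\<^bsub>M\<^esub> \<in> carrier M"
    and lm_add [simp]: "\<lbrakk>x \<in> carrier M; y \<in> carrier M\<rbrakk> \<Longrightarrow> x \<oplus>\<^bsub>M\<^esub> y \<in> carrier M"
    and lm_smult [simp]: "\<lbrakk>a \<in> carrier A; x \<in> carrier M\<rbrakk> \<Longrightarrow> a \<odot>\<^bsub>M\<^esub> x \<in> carrier M"
    and lm_ldistr: "\<lbrakk>a \<in> carrier A; b \<in> carrier A; x \<in> carrier M\<rbrakk>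
        \<Longrightarrow> (a \<oplus> b) \<odot>\<^bsub>M\<^esub> x = a \<odot>\<^bsub>M\<^esub> x \<oplus>\<^bsub>M\<^esub> b \<odot>\<^bsub>M\<^esub> x"
    and lm_rdistr: "\<lbrakk>a \<in> carrier A; x \<in> carrier M; y \<in> carrier M\<rbrakk>
        \<Longrightarrow> a \<odot>\<^bsub>M\<^esub> (x \<oplus>\<^bsub>M\<^esub> y) = a \<odot>\<^bsub>M\<^esub> x \<oplus>\<^bsub>M\<^esub> a \<odot>\<^bsub>M\<^esub> y"
    and lm_assoc: "\<lbrakk>a \<in> carrier A; b \<in> carrier A; x \<in> carrier M\<rbrakk>
        \<Longrightarrow> (a \<otimes> b) \<odot>\<^bsub>M\<^esub> x = a \<odot>\<^bsub>M\<^esub> (b \<odot>\<^bsub>M\<^esub> x)"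
    and lm_one [simp]: "x \<in> carrier M \<Longrightarrow> \<one> \<odot>\<^bsub>M\<^esub> x = x"
    and lm_a_assoc: "\<lbrakk>x \<in> carrier M; y \<in> carrier M; z \<in> carrier M\<rbrakk>
        \<Longrightarrow> (x \<oplus>\<^bsub>M\<^esub> y) \<oplus>\<^bsub>M\<^esub> z = x \<oplus>\<^bsub>M\<^esub> (y \<oplus>\<^bsub>M\<^esub> z)"
    and lm_a_comm: "\<lbrakk>x \<in> carrier M; y \<in> carrier M\<rbrakk> \<Longrightarrow> x \<oplus>\<^bsub>M\<^esub> y = y \<oplus>\<^bsub>M\<^esub> x"
    and lm_a_lcomm: "\<lbrakk>x \<in> carrier M; y \<in> carrier M; z \<in> carrier M\<rbrakk>
        \<Longrightarrow> x \<oplus>\<^bsub>M\<^esub> (y \<oplus>\<^bsub>M\<^esub> z) = y \<oplus>\<^bsub>M\<^esub> (x \<oplus>\<^bsub>M\<^esub> z)"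
    and lm_l_zero [simp]: "x \<in> carrier M \<Longrightarrow> \<zero>\<^bsub>M\<^esub> \<oplus>\<^bsub>M\<^esub> x = x"
    and lm_r_zero [simp]: "x \<in> carrier M \<Longrightarrow> x \<oplus>\<^bsub>M\<^esub> \<zero>\<^bsub>M\<^esub> = x"
    and lm_cancel: "\<lbrakk>x \<in> carrier M; y \<in> carrier M; z \<in> carrier M\<rbrakk>
        \<Longrightarrow> x \<oplus>\<^bsub>M\<^esub> y = x \<oplus>\<^bsub>M\<^esub> z \<longleftrightarrow> y = z"
    and lm_zero_smult [simp]: "x \<in> carrier M \<Longrightarrow> \<zero> \<odot>\<^bsub>M\<^esub> x = \<zero>\<^bsub>M\<^esub>"
    and lm_smult_zero [simp]: "a \<in> carrier A \<Longrightarrow> a \<odot>\<^bsub>M\<^esub> \<zero>\<^bsub>M\<^esub> = \<zero>\<^bsub>M\<^esub>"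
proof -
  interpret M: left_module A M by fact
  show "\<zero>\<^bsub>M\<^esub> \<in> carrier M" by simp
  show "\<lbrakk>x \<in> carrier M; y \<in> carrier M\<rbrakk> \<Longrightarrow> x \<oplus>\<^bsub>M\<^esub> y \<in> carrier M" by simp
  show "\<lbrakk>a \<in> carrier A; x \<in> carrier M\<rbrakk> \<Longrightarrow> a \<odot>\<^bsub>M\<^esub> x \<in> carrier M" by simp
  show ld: "\<lbrakk>a \<in> carrier A; b \<in> carrier A; x \<in> carrier M\<rbrakk>
        \<Longrightarrow> (a \<oplus> b) \<odot>\<^bsub>M\<^esub> x = a \<odot>\<^bsub>M\<^esub> x \<oplus>\<^bsub>M\<^esub> b \<odot>\<^bsub>M\<^esub> x" for a b x by (rule M.smult_l_distr)
  show rd: "\<lbrakk>a \<in> carrier A; x \<in> carrier M; y \<in> carrier M\<rbrakk>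
        \<Longrightarrow> a \<odot>\<^bsub>M\<^esub> (x \<oplus>\<^bsub>M\<^esub> y) = a \<odot>\<^bsub>M\<^esub> x \<oplus>\<^bsub>M\<^esub> a \<odot>\<^bsub>M\<^esub> y" for a x y by (rule M.smult_r_distr)
  show "\<lbrakk>a \<in> carrier A; b \<in> carrier A; x \<in> carrier M\<rbrakk>
        \<Longrightarrow> (a \<otimes> b) \<odot>\<^bsub>M\<^esub> x = a \<odot>\<^bsub>M\<^esub> (b \<odot>\<^bsub>M\<^esub> x)" by (rule M.smult_assoc)
  show "x \<in> carrier M \<Longrightarrow> \<one> \<odot>\<^bsub>M\<^esub> x = x" by simp
  show "\<lbrakk>x \<in> carrier M; y \<in> carrier M; z \<in> carrier M\<rbrakk>
        \<Longrightarrow> (x \<oplus>\<^bsub>M\<^esub> y) \<oplus>\<^bsub>M\<^esub> z = x \<oplus>\<^bsub>M\<^esub> (y \<oplus>\<^bsub>M\<^esub> z)" by (rule M.M.a_assoc)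
  show "\<lbrakk>x \<in> carrier M; y \<in> carrier M\<rbrakk> \<Longrightarrow> x \<oplus>\<^bsub>M\<^esub> y = y \<oplus>\<^bsub>M\<^esub> x" by (rule M.M.a_comm)
  show "\<lbrakk>x \<in> carrier M; y \<in> carrier M; z \<in> carrier M\<rbrakk>
        \<Longrightarrow> x \<oplus>\<^bsub>M\<^esub> (y \<oplus>\<^bsub>M\<^esub> z) = y \<oplus>\<^bsub>M\<^esub> (x \<oplus>\<^bsub>M\<^esub> z)" by (rule M.M.a_lcomm)
  show "x \<in> carrier M \<Longrightarrow> \<zero>\<^bsub>M\<^esub> \<oplus>\<^bsub>M\<^esub> x = x" by simp
  show "x \<in> carrier M \<Longrightarrow> x \<oplus>\<^bsub>M\<^esub> \<zero>\<^bsub>M\<^esub> = x" by simp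
  show cancel: "\<lbrakk>x \<in> carrier M; y \<in> carrier M; z \<in> carrier M\<rbrakk>
        \<Longrightarrow> x \<oplus>\<^bsub>M\<^esub> y = x \<oplus>\<^bsub>M\<^esub> z \<longleftrightarrow> y = z" for x y z by simp
  show "\<zero> \<odot>\<^bsub>M\<^esub> x = \<zero>\<^bsub>M\<^esub>" if "x \<in> carrier M" for x
  proof -
    have "\<zero> \<odot>\<^bsub>M\<^esub> x \<oplus>\<^bsub>M\<^esub> \<zero> \<odot>\<^bsub>M\<^esub> x = \<zero> \<odot>\<^bsub>M\<^esub> x \<oplus>\<^bsub>M\<^esub> \<zero>\<^bsub>M\<^esub>"
      using ld[of \<zero> \<zero> x] that by simp
    then show ?thesis using cancel that by (metis M.M.zero_closed M.smult_closed zero_closed)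
  qed
  show "a \<odot>\<^bsub>M\<^esub> \<zero>\<^bsub>M\<^esub> = \<zero>\<^bsub>M\<^esub>" if "a \<in> carrier A" for a
  proof -
    have "a \<odot>\<^bsub>M\<^esub> \<zero>\<^bsub>M\<^esub> \<oplus>\<^bsub>M\<^esub> a \<odot>\<^bsub>M\<^esub> \<zero>\<^bsub>M\<^esub> = a \<odot>\<^bsub>M\<^esub> \<zero>\<^bsub>M\<^esub> \<oplus>\<^bsub>M\<^esub> \<zero>\<^bsub>M\<^esub>"
      using rd[of a "\<zero>\<^bsub>M\<^esub>" "\<zero>\<^bsub>M\<^esub>"] that by simp
    then show ?thesis using cancel that by (metis M.M.zero_closed M.smult_closed)
  qed
qed

lemmas lm_ac = lm_a_assoc lm_a_comm lm_a_lcomm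

lemma lm_neg:
  assumes "lmod M" "x \<in> carrier M"
  shows "x \<oplus>\<^bsub>M\<^esub> (\<ominus> \<one>) \<odot>\<^bsub>M\<^esub> x = \<zero>\<^bsub>M\<^esub>"
proof -
  have "x \<oplus>\<^bsub>M\<^esub> (\<ominus> \<one>) \<odot>\<^bsub>M\<^esub> x = (\<one> \<oplus> \<ominus> \<one>) \<odot>\<^bsub>M\<^esub> x"
    using assms by (simp add: lm_ldistr del: r_neg)
  then show ?thesis using assms by (simp add: r_neg)
qed

lemma dif_closed [simp]: "\<lbrakk>lmod M; x \<in> carrier M; y \<in> carrier M\<rbrakk> \<Longrightarrow> dif M x y \<in> carrier M"
  by (simp add: dif_def)

lemma dif_self [simp]: "\<lbrakk>lmod M; x \<in> carrier M\<rbrakk> \<Longrightarrow> dif M x x = \<zero>\<^bsub>M\<^esub>"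
  by (simp add: dif_def lm_neg)

lemma dif_zero_right [simp]: "\<lbrakk>lmod M; x \<in> carrier M\<rbrakk> \<Longrightarrow> dif M x \<zero>\<^bsub>M\<^esub> = x"
  by (simp add: dif_def)

lemma dif_add_cancel [simp]:
  assumes "lmod M" "x \<in> carrier M" "y \<in> carrier M"
  shows "dif M x y \<oplus>\<^bsub>M\<^esub> y = x" "y \<oplus>\<^bsub>M\<^esub> dif M x y = x"
proof -
  have "dif M x y \<oplus>\<^bsub>M\<^esub> y = x \<oplus>\<^bsub>M\<^esub> (y \<oplus>\<^bsub>M\<^esub> (\<ominus> \<one>) \<odot>\<^bsub>M\<^esub> y)"
    unfolding dif_def using assms by (simp add: lm_ac)
  then show "dif M x y \<oplus>\<^bsub>M\<^esub> y = x" using assms by (simp add: lm_neg)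
  then show "y \<oplus>\<^bsub>M\<^esub> dif M x y = x" using assms by (simp add: lm_a_comm)
qed

lemma dif_eq_zero: "\<lbrakk>lmod M; x \<in> carrier M; y \<in> carrier M\<rbrakk> \<Longrightarrow> dif M x y = \<zero>\<^bsub>M\<^esub> \<longleftrightarrow> x = y"
  by (metis dif_add_cancel(1) dif_self lm_l_zero)

lemma add_dif_cancel [simp]:
  assumes "lmod M" "x \<in> carrier M" "y \<in> carrier M"
  shows "dif M (x \<oplus>\<^bsub>M\<^esub> y) y = x"
  using assms lm_cancel[OF assms(1), of y "dif M (x \<oplus>\<^bsub>M\<^esub> y) y" x] by (simp add: lm_a_comm)

text \<open>Additive inverses are supplied by \<open>(- 1) x\<close>.\<close>

lemma lmodI:
  assumes "\<zero>\<^bsub>M\<^esub> \<in> carrier M"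
    and "\<And>x y. \<lbrakk>x \<in> carrier M; y \<in> carrier M\<rbrakk> \<Longrightarrow> x \<oplus>\<^bsub>M\<^esub> y \<in> carrier M"
    and "\<And>a x. \<lbrakk>a \<in> carrier A; x \<in> carrier M\<rbrakk> \<Longrightarrow> a \<odot>\<^bsub>M\<^esub> x \<in> carrier M"
    and "\<And>a b x. \<lbrakk>a \<in> carrier A; b \<in> carrier A; x \<in> carrier M\<rbrakk>
        \<Longrightarrow> (a \<oplus> b) \<odot>\<^bsub>M\<^esub> x = a \<odot>\<^bsub>M\<^esub> x \<oplus>\<^bsub>M\<^esub> b \<odot>\<^bsub>M\<^esub> x"
    and "\<And>a x y. \<lbrakk>a \<in> carrier A; x \<in> carrier M; y \<in> carrier M\<rbrakk>
        \<Longrightarrow> a \<odot>\<^bsub>M\<^esub> (x \<oplus>\<^bsub>M\<^esub> y) = a \<odot>\<^bsub>M\<^esub> x \<oplus>\<^bsub>M\<^esub> a \<odot>\<^bsub>M\<^esub> y"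
    and "\<And>a b x. \<lbrakk>a \<in> carrier A; b \<in> carrier A; x \<in> carrier M\<rbrakk>
        \<Longrightarrow> (a \<otimes> b) \<odot>\<^bsub>M\<^esub> x = a \<odot>\<^bsub>M\<^esub> (b \<odot>\<^bsub>M\<^esub> x)"
    and "\<And>x. x \<in> carrier M \<Longrightarrow> \<one> \<odot>\<^bsub>M\<^esub> x = x"
    and "\<And>x. x \<in> carrier M \<Longrightarrow> \<zero> \<odot>\<^bsub>M\<^esub> x = \<zero>\<^bsub>M\<^esub>"
    and "\<And>x y z. \<lbrakk>x \<in> carrier M; y \<in> carrier M; z \<in> carrier M\<rbrakk>
        \<Longrightarrow> (x \<oplus>\<^bsub>M\<^esub> y) \<oplus>\<^bsub>M\<^esub> z = x \<oplus>\<^bsub>M\<^esub> (y \<oplus>\<^bsub>M\<^esub> z)"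
    and "\<And>x y. \<lbrakk>x \<in> carrier M; y \<in> carrier M\<rbrakk> \<Longrightarrow> x \<oplus>\<^bsub>M\<^esub> y = y \<oplus>\<^bsub>M\<^esub> x"
    and "\<And>x. x \<in> carrier M \<Longrightarrow> \<zero>\<^bsub>M\<^esub> \<oplus>\<^bsub>M\<^esub> x = x"
  shows "lmod M"
proof -
  have inv: "\<exists>y\<in>carrier M. y \<oplus>\<^bsub>M\<^esub> x = \<zero>\<^bsub>M\<^esub>" if "x \<in> carrier M" for x
  proof
    show "(\<ominus> \<one>) \<odot>\<^bsub>M\<^esub> x \<in> carrier M" using assms(3) that by simp
    have "(\<ominus> \<one> \<oplus> \<one>) \<odot>\<^bsub>M\<^esub> x = (\<ominus> \<one>) \<odot>\<^bsub>M\<^esub> x \<oplus>\<^bsub>M\<^esub> \<one> \<odot>\<^bsub>M\<^esub> x" using that by (intro assms(4)) auto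
    then show "(\<ominus> \<one>) \<odot>\<^bsub>M\<^esub> x \<oplus>\<^bsub>M\<^esub> x = \<zero>\<^bsub>M\<^esub>" using assms(7,8) that by (simp add: l_neg)
  qed
  show ?thesis
  proof (intro left_module.intro left_module_axioms.intro)
    show "ring A" by (rule ring_axioms)
    show "abelian_group M" by (rule abelian_groupI) (use assms(1,2,9,10,11) inv in auto)
  qed (use assms in auto)
qed

subsection \<open>Submodules\<close>

lemma
  assumes "subm N M"
  shows subm_subset: "N \<subseteq> carrier M"
    and subm_zero [simp]: "\<zero>\<^bsub>M\<^esub> \<in> N"
    and subm_add [simp]: "\<lbrakk>x \<in> N; y \<in> N\<rbrakk> \<Longrightarrow> x \<oplus>\<^bsub>M\<^esub> y \<in> N"
    and subm_smult [simp]: "\<lbrakk>a \<in> carrier A; x \<in> N\<rbrakk> \<Longrightarrow> a \<odot>\<^bsub>M\<^esub> x \<in> N"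
proof -
  interpret submodule N A M by fact
  show "N \<subseteq> carrier M" "\<zero>\<^bsub>M\<^esub> \<in> N" "\<lbrakk>x \<in> N; y \<in> N\<rbrakk> \<Longrightarrow> x \<oplus>\<^bsub>M\<^esub> y \<in> N"
    "\<lbrakk>a \<in> carrier A; x \<in> N\<rbrakk> \<Longrightarrow> a \<odot>\<^bsub>M\<^esub> x \<in> N"
    using subset one_closed m_closed by auto
qed

lemma subm_carrierD: "subm N M \<Longrightarrow> x \<in> N \<Longrightarrow> x \<in> carrier M"
  using subm_subset by blast

lemma subm_dif [simp]: "\<lbrakk>subm N M; x \<in> N; y \<in> N\<rbrakk> \<Longrightarrow> dif M x y \<in> N"
  by (simp add: dif_def)

lemma submI:
  assumes M: "lmod M" and "N \<subseteq> carrier M" "\<zero>\<^bsub>M\<^esub> \<in> N"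
    and "\<And>x y. \<lbrakk>x \<in> N; y \<in> N\<rbrakk> \<Longrightarrow> x \<oplus>\<^bsub>M\<^esub> y \<in> N"
    and "\<And>a x. \<lbrakk>a \<in> carrier A; x \<in> N\<rbrakk> \<Longrightarrow> a \<odot>\<^bsub>M\<^esub> x \<in> N"
  shows "subm N M"
proof -
  interpret M: abelian_group M by (rule lmod_abelian_group[OF M])
  have "inv\<^bsub>add_monoid M\<^esub> x \<in> N" if "x \<in> N" for x
  proof -
    have x: "x \<in> carrier M" using that assms by auto
    have n: "(\<ominus>\<^bsub>A\<^esub> \<one>\<^bsub>A\<^esub>) \<odot>\<^bsub>M\<^esub> x \<in> N" using that assms(5) by simp
    have n': "(\<ominus>\<^bsub>A\<^esub> \<one>\<^bsub>A\<^esub>) \<odot>\<^bsub>M\<^esub> x \<in> carrier M" using n assms(2) by auto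
    have "(\<ominus>\<^bsub>A\<^esub> \<one>\<^bsub>A\<^esub>) \<odot>\<^bsub>M\<^esub> x \<oplus>\<^bsub>M\<^esub> x = \<zero>\<^bsub>M\<^esub>"
      using lm_neg[OF M x] M.a_comm[OF x n'] by simp
    then have "inv\<^bsub>add_monoid M\<^esub> x = (\<ominus>\<^bsub>A\<^esub> \<one>\<^bsub>A\<^esub>) \<odot>\<^bsub>M\<^esub> x"
      using M.add.inv_equality[of "(\<ominus>\<^bsub>A\<^esub> \<one>\<^bsub>A\<^esub>) \<odot>\<^bsub>M\<^esub> x" x] x n' by (simp add: a_inv_def)
    then show ?thesis using n by simp
  qed
  then show ?thesis
    using assms by (intro submodule.intro submodule_axioms.intro subgroup.intro) auto
qed

lemma subm_carrier [simp]: "lmod M \<Longrightarrow> subm (carrier M) M"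
  by (rule submI) auto

lemma subm_zero_set [simp]: "lmod M \<Longrightarrow> subm {\<zero>\<^bsub>M\<^esub>} M"
  by (rule submI) auto

lemma lmod_restr [simp]:
  assumes "lmod M" "subm N M" shows "lmod (M \<restriction> N)"
  using assms subm_subset[OF assms(2)]
  by (intro lmodI) (auto simp: lm_ldistr lm_rdistr lm_assoc lm_ac subset_eq)

lemma subm_restr:
  assumes "lmod M" "subm N M" shows "subm K (M \<restriction> N) \<longleftrightarrow> subm K M \<and> K \<subseteq> N"
proof
  assume K: "subm K (M \<restriction> N)"
  then have KN: "K \<subseteq> N" using subm_subset[OF K] by simp
  have "subm K M"
    by (rule submI) (use assms KN subm_subset[OF assms(2)] subm_zero[OF K] subm_add[OF K] subm_smult[OF K] in auto)
  then show "subm K M \<and> K \<subseteq> N" using KN by simp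
next
  assume K: "subm K M \<and> K \<subseteq> N"
  show "subm K (M \<restriction> N)"
    by (rule submI) (use assms K in auto)
qed

lemma subm_inter: "\<lbrakk>lmod M; subm N M; subm K M\<rbrakk> \<Longrightarrow> subm (N \<inter> K) M"
  by (rule submI) (auto dest: subm_subset)

subsection \<open>Linear maps\<close>

lemma linI:
  assumes "\<And>x. x \<in> carrier M \<Longrightarrow> f x \<in> carrier N"
    and "\<And>x y. \<lbrakk>x \<in> carrier M; y \<in> carrier M\<rbrakk> \<Longrightarrow> f (x \<oplus>\<^bsub>M\<^esub> y) = f x \<oplus>\<^bsub>N\<^esub> f y"
    and "\<And>a x. \<lbrakk>a \<in> carrier A; x \<in> carrier M\<rbrakk> \<Longrightarrow> f (a \<odot>\<^bsub>M\<^esub> x) = a \<odot>\<^bsub>N\<^esub> f x"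
  shows "lin M N f"
  using assms by (auto simp: lin_def)

lemma
  assumes "lin M N f"
  shows lin_closed: "x \<in> carrier M \<Longrightarrow> f x \<in> carrier N"
    and lin_add: "\<lbrakk>x \<in> carrier M; y \<in> carrier M\<rbrakk> \<Longrightarrow> f (x \<oplus>\<^bsub>M\<^esub> y) = f x \<oplus>\<^bsub>N\<^esub> f y"
    and lin_smult: "\<lbrakk>a \<in> carrier A; x \<in> carrier M\<rbrakk> \<Longrightarrow> f (a \<odot>\<^bsub>M\<^esub> x) = a \<odot>\<^bsub>N\<^esub> f x"
  using assms by (auto simp: lin_def)

lemma lin_zero:
  assumes "lin M N f" "lmod M" "lmod N" shows "f \<zero>\<^bsub>M\<^esub> = \<zero>\<^bsub>N\<^esub>"
proof -
  have "f (\<zero> \<odot>\<^bsub>M\<^esub> \<zero>\<^bsub>M\<^esub>) = \<zero> \<odot>\<^bsub>N\<^esub> f \<zero>\<^bsub>M\<^esub>"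
    using assms by (intro lin_smult[OF assms(1)]) auto
  then show ?thesis using assms by (simp add: lin_closed[OF assms(1)])
qed

lemma lin_dif: "\<lbrakk>lin M N f; lmod M; x \<in> carrier M; y \<in> carrier M\<rbrakk> \<Longrightarrow> f (dif M x y) = dif N (f x) (f y)"
  by (simp add: dif_def lin_add lin_smult)

lemma lin_cong:
  assumes "lin M N f" "lmod M" "\<And>x. x \<in> carrier M \<Longrightarrow> f x = g x" shows "lin M N g"
  using assms(1,2) assms(3)[symmetric] by (simp add: lin_def)

lemma lin_restrict [simp]: "lmod M \<Longrightarrow> lin M N (restrict f (carrier M)) \<longleftrightarrow> lin M N f"
  by (auto intro: lin_cong)

lemma lin_id: "lin M M (\<lambda>x. x)"
  by (simp add: lin_def)

lemma lin_comp: "\<lbrakk>lin M N f; lin N K g\<rbrakk> \<Longrightarrow> lin M K (\<lambda>x. g (f x))"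
  by (simp add: lin_def)

lemma lin_const_zero: "lmod N \<Longrightarrow> lin M N (\<lambda>x. \<zero>\<^bsub>N\<^esub>)"
  by (simp add: lin_def)

lemma lin_plus: "\<lbrakk>lin M N f; lin M N g; lmod N\<rbrakk> \<Longrightarrow> lin M N (\<lambda>x. f x \<oplus>\<^bsub>N\<^esub> g x)"
  by (simp add: lin_def lm_ac lm_rdistr)

lemma lin_minus:
  assumes "lin M N f" "lin M N g" "lmod N" shows "lin M N (\<lambda>x. dif N (f x) (g x))"
proof -
  have "a \<otimes> (\<ominus> \<one>) = (\<ominus> \<one>) \<otimes> a" if "a \<in> carrier A" for a
    using that by (simp add: l_minus r_minus)
  then have *: "a \<odot>\<^bsub>N\<^esub> ((\<ominus> \<one>) \<odot>\<^bsub>N\<^esub> y) = (\<ominus> \<one>) \<odot>\<^bsub>N\<^esub> (a \<odot>\<^bsub>N\<^esub> y)"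
    if "a \<in> carrier A" "y \<in> carrier N" for a y
    using that assms(3) lm_assoc[OF assms(3), symmetric] by simp
  show ?thesis unfolding dif_def
    by (rule lin_plus[OF assms(1) _ assms(3)]) (use assms * in \<open>auto simp: lin_def lm_rdistr\<close>)
qed

lemma lin_restr_dom: "\<lbrakk>lin M N f; K \<subseteq> carrier M\<rbrakk> \<Longrightarrow> lin (M \<restriction> K) N f"
  by (rule linI) (auto simp: lin_closed lin_add lin_smult subset_eq)

lemma lin_restr_cod: "lin M (N \<restriction> K) f \<Longrightarrow> K \<subseteq> carrier N \<Longrightarrow> lin M N f"
  by (simp add: lin_def subset_eq)

lemma lin_to_restr: "lin M N f \<Longrightarrow> (\<And>x. x \<in> carrier M \<Longrightarrow> f x \<in> K) \<Longrightarrow> lin M (N \<restriction> K) f"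
  by (simp add: lin_def)

lemma subm_ker: "\<lbrakk>lin M N f; lmod M; lmod N\<rbrakk> \<Longrightarrow> subm {x \<in> carrier M. f x = \<zero>\<^bsub>N\<^esub>} M"
  by (rule submI) (auto simp: lin_add lin_smult lin_zero)

lemma subm_image:
  assumes "lin M N f" "lmod M" "lmod N" "subm K M" shows "subm (f ` K) N"
proof (rule submI)
  show "f ` K \<subseteq> carrier N" using assms(1,4) by (auto simp: lin_closed dest: subm_carrierD)
  show "\<zero>\<^bsub>N\<^esub> \<in> f ` K" using assms by (metis image_eqI lin_zero subm_zero)
  show "x \<oplus>\<^bsub>N\<^esub> y \<in> f ` K" if "x \<in> f ` K" "y \<in> f ` K" for x y
    using that assms by (auto simp: lin_add[OF assms(1), symmetric] subm_carrierD[OF assms(4)])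
  show "a \<odot>\<^bsub>N\<^esub> x \<in> f ` K" if "a \<in> carrier A" "x \<in> f ` K" for a x
    using that assms by (auto simp: lin_smult[OF assms(1), symmetric] subm_carrierD[OF assms(4)])
qed (use assms in auto)

lemma subm_vimage:
  assumes "lin M N f" "lmod M" "lmod N" "subm K N" shows "subm {x \<in> carrier M. f x \<in> K} M"
  by (rule submI) (use assms in \<open>auto simp: lin_add lin_smult lin_zero\<close>)

lemma subm_eqlz:
  assumes "lin M N f" "lin M N g" "lmod M" "lmod N" shows "subm {x \<in> carrier M. f x = g x} M"
  by (rule submI) (use assms in \<open>auto simp: lin_add lin_smult lin_zero\<close>)

lemma factor_thru:
  assumes "lmod M" "lmod Y" "lin M N g" "g ` carrier M = carrier N" "lin M Y f"
    and ker: "\<And>x. x \<in> carrier M \<Longrightarrow> g x = \<zero>\<^bsub>N\<^esub> \<Longrightarrow> f x = \<zero>\<^bsub>Y\<^esub>" and N: "lmod N"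
  obtains h where "lin N Y h" "\<And>x. x \<in> carrier M \<Longrightarrow> h (g x) = f x"
proof -
  define s where "s n = (SOME x. x \<in> carrier M \<and> g x = n)" for n
  have s: "s n \<in> carrier M" "g (s n) = n" if "n \<in> carrier N" for n
  proof -
    have "\<exists>x. x \<in> carrier M \<and> g x = n" using that assms(4) by (metis imageE)
    from someI_ex[OF this] show "s n \<in> carrier M" "g (s n) = n" by (auto simp: s_def)
  qed
  have eq: "f x = f y" if "x \<in> carrier M" "y \<in> carrier M" "g x = g y" for x y
  proof -
    have "g (dif M x y) = \<zero>\<^bsub>N\<^esub>" using that assms by (simp add: lin_dif lin_closed)
    then have "dif Y (f x) (f y) = \<zero>\<^bsub>Y\<^esub>" using that assms by (metis dif_closed lin_dif)
    then show ?thesis using that assms by (simp add: dif_eq_zero lin_closed)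
  qed
  have h: "f (s (g x)) = f x" if "x \<in> carrier M" for x
    using that s assms by (intro eq) (auto simp: lin_closed)
  have "lin N Y (\<lambda>n. f (s n))"
  proof (rule linI)
    fix x y assume xy: "x \<in> carrier N" "y \<in> carrier N"
    have "f (s (x \<oplus>\<^bsub>N\<^esub> y)) = f (s x \<oplus>\<^bsub>M\<^esub> s y)"
      using xy s assms by (intro eq) (auto simp: lin_add)
    then show "f (s (x \<oplus>\<^bsub>N\<^esub> y)) = f (s x) \<oplus>\<^bsub>Y\<^esub> f (s y)" using xy s assms by (simp add: lin_add)
  next
    fix a x assume ax: "a \<in> carrier A" "x \<in> carrier N"
    have "f (s (a \<odot>\<^bsub>N\<^esub> x)) = f (a \<odot>\<^bsub>M\<^esub> s x)"
      using ax s assms by (intro eq) (auto simp: lin_smult)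
    then show "f (s (a \<odot>\<^bsub>N\<^esub> x)) = a \<odot>\<^bsub>Y\<^esub> f (s x)" using ax s assms by (simp add: lin_smult)
  qed (use s assms in \<open>auto simp: lin_closed\<close>)
  then show ?thesis using h that by blast
qed

lemma inverse_lin:
  assumes "lmod M" "lmod N" "lin M N f" "bij_betw f (carrier M) (carrier N)"
  obtains g where "lin N M g" "\<forall>x\<in>carrier M. g (f x) = x" "\<forall>y\<in>carrier N. f (g y) = y"
proof -
  have ker: "x = \<zero>\<^bsub>M\<^esub>" if "x \<in> carrier M" "f x = \<zero>\<^bsub>N\<^esub>" for x
    using that assms(1) lin_zero[OF assms(3,1,2)] inj_onD[OF bij_betw_imp_inj_on[OF assms(4)], of x "\<zero>\<^bsub>M\<^esub>"] by simp
  have surj: "f ` carrier M = carrier N" using assms(4) by (rule bij_betw_imp_surj_on)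
  obtain g where g: "lin N M g" "\<And>x. x \<in> carrier M \<Longrightarrow> g (f x) = x"
    using factor_thru[OF assms(1,1,3) surj lin_id ker assms(2)] by blast
  moreover have "f (g y) = y" if "y \<in> carrier N" for y
    using that g(2) unfolding surj[symmetric] by auto
  ultimately show ?thesis using that by blast
qed

lemma lin_inj_iff:
  assumes "lin M N f" "lmod M" "lmod N"
  shows "inj_on f (carrier M) \<longleftrightarrow> (\<forall>x\<in>carrier M. f x = \<zero>\<^bsub>N\<^esub> \<longrightarrow> x = \<zero>\<^bsub>M\<^esub>)"
proof
  assume "inj_on f (carrier M)"
  then show "\<forall>x\<in>carrier M. f x = \<zero>\<^bsub>N\<^esub> \<longrightarrow> x = \<zero>\<^bsub>M\<^esub>"
    using assms lin_zero[OF assms] by (metis inj_onD lm_zero)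
next
  assume *: "\<forall>x\<in>carrier M. f x = \<zero>\<^bsub>N\<^esub> \<longrightarrow> x = \<zero>\<^bsub>M\<^esub>"
  show "inj_on f (carrier M)"
  proof (rule inj_onI)
    fix x y assume "x \<in> carrier M" "y \<in> carrier M" "f x = f y"
    then have "f (dif M x y) = \<zero>\<^bsub>N\<^esub>" using assms by (simp add: lin_dif lin_closed)
    then have "dif M x y = \<zero>\<^bsub>M\<^esub>" using * assms \<open>x \<in> carrier M\<close> \<open>y \<in> carrier M\<close> by simp
    then show "x = y" using assms \<open>x \<in> carrier M\<close> \<open>y \<in> carrier M\<close> by (simp add: dif_eq_zero)
  qed
qed

lemma mod_hom_iff: "f \<in> mod_hom A M N \<longleftrightarrow> lin M N f \<and> f \<in> extensional (carrier M)"
  by (auto simp: mod_hom_def lin_def PiE_def)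

lemma restrict_mod_hom: "lmod M \<Longrightarrow> lin M N f \<Longrightarrow> restrict f (carrier M) \<in> mod_hom A M N"
  by (simp add: mod_hom_iff)

lemma mod_iso_iff:
  assumes "lmod M"
  shows "mod_iso A M N \<longleftrightarrow> (\<exists>f. lin M N f \<and> bij_betw f (carrier M) (carrier N))"
proof
  assume "mod_iso A M N" then show "\<exists>f. lin M N f \<and> bij_betw f (carrier M) (carrier N)"
    by (auto simp: mod_iso_def mod_hom_iff)
next
  assume "\<exists>f. lin M N f \<and> bij_betw f (carrier M) (carrier N)"
  then obtain f where f: "lin M N f" "bij_betw f (carrier M) (carrier N)" by blast
  have "bij_betw (restrict f (carrier M)) (carrier M) (carrier N)"
    using f(2) bij_betw_cong[of "carrier M" "restrict f (carrier M)" f] by simp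
  then show "mod_iso A M N" unfolding mod_iso_def by (rule bexI[OF _ restrict_mod_hom[OF assms f(1)]])
qed

subsection \<open>Quotients\<close>

text \<open>The module laws are required only up to the subgroup \<open>N\<close>, because the free abelian group behind a
  tensor product satisfies them only modulo the bilinearity relations.\<close>

lemma quotient_module_general:
  fixes M :: "('a, 'm) module"
  defines "Q \<equiv> quotient_module M" and "q \<equiv> (\<lambda>N x. N +>\<^bsub>M\<^esub> x)"
  assumes G: "abelian_group M" and S: "additive_subgroup N M"
    and cl: "\<And>a x. \<lbrakk>a \<in> carrier A; x \<in> carrier M\<rbrakk> \<Longrightarrow> a \<odot>\<^bsub>M\<^esub> x \<in> carrier M"
    and ad: "\<And>a x y. \<lbrakk>a \<in> carrier A; x \<in> carrier M; y \<in> carrier M\<rbrakk>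
        \<Longrightarrow> a \<odot>\<^bsub>M\<^esub> (x \<oplus>\<^bsub>M\<^esub> y) = a \<odot>\<^bsub>M\<^esub> x \<oplus>\<^bsub>M\<^esub> a \<odot>\<^bsub>M\<^esub> y"
    and N: "\<And>a x. \<lbrakk>a \<in> carrier A; x \<in> N\<rbrakk> \<Longrightarrow> a \<odot>\<^bsub>M\<^esub> x \<in> N"
    and ld: "\<And>a b x. \<lbrakk>a \<in> carrier A; b \<in> carrier A; x \<in> carrier M\<rbrakk>
        \<Longrightarrow> (a \<oplus> b) \<odot>\<^bsub>M\<^esub> x \<in> N +>\<^bsub>M\<^esub> (a \<odot>\<^bsub>M\<^esub> x \<oplus>\<^bsub>M\<^esub> b \<odot>\<^bsub>M\<^esub> x)"
    and as: "\<And>a b x. \<lbrakk>a \<in> carrier A; b \<in> carrier A; x \<in> carrier M\<rbrakk>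
        \<Longrightarrow> (a \<otimes> b) \<odot>\<^bsub>M\<^esub> x \<in> N +>\<^bsub>M\<^esub> (a \<odot>\<^bsub>M\<^esub> (b \<odot>\<^bsub>M\<^esub> x))"
    and on: "\<And>x. x \<in> carrier M \<Longrightarrow> \<one> \<odot>\<^bsub>M\<^esub> x \<in> N +>\<^bsub>M\<^esub> x"
  shows "lmod (Q N)"
    and "carrier (Q N) = q N ` carrier M"
    and "\<And>x y. \<lbrakk>x \<in> carrier M; y \<in> carrier M\<rbrakk> \<Longrightarrow> q N (x \<oplus>\<^bsub>M\<^esub> y) = q N x \<oplus>\<^bsub>Q N\<^esub> q N y"
    and "\<And>a x. \<lbrakk>a \<in> carrier A; x \<in> carrier M\<rbrakk> \<Longrightarrow> q N (a \<odot>\<^bsub>M\<^esub> x) = a \<odot>\<^bsub>Q N\<^esub> q N x"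
    and "\<And>x. x \<in> carrier M \<Longrightarrow> q N x = \<zero>\<^bsub>Q N\<^esub> \<longleftrightarrow> x \<in> N"
proof -
  interpret S: abelian_subgroup N M by (rule abelian_subgroupI3[OF S G])
  have NM: "N \<subseteq> carrier M" by (rule S.a_subset)
  have qeq: "q N y = q N x" if "y \<in> N +>\<^bsub>M\<^esub> x" "x \<in> carrier M" for x y
    using S.a_repr_independence'[OF that] by (simp add: q_def)
  have car: "carrier (Q N) = q N ` carrier M"
    by (auto simp: Q_def q_def quotient_module_def A_RCOSETS_def')
  have plus: "q N (x \<oplus>\<^bsub>M\<^esub> y) = q N x \<oplus>\<^bsub>Q N\<^esub> q N y" if "x \<in> carrier M" "y \<in> carrier M" for x y
    using S.a_rcos_sum[OF that] by (simp add: Q_def q_def quotient_module_def)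
  have smult: "q N (a \<odot>\<^bsub>M\<^esub> x) = a \<odot>\<^bsub>Q N\<^esub> q N x" if a: "a \<in> carrier A" and x: "x \<in> carrier M" for a x
  proof -
    have "q N (a \<odot>\<^bsub>M\<^esub> y) = q N (a \<odot>\<^bsub>M\<^esub> x)" if y: "y \<in> q N x" for y
    proof -
      obtain n where n: "n \<in> N" "y = n \<oplus>\<^bsub>M\<^esub> x" using y by (auto simp: q_def a_r_coset_def')
      have "a \<odot>\<^bsub>M\<^esub> y = a \<odot>\<^bsub>M\<^esub> n \<oplus>\<^bsub>M\<^esub> a \<odot>\<^bsub>M\<^esub> x" using n ad a x NM by auto
      then have "a \<odot>\<^bsub>M\<^esub> y \<in> N +>\<^bsub>M\<^esub> (a \<odot>\<^bsub>M\<^esub> x)" using N[OF a n(1)] by (auto simp: a_r_coset_def')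
      then show ?thesis by (rule qeq) (use cl a x in auto)
    qed
    moreover have "x \<in> q N x" unfolding q_def by (rule S.a_rcos_self[OF x])
    ultimately have "(\<Union>y\<in>q N x. q N (a \<odot>\<^bsub>M\<^esub> y)) = q N (a \<odot>\<^bsub>M\<^esub> x)" by blast
    then show ?thesis by (simp add: Q_def quotient_module_def q_def)
  qed
  have z: "\<zero>\<^bsub>Q N\<^esub> = q N \<zero>\<^bsub>M\<^esub>" "\<zero>\<^bsub>Q N\<^esub> = N"
    using S.a_coset_add_zero[OF NM] by (auto simp: Q_def quotient_module_def q_def)
  have q0: "q N x = \<zero>\<^bsub>Q N\<^esub> \<longleftrightarrow> x \<in> N" if "x \<in> carrier M" for x
    using that S.a_rcos_self[OF that] S.a_rcos_const[of x] z(2) by (auto simp: q_def)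
  have zs: "\<zero> \<odot>\<^bsub>M\<^esub> x \<in> N" if x: "x \<in> carrier M" for x
  proof -
    let ?z = "\<zero> \<odot>\<^bsub>M\<^esub> x"
    have zc: "?z \<in> carrier M" using x cl by simp
    obtain n where n: "n \<in> N" "?z = n \<oplus>\<^bsub>M\<^esub> (?z \<oplus>\<^bsub>M\<^esub> ?z)"
      using ld[OF zero_closed zero_closed x] by (auto simp: a_r_coset_def')
    have nc: "n \<in> carrier M" using n NM by auto
    have "(n \<oplus>\<^bsub>M\<^esub> ?z) \<oplus>\<^bsub>M\<^esub> ?z = ?z" using n(2) zc nc S.a_assoc by simp
    then have "n \<oplus>\<^bsub>M\<^esub> ?z = \<zero>\<^bsub>M\<^esub>" using zc nc by simp
    then have "?z = \<ominus>\<^bsub>M\<^esub> n" using zc nc S.a_comm S.minus_equality by metis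
    then show ?thesis using n(1) by simp
  qed
  show "lmod (Q N)"
  proof (rule lmodI)
    show "\<zero>\<^bsub>Q N\<^esub> \<in> carrier (Q N)" unfolding z(1) car by simp
    show "\<And>x y. \<lbrakk>x \<in> carrier (Q N); y \<in> carrier (Q N)\<rbrakk> \<Longrightarrow> x \<oplus>\<^bsub>Q N\<^esub> y \<in> carrier (Q N)"
      unfolding car by (auto simp: plus[symmetric])
    show "\<And>a x. \<lbrakk>a \<in> carrier A; x \<in> carrier (Q N)\<rbrakk> \<Longrightarrow> a \<odot>\<^bsub>Q N\<^esub> x \<in> carrier (Q N)"
      unfolding car by (auto simp: smult[symmetric] cl)
    show "(a \<oplus> b) \<odot>\<^bsub>Q N\<^esub> x = a \<odot>\<^bsub>Q N\<^esub> x \<oplus>\<^bsub>Q N\<^esub> b \<odot>\<^bsub>Q N\<^esub> x"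
      if "a \<in> carrier A" "b \<in> carrier A" "x \<in> carrier (Q N)" for a b x
      using that unfolding car by (auto simp: smult[symmetric] plus[symmetric] cl qeq[OF ld])
    show "a \<odot>\<^bsub>Q N\<^esub> (x \<oplus>\<^bsub>Q N\<^esub> y) = a \<odot>\<^bsub>Q N\<^esub> x \<oplus>\<^bsub>Q N\<^esub> a \<odot>\<^bsub>Q N\<^esub> y"
      if "a \<in> carrier A" "x \<in> carrier (Q N)" "y \<in> carrier (Q N)" for a x y
      using that unfolding car by (auto simp: smult[symmetric] plus[symmetric] cl ad)
    show "(a \<otimes> b) \<odot>\<^bsub>Q N\<^esub> x = a \<odot>\<^bsub>Q N\<^esub> (b \<odot>\<^bsub>Q N\<^esub> x)"
      if "a \<in> carrier A" "b \<in> carrier A" "x \<in> carrier (Q N)" for a b x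
      using that unfolding car by (auto simp: smult[symmetric] plus[symmetric] cl qeq[OF as])
    show "\<one> \<odot>\<^bsub>Q N\<^esub> x = x" if "x \<in> carrier (Q N)" for x
      using that unfolding car by (auto simp: smult[symmetric] qeq[OF on])
    show "\<zero> \<odot>\<^bsub>Q N\<^esub> x = \<zero>\<^bsub>Q N\<^esub>" if "x \<in> carrier (Q N)" for x
    proof -
      obtain y where y: "y \<in> carrier M" "x = q N y" using \<open>x \<in> carrier (Q N)\<close> unfolding car by auto
      have "\<zero> \<odot>\<^bsub>Q N\<^esub> x = q N (\<zero> \<odot>\<^bsub>M\<^esub> y)" using y smult[OF zero_closed y(1)] by simp
      then show ?thesis using q0[of "\<zero> \<odot>\<^bsub>M\<^esub> y"] zs[OF y(1)] cl[OF zero_closed y(1)] by simp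
    qed
    show "(x \<oplus>\<^bsub>Q N\<^esub> y) \<oplus>\<^bsub>Q N\<^esub> w = x \<oplus>\<^bsub>Q N\<^esub> (y \<oplus>\<^bsub>Q N\<^esub> w)"
      if "x \<in> carrier (Q N)" "y \<in> carrier (Q N)" "w \<in> carrier (Q N)" for x y w
      using that unfolding car by (auto simp: plus[symmetric] S.a_assoc)
    show "x \<oplus>\<^bsub>Q N\<^esub> y = y \<oplus>\<^bsub>Q N\<^esub> x"
      if "x \<in> carrier (Q N)" "y \<in> carrier (Q N)" for x y
      using that unfolding car by (auto simp: plus[symmetric] S.a_comm)
    show "\<zero>\<^bsub>Q N\<^esub> \<oplus>\<^bsub>Q N\<^esub> x = x" if "x \<in> carrier (Q N)" for x
      using that unfolding car z(1) by (auto simp: plus[symmetric])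
  qed
  show "carrier (Q N) = q N ` carrier M" by (rule car)
  show "q N (x \<oplus>\<^bsub>M\<^esub> y) = q N x \<oplus>\<^bsub>Q N\<^esub> q N y" if "x \<in> carrier M" "y \<in> carrier M" for x y by (rule plus[OF that])
  show "q N (a \<odot>\<^bsub>M\<^esub> x) = a \<odot>\<^bsub>Q N\<^esub> q N x" if a: "a \<in> carrier A" and x: "x \<in> carrier M" for a x by (rule smult[OF that])
  show "q N x = \<zero>\<^bsub>Q N\<^esub> \<longleftrightarrow> x \<in> N" if "x \<in> carrier M" for x by (rule q0[OF that])
qed

lemma
  assumes M: "lmod M" and N: "subm N M"
  shows lmod_quotient: "lmod (quotient_module M N)"
    and lin_quotient: "lin M (quotient_module M N) (\<lambda>x. N +>\<^bsub>M\<^esub> x)"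
    and quotient_surj: "(\<lambda>x. N +>\<^bsub>M\<^esub> x) ` carrier M = carrier (quotient_module M N)"
    and quotient_eq_zero: "\<And>x. x \<in> carrier M \<Longrightarrow> N +>\<^bsub>M\<^esub> x = \<zero>\<^bsub>quotient_module M N\<^esub> \<longleftrightarrow> x \<in> N"
proof -
  have G: "abelian_group M" by (rule lmod_abelian_group[OF M])
  have S: "additive_subgroup N M"
    using N by (intro additive_subgroup.intro) (rule submodule.axioms(1))
  interpret S: abelian_subgroup N M by (rule abelian_subgroupI3[OF S G])
  have self: "x = y \<Longrightarrow> y \<in> carrier M \<Longrightarrow> x \<in> N +>\<^bsub>M\<^esub> y" for x y by (simp add: S.a_rcos_self)
  have a: "(a \<oplus> b) \<odot>\<^bsub>M\<^esub> x \<in> N +>\<^bsub>M\<^esub> (a \<odot>\<^bsub>M\<^esub> x \<oplus>\<^bsub>M\<^esub> b \<odot>\<^bsub>M\<^esub> x)"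
    if "a \<in> carrier A" "b \<in> carrier A" "x \<in> carrier M" for a b x
    using that M by (intro self) (auto simp: lm_ldistr)
  have b: "(a \<otimes> b) \<odot>\<^bsub>M\<^esub> x \<in> N +>\<^bsub>M\<^esub> (a \<odot>\<^bsub>M\<^esub> (b \<odot>\<^bsub>M\<^esub> x))"
    if "a \<in> carrier A" "b \<in> carrier A" "x \<in> carrier M" for a b x
    using that M by (intro self) (auto simp: lm_assoc)
  have c: "\<one> \<odot>\<^bsub>M\<^esub> x \<in> N +>\<^bsub>M\<^esub> x" if "x \<in> carrier M" for x
    using that M by (intro self) auto
  note * = quotient_module_general[OF G S]
  show "lmod (quotient_module M N)"
    by (rule *(1)) (use M N a b c in \<open>auto simp: lm_rdistr\<close>)
  show car: "(\<lambda>x. N +>\<^bsub>M\<^esub> x) ` carrier M = carrier (quotient_module M N)"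
    by (rule *(2)[symmetric]) (use M N a b c in \<open>auto simp: lm_rdistr\<close>)
  show "\<And>x. x \<in> carrier M \<Longrightarrow> N +>\<^bsub>M\<^esub> x = \<zero>\<^bsub>quotient_module M N\<^esub> \<longleftrightarrow> x \<in> N"
    by (rule *(5)) (use M N a b c in \<open>auto simp: lm_rdistr\<close>)
  show "lin M (quotient_module M N) (\<lambda>x. N +>\<^bsub>M\<^esub> x)"
  proof (rule linI)
    show "N +>\<^bsub>M\<^esub> x \<in> carrier (quotient_module M N)" if "x \<in> carrier M" for x using that car by blast
    show "N +>\<^bsub>M\<^esub> (x \<oplus>\<^bsub>M\<^esub> y) = (N +>\<^bsub>M\<^esub> x) \<oplus>\<^bsub>quotient_module M N\<^esub> (N +>\<^bsub>M\<^esub> y)"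
      if "x \<in> carrier M" "y \<in> carrier M" for x y
      by (rule *(3)) (use that M N a b c in \<open>auto simp: lm_rdistr\<close>)
    show "N +>\<^bsub>M\<^esub> (r \<odot>\<^bsub>M\<^esub> x) = r \<odot>\<^bsub>quotient_module M N\<^esub> (N +>\<^bsub>M\<^esub> x)"
      if "r \<in> carrier A" "x \<in> carrier M" for r x
      by (rule *(4)) (use that M N a b c in \<open>auto simp: lm_rdistr\<close>)
  qed
qed

lemma iso_quotient_iff:
  assumes M: "lmod M" and N: "subm N M" and X: "lmod X"
  shows "mod_iso A (quotient_module M N) X \<longleftrightarrow>
    (\<exists>g. lin M X g \<and> g ` carrier M = carrier X \<and> {x \<in> carrier M. g x = \<zero>\<^bsub>X\<^esub>} = N)" (is "?L \<longleftrightarrow> ?R")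
proof -
  let ?Q = "quotient_module M N" and ?q = "\<lambda>x. N +>\<^bsub>M\<^esub> x"
  note q = lmod_quotient[OF M N] lin_quotient[OF M N] quotient_surj[OF M N] quotient_eq_zero[OF M N]
  have NM: "N \<subseteq> carrier M" by (rule subm_subset[OF N])
  show ?thesis
  proof
    assume ?L
    then obtain f where f: "lin ?Q X f" "bij_betw f (carrier ?Q) (carrier X)"
      unfolding mod_iso_iff[OF q(1)] by blast
    have inj: "\<forall>y\<in>carrier ?Q. f y = \<zero>\<^bsub>X\<^esub> \<longrightarrow> y = \<zero>\<^bsub>?Q\<^esub>"
      using lin_inj_iff[OF f(1) q(1) X] bij_betw_imp_inj_on[OF f(2)] by blast
    have f0: "f \<zero>\<^bsub>?Q\<^esub> = \<zero>\<^bsub>X\<^esub>" by (rule lin_zero[OF f(1) q(1) X])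
    have "f (?q x) = \<zero>\<^bsub>X\<^esub> \<longleftrightarrow> x \<in> N" if "x \<in> carrier M" for x
    proof
      assume "f (?q x) = \<zero>\<^bsub>X\<^esub>"
      then have "?q x = \<zero>\<^bsub>?Q\<^esub>" using inj lin_closed[OF q(2) that] by blast
      then show "x \<in> N" using q(4)[OF that] by blast
    next
      assume "x \<in> N" then have "?q x = \<zero>\<^bsub>?Q\<^esub>" using q(4)[OF that] by blast
      then show "f (?q x) = \<zero>\<^bsub>X\<^esub>" using f0 by simp
    qed
    moreover have "(\<lambda>x. f (?q x)) ` carrier M = carrier X"
      using q(3) bij_betw_imp_surj_on[OF f(2)] by (metis image_image)
    ultimately show ?R using lin_comp[OF q(2) f(1)] NM by (intro exI[of _ "\<lambda>x. f (?q x)"]) auto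
  next
    assume ?R
    then obtain g where g: "lin M X g" "g ` carrier M = carrier X" "{x \<in> carrier M. g x = \<zero>\<^bsub>X\<^esub>} = N" by blast
    have kk: "g x = \<zero>\<^bsub>X\<^esub>" if "x \<in> carrier M" "?q x = \<zero>\<^bsub>?Q\<^esub>" for x
      using that q(4)[OF that(1)] g(3) by blast
    obtain h where h: "lin ?Q X h" "\<And>x. x \<in> carrier M \<Longrightarrow> h (?q x) = g x"
      using factor_thru[OF M X q(2,3) g(1) kk q(1)] by blast
    have "inj_on h (carrier ?Q)"
      unfolding lin_inj_iff[OF h(1) q(1) X] unfolding q(3)[symmetric] using h(2) q(4) g(3) by auto
    moreover have "h ` carrier ?Q = carrier X"
      unfolding q(3)[symmetric] g(2)[symmetric] image_image using h(2) by (intro image_cong) auto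
    ultimately show ?L unfolding mod_iso_iff[OF q(1)] using h(1) by (auto simp: bij_betw_def)
  qed
qed

subsection \<open>Filtrations\<close>

text \<open>A filtration between two submodules. Each factor is given by an epimorphism whose kernel is the
  previous step, so that induction along a filtration never mentions quotient modules.\<close>

inductive fchain :: "('a, 't) module set \<Rightarrow> ('a, 'm) module \<Rightarrow> 'm set \<Rightarrow> 'm set \<Rightarrow> bool"
  for \<theta> :: "('a, 't) module set" and M :: "('a, 'm) module" and N0 :: "'m set" where
  base: "fchain \<theta> M N0 N0"
| step: "\<lbrakk>fchain \<theta> M N0 N; subm N' M; X \<in> \<theta>; lin (M \<restriction> N') X g; g ` N' = carrier X;
    {x \<in> N'. g x = \<zero>\<^bsub>X\<^esub>} = N\<rbrakk> \<Longrightarrow> fchain \<theta> M N0 N'"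

lemma fchain_subm:
  assumes "fchain \<theta> M N0 N" "subm N0 M" shows "subm N M \<and> N0 \<subseteq> N"
  using assms(1) by (induction) (use assms(2) in auto)

lemma fchain_trans: "fchain \<theta> M N1 N2 \<Longrightarrow> fchain \<theta> M N0 N1 \<Longrightarrow> fchain \<theta> M N0 N2"
  by (induction rule: fchain.induct) (auto intro: fchain.intros)

lemma fchain_factors:
  assumes ch: "fchain \<theta> M N0 N" and M: "lmod M" and N0: "subm N0 M"
    and sub: "\<And>X. X \<in> \<theta> \<Longrightarrow> lmod X \<and> (\<exists>Y\<in>\<theta>'. lmod Y \<and> (\<exists>f. lin X Y f \<and> bij_betw f (carrier X) (carrier Y)))"
  shows "fchain \<theta>' M N0 N"
  using ch
proof induction
  case base show ?case by (rule fchain.base)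
next
  case (step N N' X g)
  obtain Y f where Y: "Y \<in> \<theta>'" "lmod X" "lmod Y" "lin X Y f" "bij_betw f (carrier X) (carrier Y)"
    using sub[OF step(3)] by blast
  have f: "f ` carrier X = carrier Y" "\<forall>x\<in>carrier X. f x = \<zero>\<^bsub>Y\<^esub> \<longrightarrow> x = \<zero>\<^bsub>X\<^esub>" "f \<zero>\<^bsub>X\<^esub> = \<zero>\<^bsub>Y\<^esub>"
    using bij_betw_imp_surj_on[OF Y(5)] lin_inj_iff[OF Y(4,2,3)] bij_betw_imp_inj_on[OF Y(5)]
      lin_zero[OF Y(4,2,3)] by auto
  show ?case
  proof (rule fchain.step[OF step.IH step(2) Y(1)])
    show "lin (M \<restriction> N') Y (\<lambda>x. f (g x))" by (rule lin_comp[OF step(4) Y(4)])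
    show "(\<lambda>x. f (g x)) ` N' = carrier Y" using step(5) f(1) by (metis image_image)
    show "{x \<in> N'. f (g x) = \<zero>\<^bsub>Y\<^esub>} = N"
      using step(6) f(2,3) lin_closed[OF step(4)] by auto
  qed
qed

text \<open>When the kernel lies below the bottom of the chain, each epimorphism onto a factor still factors
  through the image, so the factors do not change. This carries filtrations both along monomorphisms
  and to quotients.\<close>

lemma fchain_map:
  assumes ch: "fchain \<theta> M N0 N" and M: "lmod M" and M': "lmod M'" and N0: "subm N0 M"
    and q: "lin M M' q" and ker: "{x \<in> carrier M. q x = \<zero>\<^bsub>M'\<^esub>} \<subseteq> N0"
    and \<theta>: "\<And>X. X \<in> \<theta> \<Longrightarrow> lmod X"
  shows "fchain \<theta> M' (q ` N0) (q ` N)"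
  using ch
proof induction
  case base show ?case by (rule fchain.base)
next
  case (step N N' X g)
  have N: "subm N M" "N0 \<subseteq> N" using fchain_subm[OF step(1) N0] by auto
  have X: "lmod X" by (rule \<theta>[OF step(3)])
  have N'M: "N' \<subseteq> carrier M" by (rule subm_subset[OF step(2)])
  have sN': "subm (q ` N') M'" by (rule subm_image[OF q M M' step(2)])
  have l: "lin (M \<restriction> N') (M' \<restriction> (q ` N')) q"
    by (rule lin_to_restr[OF lin_restr_dom[OF q N'M]]) auto
  have kk: "g x = \<zero>\<^bsub>X\<^esub>" if "x \<in> carrier (M \<restriction> N')" "q x = \<zero>\<^bsub>M' \<restriction> (q ` N')\<^esub>" for x
    using that N'M ker N(2) step(6) by auto
  obtain h where h: "lin (M' \<restriction> (q ` N')) X h" "\<And>x. x \<in> N' \<Longrightarrow> h (q x) = g x"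
    using factor_thru[OF lmod_restr[OF M step(2)] X l _ step(4) kk lmod_restr[OF M' sN']] by auto
  show ?case
  proof (rule fchain.step[OF step.IH sN' step(3) h(1)])
    show "h ` q ` N' = carrier X"
      unfolding image_image step(5)[symmetric] using h(2) by (intro image_cong) auto
    show "{x \<in> q ` N'. h x = \<zero>\<^bsub>X\<^esub>} = q ` N" using h(2) step(6) by auto
  qed
qed

text \<open>The bridge to filtrations given as sequences of submodules with isomorphic quotients.\<close>

lemma filt_iff_fchain:
  assumes \<theta>: "\<And>X. X \<in> \<theta> \<Longrightarrow> lmod X"
  shows "M \<in> filt A \<theta> \<longleftrightarrow> fg_module A M \<and> fchain \<theta> M {\<zero>\<^bsub>M\<^esub>} (carrier M)"
proof -
  have iff: "mod_iso A (quotient_module (M \<restriction> N') N) X \<longleftrightarrow>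
      (\<exists>g. lin (M \<restriction> N') X g \<and> g ` N' = carrier X \<and> {x \<in> N'. g x = \<zero>\<^bsub>X\<^esub>} = N)"
    if "lmod M" "subm N M" "subm N' M" "N \<subseteq> N'" "X \<in> \<theta>" for N N' X
    using iso_quotient_iff[of "M \<restriction> N'" N X] that \<theta> by (simp add: subm_restr)
  show ?thesis
  proof
    assume "M \<in> filt A \<theta>"
    then obtain n and N :: "nat \<Rightarrow> _" where fg: "fg_module A M"
      and N: "N 0 = {\<zero>\<^bsub>M\<^esub>}" "N n = carrier M" "\<forall>i\<le>n. subm (N i) M"
      "\<forall>i<n. N i \<subseteq> N (Suc i) \<and> (\<exists>X\<in>\<theta>. mod_iso A (quotient_module (M \<restriction> N (Suc i)) (N i)) X)"
      unfolding filt_def by blast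
    have M: "lmod M" using fg by (simp add: fg_module_def)
    have "fchain \<theta> M {\<zero>\<^bsub>M\<^esub>} (N i)" if "i \<le> n" for i
      using that
    proof (induction i)
      case 0 show ?case unfolding N(1) by (rule fchain.base)
    next
      case (Suc i)
      then have i: "i < n" and IH: "fchain \<theta> M {\<zero>\<^bsub>M\<^esub>} (N i)" by auto
      have sub: "N i \<subseteq> N (Suc i)" using N(4) i by blast
      obtain X where X: "X \<in> \<theta>" "mod_iso A (quotient_module (M \<restriction> N (Suc i)) (N i)) X" using N(4) i by blast
      have "subm (N i) M" "subm (N (Suc i)) M" using N(3) i by auto
      then obtain g where "lin (M \<restriction> N (Suc i)) X g" "g ` N (Suc i) = carrier X" "{x \<in> N (Suc i). g x = \<zero>\<^bsub>X\<^esub>} = N i"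
        using X(2) unfolding iff[OF M \<open>subm (N i) M\<close> \<open>subm (N (Suc i)) M\<close> sub X(1)] by blast
      then show ?case by (rule fchain.step[OF IH \<open>subm (N (Suc i)) M\<close> X(1)])
    qed
    from this[OF order_refl] show "fg_module A M \<and> fchain \<theta> M {\<zero>\<^bsub>M\<^esub>} (carrier M)" using fg N(2) by simp
  next
    assume *: "fg_module A M \<and> fchain \<theta> M {\<zero>\<^bsub>M\<^esub>} (carrier M)"
    then have fg: "fg_module A M" and M: "lmod M" by (auto simp: fg_module_def)
    have "\<exists>n N. N 0 = {\<zero>\<^bsub>M\<^esub>} \<and> N n = K \<and> (\<forall>i\<le>(n::nat). subm (N i) M) \<and>
       (\<forall>i<n. N i \<subseteq> N (Suc i) \<and> (\<exists>X\<in>\<theta>. mod_iso A (quotient_module (M \<restriction> N (Suc i)) (N i)) X))"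
      if "fchain \<theta> M {\<zero>\<^bsub>M\<^esub>} K" for K
      using that
    proof induction
      case base
      then show ?case using M by (intro exI[of _ 0] exI[of _ "\<lambda>_. {\<zero>\<^bsub>M\<^esub>}"]) auto
    next
      case (step K K' X g)
      obtain n :: nat and N where N: "N 0 = {\<zero>\<^bsub>M\<^esub>}" "N n = K" "\<forall>i\<le>n. subm (N i) M"
       "\<forall>i<n. N i \<subseteq> N (Suc i) \<and> (\<exists>X\<in>\<theta>. mod_iso A (quotient_module (M \<restriction> N (Suc i)) (N i)) X)"
        using step.IH by blast
      have KK: "K \<subseteq> K'" "subm K M" using step(6) N(2,3) by auto
      have iso: "mod_iso A (quotient_module (M \<restriction> K') K) X"
        unfolding iff[OF M KK(2) step(2) KK(1) step(3)] using step(4-6) by blast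
      define N' where "N' = N(Suc n := K')"
      have "\<forall>i\<le>Suc n. subm (N' i) M" using N(3) step(2) by (auto simp: N'_def)
      moreover have "\<forall>i<Suc n. N' i \<subseteq> N' (Suc i) \<and> (\<exists>X\<in>\<theta>. mod_iso A (quotient_module (M \<restriction> N' (Suc i)) (N' i)) X)"
      proof (intro allI impI)
        fix i assume "i < Suc n"
        then consider "i < n" | "i = n" by linarith
        then show "N' i \<subseteq> N' (Suc i) \<and> (\<exists>X\<in>\<theta>. mod_iso A (quotient_module (M \<restriction> N' (Suc i)) (N' i)) X)"
        proof cases
          case 1 then show ?thesis using N(4) by (simp add: N'_def)
        next
          case 2 then show ?thesis using KK(1) iso step(3) N(2) by (auto simp: N'_def)
        qed
      qed
      moreover have "N' 0 = {\<zero>\<^bsub>M\<^esub>}" "N' (Suc n) = K'" using N(1) by (auto simp: N'_def)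
      ultimately show ?case by blast
    qed
    then show "M \<in> filt A \<theta>" using * by (simp add: filt_def)
  qed
qed

subsection \<open>Maps that factor through sums of given modules\<close>

text \<open>The maps \<open>K \<rightarrow> L\<close> that factor through a finite direct sum of modules from \<open>\<M>\<close>, built one summand
  at a time and without forming the direct sum. The rule \<open>ext\<close> is needed because the values of a map
  outside its domain are arbitrary.\<close>

inductive thru :: "('a, 't) module set \<Rightarrow> ('a, 'm) module \<Rightarrow> ('a, 'n) module \<Rightarrow> ('m \<Rightarrow> 'n) \<Rightarrow> bool"
  for \<M> :: "('a, 't) module set" and K :: "('a, 'm) module" and L :: "('a, 'n) module" where
  zero: "thru \<M> K L (\<lambda>x. \<zero>\<^bsub>L\<^esub>)"
| step: "\<lbrakk>thru \<M> K L f; M \<in> \<M>; lin K M b; lin M L a\<rbrakk> \<Longrightarrow> thru \<M> K L (\<lambda>x. f x \<oplus>\<^bsub>L\<^esub> a (b x))"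
| ext: "\<lbrakk>thru \<M> K L f; \<And>x. x \<in> carrier K \<Longrightarrow> f x = g x\<rbrakk> \<Longrightarrow> thru \<M> K L g"

text \<open>The identity factors through a finite direct sum, that is, \<open>L\<close> is in \<open>add\<close> of \<open>\<M>\<close>.\<close>

definition summand :: "('a, 't) module set \<Rightarrow> ('a, 'm) module \<Rightarrow> bool" where
  "summand \<M> L \<longleftrightarrow> thru \<M> L L (\<lambda>x. x)"

lemma thru_lin: "\<lbrakk>thru \<M> K L f; lmod K; lmod L\<rbrakk> \<Longrightarrow> lin K L f"
proof (induction rule: thru.induct)
  case zero then show ?case by (intro lin_const_zero)
next
  case (step f M b a) then show ?case by (intro lin_plus lin_comp[OF step(3,4)]) auto
next
  case (ext f g) then show ?case using lin_cong by blast
qed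

lemma thru_single: "\<lbrakk>M \<in> \<M>; lin K M b; lin M L a; lmod L\<rbrakk> \<Longrightarrow> thru \<M> K L (\<lambda>x. a (b x))"
  by (rule thru.ext[OF thru.step[OF thru.zero]]) (auto simp: lin_closed)

lemma thru_plus:
  assumes "thru \<M> K L g" "thru \<M> K L f" "lmod L" "lmod K"
  shows "thru \<M> K L (\<lambda>x. f x \<oplus>\<^bsub>L\<^esub> g x)"
  using assms(1)
proof induction
  case zero
  show ?case
    by (rule thru.ext[OF assms(2)]) (use lin_closed[OF thru_lin[OF assms(2,4,3)]] assms in auto)
next
  case (step g M b a)
  have c: "f x \<in> carrier L" "g x \<in> carrier L" "a (b x) \<in> carrier L" if "x \<in> carrier K" for x
    using that thru_lin[OF assms(2,4,3)] thru_lin[OF step(1) assms(4,3)] step(3,4) by (auto simp: lin_closed)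
  show ?case
    by (rule thru.ext[OF thru.step[OF step.IH step(2,3,4)]]) (use c assms(3) in \<open>simp add: lm_a_assoc\<close>)
next
  case (ext g h)
  show ?case by (rule thru.ext[OF ext.IH]) (simp add: ext(2))
qed

lemma thru_comp_left:
  assumes "thru \<M> K L f" "lin L L' g" "lmod K" "lmod L" "lmod L'"
  shows "thru \<M> K L' (\<lambda>x. g (f x))"
  using assms(1)
proof induction
  case zero show ?case by (rule thru.ext[OF thru.zero]) (simp add: lin_zero[OF assms(2,4,5)])
next
  case (step f M b a)
  show ?case
    by (rule thru.ext[OF thru.step[OF step.IH step(2,3) lin_comp[OF step(4) assms(2)]]])
      (use step(3,4) in \<open>simp add: lin_add[OF assms(2)] lin_closed[OF thru_lin[OF step(1) assms(3,4)]] lin_closed\<close>)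
next
  case (ext f h) show ?case by (rule thru.ext[OF ext.IH]) (simp add: ext(2))
qed

lemma thru_comp_right:
  assumes "thru \<M> K L f" "lin K' K g" shows "thru \<M> K' L (\<lambda>x. f (g x))"
  using assms(1)
proof induction
  case zero show ?case by (rule thru.zero)
next
  case (step f M b a)
  show ?case by (rule thru.step[OF step.IH step(2) lin_comp[OF assms(2) step(3)] step(4)])
next
  case (ext f h) show ?case by (rule thru.ext[OF ext.IH]) (simp add: ext(2) lin_closed[OF assms(2)])
qed

lemma thru_trans:
  assumes "thru \<M> K L f" "\<And>M. M \<in> \<M> \<Longrightarrow> summand \<N> M \<and> lmod M" "lmod K" "lmod L"
  shows "thru \<N> K L f"
  using assms(1)
proof induction
  case zero show ?case by (rule thru.zero)
next
  case (step f M b a)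
  have M: "thru \<N> M M (\<lambda>x. x)" "lmod M" using assms(2)[OF step(2)] by (auto simp: summand_def)
  have "thru \<N> K L (\<lambda>x. a (b x))"
    using thru_comp_left[OF thru_comp_right[OF M(1) step(3)] step(4) assms(3) M(2) assms(4)] .
  from thru_plus[OF this step.IH assms(4,3)] show ?case .
next
  case (ext f h) show ?case by (rule thru.ext[OF ext.IH]) (simp add: ext(2))
qed

lemma summand_self: "M \<in> \<M> \<Longrightarrow> lmod M \<Longrightarrow> summand \<M> M"
  unfolding summand_def by (rule thru_single[OF _ lin_id lin_id])

lemma summand_trans:
  "\<lbrakk>summand \<M> L; \<And>M. M \<in> \<M> \<Longrightarrow> summand \<N> M \<and> lmod M; lmod L\<rbrakk> \<Longrightarrow> summand \<N> L"
  unfolding summand_def by (erule thru_trans) (auto simp: summand_def)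

lemma summand_retract:
  assumes "summand \<M> L" "lin L' L b" "lin L L' a" "\<And>x. x \<in> carrier L' \<Longrightarrow> a (b x) = x" "lmod L" "lmod L'"
  shows "summand \<M> L'"
  unfolding summand_def
  by (rule thru.ext[OF thru_comp_left[OF thru_comp_right[OF assms(1)[unfolded summand_def] assms(2)] assms(3)]])
    (use assms in auto)

lemma thru_vanish_from:
  assumes "thru \<M> K L f" "lin L Y g" "lmod K" "lmod L" "lmod Y"
    and 0: "\<And>M a x. \<lbrakk>M \<in> \<M>; lin M Y a; x \<in> carrier M\<rbrakk> \<Longrightarrow> a x = \<zero>\<^bsub>Y\<^esub>"
  shows "\<forall>x\<in>carrier K. g (f x) = \<zero>\<^bsub>Y\<^esub>"
  using assms(1)
proof induction
  case zero show ?case by (simp add: lin_zero[OF assms(2,4,5)])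
next
  case (step f M b a)
  have "g (a (b x)) = \<zero>\<^bsub>Y\<^esub>" if "x \<in> carrier K" for x
    using 0[OF step(2) lin_comp[OF step(4) assms(2)] lin_closed[OF step(3) that]] .
  then show ?case using step.IH assms(5) step(3,4)
    by (simp add: lin_add[OF assms(2)] lin_closed[OF thru_lin[OF step(1) assms(3,4)]] lin_closed)
next
  case (ext f h) then show ?case by simp
qed

lemma summand_vanish_from:
  assumes "summand \<M> L" "lin L Y g" "lmod L" "lmod Y"
    and "\<And>M a x. \<lbrakk>M \<in> \<M>; lin M Y a; x \<in> carrier M\<rbrakk> \<Longrightarrow> a x = \<zero>\<^bsub>Y\<^esub>" and "x \<in> carrier L"
  shows "g x = \<zero>\<^bsub>Y\<^esub>"
  using thru_vanish_from[of \<M> L L "\<lambda>x. x" Y g] assms by (simp add: summand_def)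

lemma thru_vanish_into:
  assumes "thru \<M> K L f" "lin Y K g" "lmod K" "lmod L" "lmod Y"
    and 0: "\<And>M b x. \<lbrakk>M \<in> \<M>; lin Y M b; x \<in> carrier Y\<rbrakk> \<Longrightarrow> b x = \<zero>\<^bsub>M\<^esub>" and \<M>: "\<And>M. M \<in> \<M> \<Longrightarrow> lmod M"
  shows "\<forall>x\<in>carrier Y. f (g x) = \<zero>\<^bsub>L\<^esub>"
  using assms(1)
proof induction
  case zero show ?case by simp
next
  case (step f M b a)
  have "b (g x) = \<zero>\<^bsub>M\<^esub>" if "x \<in> carrier Y" for x
    using 0[OF step(2) lin_comp[OF assms(2) step(3)] that] .
  then show ?case using step.IH assms(4) by (simp add: lin_zero[OF step(4) \<M>[OF step(2)] assms(4)])
next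
  case (ext f h) then show ?case by (simp add: lin_closed[OF assms(2)])
qed

lemma summand_vanish_into:
  assumes "summand \<M> L" "lin Y L g" "lmod L" "lmod Y"
    and "\<And>M b x. \<lbrakk>M \<in> \<M>; lin Y M b; x \<in> carrier Y\<rbrakk> \<Longrightarrow> b x = \<zero>\<^bsub>M\<^esub>" and "\<And>M. M \<in> \<M> \<Longrightarrow> lmod M"
    and "x \<in> carrier Y"
  shows "g x = \<zero>\<^bsub>L\<^esub>"
  using thru_vanish_into[of \<M> L L "\<lambda>x. x" Y g] assms by (simp add: summand_def)

lemma thru_lift:
  assumes "thru \<M> K L \<alpha>" "lin L Q f" "lmod K" "lmod L" "lmod E" "lmod Q" "lin E Q g"
    and lift: "\<And>M w. \<lbrakk>M \<in> \<M>; lin M Q w\<rbrakk> \<Longrightarrow> \<exists>h. lin M E h \<and> (\<forall>x\<in>carrier M. g (h x) = w x)"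
  shows "\<exists>h. lin K E h \<and> (\<forall>x\<in>carrier K. g (h x) = f (\<alpha> x))"
  using assms(1)
proof induction
  case zero
  show ?case using lin_zero[OF assms(7,5,6)] lin_zero[OF assms(2,4,6)] lin_const_zero[OF assms(5)]
    by (intro exI[of _ "\<lambda>x. \<zero>\<^bsub>E\<^esub>"]) auto
next
  case (step \<alpha> M b a)
  obtain h where h: "lin K E h" "\<forall>x\<in>carrier K. g (h x) = f (\<alpha> x)" using step.IH by blast
  obtain k where k: "lin M E k" "\<forall>x\<in>carrier M. g (k x) = f (a x)"
    using lift[OF step(2) lin_comp[OF step(4) assms(2)]] by blast
  have "lin K E (\<lambda>x. h x \<oplus>\<^bsub>E\<^esub> k (b x))" by (rule lin_plus[OF h(1) lin_comp[OF step(3) k(1)] assms(5)])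
  moreover have "g (h x \<oplus>\<^bsub>E\<^esub> k (b x)) = f (\<alpha> x \<oplus>\<^bsub>L\<^esub> a (b x))" if x: "x \<in> carrier K" for x
    using x h k step(3,4) lin_closed[OF thru_lin[OF step(1) assms(3,4)]]
    by (simp add: lin_add[OF assms(2)] lin_add[OF assms(7)] lin_closed)
  ultimately show ?case by blast
next
  case (ext \<alpha> \<beta>) then show ?case by auto
qed

text \<open>Lifting problems along an epimorphism pass from the modules in \<open>\<M>\<close> to their summands.\<close>

lemma summand_lift:
  assumes "summand \<M> L" "lin L Q f" "lmod L" "lmod E" "lmod Q" "lin E Q g"
    and "\<And>M w. \<lbrakk>M \<in> \<M>; lin M Q w\<rbrakk> \<Longrightarrow> \<exists>h. lin M E h \<and> (\<forall>x\<in>carrier M. g (h x) = w x)"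
  obtains h where "lin L E h" "\<And>x. x \<in> carrier L \<Longrightarrow> g (h x) = f x"
  using thru_lift[OF assms(1)[unfolded summand_def] assms(2,3,3,4-7)] by blast

subsection \<open>The regular module and projectives\<close>

lemma regular_simps [simp]:
  "carrier (regular_module A) = carrier A" "\<zero>\<^bsub>regular_module A\<^esub> = \<zero>"
  "x \<oplus>\<^bsub>regular_module A\<^esub> y = x \<oplus> y" "a \<odot>\<^bsub>regular_module A\<^esub> x = a \<otimes> x"
  by (auto simp: regular_module_def)

lemma lmod_regular [simp]: "lmod (regular_module A)"
  by (rule lmodI) (auto simp: l_distr r_distr m_assoc a_assoc a_comm a_lcomm)

lemma lin_orbit: "\<lbrakk>lmod M; x \<in> carrier M\<rbrakk> \<Longrightarrow> lin (regular_module A) M (\<lambda>a. a \<odot>\<^bsub>M\<^esub> x)"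
  by (rule linI) (auto simp: lm_ldistr lm_assoc)

lemma lin_regular: "lin (regular_module A) M f \<Longrightarrow> a \<in> carrier A \<Longrightarrow> f a = a \<odot>\<^bsub>M\<^esub> f \<one>"
  using lin_smult[of "regular_module A" M f a \<one>] by simp

lemma projective_lift:
  assumes P: "summand {regular_module A} P" and f: "lin P Q f" and "lmod P" and E: "lmod E" and Q: "lmod Q"
    and g: "lin E Q g" "carrier Q \<subseteq> g ` carrier E"
  obtains h where "lin P E h" "\<And>x. x \<in> carrier P \<Longrightarrow> g (h x) = f x"
proof (rule summand_lift[OF P f \<open>lmod P\<close> E Q g(1)])
  fix M w assume "M \<in> {regular_module A}" and w: "lin M Q w"
  then have M: "M = regular_module A" by simp
  have "w \<one> \<in> carrier Q" using lin_closed[OF w] M by simp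
  then obtain y where y: "y \<in> carrier E" "g y = w \<one>" using g(2) by force
  have "g (a \<odot>\<^bsub>E\<^esub> y) = w a" if "a \<in> carrier A" for a
    using lin_smult[OF g(1) that y(1)] lin_regular[OF w[unfolded M] that] y(2) by simp
  then show "\<exists>h. lin M E h \<and> (\<forall>x\<in>carrier M. g (h x) = w x)"
    using lin_orbit[OF E y(1)] unfolding M by (intro exI[of _ "\<lambda>a. a \<odot>\<^bsub>E\<^esub> y"]) simp
qed (use that in blast)

subsection \<open>Direct sums\<close>

lemma dsum_simps [simp]:
  "carrier (dsum J M) = (\<Pi>\<^sub>E j\<in>J. carrier (M j))" "\<zero>\<^bsub>dsum J M\<^esub> = (\<lambda>j\<in>J. \<zero>\<^bsub>M j\<^esub>)"
  "f \<oplus>\<^bsub>dsum J M\<^esub> g = (\<lambda>j\<in>J. f j \<oplus>\<^bsub>M j\<^esub> g j)" "a \<odot>\<^bsub>dsum J M\<^esub> f = (\<lambda>j\<in>J. a \<odot>\<^bsub>M j\<^esub> f j)"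
  by (auto simp: dsum_def)

lemma lmod_dsum:
  assumes "\<And>j. j \<in> J \<Longrightarrow> lmod (M j)" shows "lmod (dsum J M)"
proof (rule lmodI)
  show "\<one> \<odot>\<^bsub>dsum J M\<^esub> x = x" if "x \<in> carrier (dsum J M)" for x
    using that assms by (auto simp: PiE_iff extensional_def fun_eq_iff)
  show "\<zero>\<^bsub>dsum J M\<^esub> \<oplus>\<^bsub>dsum J M\<^esub> x = x" if "x \<in> carrier (dsum J M)" for x
    using that assms by (auto simp: PiE_iff extensional_def fun_eq_iff)
qed (use assms in \<open>auto simp: PiE_iff fun_eq_iff lm_ldistr lm_rdistr lm_assoc lm_ac\<close>)

definition inj_at :: "'j set \<Rightarrow> ('j \<Rightarrow> ('a, 'm) module) \<Rightarrow> 'j \<Rightarrow> 'm \<Rightarrow> 'j \<Rightarrow> 'm" where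
  "inj_at J M j x = (\<lambda>i\<in>J. if i = j then x else \<zero>\<^bsub>M i\<^esub>)"

lemma lin_inj_at:
  assumes "\<And>j. j \<in> J \<Longrightarrow> lmod (M j)" "j \<in> J" shows "lin (M j) (dsum J M) (inj_at J M j)"
  by (rule linI) (use assms in \<open>auto simp: inj_at_def fun_eq_iff\<close>)

lemma lin_proj_at: "j \<in> J \<Longrightarrow> lin (dsum J M) (M j) (\<lambda>f. f j)"
  by (rule linI) auto

text \<open>Truncations to growing subsets of the index set turn statements about finite direct sums into
  inductions.\<close>

lemma dsum_induct [consumes 3, case_names zero step]:
  assumes "finite J" and lm: "\<forall>j\<in>J. lmod (M j)" and f: "f \<in> carrier (dsum J M)"
    and "Q \<zero>\<^bsub>dsum J M\<^esub>"
    and step: "\<And>g j. \<lbrakk>g \<in> carrier (dsum J M); Q g; j \<in> J\<rbrakk> \<Longrightarrow> Q (g \<oplus>\<^bsub>dsum J M\<^esub> inj_at J M j (f j))"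
  shows "Q f"
proof -
  define t where "t S = (\<lambda>j\<in>J. if j \<in> S then f j else \<zero>\<^bsub>M j\<^esub>)" for S
  have tc: "t S \<in> carrier (dsum J M)" for S using lm f by (auto simp: t_def)
  have "Q (t S)" if "S \<subseteq> J" "finite S" for S
    using that(2,1)
  proof (induction S)
    case empty
    have "t {} = \<zero>\<^bsub>dsum J M\<^esub>" by (auto simp: t_def)
    then show ?case using assms(4) by (simp only:)
  next
    case (insert j S)
    have "t (insert j S) = t S \<oplus>\<^bsub>dsum J M\<^esub> inj_at J M j (f j)"
      using insert.hyps insert.prems lm f by (auto simp: t_def inj_at_def fun_eq_iff PiE_iff)
    moreover have "Q (t S)" "j \<in> J" using insert by auto
    ultimately show ?case using step[OF tc, of S j] by (simp only:)
  qed
  from this[OF subset_refl \<open>finite J\<close>] have "Q (t J)" .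
  moreover have "t J = f" using f by (auto simp: t_def PiE_iff extensional_def fun_eq_iff)
  ultimately show ?thesis by simp
qed

lemma summand_dsum:
  assumes "finite J" and lm: "\<And>j. j \<in> J \<Longrightarrow> lmod (M j)" shows "summand (M ` J) (dsum J M)"
proof -
  let ?D = "dsum J M"
  define t where "t S f = (\<lambda>j\<in>J. if j \<in> S then f j else \<zero>\<^bsub>M j\<^esub>)" for S f
  have "thru (M ` J) ?D ?D (t S)" if "S \<subseteq> J" "finite S" for S
    using that(2,1)
  proof (induction S)
    case empty
    show ?case by (rule thru.ext[OF thru.zero]) (simp add: t_def restrict_def)
  next
    case (insert j S)
    have j: "j \<in> J" using insert.prems by simp
    have l: "lin (M j) ?D (inj_at J M j)" by (rule lin_inj_at[OF _ j]) (use lm in auto)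
    have "thru (M ` J) ?D ?D (t S)" using insert by simp
    then have "thru (M ` J) ?D ?D (\<lambda>x. t S x \<oplus>\<^bsub>?D\<^esub> inj_at J M j (x j))"
      using thru.step[where M = "M j" and b = "\<lambda>x. x j" and a = "inj_at J M j" and f = "t S"] j l
        lin_proj_at[OF j, of M] by blast
    moreover have "t S f \<oplus>\<^bsub>?D\<^esub> inj_at J M j (f j) = t (insert j S) f" if "f \<in> carrier ?D" for f
      using insert.hyps that lm j by (auto simp: t_def inj_at_def fun_eq_iff PiE_iff)
    ultimately show ?case by (rule thru.ext)
  qed
  from this[OF subset_refl \<open>finite J\<close>] have "thru (M ` J) ?D ?D (t J)" .
  then show ?thesis unfolding summand_def
    by (rule thru.ext) (auto simp: t_def PiE_iff extensional_def fun_eq_iff)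
qed

lemma subm_dsum_eq:
  assumes "finite J" and lm: "\<And>j. j \<in> J \<Longrightarrow> lmod (M j)" and N: "subm N (dsum J M)"
    and inj: "\<And>j x. \<lbrakk>j \<in> J; x \<in> carrier (M j)\<rbrakk> \<Longrightarrow> inj_at J M j x \<in> N"
  shows "N = carrier (dsum J M)"
proof
  show "carrier (dsum J M) \<subseteq> N"
  proof
    fix f assume f: "f \<in> carrier (dsum J M)"
    have "\<forall>j\<in>J. lmod (M j)" using lm by blast
    from \<open>finite J\<close> this f show "f \<in> N"
    proof (induction rule: dsum_induct)
      case zero show ?case by (rule subm_zero[OF N])
    next
      case (step g j)
      have "inj_at J M j (f j) \<in> N" using f step by (intro inj) auto
      with step show ?case by (intro subm_add[OF N])
    qed
  qed
qed (rule subm_subset[OF N])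

lemma lmod_free [simp]: "lmod (free_module A n)"
  unfolding module_power_def by (rule lmod_dsum) simp

lemma summand_power: "lmod M \<Longrightarrow> summand {M} (module_power M n)"
proof (cases "n = 0")
  case True
  assume "lmod M"
  show ?thesis unfolding True module_power_def summand_def by (rule thru.ext[OF thru.zero]) auto
next
  case False
  assume "lmod M"
  have "(\<lambda>_. M) ` {..<n} = {M}" using False by auto
  then show ?thesis unfolding module_power_def using summand_dsum[of "{..<n}" "\<lambda>_. M"] \<open>lmod M\<close> by simp
qed

abbreviation unit_vec :: "nat \<Rightarrow> nat \<Rightarrow> nat \<Rightarrow> 'a" where
  "unit_vec n k \<equiv> inj_at {..<n} (\<lambda>_. regular_module A) k \<one>"

lemma unit_vec_closed [simp]: "unit_vec n k \<in> carrier (free_module A n)"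
  by (auto simp: inj_at_def module_power_def)

lemma subm_free_eq:
  assumes N: "subm N (free_module A n)" and e: "\<And>k. k < n \<Longrightarrow> unit_vec n k \<in> N"
  shows "N = carrier (free_module A n)"
  unfolding module_power_def
proof (rule subm_dsum_eq)
  show "subm N (dsum {..<n} (\<lambda>_. regular_module A))" using N by (simp add: module_power_def)
  fix k x assume k: "k \<in> {..<n}" and x: "x \<in> carrier (regular_module A)"
  have "inj_at {..<n} (\<lambda>_. regular_module A) k x = x \<odot>\<^bsub>free_module A n\<^esub> unit_vec n k"
    using k x by (auto simp: inj_at_def module_power_def fun_eq_iff)
  then show "inj_at {..<n} (\<lambda>_. regular_module A) k x \<in> N"
    using subm_smult[OF N] x e k by simp
qed auto

lemma free_lin_exists:
  assumes M: "lmod M" and x: "\<And>k. k < n \<Longrightarrow> x k \<in> carrier M"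
  obtains f where "lin (free_module A n) M f" "\<And>k. k < n \<Longrightarrow> f (unit_vec n k) = x k"
proof -
  have "\<exists>f. lin (free_module A n) M f \<and> (\<forall>k<n. f (unit_vec n k) = (if k < m then x k else \<zero>\<^bsub>M\<^esub>))" if "m \<le> n" for m
    using that
  proof (induction m)
    case 0
    then show ?case using lin_const_zero[OF M] by auto
  next
    case (Suc m)
    then obtain f where f: "lin (free_module A n) M f" "\<forall>k<n. f (unit_vec n k) = (if k < m then x k else \<zero>\<^bsub>M\<^esub>)"
      by auto
    have m: "m \<in> {..<n}" using Suc by simp
    have l: "lin (free_module A n) M (\<lambda>c. c m \<odot>\<^bsub>M\<^esub> x m)"
      using lin_comp[OF lin_proj_at[OF m, of "\<lambda>_. regular_module A"] lin_orbit[OF M]] x m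
      by (simp add: module_power_def)
    have "(unit_vec n k) m \<odot>\<^bsub>M\<^esub> x m = (if k = m then x m else \<zero>\<^bsub>M\<^esub>)" for k
      using m M x by (auto simp: inj_at_def)
    then have "\<forall>k<n. f (unit_vec n k) \<oplus>\<^bsub>M\<^esub> (unit_vec n k) m \<odot>\<^bsub>M\<^esub> x m = (if k < Suc m then x k else \<zero>\<^bsub>M\<^esub>)"
      using f(2) x M by (auto simp: less_Suc_eq)
    then show ?case using lin_plus[OF f(1) l M] by blast
  qed
  from this[OF order_refl] show ?thesis using that by auto
qed

subsection \<open>Direct summands\<close>

text \<open>The projection to a complemented submodule is linear because the decomposition of an element is
  unique.\<close>

lemma direct_summand_retract:
  assumes ds: "direct_summand A X L" and X: "lmod X" and L: "lmod L"
  obtains a b where "lin X L b" "lin L X a" "\<And>x. x \<in> carrier X \<Longrightarrow> a (b x) = x"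
proof -
  obtain N N' where N: "subm N L" "subm N' L" "N \<inter> N' = {\<zero>\<^bsub>L\<^esub>}" "N <+>\<^bsub>L\<^esub> N' = carrier L" "mod_iso A X (L \<restriction> N)"
    using ds unfolding direct_summand_def by blast
  obtain f where f: "lin X (L \<restriction> N) f" "bij_betw f (carrier X) (carrier (L \<restriction> N))"
    using N(5) unfolding mod_iso_iff[OF X] by blast
  obtain g where g: "lin (L \<restriction> N) X g" "\<forall>x\<in>carrier X. g (f x) = x"
    "\<forall>y\<in>carrier (L \<restriction> N). f (g y) = y"
    by (rule inverse_lin[OF X lmod_restr[OF L N(1)] f])
  define p where "p z = (SOME n. n \<in> N \<and> (\<exists>n'\<in>N'. z = n \<oplus>\<^bsub>L\<^esub> n'))" for z
  have p: "p z \<in> N" "\<exists>n'\<in>N'. z = p z \<oplus>\<^bsub>L\<^esub> n'" if "z \<in> carrier L" for z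
  proof -
    have "\<exists>n. n \<in> N \<and> (\<exists>n'\<in>N'. z = n \<oplus>\<^bsub>L\<^esub> n')" using that N(4) by (force simp: set_add_def')
    from someI_ex[OF this] show "p z \<in> N" "\<exists>n'\<in>N'. z = p z \<oplus>\<^bsub>L\<^esub> n'" by (auto simp: p_def)
  qed
  note cN = subm_carrierD[OF N(1)] and cN' = subm_carrierD[OF N(2)]
  have uniq: "n = m" if "n \<in> N" "m \<in> N" "n' \<in> N'" "m' \<in> N'" "n \<oplus>\<^bsub>L\<^esub> n' = m \<oplus>\<^bsub>L\<^esub> m'" for n n' m m'
  proof -
    have c: "n \<in> carrier L" "m \<in> carrier L" "n' \<in> carrier L" "m' \<in> carrier L" using that cN cN' by auto
    have "dif L n m \<oplus>\<^bsub>L\<^esub> n' = (n \<oplus>\<^bsub>L\<^esub> n') \<oplus>\<^bsub>L\<^esub> (\<ominus> \<one>) \<odot>\<^bsub>L\<^esub> m"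
      using c L by (simp add: dif_def lm_ac)
    also have "\<dots> = dif L (m' \<oplus>\<^bsub>L\<^esub> m) m" unfolding that(5) using c L by (simp add: dif_def lm_a_comm)
    also have "\<dots> = m'" using c L by simp
    finally have "dif L n m \<oplus>\<^bsub>L\<^esub> n' = m'" .
    then have "dif L n m = dif L m' n'" using add_dif_cancel[OF L, of "dif L n m" n'] c L by simp
    then have "dif L n m \<in> N \<inter> N'" using subm_dif[OF N(1) that(1,2)] subm_dif[OF N(2) that(4,3)] by simp
    then show ?thesis using N(3) dif_eq_zero[OF L c(1,2)] by auto
  qed
  have pu: "p z = n" if "z = n \<oplus>\<^bsub>L\<^esub> n'" "n \<in> N" "n' \<in> N'" for z n n'
  proof -
    have "z \<in> carrier L" using that cN cN' L by simp
    then show ?thesis using p[of z] uniq[OF _ that(2) _ that(3)] that(1) by auto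
  qed
  have pl: "lin L (L \<restriction> N) p"
  proof (rule linI)
    fix x y assume xy: "x \<in> carrier L" "y \<in> carrier L"
    obtain x' y' where x': "x' \<in> N'" "x = p x \<oplus>\<^bsub>L\<^esub> x'" and y': "y' \<in> N'" "y = p y \<oplus>\<^bsub>L\<^esub> y'"
      using p(2)[OF xy(1)] p(2)[OF xy(2)] by blast
    have c: "p x \<in> carrier L" "p y \<in> carrier L" "x' \<in> carrier L" "y' \<in> carrier L"
      using cN[OF p(1)[OF xy(1)]] cN[OF p(1)[OF xy(2)]] cN'[OF x'(1)] cN'[OF y'(1)] by auto
    have "x \<oplus>\<^bsub>L\<^esub> y = (p x \<oplus>\<^bsub>L\<^esub> x') \<oplus>\<^bsub>L\<^esub> (p y \<oplus>\<^bsub>L\<^esub> y')" using x'(2) y'(2) by simp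
    also have "\<dots> = (p x \<oplus>\<^bsub>L\<^esub> p y) \<oplus>\<^bsub>L\<^esub> (x' \<oplus>\<^bsub>L\<^esub> y')" using c L by (simp add: lm_ac)
    finally show "p (x \<oplus>\<^bsub>L\<^esub> y) = p x \<oplus>\<^bsub>L \<restriction> N\<^esub> p y"
      by (rule pu[THEN trans]) (use N p(1) xy x' y' in auto)
  next
    fix a x assume ax: "a \<in> carrier A" "x \<in> carrier L"
    obtain x' where x': "x' \<in> N'" "x = p x \<oplus>\<^bsub>L\<^esub> x'" using p(2)[OF ax(2)] by blast
    have c: "p x \<in> carrier L" "x' \<in> carrier L" using cN[OF p(1)[OF ax(2)]] cN'[OF x'(1)] by auto
    have "a \<odot>\<^bsub>L\<^esub> x = a \<odot>\<^bsub>L\<^esub> (p x \<oplus>\<^bsub>L\<^esub> x')" using x'(2) by simp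
    also have "\<dots> = a \<odot>\<^bsub>L\<^esub> p x \<oplus>\<^bsub>L\<^esub> a \<odot>\<^bsub>L\<^esub> x'" using c L ax by (simp add: lm_rdistr)
    finally show "p (a \<odot>\<^bsub>L\<^esub> x) = a \<odot>\<^bsub>L \<restriction> N\<^esub> p x"
      by (rule pu[THEN trans]) (use N p(1) ax x' in auto)
  qed (use p in auto)
  have pid: "p n = n" if "n \<in> N" for n
    by (rule pu[of _ _ "\<zero>\<^bsub>L\<^esub>"]) (use that cN L N(2) in auto)
  have "f x \<in> N" if "x \<in> carrier X" for x using lin_closed[OF f(1) that] by simp
  then show ?thesis
    using that[of f "\<lambda>z. g (p z)"] lin_restr_cod[OF f(1) subm_subset[OF N(1)]] lin_comp[OF pl g(1)] g(2) pid by auto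
qed

lemma direct_summandI:
  assumes X: "lmod X" and L: "lmod L" and b: "lin X L b" and a: "lin L X a"
    and ab: "\<And>x. x \<in> carrier X \<Longrightarrow> a (b x) = x"
  shows "direct_summand A X L"
proof -
  let ?N = "b ` carrier X" and ?N' = "{z \<in> carrier L. a z = \<zero>\<^bsub>X\<^esub>}"
  have N: "subm ?N L" by (rule subm_image[OF b X L subm_carrier[OF X]])
  have N': "subm ?N' L" by (rule subm_ker[OF a L X])
  have i: "?N \<inter> ?N' = {\<zero>\<^bsub>L\<^esub>}"
    using subm_zero[OF N] subm_zero[OF N'] ab lin_zero[OF b X L] by auto
  have "z \<in> ?N <+>\<^bsub>L\<^esub> ?N'" if z: "z \<in> carrier L" for z
  proof -
    have az: "a z \<in> carrier X" "b (a z) \<in> carrier L" using z a b by (auto simp: lin_closed)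
    have "a (dif L z (b (a z))) = \<zero>\<^bsub>X\<^esub>" using z az ab X L by (simp add: lin_dif[OF a L])
    moreover have "z = b (a z) \<oplus>\<^bsub>L\<^esub> dif L z (b (a z))" using z az L by simp
    moreover have "b (a z) \<in> ?N" "dif L z (b (a z)) \<in> carrier L" using z az L by auto
    ultimately show ?thesis unfolding set_add_def' by blast
  qed
  then have s: "?N <+>\<^bsub>L\<^esub> ?N' = carrier L"
    using lin_closed[OF b] L by (auto simp: set_add_def')
  have "lin X (L \<restriction> ?N) b" by (rule lin_to_restr[OF b]) simp
  moreover have "bij_betw b (carrier X) (carrier (L \<restriction> ?N))"
    using ab by (auto simp: bij_betw_def intro: inj_on_inverseI)
  ultimately have "mod_iso A X (L \<restriction> ?N)" unfolding mod_iso_iff[OF X] by blast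
  then show ?thesis unfolding direct_summand_def using N N' i s by blast
qed

lemma fg_projective_summand:
  assumes "fg_projective A P" shows "lmod P" "fg_module A P" "summand {regular_module A} P"
proof -
  obtain n where fg: "fg_module A P" and ds: "direct_summand A P (free_module A n)"
    using assms by (auto simp: fg_projective_def)
  show "fg_module A P" by (rule fg)
  show P: "lmod P" using fg by (simp add: fg_module_def)
  obtain a b where "lin P (free_module A n) b" "lin (free_module A n) P a" "\<And>x. x \<in> carrier P \<Longrightarrow> a (b x) = x"
    using direct_summand_retract[OF ds P lmod_free] by metis
  then show "summand {regular_module A} P"
    using summand_retract[OF summand_power[OF lmod_regular]] P lmod_free by blast
qed

subsection \<open>Finitely generated modules\<close>

lemma fg_lmod [simp]: "fg_module A M \<Longrightarrow> lmod M"
  by (simp add: fg_module_def)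

lemma fgI:
  assumes "lmod M" "S \<subseteq> carrier M" "finite S" "\<And>N. \<lbrakk>subm N M; S \<subseteq> N\<rbrakk> \<Longrightarrow> carrier M \<subseteq> N"
  shows "fg_module A M"
  unfolding fg_module_def using assms subm_subset by (intro conjI exI[of _ S]) blast+

lemma fgE:
  assumes "fg_module A M"
  obtains S where "S \<subseteq> carrier M" "finite S" "\<forall>N. subm N M \<longrightarrow> S \<subseteq> N \<longrightarrow> N = carrier M"
  using assms unfolding fg_module_def by blast

lemma fg_image:
  assumes fg: "fg_module A M" and N: "lmod N" and f: "lin M N f" "f ` carrier M = carrier N"
  shows "fg_module A N"
proof -
  obtain S where S: "S \<subseteq> carrier M" "finite S" "\<forall>N. subm N M \<longrightarrow> S \<subseteq> N \<longrightarrow> N = carrier M" by (rule fgE[OF fg])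
  show ?thesis
  proof (rule fgI[OF N, of "f ` S"])
    fix K assume K: "subm K N" "f ` S \<subseteq> K"
    have "{x \<in> carrier M. f x \<in> K} = carrier M"
      by (rule S(3)[rule_format]) (use subm_vimage[OF f(1) _ N K(1)] K(2) S(1) fg in auto)
    then have "f ` carrier M \<subseteq> K" by blast
    then show "carrier N \<subseteq> K" unfolding f(2) .
  qed (use S lin_closed[OF f(1)] in auto)
qed

lemma fg_free [simp]: "fg_module A (free_module A n)"
proof (rule fgI[of _ "unit_vec n ` {..<n}"])
  fix N assume "subm N (free_module A n)" "unit_vec n ` {..<n} \<subseteq> N"
  then have "N = carrier (free_module A n)" by (intro subm_free_eq) auto
  then show "carrier (free_module A n) \<subseteq> N" by simp
qed auto

lemma fg_from_free:
  assumes fg: "fg_module A M"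
  obtains n f where "lin (free_module A n) M f" "f ` carrier (free_module A n) = carrier M"
proof -
  obtain S where S: "S \<subseteq> carrier M" "finite S" "\<forall>N. subm N M \<longrightarrow> S \<subseteq> N \<longrightarrow> N = carrier M" by (rule fgE[OF fg])
  obtain xs where xs: "set xs = S" using finite_list[OF S(2)] by blast
  have M: "lmod M" using fg by simp
  obtain f where f: "lin (free_module A (length xs)) M f" "\<And>k. k < length xs \<Longrightarrow> f (unit_vec (length xs) k) = xs ! k"
    using free_lin_exists[OF M, of "length xs" "\<lambda>k. xs ! k"] xs S(1) nth_mem by blast
  have "S \<subseteq> f ` carrier (free_module A (length xs))"
  proof
    fix s assume "s \<in> S"
    then obtain k where "k < length xs" "s = xs ! k" using xs by (auto simp: in_set_conv_nth)
    then show "s \<in> f ` carrier (free_module A (length xs))"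
      using f(2) imageI[OF unit_vec_closed, of f] by metis
  qed
  then have "f ` carrier (free_module A (length xs)) = carrier M"
    using S(3)[rule_format, OF subm_image[OF f(1) lmod_free M subm_carrier[OF lmod_free]]] by blast
  then show ?thesis using that f(1) by blast
qed

text \<open>Each further map through the regular module is recorded in a new last coordinate, so the number of
  summands becomes the rank of the free module.\<close>

lemma fg_projectiveI:
  assumes "lmod P" "summand {regular_module A} P" shows "fg_projective A P"
proof -
  have "\<exists>n b a. lin K (free_module A n) b \<and> lin (free_module A n) L a \<and> (\<forall>x\<in>carrier K. a (b x) = f x)"
    if "thru {regular_module A} K L f" "lmod K" "lmod L" for K :: "('a, 'p) module" and L :: "('a, 'q) module" and f
    using that(1)
  proof induction
    case zero
    show ?case using lin_const_zero[OF that(3)] lin_const_zero[OF lmod_free] by blast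
  next
    case (step f M b a)
    obtain n b' a' where 1: "lin K (free_module A n) b'" "lin (free_module A n) L a'" "\<forall>x\<in>carrier K. a' (b' x) = f x"
      using step.IH by blast
    have M: "M = regular_module A" using step(2) by simp
    define b'' where "b'' x = (\<lambda>k\<in>{..<Suc n}. if k < n then b' x k else b x)" for x
    define a'' where "a'' c = a' (restrict c {..<n}) \<oplus>\<^bsub>L\<^esub> a (c n)" for c
    have rl: "lin (free_module A (Suc n)) (free_module A n) (\<lambda>c. restrict c {..<n})"
      by (rule linI) (auto simp: module_power_def PiE_iff fun_eq_iff)
    have a'': "lin (free_module A (Suc n)) L a''"
      unfolding a''_def
    proof (rule lin_plus[OF lin_comp[OF rl 1(2)] _ that(3)])
      have "lin (free_module A (Suc n)) M (\<lambda>c. c n)"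
        unfolding module_power_def M by (rule lin_proj_at[of n "{..<Suc n}" "\<lambda>_. regular_module A"]) simp
      then show "lin (free_module A (Suc n)) L (\<lambda>c. a (c n))" by (rule lin_comp[OF _ step(4)])
    qed
    have b'': "lin K (free_module A (Suc n)) b''"
    proof (rule linI)
      show "b'' x \<in> carrier (free_module A (Suc n))" if "x \<in> carrier K" for x
        using lin_closed[OF 1(1) that] lin_closed[OF step(3) that]
        by (auto simp: b''_def module_power_def PiE_iff M less_Suc_eq)
      show "b'' (x \<oplus>\<^bsub>K\<^esub> y) = b'' x \<oplus>\<^bsub>free_module A (Suc n)\<^esub> b'' y" if "x \<in> carrier K" "y \<in> carrier K" for x y
        using lin_add[OF 1(1) that] lin_add[OF step(3) that]
        by (auto simp: b''_def module_power_def fun_eq_iff M)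
      show "b'' (r \<odot>\<^bsub>K\<^esub> x) = r \<odot>\<^bsub>free_module A (Suc n)\<^esub> b'' x" if "r \<in> carrier A" "x \<in> carrier K" for r x
        using lin_smult[OF 1(1) that] lin_smult[OF step(3) that]
        by (auto simp: b''_def module_power_def fun_eq_iff M)
    qed
    have "a'' (b'' x) = f x \<oplus>\<^bsub>L\<^esub> a (b x)" if x: "x \<in> carrier K" for x
    proof -
      have "restrict (b'' x) {..<n} = b' x"
        using lin_closed[OF 1(1) x] by (auto simp: b''_def module_power_def PiE_iff extensional_def fun_eq_iff)
      then show ?thesis using 1(3) x by (simp add: a''_def) (simp add: b''_def)
    qed
    then show ?case using a'' b'' by blast
  next
    case (ext f g) then show ?case by auto
  qed
  from this[OF assms(2)[unfolded summand_def] assms(1) assms(1)]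
  obtain n b a where ab: "lin P (free_module A n) b" "lin (free_module A n) P a" "\<forall>x\<in>carrier P. a (b x) = x"
    by blast
  have "a ` carrier (free_module A n) = carrier P"
  proof
    show "carrier P \<subseteq> a ` carrier (free_module A n)"
      using ab(3) lin_closed[OF ab(1)] by (metis image_eqI subsetI)
  qed (use lin_closed[OF ab(2)] in auto)
  then have "fg_module A P" by (rule fg_image[OF fg_free assms(1) ab(2)])
  then show ?thesis unfolding fg_projective_def
    using direct_summandI[OF assms(1) lmod_free ab(1,2)] ab(3) by blast
qed

text \<open>Every quotient of a finitely generated module is a quotient of a free module of finite rank, and
  hence has a model of the one type that the existential quantifiers over modules range over.\<close>

lemma realize_quotient:
  fixes B :: "('a, 'm) module"
  assumes fg: "fg_module A B" and D: "subm D B"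
  obtains Q :: "'a umodule" and q where "fg_module A Q" "lin B Q q" "q ` carrier B = carrier Q"
    "\<And>x. x \<in> carrier B \<Longrightarrow> q x = \<zero>\<^bsub>Q\<^esub> \<longleftrightarrow> x \<in> D"
proof -
  have B: "lmod B" using fg by simp
  obtain n f where f: "lin (free_module A n) B f" "f ` carrier (free_module A n) = carrier B"
    by (rule fg_from_free[OF fg])
  let ?F = "free_module A n"
  define D' where "D' = {c \<in> carrier ?F. f c \<in> D}"
  have D': "subm D' ?F" unfolding D'_def by (rule subm_vimage[OF f(1) lmod_free B D])
  let ?Q = "quotient_module ?F D'" and ?p = "\<lambda>c. D' +>\<^bsub>?F\<^esub> c"
  note q = lmod_quotient[OF lmod_free D'] lin_quotient[OF lmod_free D'] quotient_surj[OF lmod_free D'] quotient_eq_zero[OF lmod_free D']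
  have kk: "?p c = \<zero>\<^bsub>?Q\<^esub>" if "c \<in> carrier ?F" "f c = \<zero>\<^bsub>B\<^esub>" for c
    using q(4)[OF that(1)] that subm_zero[OF D] by (simp add: D'_def)
  obtain h where h: "lin B ?Q h" "\<And>c. c \<in> carrier ?F \<Longrightarrow> h (f c) = ?p c"
    using factor_thru[OF lmod_free q(1) f q(2) kk B] by blast
  have "fg_module A ?Q" by (rule fg_image[OF fg_free q(1-3)])
  moreover have "h ` carrier B = carrier ?Q"
    unfolding f(2)[symmetric] q(3)[symmetric] image_image using h(2) by (intro image_cong) auto
  moreover have "h x = \<zero>\<^bsub>?Q\<^esub> \<longleftrightarrow> x \<in> D" if "x \<in> carrier B" for x
  proof -
    have "x \<in> f ` carrier ?F" using that f(2) by simp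
    then obtain c where c: "c \<in> carrier ?F" "x = f c" by (rule imageE)
    then show ?thesis using h(2)[OF c(1)] q(4)[OF c(1)] by (simp add: D'_def)
  qed
  ultimately show ?thesis using that[of ?Q h] h(1) by blast
qed

lemma realize:
  fixes B :: "('a, 'm) module"
  assumes fg: "fg_module A B"
  obtains Q :: "'a umodule" and q where "fg_module A Q" "lin B Q q" "bij_betw q (carrier B) (carrier Q)"
proof -
  have B: "lmod B" using fg by simp
  obtain Q :: "'a umodule" and q where q: "fg_module A Q" "lin B Q q" "q ` carrier B = carrier Q"
    "\<And>x. x \<in> carrier B \<Longrightarrow> q x = \<zero>\<^bsub>Q\<^esub> \<longleftrightarrow> x \<in> {\<zero>\<^bsub>B\<^esub>}"
    using realize_quotient[OF fg subm_zero_set[OF B]] by metis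
  have "inj_on q (carrier B)" unfolding lin_inj_iff[OF q(2) B fg_lmod[OF q(1)]] using q(4) by simp
  then show ?thesis using that q by (simp add: bij_betw_def)
qed

subsection \<open>Pushouts\<close>

text \<open>The carriers of \<open>M\<close> and \<open>N\<close> may have different types, which excludes the indexed direct sum.\<close>

definition prodm :: "('a, 'm) module \<Rightarrow> ('a, 'n) module \<Rightarrow> ('a, 'm \<times> 'n) module" where
  "prodm M N = \<lparr>carrier = carrier M \<times> carrier N, monoid.mult = undefined, one = undefined,
     zero = (\<zero>\<^bsub>M\<^esub>, \<zero>\<^bsub>N\<^esub>), add = (\<lambda>x y. (fst x \<oplus>\<^bsub>M\<^esub> fst y, snd x \<oplus>\<^bsub>N\<^esub> snd y)),
     smult = (\<lambda>a x. (a \<odot>\<^bsub>M\<^esub> fst x, a \<odot>\<^bsub>N\<^esub> snd x))\<rparr>"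

lemma prodm_simps [simp]:
  "carrier (prodm M N) = carrier M \<times> carrier N" "\<zero>\<^bsub>prodm M N\<^esub> = (\<zero>\<^bsub>M\<^esub>, \<zero>\<^bsub>N\<^esub>)"
  "x \<oplus>\<^bsub>prodm M N\<^esub> y = (fst x \<oplus>\<^bsub>M\<^esub> fst y, snd x \<oplus>\<^bsub>N\<^esub> snd y)"
  "a \<odot>\<^bsub>prodm M N\<^esub> x = (a \<odot>\<^bsub>M\<^esub> fst x, a \<odot>\<^bsub>N\<^esub> snd x)"
  by (auto simp: prodm_def)

lemma lmod_prodm [simp]: "\<lbrakk>lmod M; lmod N\<rbrakk> \<Longrightarrow> lmod (prodm M N)"
  by (rule lmodI) (auto simp: lm_ldistr lm_rdistr lm_assoc lm_ac)

lemma fg_prodm: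
  assumes M: "fg_module A M" and N: "fg_module A N" shows "fg_module A (prodm M N)"
proof -
  have lm: "lmod M" "lmod N" using M N by auto
  obtain S where S: "S \<subseteq> carrier M" "finite S" "\<forall>K. subm K M \<longrightarrow> S \<subseteq> K \<longrightarrow> K = carrier M" by (rule fgE[OF M])
  obtain S' where S': "S' \<subseteq> carrier N" "finite S'" "\<forall>K. subm K N \<longrightarrow> S' \<subseteq> K \<longrightarrow> K = carrier N" by (rule fgE[OF N])
  show ?thesis
  proof (rule fgI[of _ "(\<lambda>x. (x, \<zero>\<^bsub>N\<^esub>)) ` S \<union> (\<lambda>y. (\<zero>\<^bsub>M\<^esub>, y)) ` S'"])
    fix K assume K: "subm K (prodm M N)" "(\<lambda>x. (x, \<zero>\<^bsub>N\<^esub>)) ` S \<union> (\<lambda>y. (\<zero>\<^bsub>M\<^esub>, y)) ` S' \<subseteq> K"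
    have l1: "lin M (prodm M N) (\<lambda>x. (x, \<zero>\<^bsub>N\<^esub>))" using lm by (intro linI) auto
    have l2: "lin N (prodm M N) (\<lambda>y. (\<zero>\<^bsub>M\<^esub>, y))" using lm by (intro linI) auto
    have 1: "{x \<in> carrier M. (x, \<zero>\<^bsub>N\<^esub>) \<in> K} = carrier M"
      by (rule S(3)[rule_format, OF subm_vimage[OF l1 lm(1) _ K(1)]]) (use K(2) S(1) lm in auto)
    have 2: "{y \<in> carrier N. (\<zero>\<^bsub>M\<^esub>, y) \<in> K} = carrier N"
      by (rule S'(3)[rule_format, OF subm_vimage[OF l2 lm(2) _ K(1)]]) (use K(2) S'(1) lm in auto)
    show "carrier (prodm M N) \<subseteq> K"
    proof
      fix z assume "z \<in> carrier (prodm M N)"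
      then obtain x y where z: "z = (x, y)" "x \<in> carrier M" "y \<in> carrier N" by auto
      have "(x, \<zero>\<^bsub>N\<^esub>) \<in> K" "(\<zero>\<^bsub>M\<^esub>, y) \<in> K" using 1 2 z by auto
      from subm_add[OF K(1) this] show "z \<in> K" using z lm by simp
    qed
  qed (use S S' lm in auto)
qed

text \<open>The pushout of the inclusion of \<open>N\<close> along \<open>h\<close>, realised as the quotient of \<open>T \<times> B\<close> by the
  antidiagonal copy of \<open>N\<close>.\<close>

lemma pushout:
  fixes B :: "('a, 'm) module" and T :: "('a, 'n) module"
  assumes fgB: "fg_module A B" and fgT: "fg_module A T" and N: "subm N B" and h: "lin (B \<restriction> N) T h"
  obtains E :: "'a umodule" and i j where "fg_module A E" "lin T E i" "lin B E j"
    "inj_on i (carrier T)" "\<forall>x\<in>N. j x = i (h x)"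
    "\<forall>e\<in>carrier E. \<exists>t\<in>carrier T. \<exists>b\<in>carrier B. e = i t \<oplus>\<^bsub>E\<^esub> j b"
    "\<forall>t\<in>carrier T. \<forall>b\<in>carrier B. i t \<oplus>\<^bsub>E\<^esub> j b = \<zero>\<^bsub>E\<^esub> \<longrightarrow> b \<in> N"
proof -
  have B: "lmod B" and T: "lmod T" using fgB fgT by auto
  let ?P = "prodm T B"
  have P: "lmod ?P" using B T by simp
  have NB: "N \<subseteq> carrier B" by (rule subm_subset[OF N])
  define s where "s c = (h c, (\<ominus> \<one>) \<odot>\<^bsub>B\<^esub> c)" for c
  have Nm: "lmod (B \<restriction> N)" using B N by simp
  have "a \<otimes> (\<ominus> \<one>) = (\<ominus> \<one>) \<otimes> a" if "a \<in> carrier A" for a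
    using that by (simp add: l_minus r_minus)
  then have comm: "a \<odot>\<^bsub>B\<^esub> ((\<ominus> \<one>) \<odot>\<^bsub>B\<^esub> y) = (\<ominus> \<one>) \<odot>\<^bsub>B\<^esub> (a \<odot>\<^bsub>B\<^esub> y)"
    if "a \<in> carrier A" "y \<in> carrier B" for a y
    using that lm_assoc[OF B, symmetric] by simp
  have sl: "lin (B \<restriction> N) ?P s"
    by (rule linI) (use h NB B comm in \<open>auto simp: s_def lin_add[OF h, simplified] lin_smult[OF h, simplified]
      lm_rdistr subset_eq lin_closed[OF h, simplified]\<close>)
  have D: "subm (s ` N) ?P" using subm_image[OF sl Nm P subm_carrier[OF Nm]] by simp
  obtain E :: "'a umodule" and q where q: "fg_module A E" "lin ?P E q" "q ` carrier ?P = carrier E"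
    "\<And>x. x \<in> carrier ?P \<Longrightarrow> q x = \<zero>\<^bsub>E\<^esub> \<longleftrightarrow> x \<in> s ` N"
    using realize_quotient[OF fg_prodm[OF fgT fgB] D] by metis
  have E: "lmod E" using q(1) by simp
  define i where "i t = q (t, \<zero>\<^bsub>B\<^esub>)" for t
  define j where "j b = q (\<zero>\<^bsub>T\<^esub>, b)" for b
  have i: "lin T E i" unfolding i_def
    by (rule lin_comp[OF _ q(2)]) (use T B in \<open>auto intro!: linI\<close>)
  have j: "lin B E j" unfolding j_def
    by (rule lin_comp[OF _ q(2)]) (use T B in \<open>auto intro!: linI\<close>)
  have ij: "i t \<oplus>\<^bsub>E\<^esub> j b = q (t, b)" if "t \<in> carrier T" "b \<in> carrier B" for t b
    using lin_add[OF q(2), of "(t, \<zero>\<^bsub>B\<^esub>)" "(\<zero>\<^bsub>T\<^esub>, b)"] that T B by (simp add: i_def j_def)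
  have hc: "h c \<in> carrier T" if "c \<in> N" for c using lin_closed[OF h] that by simp
  have neg0: "c = \<zero>\<^bsub>B\<^esub>" if "c \<in> N" "(\<ominus> \<one>) \<odot>\<^bsub>B\<^esub> c = \<zero>\<^bsub>B\<^esub>" for c
    using lm_neg[OF B, of c] that NB B by (auto simp: subset_eq)
  have h0: "h \<zero>\<^bsub>B\<^esub> = \<zero>\<^bsub>T\<^esub>" using lin_zero[OF h Nm T] by simp
  have "inj_on i (carrier T)"
    unfolding lin_inj_iff[OF i T E]
  proof (intro ballI impI)
    fix t assume t: "t \<in> carrier T" "i t = \<zero>\<^bsub>E\<^esub>"
    then obtain c where "c \<in> N" "(t, \<zero>\<^bsub>B\<^esub>) = s c" using q(4)[of "(t, \<zero>\<^bsub>B\<^esub>)"] B by (auto simp: i_def)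
    then show "t = \<zero>\<^bsub>T\<^esub>" using neg0[of c] h0 by (auto simp: s_def)
  qed
  moreover have "j x = i (h x)" if x: "x \<in> N" for x
  proof -
    have xB: "x \<in> carrier B" using x NB by auto
    have "q (dif ?P (h x, \<zero>\<^bsub>B\<^esub>) (\<zero>\<^bsub>T\<^esub>, x)) = \<zero>\<^bsub>E\<^esub>"
      using x xB hc[OF x] T B by (subst q(4)) (auto simp: dif_def s_def)
    then have "dif E (i (h x)) (j x) = \<zero>\<^bsub>E\<^esub>"
      using lin_dif[OF q(2) P, of "(h x, \<zero>\<^bsub>B\<^esub>)" "(\<zero>\<^bsub>T\<^esub>, x)"] xB hc[OF x] T B by (simp add: i_def j_def)
    then show ?thesis using dif_eq_zero[OF E lin_closed[OF i hc[OF x]] lin_closed[OF j xB]] by simp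
  qed
  moreover have "\<exists>t\<in>carrier T. \<exists>b\<in>carrier B. e = i t \<oplus>\<^bsub>E\<^esub> j b" if "e \<in> carrier E" for e
  proof -
    have "e \<in> q ` carrier ?P" using that q(3) by simp
    then obtain t b where "t \<in> carrier T" "b \<in> carrier B" "e = q (t, b)" by auto
    then show ?thesis using ij by metis
  qed
  moreover have "b \<in> N" if "t \<in> carrier T" "b \<in> carrier B" "i t \<oplus>\<^bsub>E\<^esub> j b = \<zero>\<^bsub>E\<^esub>" for t b
  proof -
    have "(t, b) \<in> s ` N" using that q(4)[of "(t, b)"] ij by auto
    then obtain c where c: "c \<in> N" "(t, b) = s c" by (rule imageE)
    then show ?thesis using subm_smult[OF N neg_one_closed c(1)] by (simp add: s_def)
  qed
  ultimately show ?thesis using that[OF q(1) i j] by blast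
qed

end

section \<open>Noetherian modules\<close>

context ring_modules
begin

definition noeth :: "('a, 'm) module \<Rightarrow> bool" where
  "noeth M \<longleftrightarrow> lmod M \<and> (\<forall>N. subm N M \<longrightarrow> fg_module A (M \<restriction> N))"

lemma noeth_lmod: "noeth M \<Longrightarrow> lmod M"
  by (simp add: noeth_def)

lemma noeth_fg: "noeth M \<Longrightarrow> fg_module A M"
  unfolding noeth_def using subm_carrier[of M] by fastforce

lemma noeth_image:
  assumes M: "noeth M" and N: "lmod N" and f: "lin M N f" "f ` carrier M = carrier N"
  shows "noeth N"
  unfolding noeth_def
proof (intro conjI allI impI N)
  fix K assume K: "subm K N"
  have lM: "lmod M" by (rule noeth_lmod[OF M])
  define K' where "K' = {x \<in> carrier M. f x \<in> K}"
  have K': "subm K' M" unfolding K'_def by (rule subm_vimage[OF f(1) lM N K])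
  have fg: "fg_module A (M \<restriction> K')" using M K' by (simp add: noeth_def)
  have l: "lin (M \<restriction> K') (N \<restriction> K) f"
    by (rule lin_to_restr[OF lin_restr_dom[OF f(1)]]) (auto simp: K'_def)
  have "f ` carrier (M \<restriction> K') = carrier (N \<restriction> K)"
    using f(2) subm_subset[OF K] by (force simp: K'_def)
  then show "fg_module A (N \<restriction> K)" by (rule fg_image[OF fg lmod_restr[OF N K] l])
qed

text \<open>A submodule is generated by generators of its intersection with the kernel together with lifts of
  generators of its image.\<close>

lemma noeth_extension:
  assumes M: "lmod M" and f: "lin M N f" and N: "noeth N"
    and ker: "noeth (M \<restriction> {x \<in> carrier M. f x = \<zero>\<^bsub>N\<^esub>})"
  shows "noeth M"
  unfolding noeth_def
proof (intro conjI allI impI M)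
  have lN: "lmod N" by (rule noeth_lmod[OF N])
  fix L assume L: "subm L M"
  let ?Z = "{x \<in> carrier M. f x = \<zero>\<^bsub>N\<^esub>}"
  have Z: "subm ?Z M" by (rule subm_ker[OF f M lN])
  have LZ: "subm (L \<inter> ?Z) M" by (rule subm_inter[OF M L Z])
  have "fg_module A (M \<restriction> (L \<inter> ?Z))" using ker LZ subm_restr[OF M Z] by (auto simp: noeth_def)
  then obtain S1 where S1: "S1 \<subseteq> carrier (M \<restriction> (L \<inter> ?Z))" "finite S1"
    "\<forall>N. subm N (M \<restriction> (L \<inter> ?Z)) \<longrightarrow> S1 \<subseteq> N \<longrightarrow> N = carrier (M \<restriction> (L \<inter> ?Z))" by (rule fgE)
  have fL: "subm (f ` L) N" by (rule subm_image[OF f M lN L])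
  have "fg_module A (N \<restriction> (f ` L))" using N fL by (simp add: noeth_def)
  then obtain S2 where S2: "S2 \<subseteq> carrier (N \<restriction> (f ` L))" "finite S2"
    "\<forall>K. subm K (N \<restriction> (f ` L)) \<longrightarrow> S2 \<subseteq> K \<longrightarrow> K = carrier (N \<restriction> (f ` L))" by (rule fgE)
  have "S2 \<subseteq> f ` L" using S2(1) by simp
  then obtain S3 where S3: "S3 \<subseteq> L" "finite S3" "S2 = f ` S3"
    using finite_subset_image[OF S2(2)] by metis
  show "fg_module A (M \<restriction> L)"
  proof (rule fgI[OF lmod_restr[OF M L], of "S1 \<union> S3"])
    fix K assume "subm K (M \<restriction> L)" and sub: "S1 \<union> S3 \<subseteq> K"
    then have K: "subm K M" "K \<subseteq> L" using subm_restr[OF M L] by auto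
    have "subm (f ` K) N" by (rule subm_image[OF f M lN K(1)])
    then have "subm (f ` K) (N \<restriction> (f ` L))" using subm_restr[OF lN fL] K(2) by auto
    from S2(3)[rule_format, OF this] have fK: "f ` K = f ` L" using S3(3) sub by (simp add: image_mono)
    have "subm (K \<inter> (L \<inter> ?Z)) (M \<restriction> (L \<inter> ?Z))"
      using subm_inter[OF M K(1) LZ] subm_restr[OF M LZ] by auto
    then have "K \<inter> (L \<inter> ?Z) = L \<inter> ?Z" using S1(1,3) sub by auto
    then have kz: "L \<inter> ?Z \<subseteq> K" by blast
    have "x \<in> K" if x: "x \<in> L" for x
    proof -
      have "f x \<in> f ` K" using x fK by auto
      then obtain k where k: "k \<in> K" "f x = f k" by (rule imageE)
      have c: "x \<in> carrier M" "k \<in> carrier M"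
        using subm_carrierD[OF L x] subm_carrierD[OF K(1) k(1)] by auto
      have "f (dif M x k) = \<zero>\<^bsub>N\<^esub>" using c k(2) lN f by (simp add: lin_dif[OF f M] lin_closed[OF f])
      moreover have "dif M x k \<in> L" using subm_dif[OF L x] k(1) K(2) by auto
      ultimately have "dif M x k \<in> K" using kz c M by auto
      then have "dif M x k \<oplus>\<^bsub>M\<^esub> k \<in> K" using k(1) K(1) by simp
      then show ?thesis using c M by simp
    qed
    then show "carrier (M \<restriction> L) \<subseteq> K" by auto
  qed (use S1 S2 S3 in auto)
qed

lemma noeth_trivial:
  assumes "lmod M" "carrier M \<subseteq> {\<zero>\<^bsub>M\<^esub>}" shows "noeth M"
  unfolding noeth_def
proof (intro conjI allI impI assms(1))
  fix N assume N: "subm N M"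
  show "fg_module A (M \<restriction> N)"
  proof (rule fgI[of _ "{}"])
    fix K assume "subm K (M \<restriction> N)"
    from subm_zero[OF this] show "carrier (M \<restriction> N) \<subseteq> K" using assms(2) subm_subset[OF N] by auto
  qed (use assms N in auto)
qed

lemma noeth_free:
  assumes reg: "noeth (regular_module A)" shows "noeth (free_module A n)"
proof (induction n)
  case 0
  show ?case by (rule noeth_trivial[OF lmod_free]) (auto simp: module_power_def)
next
  case (Suc n)
  let ?F = "free_module A (Suc n)" and ?p = "\<lambda>c. c n"
  have p: "lin ?F (regular_module A) ?p"
    unfolding module_power_def by (rule lin_proj_at[of n "{..<Suc n}" "\<lambda>_. regular_module A"]) simp
  let ?Z = "{c \<in> carrier ?F. ?p c = \<zero>\<^bsub>regular_module A\<^esub>}"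
  define e where "e c = (\<lambda>k\<in>{..<Suc n}. if k < n then c k else \<zero>)" for c :: "nat \<Rightarrow> 'a"
  have e: "lin (free_module A n) (?F \<restriction> ?Z) e"
    by (rule linI) (auto simp: e_def module_power_def PiE_iff fun_eq_iff)
  have "e ` carrier (free_module A n) = carrier (?F \<restriction> ?Z)"
  proof
    show "e ` carrier (free_module A n) \<subseteq> carrier (?F \<restriction> ?Z)" using lin_closed[OF e] by blast
    show "carrier (?F \<restriction> ?Z) \<subseteq> e ` carrier (free_module A n)"
    proof
      fix c assume c: "c \<in> carrier (?F \<restriction> ?Z)"
      then have "c = e (restrict c {..<n})"
        by (auto simp: e_def module_power_def PiE_iff extensional_def fun_eq_iff less_Suc_eq)
      moreover have "restrict c {..<n} \<in> carrier (free_module A n)"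
        using c by (auto simp: module_power_def PiE_iff)
      ultimately show "c \<in> e ` carrier (free_module A n)" by (rule image_eqI)
    qed
  qed
  then have "noeth (?F \<restriction> ?Z)"
    by (intro noeth_image[OF Suc _ e] lmod_restr subm_ker[OF p]) auto
  then show ?case by (rule noeth_extension[OF lmod_free p reg])
qed

lemma fg_noeth:
  assumes "noeth (regular_module A)" "fg_module A M" shows "noeth M"
proof -
  obtain n f where f: "lin (free_module A n) M f" "f ` carrier (free_module A n) = carrier M"
    by (rule fg_from_free[OF assms(2)])
  show ?thesis by (rule noeth_image[OF noeth_free[OF assms(1)] fg_lmod[OF assms(2)] f])
qed

end

text \<open>The submodules of the regular module are the ideals.\<close>

lemma noetherian_ring_noeth:
  assumes "cring R" "noetherian_ring R" shows "ring_modules.noeth R (regular_module R)"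
proof -
  interpret cring R by fact
  interpret N: noetherian_ring R by fact
  interpret ring_modules R by unfold_locales
  have id: "ideal I R" if I: "subm I (regular_module R)" for I
  proof (rule idealI)
    show "ring R" by (rule ring_axioms)
    have "\<ominus>\<^bsub>R\<^esub> a \<in> I" if "a \<in> I" for a
      using subm_smult[OF I neg_one_closed that] subm_carrierD[OF I that] by (simp add: l_minus)
    then show "subgroup I (add_monoid R)"
      using subm_subset[OF I] subm_zero[OF I] subm_add[OF I]
      by (intro add.subgroupI) (auto simp: a_inv_def[symmetric])
    show l: "x \<otimes>\<^bsub>R\<^esub> a \<in> I" if "a \<in> I" "x \<in> carrier R" for a x
      using subm_smult[OF I that(2,1)] by simp
    show "a \<otimes>\<^bsub>R\<^esub> x \<in> I" if "a \<in> I" "x \<in> carrier R" for a x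
      using l[OF that] that subm_carrierD[OF I that(1)] by (simp add: m_comm)
  qed
  show ?thesis
    unfolding noeth_def
  proof (intro conjI allI impI lmod_regular)
    fix I assume I: "subm I (regular_module R)"
    obtain S where S: "S \<subseteq> carrier R" "finite S" "I = Idl\<^bsub>R\<^esub> S"
      using N.finetely_gen[OF id[OF I]] by blast
    show "fg_module R (regular_module R \<restriction> I)"
    proof (rule fgI[OF lmod_restr[OF lmod_regular I], of S])
      show "S \<subseteq> carrier (regular_module R \<restriction> I)" using genideal_self[OF S(1)] S(3) by simp
      fix K assume K: "subm K (regular_module R \<restriction> I)" "S \<subseteq> K"
      then have "subm K (regular_module R)" using subm_restr[OF lmod_regular I] by blast
      from genideal_minimal[OF id[OF this] K(2)] show "carrier (regular_module R \<restriction> I) \<subseteq> K"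
        using S(3) by simp
    qed (rule S(2))
  qed
qed

section \<open>Modules over an algebra\<close>

locale algebra_modules = A: ring_modules A + R: ring_modules R
  for R :: "('r, 'x) ring_scheme" and A :: "('r, 'a) module" +
  assumes R_cring: "cring R" and R_noetherian: "noetherian_ring R"
    and r_algebra: "r_algebra R A" and A_fg: "fg_module R A"
begin

abbreviation Rs :: "('a, 'm) module \<Rightarrow> ('r, 'm) module" where
  "Rs \<equiv> restrict_scalars A"

definition scal :: "'r \<Rightarrow> 'a" where
  "scal r = r \<odot>\<^bsub>A\<^esub> \<one>\<^bsub>A\<^esub>"

lemma lmod_A [simp]: "R.lmod A"
  using A_fg by simp

lemma scal_closed [simp]: "r \<in> carrier R \<Longrightarrow> scal r \<in> carrier A"
  by (simp add: scal_def)

lemma scal_mult: "\<lbrakk>r \<in> carrier R; a \<in> carrier A\<rbrakk> \<Longrightarrow> scal r \<otimes>\<^bsub>A\<^esub> a = r \<odot>\<^bsub>A\<^esub> a"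
  using r_algebra.smult_mult_left[OF r_algebra, of r "\<one>\<^bsub>A\<^esub>" a] by (simp add: scal_def)

lemma mult_scal: "\<lbrakk>r \<in> carrier R; a \<in> carrier A\<rbrakk> \<Longrightarrow> a \<otimes>\<^bsub>A\<^esub> scal r = r \<odot>\<^bsub>A\<^esub> a"
  using r_algebra.smult_mult_right[OF r_algebra, of r a "\<one>\<^bsub>A\<^esub>"] by (simp add: scal_def)

lemma scal_add: "\<lbrakk>r \<in> carrier R; s \<in> carrier R\<rbrakk> \<Longrightarrow> scal (r \<oplus>\<^bsub>R\<^esub> s) = scal r \<oplus>\<^bsub>A\<^esub> scal s"
  by (simp add: scal_def R.lm_ldistr[OF lmod_A])

lemma scal_times: "\<lbrakk>r \<in> carrier R; s \<in> carrier R\<rbrakk> \<Longrightarrow> scal (r \<otimes>\<^bsub>R\<^esub> s) = scal r \<otimes>\<^bsub>A\<^esub> scal s"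
  using scal_mult[of r "scal s"] by (simp add: scal_def R.lm_assoc[OF lmod_A])

lemma scal_one [simp]: "scal \<one>\<^bsub>R\<^esub> = \<one>\<^bsub>A\<^esub>"
  by (simp add: scal_def)

lemma scal_zero [simp]: "scal \<zero>\<^bsub>R\<^esub> = \<zero>\<^bsub>A\<^esub>"
  using R.lm_zero_smult[OF lmod_A, of "\<one>\<^bsub>A\<^esub>"] by (simp add: scal_def)

lemma scal_central:
  assumes "A.lmod M" "r \<in> carrier R" "a \<in> carrier A" "x \<in> carrier M"
  shows "scal r \<odot>\<^bsub>M\<^esub> (a \<odot>\<^bsub>M\<^esub> x) = a \<odot>\<^bsub>M\<^esub> (scal r \<odot>\<^bsub>M\<^esub> x)"
  using assms A.lm_assoc[OF assms(1), symmetric] by (simp add: scal_mult mult_scal)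

lemma lin_scal: "\<lbrakk>A.lin M N f; A.lmod N; r \<in> carrier R\<rbrakk> \<Longrightarrow> A.lin M N (\<lambda>x. scal r \<odot>\<^bsub>N\<^esub> f x)"
  by (rule A.linI) (auto simp: A.lin_closed A.lin_add A.lin_smult A.lm_rdistr scal_central)

lemma Rs_simps [simp]:
  "carrier (Rs M) = carrier M" "\<zero>\<^bsub>Rs M\<^esub> = \<zero>\<^bsub>M\<^esub>" "x \<oplus>\<^bsub>Rs M\<^esub> y = x \<oplus>\<^bsub>M\<^esub> y"
  "r \<odot>\<^bsub>Rs M\<^esub> x = scal r \<odot>\<^bsub>M\<^esub> x"
  by (auto simp: restrict_scalars_def scal_def)

lemma Rs_restr [simp]: "Rs (M \<restriction> N) = (Rs M) \<restriction> N"
  by (simp add: restrict_scalars_def)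

lemma lmod_Rs [simp]: "A.lmod M \<Longrightarrow> R.lmod (Rs M)"
  by (rule R.lmodI) (auto simp: scal_add scal_times A.lm_ldistr A.lm_rdistr A.lm_assoc A.lm_ac)

lemma lin_Rs: "A.lin M N f \<Longrightarrow> R.lin (Rs M) (Rs N) f"
  by (rule R.linI) (auto simp: A.lin_closed A.lin_add A.lin_smult)

lemma subm_Rs: "\<lbrakk>A.lmod M; A.subm N M\<rbrakk> \<Longrightarrow> R.subm N (Rs M)"
  by (rule R.submI) (auto dest: A.subm_subset)

text \<open>The products of generators of the algebra over \<open>R\<close> with generators of the module over the algebra
  generate over \<open>R\<close>.\<close>

lemma fg_Rs:
  assumes fg: "fg_module A M" shows "fg_module R (Rs M)"
proof -
  have M: "A.lmod M" using fg by simp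
  obtain S where S: "S \<subseteq> carrier M" "finite S" "\<forall>N. A.subm N M \<longrightarrow> S \<subseteq> N \<longrightarrow> N = carrier M" by (rule A.fgE[OF fg])
  obtain T where T: "T \<subseteq> carrier A" "finite T" "\<forall>N. R.subm N A \<longrightarrow> T \<subseteq> N \<longrightarrow> N = carrier A" by (rule R.fgE[OF A_fg])
  show ?thesis
  proof (rule R.fgI[of _ "(\<lambda>(t, s). t \<odot>\<^bsub>M\<^esub> s) ` (T \<times> S)"])
    fix K assume K: "R.subm K (Rs M)" "(\<lambda>(t, s). t \<odot>\<^bsub>M\<^esub> s) ` (T \<times> S) \<subseteq> K"
    note K0 = R.subm_zero[OF K(1)] R.subm_add[OF K(1)] R.subm_smult[OF K(1)]
    have as: "a \<odot>\<^bsub>M\<^esub> s \<in> K" if "a \<in> carrier A" "s \<in> S" for a s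
    proof -
      have s: "s \<in> carrier M" using that S by auto
      have "R.subm {a \<in> carrier A. a \<odot>\<^bsub>M\<^esub> s \<in> K} A"
        by (rule R.submI) (use s M K0 in \<open>auto simp: A.lm_ldistr scal_mult[symmetric] A.lm_assoc\<close>)
      moreover have "T \<subseteq> {a \<in> carrier A. a \<odot>\<^bsub>M\<^esub> s \<in> K}" using K(2) T(1) that(2) by auto
      ultimately show ?thesis using T(3) that(1) by blast
    qed
    define K' where "K' = {x \<in> carrier M. \<forall>a\<in>carrier A. a \<odot>\<^bsub>M\<^esub> x \<in> K}"
    have "A.subm K' M"
      by (rule A.submI) (use M K0 in \<open>auto simp: K'_def A.lm_rdistr A.lm_assoc[OF M, symmetric]\<close>)
    moreover have "S \<subseteq> K'" using S(1) as by (auto simp: K'_def)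
    ultimately have "K' = carrier M" using S(3) by blast
    then have "\<one>\<^bsub>A\<^esub> \<odot>\<^bsub>M\<^esub> x \<in> K" if "x \<in> carrier M" for x using that by (auto simp: K'_def)
    then show "carrier (Rs M) \<subseteq> K" using M by auto
  qed (use S T M in \<open>auto simp: subset_eq\<close>)
qed

lemma noeth_regular_R: "R.noeth (regular_module R)"
  by (rule noetherian_ring_noeth[OF R_cring R_noetherian])

lemma fg_noeth_Rs: "fg_module A M \<Longrightarrow> R.noeth (Rs M)"
  by (rule R.fg_noeth[OF noeth_regular_R fg_Rs])

text \<open>Submodules over the algebra are submodules over \<open>R\<close>, so the algebra inherits the Noetherian
  property from \<open>R\<close>.\<close>

lemma fg_restr:
  assumes fg: "fg_module A M" and N: "A.subm N M" shows "fg_module A (M \<restriction> N)"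
proof -
  have M: "A.lmod M" using fg by simp
  have MN: "A.lmod (M \<restriction> N)" using M N by simp
  have "fg_module R (Rs (M \<restriction> N))"
    using fg_noeth_Rs[OF fg] subm_Rs[OF M N] by (simp add: R.noeth_def)
  then obtain S where S: "S \<subseteq> carrier (Rs (M \<restriction> N))" "finite S"
    "\<forall>K. R.subm K (Rs (M \<restriction> N)) \<longrightarrow> S \<subseteq> K \<longrightarrow> K = carrier (Rs (M \<restriction> N))" by (rule R.fgE)
  show ?thesis
  proof (rule A.fgI[OF MN, of S])
    fix K assume "A.subm K (M \<restriction> N)" "S \<subseteq> K"
    then have "K = carrier (Rs (M \<restriction> N))" using S(3) subm_Rs[OF MN] by blast
    then show "carrier (M \<restriction> N) \<subseteq> K" by simp
  qed (use S in auto)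
qed

subsection \<open>Modules of homomorphisms\<close>

lemma hom_module_simps [simp]:
  "carrier (hom_module A M N) = mod_hom A M N" "\<zero>\<^bsub>hom_module A M N\<^esub> = (\<lambda>x\<in>carrier M. \<zero>\<^bsub>N\<^esub>)"
  "f \<oplus>\<^bsub>hom_module A M N\<^esub> g = (\<lambda>x\<in>carrier M. f x \<oplus>\<^bsub>N\<^esub> g x)"
  "r \<odot>\<^bsub>hom_module A M N\<^esub> f = (\<lambda>x\<in>carrier M. scal r \<odot>\<^bsub>N\<^esub> f x)"
  by (auto simp: hom_module_def scal_def)

lemma lmod_hom_module [simp]:
  assumes M: "A.lmod M" and N: "A.lmod N" shows "R.lmod (hom_module A M N)"
proof (rule R.lmodI, goal_cases)
  case 1 then show ?case using A.lin_const_zero[OF N] M by (simp add: A.mod_hom_iff)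
next
  case (2 f g) then show ?case using A.lin_plus[of M N f g, OF _ _ N] M by (simp add: A.mod_hom_iff)
next
  case (3 r f) then show ?case using lin_scal[of M N f r, OF _ N] M by (simp add: A.mod_hom_iff)
next
  case (7 f)
  then have "\<And>x. x \<notin> carrier M \<Longrightarrow> f x = undefined" by (auto simp: A.mod_hom_iff extensional_def)
  then show ?case using N 7 by (auto simp: fun_eq_iff A.mod_hom_iff A.lin_closed)
next
  case (11 f)
  then have "\<And>x. x \<notin> carrier M \<Longrightarrow> f x = undefined" by (auto simp: A.mod_hom_iff extensional_def)
  then show ?case using N 11 by (auto simp: fun_eq_iff A.mod_hom_iff A.lin_closed)
qed (use N in \<open>auto simp: fun_eq_iff A.mod_hom_iff A.lin_closed scal_add scal_times A.lm_ldistr A.lm_rdistr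
      A.lm_assoc A.lm_ac\<close>)

lemma mod_hom_eqI: "\<lbrakk>f \<in> mod_hom A M N; g \<in> mod_hom A M N; \<And>x. x \<in> carrier M \<Longrightarrow> f x = g x\<rbrakk> \<Longrightarrow> f = g"
  by (auto simp: A.mod_hom_iff intro: extensionalityI)

text \<open>Evaluation at finitely many generators embeds the homomorphisms into a finite power of \<open>N\<close>. The
  induction adds one generator at a time and uses that the kernel of evaluation consists of the maps
  that vanish at one more generator.\<close>

lemma noeth_hom_module:
  assumes M: "fg_module A M" and N: "fg_module A N" shows "R.noeth (hom_module A M N)"
proof -
  have lm: "A.lmod M" "A.lmod N" using M N by auto
  obtain S where S: "S \<subseteq> carrier M" "finite S" "\<forall>K. A.subm K M \<longrightarrow> S \<subseteq> K \<longrightarrow> K = carrier M" by (rule A.fgE[OF M])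
  let ?H = "hom_module A M N"
  define H where "H T = {f \<in> carrier ?H. \<forall>x\<in>T. f x = \<zero>\<^bsub>N\<^esub>}" for T
  have H: "R.subm (H T) ?H" if "T \<subseteq> carrier M" for T
    by (rule R.submI[OF lmod_hom_module[OF lm]])
      (use that lm R.lm_add[OF lmod_hom_module[OF lm]] R.lm_smult[OF lmod_hom_module[OF lm]]
         R.lm_zero[OF lmod_hom_module[OF lm]] in \<open>auto simp: H_def subset_eq\<close>)
  have "R.noeth (?H \<restriction> (H (S - T)))" if "finite T" "T \<subseteq> S" for T
    using that
  proof (induction T)
    case empty
    have "carrier (?H \<restriction> (H S)) \<subseteq> {\<zero>\<^bsub>?H \<restriction> (H S)\<^esub>}"
    proof
      fix f assume "f \<in> carrier (?H \<restriction> (H S))"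
      then have f: "A.lin M N f" "f \<in> mod_hom A M N" "\<forall>x\<in>S. f x = \<zero>\<^bsub>N\<^esub>" by (auto simp: H_def A.mod_hom_iff)
      have "{x \<in> carrier M. f x = \<zero>\<^bsub>N\<^esub>} = carrier M"
        by (rule S(3)[rule_format, OF A.subm_ker[OF f(1) lm]]) (use f(3) S(1) in auto)
      then have "f = \<zero>\<^bsub>?H\<^esub>" using R.lm_zero[OF lmod_hom_module[OF lm]] by (intro mod_hom_eqI[OF f(2)]) auto
      then show "f \<in> {\<zero>\<^bsub>?H \<restriction> (H S)\<^esub>}" by simp
    qed
    from R.noeth_trivial[OF R.lmod_restr[OF lmod_hom_module[OF lm] H[OF S(1)]] this] show ?case by simp
  next
    case (insert t T)
    have t: "t \<in> carrier M" using insert.prems S(1) by auto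
    let ?K = "?H \<restriction> (H (S - insert t T))"
    have Hs: "R.subm (H (S - insert t T)) ?H" by (rule H) (use S(1) in auto)
    have K: "R.lmod ?K" by (rule R.lmod_restr[OF lmod_hom_module[OF lm] Hs])
    have ev: "R.lin ?K (Rs N) (\<lambda>f. f t)"
      by (rule R.linI) (use t in \<open>auto simp: H_def A.mod_hom_iff A.lin_closed\<close>)
    have "{f \<in> carrier ?K. f t = \<zero>\<^bsub>Rs N\<^esub>} = H (S - T)"
      using insert.hyps insert.prems by (auto simp: H_def)
    then have "R.noeth (?K \<restriction> {f \<in> carrier ?K. f t = \<zero>\<^bsub>Rs N\<^esub>})" using insert by simp
    then show ?case by (rule R.noeth_extension[OF K ev fg_noeth_Rs[OF N]])
  qed
  from this[OF S(2) order_refl] have "R.noeth (?H \<restriction> (H {}))" by simp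
  moreover have "?H \<restriction> (H {}) = ?H" by (simp add: H_def)
  ultimately show ?thesis by simp
qed

end

section \<open>Tensor products with modules over the base ring\<close>

context algebra_modules
begin

context
  fixes M :: "('a, 'm) module" and U :: "('r, 'u) module"
  assumes M: "A.lmod M" and U: "R.lmod U"
begin

private abbreviation "F \<equiv> tensor_free M U"
private definition "N = generate (add_monoid F) (tensor_relations R A M U)"

private lemma F_simps [simp]:
  "\<zero>\<^bsub>F\<^esub> = 0" "x \<oplus>\<^bsub>F\<^esub> y = x + y"
  "a \<odot>\<^bsub>F\<^esub> x = frag_extend (\<lambda>(m, u). frag_of (a \<odot>\<^bsub>M\<^esub> m, u)) x"
  by (auto simp: tensor_free_def)

private lemma carrier_F: "carrier F = {c. Poly_Mapping.keys c \<subseteq> carrier M \<times> carrier U}"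
  by (simp add: tensor_free_def)

private lemma F_closed [simp]:
  "0 \<in> carrier F" "\<lbrakk>m \<in> carrier M; u \<in> carrier U\<rbrakk> \<Longrightarrow> frag_of (m, u) \<in> carrier F"
  "\<lbrakk>x \<in> carrier F; y \<in> carrier F\<rbrakk> \<Longrightarrow> x + y \<in> carrier F"
  "\<lbrakk>x \<in> carrier F; y \<in> carrier F\<rbrakk> \<Longrightarrow> x - y \<in> carrier F" "x \<in> carrier F \<Longrightarrow> - x \<in> carrier F"
  using keys_add[of x y] keys_diff[of x y] by (auto simp: carrier_F)

private lemma abelian_F: "abelian_group F"
proof (rule abelian_groupI)
  show "\<exists>y\<in>carrier F. y \<oplus>\<^bsub>F\<^esub> x = \<zero>\<^bsub>F\<^esub>" if "x \<in> carrier F" for x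
    using that by (intro bexI[of _ "- x"]) auto
qed (auto simp: add_ac)

private lemma rel_subset: "tensor_relations R A M U \<subseteq> carrier F"
  unfolding tensor_relations_def scal_def[symmetric] using M U
  by auto

private lemma N_sub: "additive_subgroup N F"
proof -
  interpret F: abelian_group F by (rule abelian_F)
  have "subgroup N (add_monoid F)" using F.add.generate_is_subgroup[of "tensor_relations R A M U"] rel_subset by (simp add: N_def)
  then show ?thesis by (rule additive_subgroup.intro)
qed

private lemma N_F: "N \<subseteq> carrier F"
  by (rule additive_subgroup.a_subset[OF N_sub])

private lemma inv_F: "x \<in> carrier F \<Longrightarrow> inv\<^bsub>add_monoid F\<^esub> x = - x"
proof -
  assume x: "x \<in> carrier F"
  interpret F: abelian_group F by (rule abelian_F)
  have "\<ominus>\<^bsub>F\<^esub> x = - x" using F.minus_equality[of "- x" x] x by simp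
  then show ?thesis unfolding a_inv_def .
qed

private lemma N_diff: "\<lbrakk>x \<in> N; y \<in> N\<rbrakk> \<Longrightarrow> x - y \<in> N"
proof -
  assume xy: "x \<in> N" "y \<in> N"
  interpret S: additive_subgroup N F by (rule N_sub)
  have "\<ominus>\<^bsub>F\<^esub> y \<in> N"
    using abelian_group.a_inv_closed[OF abelian_F] S.a_subgroup xy(2) by (metis a_inv_def subgroup.m_inv_closed)
  then have "- y \<in> N" using inv_F[of y] xy(2) N_F by (auto simp: a_inv_def)
  from S.a_closed[OF xy(1) this] show ?thesis by simp
qed

private lemma coset_iff: "x \<in> N +>\<^bsub>F\<^esub> y \<longleftrightarrow> x - y \<in> N"
  by (force simp: a_r_coset_def' algebra_simps)

private lemma rel_cases:
  assumes "x \<in> tensor_relations R A M U"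
  obtains (left) m m' u where "x = frag_of (m \<oplus>\<^bsub>M\<^esub> m', u) - frag_of (m, u) - frag_of (m', u)"
      "m \<in> carrier M" "m' \<in> carrier M" "u \<in> carrier U"
    | (right) m u u' where "x = frag_of (m, u \<oplus>\<^bsub>U\<^esub> u') - frag_of (m, u) - frag_of (m, u')"
      "m \<in> carrier M" "u \<in> carrier U" "u' \<in> carrier U"
    | (balanced) r m u where "x = frag_of (scal r \<odot>\<^bsub>M\<^esub> m, u) - frag_of (m, r \<odot>\<^bsub>U\<^esub> u)"
      "r \<in> carrier R" "m \<in> carrier M" "u \<in> carrier U"
  using assms unfolding tensor_relations_def scal_def[symmetric] by blast

private lemma rel_left: "\<lbrakk>m \<in> carrier M; m' \<in> carrier M; u \<in> carrier U\<rbrakk>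
    \<Longrightarrow> frag_of (m \<oplus>\<^bsub>M\<^esub> m', u) - frag_of (m, u) - frag_of (m', u) \<in> tensor_relations R A M U"
  unfolding tensor_relations_def by blast

private lemma rel_right: "\<lbrakk>m \<in> carrier M; u \<in> carrier U; u' \<in> carrier U\<rbrakk>
    \<Longrightarrow> frag_of (m, u \<oplus>\<^bsub>U\<^esub> u') - frag_of (m, u) - frag_of (m, u') \<in> tensor_relations R A M U"
  unfolding tensor_relations_def by blast

private lemma rel_balanced: "\<lbrakk>r \<in> carrier R; m \<in> carrier M; u \<in> carrier U\<rbrakk>
    \<Longrightarrow> frag_of (scal r \<odot>\<^bsub>M\<^esub> m, u) - frag_of (m, r \<odot>\<^bsub>U\<^esub> u) \<in> tensor_relations R A M U"
  unfolding tensor_relations_def scal_def by blast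

private lemma rel_N: "x \<in> tensor_relations R A M U \<Longrightarrow> x \<in> N"
  unfolding N_def by (rule generate.incl)

private lemma smult_F: "\<lbrakk>a \<in> carrier A; x \<in> carrier F\<rbrakk> \<Longrightarrow> a \<odot>\<^bsub>F\<^esub> x \<in> carrier F"
  using keys_frag_extend[of "\<lambda>(m, u). frag_of (a \<odot>\<^bsub>M\<^esub> m, u)" x] M by (fastforce simp: carrier_F)

private lemma smult_N: assumes a: "a \<in> carrier A" and x: "x \<in> N" shows "a \<odot>\<^bsub>F\<^esub> x \<in> N"
proof -
  let ?f = "frag_extend (\<lambda>(m, u). frag_of (a \<odot>\<^bsub>M\<^esub> m, u))"
  have 1: "?f h \<in> tensor_relations R A M U" if "h \<in> tensor_relations R A M U" for h
    using that
  proof (cases rule: rel_cases)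
    case (left m m' u)
    have "?f h = frag_of (a \<odot>\<^bsub>M\<^esub> m \<oplus>\<^bsub>M\<^esub> a \<odot>\<^bsub>M\<^esub> m', u) - frag_of (a \<odot>\<^bsub>M\<^esub> m, u) - frag_of (a \<odot>\<^bsub>M\<^esub> m', u)"
      using left a M by (simp add: frag_extend_diff A.lm_rdistr)
    then show ?thesis using rel_left[of "a \<odot>\<^bsub>M\<^esub> m" "a \<odot>\<^bsub>M\<^esub> m'" u] left a M by simp
  next
    case (right m u u')
    then show ?thesis using rel_right[of "a \<odot>\<^bsub>M\<^esub> m" u u'] a M by (simp add: frag_extend_diff)
  next
    case (balanced r m u)
    then show ?thesis using rel_balanced[of r "a \<odot>\<^bsub>M\<^esub> m" u] a M by (simp add: frag_extend_diff scal_central)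
  qed
  have "?f x \<in> N" using x[unfolded N_def]
  proof induction
    case one
    then show ?case using additive_subgroup.zero_closed[OF N_sub] by simp
  next
    case (incl h)
    then show ?case using 1 by (intro rel_N)
  next
    case (inv h)
    have "?f (inv\<^bsub>add_monoid F\<^esub> h) = 0 - ?f h"
      using inv_F[of h] inv rel_subset by (auto simp: frag_extend_minus)
    also have "\<dots> \<in> N"
      using N_diff[OF additive_subgroup.zero_closed[OF N_sub] rel_N[OF 1[OF inv]]] by simp
    finally show ?case .
  next
    case (eng h1 h2)
    then show ?case using additive_subgroup.a_closed[OF N_sub] by (simp add: frag_extend_add)
  qed
  then show ?thesis by simp
qed

private lemma mod_N:
  assumes lin: "\<And>x y. \<lbrakk>x \<in> carrier F; y \<in> carrier F\<rbrakk> \<Longrightarrow> g (x - y) = g x - g y" and z: "g 0 = 0"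
    and gen: "\<And>m u. \<lbrakk>m \<in> carrier M; u \<in> carrier U\<rbrakk> \<Longrightarrow> g (frag_of (m, u)) \<in> N"
    and x: "x \<in> carrier F"
  shows "g x \<in> N"
proof -
  have "x \<in> carrier F \<and> g x \<in> N"
    using x[unfolded carrier_F mem_Collect_eq]
  proof (induction rule: frag_induction)
    case zero then show ?case using additive_subgroup.zero_closed[OF N_sub] z by simp
  next
    case (one x) then show ?case using gen by auto
  next
    case (diff a b) then show ?case using lin N_diff by auto
  qed
  then show ?thesis by blast
qed

text \<open>The elementary tensor \<open>m \<otimes> u\<close>.\<close>

definition tens :: "'m \<Rightarrow> 'u \<Rightarrow> (('m \<times> 'u) \<Rightarrow>\<^sub>0 int) set" where
  "tens m u = N +>\<^bsub>F\<^esub> frag_of (m, u)"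

private lemma tensor_aux:
  shows "A.lmod (tensor_module R A M U)"
    and "carrier (tensor_module R A M U) = (\<lambda>x. N +>\<^bsub>F\<^esub> x) ` carrier F"
    and "\<lbrakk>x \<in> carrier F; y \<in> carrier F\<rbrakk> \<Longrightarrow> N +>\<^bsub>F\<^esub> (x \<oplus>\<^bsub>F\<^esub> y) = (N +>\<^bsub>F\<^esub> x) \<oplus>\<^bsub>tensor_module R A M U\<^esub> (N +>\<^bsub>F\<^esub> y)"
    and "\<lbrakk>a \<in> carrier A; x \<in> carrier F\<rbrakk> \<Longrightarrow> N +>\<^bsub>F\<^esub> (a \<odot>\<^bsub>F\<^esub> x) = a \<odot>\<^bsub>tensor_module R A M U\<^esub> (N +>\<^bsub>F\<^esub> x)"
    and "x \<in> carrier F \<Longrightarrow> N +>\<^bsub>F\<^esub> x = \<zero>\<^bsub>tensor_module R A M U\<^esub> \<longleftrightarrow> x \<in> N"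
proof -
  note * = A.quotient_module_general[OF abelian_F N_sub]
  have ad: "a \<odot>\<^bsub>F\<^esub> (x \<oplus>\<^bsub>F\<^esub> y) = a \<odot>\<^bsub>F\<^esub> x \<oplus>\<^bsub>F\<^esub> a \<odot>\<^bsub>F\<^esub> y" for a x y
    by (simp add: frag_extend_add)
  have ld: "(a \<oplus>\<^bsub>A\<^esub> b) \<odot>\<^bsub>F\<^esub> x \<in> N +>\<^bsub>F\<^esub> (a \<odot>\<^bsub>F\<^esub> x \<oplus>\<^bsub>F\<^esub> b \<odot>\<^bsub>F\<^esub> x)"
    if ab: "a \<in> carrier A" "b \<in> carrier A" and x: "x \<in> carrier F" for a b x
    unfolding coset_iff
  proof (rule mod_N[of "\<lambda>x. (a \<oplus>\<^bsub>A\<^esub> b) \<odot>\<^bsub>F\<^esub> x - (a \<odot>\<^bsub>F\<^esub> x \<oplus>\<^bsub>F\<^esub> b \<odot>\<^bsub>F\<^esub> x)"])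
    fix m u assume mu: "m \<in> carrier M" "u \<in> carrier U"
    have "frag_of (a \<odot>\<^bsub>M\<^esub> m \<oplus>\<^bsub>M\<^esub> b \<odot>\<^bsub>M\<^esub> m, u) - frag_of (a \<odot>\<^bsub>M\<^esub> m, u) - frag_of (b \<odot>\<^bsub>M\<^esub> m, u) \<in> tensor_relations R A M U"
      by (rule rel_left) (use mu ab M in auto)
    then show "(a \<oplus>\<^bsub>A\<^esub> b) \<odot>\<^bsub>F\<^esub> frag_of (m, u) - (a \<odot>\<^bsub>F\<^esub> frag_of (m, u) \<oplus>\<^bsub>F\<^esub> b \<odot>\<^bsub>F\<^esub> frag_of (m, u)) \<in> N"
      using mu ab M rel_N by (simp add: A.lm_ldistr diff_diff_eq)
  qed (use x in \<open>auto simp: frag_extend_diff\<close>)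
  have as: "(a \<otimes>\<^bsub>A\<^esub> b) \<odot>\<^bsub>F\<^esub> x \<in> N +>\<^bsub>F\<^esub> (a \<odot>\<^bsub>F\<^esub> (b \<odot>\<^bsub>F\<^esub> x))"
    if ab: "a \<in> carrier A" "b \<in> carrier A" and x: "x \<in> carrier F" for a b x
    unfolding coset_iff
    by (rule mod_N[of "\<lambda>x. (a \<otimes>\<^bsub>A\<^esub> b) \<odot>\<^bsub>F\<^esub> x - a \<odot>\<^bsub>F\<^esub> (b \<odot>\<^bsub>F\<^esub> x)"])
      (use x ab M additive_subgroup.zero_closed[OF N_sub] in \<open>auto simp: frag_extend_diff A.lm_assoc\<close>)
  have on: "\<one>\<^bsub>A\<^esub> \<odot>\<^bsub>F\<^esub> x \<in> N +>\<^bsub>F\<^esub> x" if x: "x \<in> carrier F" for x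
    unfolding coset_iff
    by (rule mod_N[of "\<lambda>x. \<one>\<^bsub>A\<^esub> \<odot>\<^bsub>F\<^esub> x - x"])
      (use x M additive_subgroup.zero_closed[OF N_sub] in \<open>auto simp: frag_extend_diff\<close>)
  note ** = smult_F ad smult_N ld as on
  show "A.lmod (tensor_module R A M U)" unfolding tensor_module_def N_def[symmetric] by (rule *(1)) ((rule **; assumption)+)
  show "carrier (tensor_module R A M U) = (\<lambda>x. N +>\<^bsub>F\<^esub> x) ` carrier F"
    unfolding tensor_module_def N_def[symmetric] by (rule *(2)) ((rule **; assumption)+)
  show "N +>\<^bsub>F\<^esub> (x \<oplus>\<^bsub>F\<^esub> y) = (N +>\<^bsub>F\<^esub> x) \<oplus>\<^bsub>tensor_module R A M U\<^esub> (N +>\<^bsub>F\<^esub> y)" if "x \<in> carrier F" "y \<in> carrier F"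
    unfolding tensor_module_def N_def[symmetric] by (rule *(3)) ((rule **; assumption)+, (rule that)+)
  show "N +>\<^bsub>F\<^esub> (a \<odot>\<^bsub>F\<^esub> x) = a \<odot>\<^bsub>tensor_module R A M U\<^esub> (N +>\<^bsub>F\<^esub> x)" if "a \<in> carrier A" "x \<in> carrier F"
    unfolding tensor_module_def N_def[symmetric] by (rule *(4)) ((rule **; assumption)+, (rule that)+)
  show "N +>\<^bsub>F\<^esub> x = \<zero>\<^bsub>tensor_module R A M U\<^esub> \<longleftrightarrow> x \<in> N" if "x \<in> carrier F"
    unfolding tensor_module_def N_def[symmetric] by (rule *(5)) ((rule **; assumption)+, (rule that)+)
qed

private abbreviation "T \<equiv> tensor_module R A M U"

lemma lmod_tensor: "A.lmod T"
  by (rule tensor_aux(1))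

private lemma frag_F: "m \<in> carrier M \<Longrightarrow> u \<in> carrier U \<Longrightarrow> frag_of (m, u) \<in> carrier F"
  by simp

private lemma q_eqI:
  assumes "x \<in> carrier F" "y \<in> carrier F" "x - y \<in> N" shows "N +>\<^bsub>F\<^esub> x = N +>\<^bsub>F\<^esub> y"
proof -
  interpret S: abelian_subgroup N F by (rule abelian_subgroupI3[OF N_sub abelian_F])
  show ?thesis using S.a_repr_independence'[of x y] assms coset_iff by auto
qed

lemma tens_closed: "\<lbrakk>m \<in> carrier M; u \<in> carrier U\<rbrakk> \<Longrightarrow> tens m u \<in> carrier T"
  unfolding tensor_aux(2) tens_def using frag_F by blast

lemma tens_add_left:
  assumes "m \<in> carrier M" "m' \<in> carrier M" "u \<in> carrier U"
  shows "tens (m \<oplus>\<^bsub>M\<^esub> m') u = tens m u \<oplus>\<^bsub>T\<^esub> tens m' u"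
proof -
  note rel_left[OF assms]
  then have "N +>\<^bsub>F\<^esub> frag_of (m \<oplus>\<^bsub>M\<^esub> m', u) = N +>\<^bsub>F\<^esub> (frag_of (m, u) \<oplus>\<^bsub>F\<^esub> frag_of (m', u))"
    using assms M rel_N by (intro q_eqI) (auto simp: diff_diff_eq)
  then show ?thesis unfolding tens_def using tensor_aux(3)[OF frag_F frag_F] assms by simp
qed

lemma tens_add_right:
  assumes "m \<in> carrier M" "u \<in> carrier U" "u' \<in> carrier U"
  shows "tens m (u \<oplus>\<^bsub>U\<^esub> u') = tens m u \<oplus>\<^bsub>T\<^esub> tens m u'"
proof -
  note rel_right[OF assms]
  then have "N +>\<^bsub>F\<^esub> frag_of (m, u \<oplus>\<^bsub>U\<^esub> u') = N +>\<^bsub>F\<^esub> (frag_of (m, u) \<oplus>\<^bsub>F\<^esub> frag_of (m, u'))"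
    using assms U rel_N by (intro q_eqI) (auto simp: diff_diff_eq)
  then show ?thesis unfolding tens_def using tensor_aux(3)[OF frag_F frag_F] assms by simp
qed

lemma tens_balanced:
  assumes "m \<in> carrier M" "u \<in> carrier U" "r \<in> carrier R"
  shows "tens (scal r \<odot>\<^bsub>M\<^esub> m) u = tens m (r \<odot>\<^bsub>U\<^esub> u)"
proof -
  note rel_balanced[OF assms(3,1,2)]
  then show ?thesis unfolding tens_def using assms M U rel_N by (intro q_eqI) auto
qed

lemma tens_smult: "\<lbrakk>m \<in> carrier M; u \<in> carrier U; a \<in> carrier A\<rbrakk> \<Longrightarrow> tens (a \<odot>\<^bsub>M\<^esub> m) u = a \<odot>\<^bsub>T\<^esub> tens m u"
  unfolding tens_def using tensor_aux(4)[OF _ frag_F, of a m u] by simp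

lemma tens_lin: "u \<in> carrier U \<Longrightarrow> A.lin M T (\<lambda>m. tens m u)"
  by (rule A.linI) (auto simp: tens_closed tens_add_left tens_smult)

lemma tens_zero_right: "m \<in> carrier M \<Longrightarrow> tens m \<zero>\<^bsub>U\<^esub> = \<zero>\<^bsub>T\<^esub>"
  using tens_balanced[of m "\<zero>\<^bsub>U\<^esub>" "\<zero>\<^bsub>R\<^esub>"] M U A.lin_zero[OF tens_lin M lmod_tensor] by simp

text \<open>Elements of the free abelian group are reached from generators by differences, and a submodule is
  closed under differences.\<close>

lemma tensor_generated:
  assumes K: "A.subm K T" and g: "\<And>m u. \<lbrakk>m \<in> carrier M; u \<in> carrier U\<rbrakk> \<Longrightarrow> tens m u \<in> K"
  shows "carrier T \<subseteq> K"
proof -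
  have "x \<in> carrier F \<and> N +>\<^bsub>F\<^esub> x \<in> K" if "Poly_Mapping.keys x \<subseteq> carrier M \<times> carrier U" for x
    using that
  proof (induction rule: frag_induction)
    case zero
    have "N +>\<^bsub>F\<^esub> 0 = \<zero>\<^bsub>T\<^esub>" using tensor_aux(5)[of 0] additive_subgroup.zero_closed[OF N_sub] by simp
    then show ?case using A.subm_zero[OF K] by simp
  next
    case (one x) then show ?case using g by (auto simp: tens_def)
  next
    case (diff a b)
    have c: "a - b \<in> carrier F" using diff by auto
    have cc: "N +>\<^bsub>F\<^esub> (a - b) \<in> carrier T" "N +>\<^bsub>F\<^esub> b \<in> carrier T"
      unfolding tensor_aux(2) using c diff by auto
    have "N +>\<^bsub>F\<^esub> ((a - b) \<oplus>\<^bsub>F\<^esub> b) = (N +>\<^bsub>F\<^esub> (a - b)) \<oplus>\<^bsub>T\<^esub> (N +>\<^bsub>F\<^esub> b)"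
      using tensor_aux(3)[OF c, of b] diff by blast
    then have "A.dif T (N +>\<^bsub>F\<^esub> a) (N +>\<^bsub>F\<^esub> b) = N +>\<^bsub>F\<^esub> (a - b)"
      using A.add_dif_cancel[OF lmod_tensor cc] by simp
    moreover have "A.dif T (N +>\<^bsub>F\<^esub> a) (N +>\<^bsub>F\<^esub> b) \<in> K" using diff K by simp
    ultimately show ?case using c by simp
  qed
  then show ?thesis unfolding tensor_aux(2) carrier_F by auto
qed

text \<open>A functional \<open>\<chi>\<close> on \<open>U\<close> contracts the tensor product by \<open>m \<otimes> u \<mapsto> \<chi>(u) m\<close>. Together with the maps
  \<open>m \<mapsto> m \<otimes> v\<close> these are the only maps out of and into tensor products that are used; they decompose the
  identity of \<open>M \<otimes> U\<close> when \<open>U\<close> is projective.\<close>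

lemma tensor_contraction:
  assumes \<chi>: "R.lin U (regular_module R) \<chi>"
  obtains \<beta> where "A.lin T M \<beta>" "\<And>m u. \<lbrakk>m \<in> carrier M; u \<in> carrier U\<rbrakk> \<Longrightarrow> \<beta> (tens m u) = scal (\<chi> u) \<odot>\<^bsub>M\<^esub> m"
proof -
  have aM: "abelian_group M" by (rule A.lmod_abelian_group[OF M])
  interpret M: abelian_group M by (rule aM)
  have \<chi>c: "\<chi> u \<in> carrier R" if "u \<in> carrier U" for u using R.lin_closed[OF \<chi> that] by simp
  have im: "(\<lambda>x. scal (\<chi> (snd x)) \<odot>\<^bsub>M\<^esub> fst x) ` (carrier M \<times> carrier U) \<subseteq> carrier M"
    using M \<chi>c by auto
  obtain h where h: "h \<in> hom (free_Abelian_group (carrier M \<times> carrier U)) (add_monoid M)"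
    "\<And>x. x \<in> carrier M \<times> carrier U \<Longrightarrow> h (frag_of x) = scal (\<chi> (snd x)) \<odot>\<^bsub>M\<^esub> fst x"
    using M.add.free_Abelian_group_universal[OF im] by blast
  have hc: "h x \<in> carrier M" if "x \<in> carrier F" for x
    using h(1) that by (auto simp: hom_def free_Abelian_group_def carrier_F)
  have hadd: "h (x + y) = h x \<oplus>\<^bsub>M\<^esub> h y" if "x \<in> carrier F" "y \<in> carrier F" for x y
    using h(1) that by (auto simp: hom_def free_Abelian_group_def carrier_F)
  have hdif: "h (x - y) = A.dif M (h x) (h y)" if "x \<in> carrier F" "y \<in> carrier F" for x y
  proof -
    have c: "x - y \<in> carrier F" using that by auto
    have "h x = h (x - y) \<oplus>\<^bsub>M\<^esub> h y" using hadd[OF c that(2)] by simp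
    then show ?thesis using A.add_dif_cancel[OF M hc[OF c] hc[OF that(2)]] by simp
  qed
  have h0: "h 0 = \<zero>\<^bsub>M\<^esub>" using hdif[of 0 0] hc[of 0] M by simp
  have hrel: "h x = \<zero>\<^bsub>M\<^esub>" if "x \<in> tensor_relations R A M U" for x
    using that
  proof (cases rule: rel_cases)
    case (left m m' u)
    have "frag_of (m \<oplus>\<^bsub>M\<^esub> m', u) - frag_of (m, u) \<in> carrier F" using left M by auto
    then show ?thesis
      using left M \<chi>c[OF left(4)] A.add_dif_cancel[OF M, of "scal (\<chi> u) \<odot>\<^bsub>M\<^esub> m'" "scal (\<chi> u) \<odot>\<^bsub>M\<^esub> m"]
      by (simp add: hdif h(2) A.lm_rdistr A.lm_a_comm)
  next
    case (right m u u')
    have "frag_of (m, u \<oplus>\<^bsub>U\<^esub> u') - frag_of (m, u) \<in> carrier F" using right U by auto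
    then show ?thesis
      using right M U \<chi>c A.add_dif_cancel[OF M, of "scal (\<chi> u') \<odot>\<^bsub>M\<^esub> m" "scal (\<chi> u) \<odot>\<^bsub>M\<^esub> m"]
      by (simp add: hdif h(2) R.lin_add[OF \<chi>] scal_add A.lm_ldistr A.lm_a_comm)
  next
    case (balanced r m u)
    then show ?thesis
      using M U \<chi>c scal_central[OF M balanced(2) scal_closed[OF \<chi>c[OF balanced(4)]] balanced(3)]
      by (simp add: hdif h(2) R.lin_smult[OF \<chi>] scal_times A.lm_assoc)
  qed
  have hN: "h x = \<zero>\<^bsub>M\<^esub>" if "x \<in> N" for x
    using that[unfolded N_def]
  proof induction
    case one then show ?case using h0 by simp
  next
    case (incl x) then show ?case by (rule hrel)
  next
    case (inv x)
    have x: "x \<in> carrier F" using inv rel_subset by blast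
    have "h (inv\<^bsub>add_monoid F\<^esub> x) = h (0 - x)" using inv_F[OF x] by simp
    also have "\<dots> = \<zero>\<^bsub>M\<^esub>" using hdif[of 0 x] x hrel[OF inv] h0 M by simp
    finally show ?case .
  next
    case (eng x y)
    then have "x \<in> carrier F" "y \<in> carrier F" using N_F unfolding N_def by blast+
    then show ?case using eng hadd M by simp
  qed
  have hs: "h (a \<odot>\<^bsub>F\<^esub> x) = a \<odot>\<^bsub>M\<^esub> h x" if a: "a \<in> carrier A" and x: "x \<in> carrier F" for a x
  proof -
    have "x \<in> carrier F \<and> h (a \<odot>\<^bsub>F\<^esub> x) = a \<odot>\<^bsub>M\<^esub> h x" using x[unfolded carrier_F mem_Collect_eq]
    proof (induction rule: frag_induction)
      case zero then show ?case using h0 M a by simp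
    next
      case (one x) then show ?case using a M \<chi>c by (auto simp: h(2) scal_central)
    next
      case (diff x y)
      have "a \<odot>\<^bsub>F\<^esub> (x - y) = a \<odot>\<^bsub>F\<^esub> x - a \<odot>\<^bsub>F\<^esub> y" by (simp add: frag_extend_diff)
      moreover have "a \<odot>\<^bsub>F\<^esub> x \<in> carrier F" "a \<odot>\<^bsub>F\<^esub> y \<in> carrier F" using smult_F[OF a] diff by blast+
      ultimately have "h (a \<odot>\<^bsub>F\<^esub> (x - y)) = A.dif M (a \<odot>\<^bsub>M\<^esub> h x) (a \<odot>\<^bsub>M\<^esub> h y)"
        using hdif[of "a \<odot>\<^bsub>F\<^esub> x" "a \<odot>\<^bsub>F\<^esub> y"] diff by (simp del: F_simps)
      also have "\<dots> = a \<odot>\<^bsub>M\<^esub> h (x - y)"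
        using A.lin_dif[OF _ M, of M "\<lambda>x. a \<odot>\<^bsub>M\<^esub> x" "h x" "h y"] diff hdif hc a M
        by (simp add: A.dif_def A.lm_rdistr A.lm_assoc[symmetric] A.l_minus A.r_minus)
      finally show ?case using diff by auto
    qed
    then show ?thesis by blast
  qed
  define \<beta> where "\<beta> t = h (SOME x. x \<in> carrier F \<and> N +>\<^bsub>F\<^esub> x = t)" for t
  have \<beta>: "\<beta> (N +>\<^bsub>F\<^esub> x) = h x" if x: "x \<in> carrier F" for x
  proof -
    define y where "y = (SOME y. y \<in> carrier F \<and> N +>\<^bsub>F\<^esub> y = N +>\<^bsub>F\<^esub> x)"
    have y: "y \<in> carrier F \<and> N +>\<^bsub>F\<^esub> y = N +>\<^bsub>F\<^esub> x" unfolding y_def by (rule someI) (use x in simp)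
    interpret S: abelian_subgroup N F by (rule abelian_subgroupI3[OF N_sub abelian_F])
    have "y \<in> N +>\<^bsub>F\<^esub> x" using y S.a_rcos_self by blast
    then have "h (y - x) = \<zero>\<^bsub>M\<^esub>" using hN coset_iff by blast
    then have "h y = h x" using hdif[of y x] y x A.dif_eq_zero[OF M hc[of y] hc[of x]] by simp
    then show ?thesis by (simp add: \<beta>_def y_def)
  qed
  have "A.lin T M \<beta>"
  proof (rule A.linI)
    show "\<beta> t \<in> carrier M" if "t \<in> carrier T" for t using that unfolding tensor_aux(2) using \<beta> hc by auto
    show "\<beta> (s \<oplus>\<^bsub>T\<^esub> t) = \<beta> s \<oplus>\<^bsub>M\<^esub> \<beta> t" if st: "s \<in> carrier T" "t \<in> carrier T" for s t
    proof -
      obtain x y where xy: "x \<in> carrier F" "s = N +>\<^bsub>F\<^esub> x" "y \<in> carrier F" "t = N +>\<^bsub>F\<^esub> y"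
        using st unfolding tensor_aux(2) by blast
      have "x + y \<in> carrier F" using xy(1,3) by (auto)
      then show ?thesis
        unfolding xy(2,4) tensor_aux(3)[OF xy(1,3), symmetric] \<beta>[OF xy(1)] \<beta>[OF xy(3)]
        using \<beta>[of "x + y"] hadd[OF xy(1,3)] by simp
    qed
    show "\<beta> (a \<odot>\<^bsub>T\<^esub> t) = a \<odot>\<^bsub>M\<^esub> \<beta> t" if a: "a \<in> carrier A" and t: "t \<in> carrier T" for a t
    proof -
      obtain x where x: "x \<in> carrier F" "t = N +>\<^bsub>F\<^esub> x" using t unfolding tensor_aux(2) by blast
      show ?thesis unfolding x(2) tensor_aux(4)[OF a x(1), symmetric] \<beta>[OF smult_F[OF a x(1)]] \<beta>[OF x(1)]
        by (rule hs[OF a x(1)])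
    qed
  qed
  moreover have "\<beta> (tens m u) = scal (\<chi> u) \<odot>\<^bsub>M\<^esub> m" if "m \<in> carrier M" "u \<in> carrier U" for m u
    unfolding tens_def \<beta>[OF frag_F[OF that]] using h(2) that by simp
  ultimately show ?thesis using that by blast
qed

end

abbreviation Rproj :: "('r, 'm) module \<Rightarrow> bool" where
  "Rproj H \<equiv> R.summand {regular_module R} H"

text \<open>The first halves of the maps that make up the identity are functionals, so functionals separate
  the elements of a projective module.\<close>

lemma Rproj_functionals:
  assumes U: "R.lmod U" "Rproj U" and u: "u \<in> carrier U"
    and 0: "\<And>\<chi>. R.lin U (regular_module R) \<chi> \<Longrightarrow> \<chi> u = \<zero>\<^bsub>R\<^esub>"
  shows "u = \<zero>\<^bsub>U\<^esub>"
proof -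
  have "\<alpha> u = \<zero>\<^bsub>U\<^esub>" if "R.thru {regular_module R} U U \<alpha>" for \<alpha>
    using that
  proof induction
    case (step f M b a)
    have M: "M = regular_module R" using step(2) by simp
    have "b u = \<zero>\<^bsub>R\<^esub>" using 0 step(3) M by simp
    then have "a (b u) = \<zero>\<^bsub>U\<^esub>" using R.lin_zero[OF step(4)[unfolded M] R.lmod_regular U(1)] by simp
    then show ?case using step.IH U(1) by simp
  qed (use u in auto)
  from this[OF U(2)[unfolded R.summand_def]] show ?thesis .
qed

text \<open>An endomorphism \<open>\<alpha> = \<Sum> v\<^sub>i \<chi>\<^sub>i\<close> of \<open>U\<close> induces \<open>M \<otimes> \<alpha> = \<Sum> (_ \<otimes> v\<^sub>i) \<beta>\<^sub>i\<close>, where \<open>\<beta>\<^sub>i\<close> contracts with \<open>\<chi>\<^sub>i\<close>. If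
  \<open>Hom(D, M)\<close> is generated by \<open>\<iota>\<close>, then \<open>\<beta>\<^sub>i w = c\<^sub>i \<iota>\<close> for a map \<open>w\<close> into \<open>M \<otimes> U\<close>, so that
  \<open>(M \<otimes> \<alpha>) w = \<iota> \<otimes> \<Sum> c\<^sub>i v\<^sub>i\<close>. Both consequences are proved in one induction because they concern the
  same map.\<close>

lemma tensor_endomorphism:
  fixes M :: "('a, 'm) module" and U :: "('r, 'u) module"
  assumes M: "A.lmod M" and U: "R.lmod U" and \<alpha>: "R.thru {regular_module R} U U \<alpha>"
  shows "\<exists>F. A.thru {M} (tensor_module R A M U) (tensor_module R A M U) F \<and>
     (\<forall>m\<in>carrier M. \<forall>u\<in>carrier U. F (tens M U m u) = tens M U m (\<alpha> u)) \<and>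
     (\<forall>(D :: ('a, 'd) module) \<iota> w. A.lmod D \<longrightarrow> A.lin D M \<iota> \<longrightarrow>
        (\<forall>f. A.lin D M f \<longrightarrow> (\<exists>c\<in>carrier R. \<forall>x\<in>carrier D. f x = scal c \<odot>\<^bsub>M\<^esub> \<iota> x)) \<longrightarrow>
        A.lin D (tensor_module R A M U) w \<longrightarrow> (\<exists>u\<in>carrier U. \<forall>x\<in>carrier D. F (w x) = tens M U (\<iota> x) u))"
  using \<alpha>
proof induction
  let ?T = "tensor_module R A M U"
  note T = lmod_tensor[OF M U]
  case zero
  show ?case
    using tens_zero_right[OF M U] A.lin_closed U
    by (intro exI[of _ "\<lambda>x. \<zero>\<^bsub>?T\<^esub>"] conjI A.thru.zero allI impI bexI[of _ "\<zero>\<^bsub>U\<^esub>"]) (auto simp: A.lin_closed)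
next
  let ?T = "tensor_module R A M U"
  note T = lmod_tensor[OF M U]
  case (step \<alpha> V b a)
  obtain F where F: "A.thru {M} ?T ?T F" "\<forall>m\<in>carrier M. \<forall>u\<in>carrier U. F (tens M U m u) = tens M U m (\<alpha> u)"
    "\<And>(D :: ('a, 'd) module) \<iota> w. A.lmod D \<Longrightarrow> A.lin D M \<iota> \<Longrightarrow>
        (\<forall>f. A.lin D M f \<longrightarrow> (\<exists>c\<in>carrier R. \<forall>x\<in>carrier D. f x = scal c \<odot>\<^bsub>M\<^esub> \<iota> x)) \<Longrightarrow>
        A.lin D ?T w \<Longrightarrow> (\<exists>u\<in>carrier U. \<forall>x\<in>carrier D. F (w x) = tens M U (\<iota> x) u)"
    using step.IH by blast
  have V: "V = regular_module R" using step(2) by simp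
  define v where "v = a \<one>\<^bsub>R\<^esub>"
  have v: "v \<in> carrier U" using R.lin_closed[OF step(4)] by (simp add: V v_def)
  have a: "a r = r \<odot>\<^bsub>U\<^esub> v" if "r \<in> carrier R" for r using R.lin_regular[OF step(4)[unfolded V] that] by (simp add: v_def)
  obtain \<beta> where \<beta>: "A.lin ?T M \<beta>" "\<And>m u. \<lbrakk>m \<in> carrier M; u \<in> carrier U\<rbrakk> \<Longrightarrow> \<beta> (tens M U m u) = scal (b u) \<odot>\<^bsub>M\<^esub> m"
    using tensor_contraction[OF M U step(3)[unfolded V]] by metis
  note tl = tens_lin[OF M U v]
  have bc: "b u \<in> carrier R" if "u \<in> carrier U" for u using R.lin_closed[OF step(3) that] V by simp
  have \<alpha>l: "R.lin U U \<alpha>" by (rule R.thru_lin[OF step(1) U U])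
  have Fl: "A.lin ?T ?T F" by (rule A.thru_lin[OF F(1) T T])
  show ?case
  proof (rule exI[of _ "\<lambda>t. F t \<oplus>\<^bsub>?T\<^esub> tens M U (\<beta> t) v"], intro conjI ballI allI impI)
    show "A.thru {M} ?T ?T (\<lambda>t. F t \<oplus>\<^bsub>?T\<^esub> tens M U (\<beta> t) v)"
      by (rule A.thru.step[OF F(1) _ \<beta>(1) tl]) simp
  next
    fix m u assume mu: "m \<in> carrier M" "u \<in> carrier U"
    show "F (tens M U m u) \<oplus>\<^bsub>?T\<^esub> tens M U (\<beta> (tens M U m u)) v = tens M U m (\<alpha> u \<oplus>\<^bsub>U\<^esub> a (b u))"
      using mu F(2) \<beta>(2) a[OF bc[OF mu(2)]] tens_balanced[OF M U mu(1) v bc[OF mu(2)]] U v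
        tens_add_right[OF M U mu(1) R.lin_closed[OF \<alpha>l mu(2)], of "b u \<odot>\<^bsub>U\<^esub> v"] bc by simp
  next
    fix D :: "('a, 'd) module" and \<iota> w
    assume D: "A.lmod D" "A.lin D M \<iota>" and all: "\<forall>f. A.lin D M f \<longrightarrow> (\<exists>c\<in>carrier R. \<forall>x\<in>carrier D. f x = scal c \<odot>\<^bsub>M\<^esub> \<iota> x)"
      and w: "A.lin D ?T w"
    obtain u where u: "u \<in> carrier U" "\<forall>x\<in>carrier D. F (w x) = tens M U (\<iota> x) u" using F(3)[OF D all w] by blast
    obtain c where c: "c \<in> carrier R" "\<forall>x\<in>carrier D. \<beta> (w x) = scal c \<odot>\<^bsub>M\<^esub> \<iota> x"
      using all A.lin_comp[OF w \<beta>(1)] by blast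
    show "\<exists>u\<in>carrier U. \<forall>x\<in>carrier D. F (w x) \<oplus>\<^bsub>?T\<^esub> tens M U (\<beta> (w x)) v = tens M U (\<iota> x) u"
    proof (rule bexI[of _ "u \<oplus>\<^bsub>U\<^esub> c \<odot>\<^bsub>U\<^esub> v"])
      show "\<forall>x\<in>carrier D. F (w x) \<oplus>\<^bsub>?T\<^esub> tens M U (\<beta> (w x)) v = tens M U (\<iota> x) (u \<oplus>\<^bsub>U\<^esub> c \<odot>\<^bsub>U\<^esub> v)"
        using u c U v A.lin_closed[OF D(2)]
        by (simp add: tens_balanced[OF M U] tens_add_right[OF M U])
    qed (use u c U v in auto)
  qed
next
  let ?T = "tensor_module R A M U"
  case (ext \<alpha> \<beta>)
  then obtain F where F: "A.thru {M} ?T ?T F" "\<forall>m\<in>carrier M. \<forall>u\<in>carrier U. F (tens M U m u) = tens M U m (\<alpha> u)"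
    "\<forall>(D :: ('a, 'd) module) \<iota> w. A.lmod D \<longrightarrow> A.lin D M \<iota> \<longrightarrow>
        (\<forall>f. A.lin D M f \<longrightarrow> (\<exists>c\<in>carrier R. \<forall>x\<in>carrier D. f x = scal c \<odot>\<^bsub>M\<^esub> \<iota> x)) \<longrightarrow>
        A.lin D ?T w \<longrightarrow> (\<exists>u\<in>carrier U. \<forall>x\<in>carrier D. F (w x) = tens M U (\<iota> x) u)" by blast
  show ?case by (rule exI[of _ F]) (use F ext(2) in auto)
qed

lemma tensor_lin_eqI:
  assumes M: "A.lmod M" and U: "R.lmod U" and Y: "A.lmod Y"
    and f: "A.lin (tensor_module R A M U) Y f" and g: "A.lin (tensor_module R A M U) Y g"
    and eq: "\<And>m u. \<lbrakk>m \<in> carrier M; u \<in> carrier U\<rbrakk> \<Longrightarrow> f (tens M U m u) = g (tens M U m u)"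
    and t: "t \<in> carrier (tensor_module R A M U)"
  shows "f t = g t"
  using tensor_generated[OF M U A.subm_eqlz[OF f g lmod_tensor[OF M U] Y]] eq tens_closed[OF M U] t by blast

text \<open>The preceding lemma for the identity of a projective module \<open>U\<close>: the twist \<open>M \<otimes> U\<close> is a summand of
  copies of \<open>M\<close>, and \<open>Hom(D, M \<otimes> U)\<close> consists of the maps \<open>\<iota> \<otimes> u\<close> when \<open>Hom(D, M)\<close> is generated by
  \<open>\<iota>\<close>.\<close>

lemma
  fixes M :: "('a, 'm) module" and U :: "('r, 'u) module" and D :: "('a, 'd) module"
  assumes M: "A.lmod M" and U: "R.lmod U" "Rproj U"
  shows summand_tensor: "A.summand {M} (tensor_module R A M U)"
    and lin_into_tensor: "\<lbrakk>A.lmod D; A.lin D M \<iota>;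
      \<And>f. A.lin D M f \<Longrightarrow> \<exists>c\<in>carrier R. \<forall>x\<in>carrier D. f x = scal c \<odot>\<^bsub>M\<^esub> \<iota> x;
      A.lin D (tensor_module R A M U) w\<rbrakk> \<Longrightarrow> \<exists>u\<in>carrier U. \<forall>x\<in>carrier D. w x = tens M U (\<iota> x) u"
proof -
  let ?T = "tensor_module R A M U"
  note T = lmod_tensor[OF M U(1)]
  obtain F where F: "A.thru {M} ?T ?T F" "\<forall>m\<in>carrier M. \<forall>u\<in>carrier U. F (tens M U m u) = tens M U m u"
    "\<forall>(D :: ('a, 'd) module) \<iota> w. A.lmod D \<longrightarrow> A.lin D M \<iota> \<longrightarrow>
        (\<forall>f. A.lin D M f \<longrightarrow> (\<exists>c\<in>carrier R. \<forall>x\<in>carrier D. f x = scal c \<odot>\<^bsub>M\<^esub> \<iota> x)) \<longrightarrow>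
        A.lin D ?T w \<longrightarrow> (\<exists>u\<in>carrier U. \<forall>x\<in>carrier D. F (w x) = tens M U (\<iota> x) u)"
    using tensor_endomorphism[OF M U(1) U(2)[unfolded R.summand_def], where 'd = 'd] by blast
  have id: "F t = t" if "t \<in> carrier ?T" for t
    by (rule tensor_lin_eqI[OF M U(1) T A.thru_lin[OF F(1) T T] A.lin_id _ that]) (use F(2) in auto)
  show "A.summand {M} ?T" unfolding A.summand_def by (rule A.thru.ext[OF F(1) id])
  show "\<exists>u\<in>carrier U. \<forall>x\<in>carrier D. w x = tens M U (\<iota> x) u"
    if dw: "A.lmod D" "A.lin D M \<iota>"
      "\<And>f. A.lin D M f \<Longrightarrow> \<exists>c\<in>carrier R. \<forall>x\<in>carrier D. f x = scal c \<odot>\<^bsub>M\<^esub> \<iota> x" "A.lin D ?T w"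
  proof -
    obtain u where u: "u \<in> carrier U" "\<forall>x\<in>carrier D. F (w x) = tens M U (\<iota> x) u"
      using F(3) dw by blast
    then show ?thesis using id A.lin_closed[OF dw(4)] by (intro bexI[of _ u]) auto
  qed
qed

text \<open>If \<open>U\<close> is free of rank one on \<open>v\<close>, then \<open>m \<mapsto> m \<otimes> v\<close> is inverse to the contraction.\<close>

lemma tensor_unit:
  fixes M :: "('a, 'm) module" and U :: "('r, 'u) module"
  assumes M: "A.lmod M" and U: "R.lmod U" and \<chi>: "R.lin U (regular_module R) \<chi>" "bij_betw \<chi> (carrier U) (carrier R)"
  obtains \<beta> where "A.lin (tensor_module R A M U) M \<beta>" "bij_betw \<beta> (carrier (tensor_module R A M U)) (carrier M)"
    "\<And>m u. \<lbrakk>m \<in> carrier M; u \<in> carrier U\<rbrakk> \<Longrightarrow> \<beta> (tens M U m u) = scal (\<chi> u) \<odot>\<^bsub>M\<^esub> m"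
proof -
  let ?T = "tensor_module R A M U"
  note T = lmod_tensor[OF M U]
  obtain \<beta> where \<beta>: "A.lin ?T M \<beta>" "\<And>m u. \<lbrakk>m \<in> carrier M; u \<in> carrier U\<rbrakk> \<Longrightarrow> \<beta> (tens M U m u) = scal (\<chi> u) \<odot>\<^bsub>M\<^esub> m"
    using tensor_contraction[OF M U \<chi>(1)] by metis
  have "\<one>\<^bsub>R\<^esub> \<in> \<chi> ` carrier U" using bij_betw_imp_surj_on[OF \<chi>(2)] by simp
  then obtain v where v: "v \<in> carrier U" "\<chi> v = \<one>\<^bsub>R\<^esub>" by auto
  have uv: "u = \<chi> u \<odot>\<^bsub>U\<^esub> v" if "u \<in> carrier U" for u
  proof -
    have "\<chi> u \<in> carrier R" using R.lin_closed[OF \<chi>(1) that] by simp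
    then have "\<chi> (\<chi> u \<odot>\<^bsub>U\<^esub> v) = \<chi> u" using v R.lin_smult[OF \<chi>(1)] by simp
    then show ?thesis
      using inj_onD[OF bij_betw_imp_inj_on[OF \<chi>(2)], of u "\<chi> u \<odot>\<^bsub>U\<^esub> v"] that v U \<open>\<chi> u \<in> carrier R\<close> by simp
  qed
  have r: "\<beta> (tens M U m v) = m" if "m \<in> carrier M" for m using \<beta>(2)[OF that v(1)] v(2) M that by simp
  have l: "tens M U (\<beta> t) v = t" if "t \<in> carrier ?T" for t
  proof (rule tensor_lin_eqI[OF M U T A.lin_comp[OF \<beta>(1) tens_lin[OF M U v(1)]] A.lin_id _ that])
    fix m u assume mu: "m \<in> carrier M" "u \<in> carrier U"
    have "\<chi> u \<in> carrier R" using R.lin_closed[OF \<chi>(1) mu(2)] by simp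
    then show "tens M U (\<beta> (tens M U m u)) v = tens M U m u"
      using \<beta>(2)[OF mu] tens_balanced[OF M U mu(1) v(1)] uv[OF mu(2)] by simp
  qed
  have "bij_betw \<beta> (carrier ?T) (carrier M)"
    by (rule bij_betw_byWitness[where f' = "\<lambda>m. tens M U m v"])
      (use l r A.lin_closed[OF \<beta>(1)] tens_closed[OF M U _ v(1)] in auto)
  then show ?thesis using that \<beta> by blast
qed

end

context ring_modules
begin

lemma fg_regular [simp]: "fg_module A (regular_module A)"
proof (rule fgI[of _ "{\<one>}"])
  fix N assume N: "subm N (regular_module A)" "{\<one>} \<subseteq> N"
  show "carrier (regular_module A) \<subseteq> N"
  proof
    fix a assume "a \<in> carrier (regular_module A)"
    then show "a \<in> N" using subm_smult[OF N(1), of a \<one>] N(2) by simp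
  qed
qed auto

lemma fchain_mono: "fchain \<theta> M N0 N \<Longrightarrow> \<theta> \<subseteq> \<theta>' \<Longrightarrow> fchain \<theta>' M N0 N"
  by (induction rule: fchain.induct) (auto intro: fchain.intros)

lemma thru_vanish_on:
  assumes "thru \<M> K L f" "lin L Y g" "lmod K" "lmod L" "lmod Y"
    and 0: "\<And>M a x. \<lbrakk>M \<in> \<M>; lin M L a; x \<in> carrier M\<rbrakk> \<Longrightarrow> g (a x) = \<zero>\<^bsub>Y\<^esub>"
  shows "\<forall>x\<in>carrier K. g (f x) = \<zero>\<^bsub>Y\<^esub>"
  using assms(1)
proof induction
  case zero show ?case by (simp add: lin_zero[OF assms(2,4,5)])
next
  case (step f M b a)
  have "g (a (b x)) = \<zero>\<^bsub>Y\<^esub>" if "x \<in> carrier K" for x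
    using 0[OF step(2) step(4) lin_closed[OF step(3) that]] .
  then show ?case using step.IH assms(5) step(3,4)
    by (simp add: lin_add[OF assms(2)] lin_closed[OF thru_lin[OF step(1) assms(3,4)]] lin_closed)
next
  case (ext f h) then show ?case by simp
qed

text \<open>Each \<open>y\<close> is the image of \<open>1\<close> under \<open>a \<mapsto> a y\<close>, and \<open>1\<close> is a sum of values of maps from the modules
  in \<open>\<M>\<close>. So a submodule that contains the image of every map from these generators is everything.\<close>

lemma generated_by:
  assumes gen: "summand \<M> (regular_module A)" and Y: "lmod Y" and N: "subm N Y"
    and im: "\<And>M f x. \<lbrakk>M \<in> \<M>; lin M Y f; x \<in> carrier M\<rbrakk> \<Longrightarrow> f x \<in> N"
  shows "N = carrier Y"
proof -
  let ?Q = "quotient_module Y N" and ?q = "\<lambda>x. N +>\<^bsub>Y\<^esub> x"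
  note Q = lmod_quotient[OF Y N] lin_quotient[OF Y N] quotient_eq_zero[OF Y N]
  have "y \<in> N" if y: "y \<in> carrier Y" for y
  proof -
    have "\<forall>a\<in>carrier (regular_module A). ?q (a \<odot>\<^bsub>Y\<^esub> y) = \<zero>\<^bsub>?Q\<^esub>"
    proof (rule thru_vanish_on[OF gen[unfolded summand_def] lin_comp[OF lin_orbit[OF Y y] Q(2)] lmod_regular lmod_regular Q(1)])
      fix M a x assume M: "M \<in> \<M>" "lin M (regular_module A) a" "x \<in> carrier M"
      have "a x \<odot>\<^bsub>Y\<^esub> y \<in> N" using im[OF M(1) lin_comp[OF M(2) lin_orbit[OF Y y]] M(3)] .
      moreover have "a x \<odot>\<^bsub>Y\<^esub> y \<in> carrier Y" using lin_closed[OF M(2,3)] Y y by simp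
      ultimately show "?q (a x \<odot>\<^bsub>Y\<^esub> y) = \<zero>\<^bsub>?Q\<^esub>" using Q(3) by blast
    qed
    then have "?q (\<one> \<odot>\<^bsub>Y\<^esub> y) = \<zero>\<^bsub>?Q\<^esub>" by simp
    then show ?thesis using Q(3)[OF y] y Y by simp
  qed
  then show ?thesis using subm_subset[OF N] by blast
qed

text \<open>If \<open>s\<close> splits \<open>\<rho>\<close>, then \<open>x - s(\<rho> x)\<close> lies in the kernel, hence comes from \<open>H0\<close>.\<close>

lemma complementary_projection:
  assumes lm: "lmod H0" "lmod H" "lmod H'" and j: "lin H0 H j" "inj_on j (carrier H0)"
    and \<rho>: "lin H H' \<rho>" and ker: "{x \<in> carrier H. \<rho> x = \<zero>\<^bsub>H'\<^esub>} = j ` carrier H0"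
    and s: "lin H' H s" "\<And>y. y \<in> carrier H' \<Longrightarrow> \<rho> (s y) = y"
  obtains k where "lin H H0 k" "\<forall>x\<in>carrier H0. k (j x) = x"
    "\<forall>x\<in>carrier H. s (\<rho> x) \<oplus>\<^bsub>H\<^esub> j (k x) = x"
proof -
  have jH: "j ` carrier H0 \<subseteq> carrier H" using lin_closed[OF j(1)] by blast
  have sJ: "subm (j ` carrier H0) H" by (rule subm_image[OF j(1) lm(1,2) subm_carrier[OF lm(1)]])
  have jl: "lin H0 (H \<restriction> (j ` carrier H0)) j" by (rule lin_to_restr[OF j(1)]) simp
  obtain i where i: "lin (H \<restriction> (j ` carrier H0)) H0 i" "\<forall>x\<in>carrier H0. i (j x) = x"
     "\<forall>y\<in>carrier (H \<restriction> (j ` carrier H0)). j (i y) = y"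
    by (rule inverse_lin[OF lm(1) lmod_restr[OF lm(2) sJ] jl]) (use j(2) in \<open>simp add: bij_betw_def\<close>)
  let ?e = "\<lambda>x. dif H x (s (\<rho> x))"
  have e: "lin H H ?e" by (rule lin_minus[OF lin_id lin_comp[OF \<rho> s(1)] lm(2)])
  have c: "\<rho> x \<in> carrier H'" "s (\<rho> x) \<in> carrier H" if "x \<in> carrier H" for x
    using that \<rho> s(1) by (auto simp: lin_closed)
  have "?e x \<in> j ` carrier H0" if x: "x \<in> carrier H" for x
  proof -
    have "\<rho> (?e x) = \<zero>\<^bsub>H'\<^esub>" using lin_dif[OF \<rho> lm(2) x c(2)[OF x]] s(2) c(1)[OF x] lm(3) by simp
    then show ?thesis unfolding ker[symmetric] using lin_closed[OF e x] by simp
  qed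
  note e_im = this
  have el: "lin H (H \<restriction> (j ` carrier H0)) ?e" by (rule lin_to_restr[OF e e_im])
  show ?thesis
  proof (rule that[OF lin_comp[OF el i(1)]]; rule ballI)
    fix x assume x: "x \<in> carrier H0"
    have "j x \<in> {x \<in> carrier H. \<rho> x = \<zero>\<^bsub>H'\<^esub>}" unfolding ker using x by simp
    then have "?e (j x) = j x" using lin_zero[OF s(1) lm(3,2)] lm(2) by simp
    then show "i (?e (j x)) = x" using i(2) x by simp
  next
    fix x assume x: "x \<in> carrier H"
    show "s (\<rho> x) \<oplus>\<^bsub>H\<^esub> j (i (?e x)) = x" using bspec[OF i(3), of "?e x"] e_im[OF x] c[OF x] x lm(2) by simp
  qed
qed

text \<open>The pushout of an exact sequence along a map out of its left term is again exact, with the same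
  right term.\<close>

lemma pushout_extension:
  fixes B :: "('a, 'm) module" and T :: "('a, 'n) module" and X :: "('a, 'p) module"
  assumes B: "fg_module A B" and T: "fg_module A T" and X: "lmod X"
    and g: "lin B X g" "g ` carrier B = carrier X"
    and N: "{x \<in> carrier B. g x = \<zero>\<^bsub>X\<^esub>} = N" and h: "lin (B \<restriction> N) T h"
  obtains E :: "'a umodule" and i j g' where "fg_module A E" "lin T E i" "lin B E j" "inj_on i (carrier T)"
    "\<forall>x\<in>N. j x = i (h x)" "lin E X g'" "g' ` carrier E = carrier X"
    "{e \<in> carrier E. g' e = \<zero>\<^bsub>X\<^esub>} = i ` carrier T"
proof -
  have lm: "lmod T" "lmod B" using T B by auto
  have sN: "subm N B" unfolding N[symmetric] by (rule subm_ker[OF g(1) lm(2) X])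
  obtain E :: "'a umodule" and i j where E: "fg_module A E" and i: "lin T E i" and j: "lin B E j"
    and inj: "inj_on i (carrier T)" and ji': "\<forall>x\<in>N. j x = i (h x)"
    and onto': "\<forall>e\<in>carrier E. \<exists>t\<in>carrier T. \<exists>b\<in>carrier B. e = i t \<oplus>\<^bsub>E\<^esub> j b"
    and kern': "\<forall>t\<in>carrier T. \<forall>b\<in>carrier B. i t \<oplus>\<^bsub>E\<^esub> j b = \<zero>\<^bsub>E\<^esub> \<longrightarrow> b \<in> N"
    by (rule pushout[OF B T sN h])
  note ji = bspec[OF ji'] and onto = bspec[OF onto'] and kern = kern'[rule_format]
  have lE: "lmod E" using E by simp
  let ?P = "prodm T B" and ?s = "\<lambda>x. i (fst x) \<oplus>\<^bsub>E\<^esub> j (snd x)"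
  have s: "lin ?P E ?s"
    by (rule lin_plus[OF lin_comp[OF _ i] lin_comp[OF _ j] lE]) (auto intro: linI)
  have sur: "?s ` carrier ?P = carrier E"
    using onto lin_closed[OF s] by (auto simp: image_iff)
  have gl: "lin ?P X (\<lambda>x. g (snd x))" by (rule lin_comp[OF _ g(1)]) (auto intro: linI)
  have kk: "g (snd x) = \<zero>\<^bsub>X\<^esub>" if "x \<in> carrier ?P" "?s x = \<zero>\<^bsub>E\<^esub>" for x
    using kern[of "fst x" "snd x"] that N by auto
  obtain g' where g': "lin E X g'" "\<And>x. x \<in> carrier ?P \<Longrightarrow> g' (?s x) = g (snd x)"
    using factor_thru[OF lmod_prodm[OF lm] X s sur gl kk lE] by blast
  have g'j: "g' (j b) = g b" if "b \<in> carrier B" for b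
    using g'(2)[of "(\<zero>\<^bsub>T\<^esub>, b)"] that lm lE lin_zero[OF i lm(1) lE] lin_closed[OF j that] by simp
  have j0: "j \<zero>\<^bsub>B\<^esub> = \<zero>\<^bsub>E\<^esub>" by (rule lin_zero[OF j lm(2) lE])
  have g'i: "g' (i t) = \<zero>\<^bsub>X\<^esub>" if "t \<in> carrier T" for t
    using g'(2)[of "(t, \<zero>\<^bsub>B\<^esub>)"] that lm lE j0 lin_closed[OF i that] lin_zero[OF g(1) lm(2) X] by simp
  have hc: "h b \<in> carrier T" if "b \<in> N" for b using lin_closed[OF h] that by simp
  have ker: "{e \<in> carrier E. g' e = \<zero>\<^bsub>X\<^esub>} = i ` carrier T"
  proof
    show "i ` carrier T \<subseteq> {e \<in> carrier E. g' e = \<zero>\<^bsub>X\<^esub>}" using g'i lin_closed[OF i] by auto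
    show "{e \<in> carrier E. g' e = \<zero>\<^bsub>X\<^esub>} \<subseteq> i ` carrier T"
    proof
      fix e assume e: "e \<in> {e \<in> carrier E. g' e = \<zero>\<^bsub>X\<^esub>}"
      then obtain t b where tb: "t \<in> carrier T" "b \<in> carrier B" "e = i t \<oplus>\<^bsub>E\<^esub> j b" using onto by blast
      have "g b = \<zero>\<^bsub>X\<^esub>" using g'(2)[of "(t, b)"] tb e by simp
      then have b: "b \<in> N" using N tb(2) by blast
      have "e = i (t \<oplus>\<^bsub>T\<^esub> h b)" using tb(3) ji[OF b] lin_add[OF i tb(1) hc[OF b]] by simp
      then show "e \<in> i ` carrier T" using tb(1) hc[OF b] lm(1) by simp
    qed
  qed
  have g's: "g' ` carrier E = carrier X"
  proof
    show "carrier X \<subseteq> g' ` carrier E"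
    proof
      fix x assume "x \<in> carrier X"
      then obtain b where b: "b \<in> carrier B" "x = g b" using g(2) by auto
      then have "x = g' (j b)" using g'j by simp
      then show "x \<in> g' ` carrier E" using lin_closed[OF j b(1)] by (rule image_eqI)
    qed
  qed (use lin_closed[OF g'(1)] in auto)
  show ?thesis by (rule that[OF E i j inj ji' g'(1) g's ker])
qed

end

context algebra_modules
begin

lemma twist_facts:
  assumes "\<And>j. j \<in> S \<Longrightarrow> A.lmod (M j)" "X \<in> twists R A S M"
  obtains j where "A.lmod X" "j \<in> S" "A.summand {M j} X"
proof -
  obtain j and U :: "'r umodule" where X: "X = tensor_module R A (M j) U" "j \<in> S" "fg_projective R U"
    using assms(2) by (auto simp: twists_def)
  note U = R.fg_projective_summand[OF X(3)]
  show ?thesis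
    using that[OF _ X(2)] lmod_tensor[OF assms(1)[OF X(2)] U(1)] summand_tensor[OF assms(1)[OF X(2)] U(1,3)] X(1) by blast
qed

text \<open>Twists are formed with modules \<open>U\<close> of one fixed type, so modules of homomorphisms are first replaced
  by isomorphic ones of that type.\<close>

lemma realize_Rproj:
  assumes H: "R.lmod H" "Rproj H"
  obtains U :: "'r umodule" and q where "fg_projective R U" "R.lin H U q" "bij_betw q (carrier H) (carrier U)"
proof -
  have "fg_module R H" by (rule R.fg_projective_summand(2)[OF R.fg_projectiveI[OF H]])
  then obtain U :: "'r umodule" and q where U: "fg_module R U" "R.lin H U q" "bij_betw q (carrier H) (carrier U)"
    using R.realize[of H] by blast
  have lU: "R.lmod U" using U(1) by simp
  obtain g where g: "R.lin U H g" "\<forall>x\<in>carrier H. g (q x) = x" "\<forall>y\<in>carrier U. q (g y) = y"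
    by (rule R.inverse_lin[OF H(1) lU U(2,3)])
  have "Rproj U" using R.summand_retract[OF H(2) g(1) U(2) _ H(1) lU] g(3) by blast
  then show ?thesis using that[OF R.fg_projectiveI[OF lU]] U by blast
qed

text \<open>A module is its own twist by a free module of rank one.\<close>

lemma twist_self:
  fixes D :: "('a, 'd) module"
  assumes D: "A.lmod D"
  obtains U :: "'r umodule" and g where "fg_projective R U" "A.lin D (tensor_module R A D U) g"
    "bij_betw g (carrier D) (carrier (tensor_module R A D U))"
proof -
  have "Rproj (regular_module R)" by (rule R.summand_self) auto
  then obtain U :: "'r umodule" and q where U: "fg_projective R U" "R.lin (regular_module R) U q"
    "bij_betw q (carrier (regular_module R)) (carrier U)"
    using realize_Rproj[OF R.lmod_regular] by metis
  have lU: "R.lmod U" using R.fg_projective_summand(1)[OF U(1)] .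
  obtain \<chi> where \<chi>: "R.lin U (regular_module R) \<chi>" "\<forall>x\<in>carrier (regular_module R). \<chi> (q x) = x" "\<forall>y\<in>carrier U. q (\<chi> y) = y"
    by (rule R.inverse_lin[OF R.lmod_regular lU U(2,3)])
  have "bij_betw \<chi> (carrier U) (carrier R)"
    by (rule bij_betw_byWitness[where f' = q])
      (use \<chi> R.lin_closed[OF U(2)] R.lin_closed[OF \<chi>(1)] in auto)
  then obtain \<beta> where \<beta>: "A.lin (tensor_module R A D U) D \<beta>" "bij_betw \<beta> (carrier (tensor_module R A D U)) (carrier D)"
    using tensor_unit[OF D lU \<chi>(1)] by metis
  obtain g where g: "A.lin D (tensor_module R A D U) g" "\<forall>x\<in>carrier (tensor_module R A D U). g (\<beta> x) = x"
    "\<forall>y\<in>carrier D. \<beta> (g y) = y"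
    by (rule A.inverse_lin[OF lmod_tensor[OF D lU] D \<beta>])
  have "bij_betw g (carrier D) (carrier (tensor_module R A D U))"
    by (rule bij_betw_byWitness[where f' = \<beta>])
      (use g A.lin_closed[OF \<beta>(1)] A.lin_closed[OF g(1)] in auto)
  then show ?thesis using that U(1) g(1) by blast
qed

lemma fchain_self_to_twists:
  assumes ch: "A.fchain (D ` S) M N0 N" and M: "A.lmod M" and N0: "A.subm N0 M"
    and D: "\<And>j. j \<in> S \<Longrightarrow> A.lmod (D j)"
  shows "A.fchain (twists R A S D) M N0 N"
proof (rule A.fchain_factors[OF ch M N0])
  fix X assume "X \<in> D ` S"
  then obtain j where j: "j \<in> S" "X = D j" by blast
  obtain U :: "'r umodule" and g where U: "fg_projective R U" "A.lin (D j) (tensor_module R A (D j) U) g"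
    "bij_betw g (carrier (D j)) (carrier (tensor_module R A (D j) U))" using twist_self[OF D[OF j(1)]] by metis
  have "tensor_module R A (D j) U \<in> twists R A S D" using U(1) j(1) by (auto simp: twists_def)
  moreover have "A.lmod (tensor_module R A (D j) U)"
    by (rule lmod_tensor[OF D[OF j(1)] R.fg_projective_summand(1)[OF U(1)]])
  ultimately show "A.lmod X \<and> (\<exists>Y\<in>twists R A S D. A.lmod Y \<and> (\<exists>f. A.lin X Y f \<and> bij_betw f (carrier X) (carrier Y)))"
    using U(2,3) D[OF j(1)] j(2) by blast
qed

end

section \<open>Standard modules\<close>

text \<open>The consequences of the axioms of a split quasi-hereditary algebra that the proof rests on, with
  standard modules \<open>D\<close>. The inclusion \<open>C(l) \<rightarrow> P(l)\<close> of the axioms is replaced by the kernel of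
  \<open>\<pi> l\<close>, and the condition on \<open>add\<close> by \<open>P_gen\<close>.\<close>

locale standard_modules = algebra_modules R A
  for R :: "('r, 'x) ring_scheme" and A :: "('r, 'a) module" +
  fixes \<Lambda> :: "'i::order set" and D :: "'i \<Rightarrow> ('a, 'd) module" and P :: "'i \<Rightarrow> 'a umodule"
    and \<pi> :: "'i \<Rightarrow> (nat \<Rightarrow> 'a) set \<Rightarrow> 'd"
  assumes finite_\<Lambda>: "finite \<Lambda>"
    and D_fg: "l \<in> \<Lambda> \<Longrightarrow> fg_module A (D l)"
    and D_proj: "l \<in> \<Lambda> \<Longrightarrow> Rproj (Rs (D l))"
    and D_hom: "\<lbrakk>l \<in> \<Lambda>; m \<in> \<Lambda>; A.lin (D l) (D m) f; \<not> l \<le> m; x \<in> carrier (D l)\<rbrakk> \<Longrightarrow> f x = \<zero>\<^bsub>D m\<^esub>"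
    and D_end: "\<lbrakk>l \<in> \<Lambda>; A.lin (D l) (D l) f\<rbrakk> \<Longrightarrow> \<exists>c\<in>carrier R. \<forall>x\<in>carrier (D l). f x = scal c \<odot>\<^bsub>D l\<^esub> x"
    and P_fg: "l \<in> \<Lambda> \<Longrightarrow> fg_module A (P l)"
    and P_proj: "l \<in> \<Lambda> \<Longrightarrow> A.summand {regular_module A} (P l)"
    and \<pi>_lin: "l \<in> \<Lambda> \<Longrightarrow> A.lin (P l) (D l) (\<pi> l)"
    and \<pi>_surj: "l \<in> \<Lambda> \<Longrightarrow> \<pi> l ` carrier (P l) = carrier (D l)"
    and ker_chain: "l \<in> \<Lambda> \<Longrightarrow> A.fchain (twists R A {m \<in> \<Lambda>. l < m} D) (P l) {\<zero>\<^bsub>P l\<^esub>}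
      {z \<in> carrier (P l). \<pi> l z = \<zero>\<^bsub>D l\<^esub>}"
    and P_gen: "A.summand (P ` \<Lambda>) (regular_module A)"
begin

definition K :: "'i \<Rightarrow> (nat \<Rightarrow> 'a) set set" where
  "K l = {z \<in> carrier (P l). \<pi> l z = \<zero>\<^bsub>D l\<^esub>}"

lemma D_lmod [simp]: "l \<in> \<Lambda> \<Longrightarrow> A.lmod (D l)"
  using D_fg by simp

lemma P_lmod [simp]: "l \<in> \<Lambda> \<Longrightarrow> A.lmod (P l)"
  using P_fg by simp

lemma K_subm [simp]: "l \<in> \<Lambda> \<Longrightarrow> A.subm (K l) (P l)"
  unfolding K_def by (rule A.subm_ker[OF \<pi>_lin]) auto

lemma K_carrier: "l \<in> \<Lambda> \<Longrightarrow> K l \<subseteq> carrier (P l)"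
  by (auto simp: K_def)

lemma twist_D:
  assumes "S \<subseteq> \<Lambda>" "X \<in> twists R A S D"
  obtains m where "A.lmod X" "m \<in> S" "m \<in> \<Lambda>" "A.summand {D m} X"
proof -
  obtain j where "A.lmod X" "j \<in> S" "A.summand {D j} X"
    by (rule twist_facts[OF _ assms(2)]) (use assms(1) in auto)
  then show ?thesis using that assms(1) by blast
qed

lemma K_chain: "l \<in> \<Lambda> \<Longrightarrow> A.fchain (twists R A {m \<in> \<Lambda>. l < m} D) (P l) {\<zero>\<^bsub>P l\<^esub>} (K l)"
  unfolding K_def by (rule ker_chain)

text \<open>The kernel has factors with weights above \<open>l\<close>, and \<open>D l\<close> is the factor on top.\<close>

lemma P_chain:
  assumes l: "l \<in> \<Lambda>" shows "A.fchain (twists R A {m \<in> \<Lambda>. l \<le> m} D) (P l) {\<zero>\<^bsub>P l\<^esub>} (carrier (P l))"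
proof -
  have "twists R A {m \<in> \<Lambda>. l < m} D \<subseteq> twists R A {m \<in> \<Lambda>. l \<le> m} D"
    unfolding twists_def by (blast intro: less_imp_le)
  then have 1: "A.fchain (twists R A {m \<in> \<Lambda>. l \<le> m} D) (P l) {\<zero>\<^bsub>P l\<^esub>} (K l)"
    by (rule A.fchain_mono[OF K_chain[OF l]])
  have "A.fchain (D ` {m \<in> \<Lambda>. l \<le> m}) (P l) (K l) (carrier (P l))"
    by (rule A.fchain.step[OF A.fchain.base, where X = "D l" and g = "\<pi> l"])
      (use l \<pi>_lin \<pi>_surj in \<open>auto simp: K_def\<close>)
  then have "A.fchain (twists R A {m \<in> \<Lambda>. l \<le> m} D) (P l) (K l) (carrier (P l))"
    by (rule fchain_self_to_twists) (use l in auto)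
  then show ?thesis using 1 by (rule A.fchain_trans)
qed

text \<open>A map that vanishes on one step factors through the next factor, which is a summand of copies of
  a standard module.\<close>

lemma chain_vanish:
  assumes S: "S \<subseteq> \<Lambda>" and ch: "A.fchain (twists R A S D) M N0 N" and M: "A.lmod M" and N0: "A.subm N0 M"
    and Y: "A.lmod Y" and 0: "\<And>m f x. \<lbrakk>m \<in> S; A.lin (D m) Y f; x \<in> carrier (D m)\<rbrakk> \<Longrightarrow> f x = \<zero>\<^bsub>Y\<^esub>"
    and f: "A.lin (M \<restriction> N) Y f" "\<And>x. x \<in> N0 \<Longrightarrow> f x = \<zero>\<^bsub>Y\<^esub>" and x: "x \<in> N"
  shows "f x = \<zero>\<^bsub>Y\<^esub>"
proof -
  have "\<forall>f. A.lin (M \<restriction> N) Y f \<longrightarrow> (\<forall>x\<in>N0. f x = \<zero>\<^bsub>Y\<^esub>) \<longrightarrow> (\<forall>x\<in>N. f x = \<zero>\<^bsub>Y\<^esub>)"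
    using ch
  proof induction
    case base then show ?case by simp
  next
    case (step N N' X g)
    obtain m where X: "A.lmod X" "m \<in> S" "m \<in> \<Lambda>" "A.summand {D m} X" by (rule twist_D[OF S step(3)])
    show ?case
    proof (intro allI impI)
      fix f assume f: "A.lin (M \<restriction> N') Y f" "\<forall>x\<in>N0. f x = \<zero>\<^bsub>Y\<^esub>"
      have NN: "N \<subseteq> N'" using step(6) by auto
      have "A.lin (M \<restriction> N) Y f" using A.lin_restr_dom[OF f(1), of N] NN by simp
      then have 1: "\<forall>x\<in>N. f x = \<zero>\<^bsub>Y\<^esub>" using step.IH f(2) by blast
      have kk: "f x = \<zero>\<^bsub>Y\<^esub>" if "x \<in> carrier (M \<restriction> N')" "g x = \<zero>\<^bsub>X\<^esub>" for x
        using that step(6) 1 by auto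
      have gs: "g ` carrier (M \<restriction> N') = carrier X" using step(5) by simp
      obtain h where h: "A.lin X Y h" "\<And>x. x \<in> carrier (M \<restriction> N') \<Longrightarrow> h (g x) = f x"
        using A.factor_thru[OF A.lmod_restr[OF M step(2)] Y step(4) gs f(1) kk X(1)] by blast
      have 2: "h y = \<zero>\<^bsub>Y\<^esub>" if "y \<in> carrier X" for y
        by (rule A.summand_vanish_from[OF X(4) h(1) X(1) Y _ that]) (use 0[OF X(2)] in auto)
      show "\<forall>x\<in>N'. f x = \<zero>\<^bsub>Y\<^esub>"
      proof
        fix x assume "x \<in> N'"
        then have x: "x \<in> carrier (M \<restriction> N')" by simp
        show "f x = \<zero>\<^bsub>Y\<^esub>" using h(2)[OF x] 2[OF A.lin_closed[OF step(4) x]] by simp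
      qed
    qed
  qed
  then show ?thesis using f x by blast
qed

lemma K_vanish:
  assumes l: "l \<in> \<Lambda>" and Y: "A.lmod Y" and 0: "\<And>m f x. \<lbrakk>m \<in> \<Lambda>; l < m; A.lin (D m) Y f; x \<in> carrier (D m)\<rbrakk> \<Longrightarrow> f x = \<zero>\<^bsub>Y\<^esub>"
    and f: "A.lin (P l \<restriction> K l) Y f" and x: "x \<in> K l"
  shows "f x = \<zero>\<^bsub>Y\<^esub>"
proof (rule chain_vanish[OF _ K_chain[OF l] P_lmod[OF l] _ Y _ f _ x])
  have "f \<zero>\<^bsub>P l \<restriction> K l\<^esub> = \<zero>\<^bsub>Y\<^esub>" by (rule A.lin_zero[OF f _ Y]) (use l in simp)
  then show "\<And>x. x \<in> {\<zero>\<^bsub>P l\<^esub>} \<Longrightarrow> f x = \<zero>\<^bsub>Y\<^esub>" by simp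
qed (use l 0 in auto)

lemma P_vanish:
  assumes l: "l \<in> \<Lambda>" and Y: "A.lmod Y" and 0: "\<And>m f x. \<lbrakk>m \<in> \<Lambda>; l \<le> m; A.lin (D m) Y f; x \<in> carrier (D m)\<rbrakk> \<Longrightarrow> f x = \<zero>\<^bsub>Y\<^esub>"
    and f: "A.lin (P l) Y f" and x: "x \<in> carrier (P l)"
  shows "f x = \<zero>\<^bsub>Y\<^esub>"
proof (rule chain_vanish[OF _ P_chain[OF l] P_lmod[OF l] _ Y _ _ _ x])
  show "\<And>x. x \<in> {\<zero>\<^bsub>P l\<^esub>} \<Longrightarrow> f x = \<zero>\<^bsub>Y\<^esub>" using A.lin_zero[OF f _ Y] l by simp
  show "A.lin (P l \<restriction> carrier (P l)) Y f" by (rule A.lin_restr_dom[OF f]) simp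
qed (use l 0 in auto)

lemma factor_\<pi>:
  assumes l: "l \<in> \<Lambda>" and Y: "A.lmod Y" and f: "A.lin (P l) Y f" and 0: "\<And>x. x \<in> K l \<Longrightarrow> f x = \<zero>\<^bsub>Y\<^esub>"
  obtains h where "A.lin (D l) Y h" "\<And>z. z \<in> carrier (P l) \<Longrightarrow> h (\<pi> l z) = f z"
proof -
  have kk: "f x = \<zero>\<^bsub>Y\<^esub>" if "x \<in> carrier (P l)" "\<pi> l x = \<zero>\<^bsub>D l\<^esub>" for x using 0 that by (simp add: K_def)
  show ?thesis
    using A.factor_thru[OF P_lmod[OF l] Y \<pi>_lin[OF l] \<pi>_surj[OF l] f kk D_lmod[OF l]] that by blast
qed

lemma P_lift:
  assumes l: "l \<in> \<Lambda>" and f: "A.lin (P l) Q f" and E: "A.lmod E" and Q: "A.lmod Q"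
    and g: "A.lin E Q g" "carrier Q \<subseteq> g ` carrier E"
  obtains h where "A.lin (P l) E h" "\<And>x. x \<in> carrier (P l) \<Longrightarrow> g (h x) = f x"
  using A.projective_lift[OF P_proj[OF l] f P_lmod[OF l] E Q g] by metis

subsection \<open>Vanishing of first extension groups\<close>

text \<open>This is \<open>Ext\<^sup>1(D l, X) = 0\<close>, computed from the projective presentation \<open>P l \<rightarrow> D l\<close>.\<close>

definition ext_vanishes :: "'i \<Rightarrow> ('a, 't) module \<Rightarrow> bool" where
  "ext_vanishes l X \<longleftrightarrow> (\<forall>h. A.lin (P l \<restriction> K l) X h \<longrightarrow> (\<exists>g. A.lin (P l) X g \<and> (\<forall>x\<in>K l. g x = h x)))"

lemma ext_vanishesE:
  assumes "ext_vanishes l X" "A.lin (P l \<restriction> K l) X h"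
  obtains g where "A.lin (P l) X g" "\<And>x. x \<in> K l \<Longrightarrow> g x = h x"
  using assms unfolding ext_vanishes_def by blast

text \<open>Exactness of \<open>Hom(D l, E) \<rightarrow> Hom(D l, Q) \<rightarrow> Ext\<^sup>1(D l, T)\<close>: lift to \<open>P l\<close> first, then subtract an
  extension of the lift on the kernel, so that the difference descends to \<open>D l\<close>.\<close>

lemma D_lift:
  assumes l: "l \<in> \<Lambda>" and ext: "ext_vanishes l T" and lm: "A.lmod T" "A.lmod E" "A.lmod Q"
    and i: "A.lin T E i" "inj_on i (carrier T)" and g: "A.lin E Q g" "g ` carrier E = carrier Q"
    and ker: "{e \<in> carrier E. g e = \<zero>\<^bsub>Q\<^esub>} = i ` carrier T" and w: "A.lin (D l) Q w"
  shows "\<exists>h. A.lin (D l) E h \<and> (\<forall>x\<in>carrier (D l). g (h x) = w x)"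
proof -
  obtain p where p: "A.lin (P l) E p" "\<And>z. z \<in> carrier (P l) \<Longrightarrow> g (p z) = w (\<pi> l z)"
    using P_lift[OF l A.lin_comp[OF \<pi>_lin[OF l] w] lm(2,3) g(1)] g(2) by auto
  have iT: "A.subm (i ` carrier T) E" by (rule A.subm_image[OF i(1) lm(1,2) A.subm_carrier[OF lm(1)]])
  have il: "A.lin T (E \<restriction> (i ` carrier T)) i" by (rule A.lin_to_restr[OF i(1)]) simp
  obtain i' where i': "A.lin (E \<restriction> (i ` carrier T)) T i'" "\<forall>x\<in>carrier T. i' (i x) = x"
     "\<forall>y\<in>carrier (E \<restriction> (i ` carrier T)). i (i' y) = y"
    by (rule A.inverse_lin[OF lm(1) A.lmod_restr[OF lm(2) iT] il]) (use i(2) in \<open>simp add: bij_betw_def\<close>)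
  have pK: "p z \<in> i ` carrier T" if "z \<in> K l" for z
    unfolding ker[symmetric] using that p(2)[of z] A.lin_closed[OF p(1)] A.lin_zero[OF w D_lmod[OF l] lm(3)] by (simp add: K_def)
  have "A.lin (P l \<restriction> K l) (E \<restriction> (i ` carrier T)) p"
    by (rule A.lin_to_restr[OF A.lin_restr_dom[OF p(1) K_carrier[OF l]]]) (use pK in auto)
  from ext_vanishesE[OF ext A.lin_comp[OF this i'(1)]]
  obtain q where q: "A.lin (P l) T q" "\<And>x. x \<in> K l \<Longrightarrow> q x = i' (p x)" by blast
  let ?d = "\<lambda>z. A.dif E (p z) (i (q z))"
  have d: "A.lin (P l) E ?d" by (rule A.lin_minus[OF p(1) A.lin_comp[OF q(1) i(1)] lm(2)])
  have "?d x = \<zero>\<^bsub>E\<^esub>" if "x \<in> K l" for x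
    using q(2)[OF that] bspec[OF i'(3), of "p x"] pK[OF that] lm(2) A.subm_carrierD[OF iT pK[OF that]] by simp
  then obtain h where h: "A.lin (D l) E h" "\<And>z. z \<in> carrier (P l) \<Longrightarrow> h (\<pi> l z) = ?d z"
    using factor_\<pi>[OF l lm(2) d] by blast
  have gi: "g (i t) = \<zero>\<^bsub>Q\<^esub>" if "t \<in> carrier T" for t using ker that by blast
  have "g (h x) = w x" if x: "x \<in> carrier (D l)" for x
  proof -
    obtain z where z: "z \<in> carrier (P l)" "x = \<pi> l z" using x \<pi>_surj[OF l] by auto
    have c: "p z \<in> carrier E" "q z \<in> carrier T" "i (q z) \<in> carrier E" "w x \<in> carrier Q"
      using A.lin_closed[OF p(1) z(1)] A.lin_closed[OF q(1) z(1)] A.lin_closed[OF i(1)] A.lin_closed[OF w x] by auto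
    have "g (h x) = A.dif Q (g (p z)) (g (i (q z)))" using h(2)[OF z(1)] z(2) A.lin_dif[OF g(1) lm(2) c(1,3)] by simp
    also have "\<dots> = w x" using p(2)[OF z(1)] gi[OF c(2)] z(2) c(4) lm(3) by simp
    finally show ?thesis .
  qed
  then show ?thesis using h(1) by blast
qed

text \<open>Pushing out along \<open>h\<close> gives an extension of \<open>X\<close> by \<open>T\<close>. It splits because \<open>X\<close> is a summand of copies
  of \<open>D m\<close>, and the retraction onto \<open>T\<close> extends \<open>h\<close>.\<close>

lemma ext_step:
  assumes m: "m \<in> \<Lambda>" and ext: "ext_vanishes m T" and T: "fg_module A T" and B: "fg_module A B"
    and X: "A.lmod X" "A.summand {D m} X" and g: "A.lin B X g" "g ` carrier B = carrier X"
    and N: "{x \<in> carrier B. g x = \<zero>\<^bsub>X\<^esub>} = N" and h: "A.lin (B \<restriction> N) T h"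
  obtains F where "A.lin B T F" "\<forall>x\<in>N. F x = h x"
proof -
  have lm: "A.lmod T" "A.lmod B" using T B by auto
  obtain E :: "'a umodule" and i j g' where E: "fg_module A E" and i: "A.lin T E i" and j: "A.lin B E j"
    and inj: "inj_on i (carrier T)" and ji: "\<forall>x\<in>N. j x = i (h x)" and g': "A.lin E X g'"
    and g's: "g' ` carrier E = carrier X" and ker: "{e \<in> carrier E. g' e = \<zero>\<^bsub>X\<^esub>} = i ` carrier T"
    by (rule A.pushout_extension[OF B T X(1) g N h])
  have lE: "A.lmod E" using E by simp
  have hc: "h b \<in> carrier T" if "b \<in> N" for b using A.lin_closed[OF h] N that by auto
  have lift: "\<exists>k. A.lin M E k \<and> (\<forall>x\<in>carrier M. g' (k x) = w x)" if "M \<in> {D m}" "A.lin M X w" for M w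
    using D_lift[OF m ext lm(1) lE X(1) i inj g' g's ker] that by auto
  obtain s where s: "A.lin X E s" "\<And>x. x \<in> carrier X \<Longrightarrow> g' (s x) = x"
    using A.summand_lift[OF X(2) A.lin_id X(1) lE X(1) g' lift] by blast
  obtain k where k: "A.lin E T k" "\<forall>x\<in>carrier T. k (i x) = x" "\<forall>x\<in>carrier E. s (g' x) \<oplus>\<^bsub>E\<^esub> i (k x) = x"
    by (rule A.complementary_projection[OF lm(1) lE X(1) i inj g' ker s])
  have "k (j x) = h x" if "x \<in> N" for x using bspec[OF ji that] bspec[OF k(2) hc[OF that]] by simp
  then show ?thesis using that[OF A.lin_comp[OF j k(1)]] by blast
qed

text \<open>Maps from the generators \<open>P l\<close> into \<open>Y\<close> lift to \<open>X\<close>, by induction along the standard filtration of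
  \<open>P l\<close>: extend the lift from one step to the next by \<open>ext_step\<close>, and correct the error, which factors
  through a summand of copies of a standard module, by a lift from there.\<close>

lemma surj_from_standard:
  assumes X: "fg_module A X" and Y: "A.lmod Y" and \<phi>: "A.lin X Y \<phi>"
    and ext: "\<And>m. m \<in> \<Lambda> \<Longrightarrow> ext_vanishes m X"
    and lift: "\<And>m f. \<lbrakk>m \<in> \<Lambda>; A.lin (D m) Y f\<rbrakk> \<Longrightarrow> \<exists>h. A.lin (D m) X h \<and> (\<forall>x\<in>carrier (D m). \<phi> (h x) = f x)"
  shows "\<phi> ` carrier X = carrier Y"
proof (rule A.generated_by[OF P_gen Y])
  have lX: "A.lmod X" using X by simp
  show "A.subm (\<phi> ` carrier X) Y" by (rule A.subm_image[OF \<phi> lX Y A.subm_carrier[OF lX]])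
  fix M f x assume M: "M \<in> P ` \<Lambda>" "A.lin M Y f" "x \<in> carrier M"
  then obtain l where l: "l \<in> \<Lambda>" and Ml: "M = P l" by blast
  have "\<forall>f. A.lin (P l \<restriction> N) Y f \<longrightarrow> (\<exists>h. A.lin (P l \<restriction> N) X h \<and> (\<forall>x\<in>N. \<phi> (h x) = f x))"
    if "A.fchain (twists R A {m \<in> \<Lambda>. l \<le> m} D) (P l) {\<zero>\<^bsub>P l\<^esub>} N" for N
    using that
  proof induction
    case base
    show ?case
    proof (intro allI impI)
      fix f assume f: "A.lin (P l \<restriction> {\<zero>\<^bsub>P l\<^esub>}) Y f"
      have "f \<zero>\<^bsub>P l \<restriction> {\<zero>\<^bsub>P l\<^esub>}\<^esub> = \<zero>\<^bsub>Y\<^esub>" by (rule A.lin_zero[OF f _ Y]) (use l in simp)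
      then show "\<exists>h. A.lin (P l \<restriction> {\<zero>\<^bsub>P l\<^esub>}) X h \<and> (\<forall>x\<in>{\<zero>\<^bsub>P l\<^esub>}. \<phi> (h x) = f x)"
        using A.lin_const_zero[OF lX] A.lin_zero[OF \<phi> lX Y] by (intro exI[of _ "\<lambda>x. \<zero>\<^bsub>X\<^esub>"]) auto
    qed
  next
    case (step N N' L g)
    obtain m where L: "A.lmod L" "m \<in> {m \<in> \<Lambda>. l \<le> m}" "m \<in> \<Lambda>" "A.summand {D m} L"
      by (rule twist_D[OF _ step(3)]) auto
    show ?case
    proof (intro allI impI)
      fix f assume f: "A.lin (P l \<restriction> N') Y f"
      have NN: "N \<subseteq> N'" using step(6) by auto
      have B: "fg_module A (P l \<restriction> N')" by (rule fg_restr[OF P_fg[OF l] step(2)])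
      have "A.lin (P l \<restriction> N) Y f" using A.lin_restr_dom[OF f, of N] NN by simp
      then obtain h where h: "A.lin (P l \<restriction> N) X h" "\<forall>x\<in>N. \<phi> (h x) = f x" using step.IH by blast
      have g: "g ` carrier (P l \<restriction> N') = carrier L" "{x \<in> carrier (P l \<restriction> N'). g x = \<zero>\<^bsub>L\<^esub>} = N"
        using step(5,6) by auto
      obtain F where F: "A.lin (P l \<restriction> N') X F" "\<forall>x\<in>N. F x = h x"
        by (rule ext_step[OF L(3) ext[OF L(3)] X B L(1,4) step(4) g, of h]) (use h(1) in auto)
      \<comment> \<open>The error of the extended lift.\<close>
      let ?d = "\<lambda>x. A.dif Y (f x) (\<phi> (F x))"
      have d: "A.lin (P l \<restriction> N') Y ?d" by (rule A.lin_minus[OF f A.lin_comp[OF F(1) \<phi>] Y])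
      have kk: "?d x = \<zero>\<^bsub>Y\<^esub>" if "x \<in> carrier (P l \<restriction> N')" "g x = \<zero>\<^bsub>L\<^esub>" for x
      proof -
        have "x \<in> N" using that g(2) by blast
        then show ?thesis using F(2) h(2) Y A.lin_closed[OF f that(1)] by simp
      qed
      obtain k where k: "A.lin L Y k" "\<And>x. x \<in> carrier (P l \<restriction> N') \<Longrightarrow> k (g x) = ?d x"
        using A.factor_thru[OF A.fg_lmod[OF B] Y step(4) g(1) d kk L(1)] by blast
      have lift': "\<exists>h. A.lin M X h \<and> (\<forall>x\<in>carrier M. \<phi> (h x) = w x)" if "M \<in> {D m}" "A.lin M Y w" for M w
        using lift[OF L(3)] that by auto
      obtain k' where k': "A.lin L X k'" "\<And>x. x \<in> carrier L \<Longrightarrow> \<phi> (k' x) = k x"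
        using A.summand_lift[OF L(4) k(1) L(1) lX Y \<phi> lift'] by blast
      have "\<phi> (F x \<oplus>\<^bsub>X\<^esub> k' (g x)) = f x" if x: "x \<in> N'" for x
      proof -
        have x': "x \<in> carrier (P l \<restriction> N')" using x by simp
        have c: "F x \<in> carrier X" "g x \<in> carrier L" "k' (g x) \<in> carrier X" "f x \<in> carrier Y" "\<phi> (F x) \<in> carrier Y"
          using A.lin_closed[OF F(1) x'] A.lin_closed[OF step(4) x'] A.lin_closed[OF k'(1)] A.lin_closed[OF f x']
            A.lin_closed[OF \<phi>] by auto
        show ?thesis using A.lin_add[OF \<phi> c(1,3)] k'(2)[OF c(2)] k(2)[OF x'] c Y by simp
      qed
      then show "\<exists>h. A.lin (P l \<restriction> N') X h \<and> (\<forall>x\<in>N'. \<phi> (h x) = f x)"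
        using A.lin_plus[OF F(1) A.lin_comp[OF step(4) k'(1)] lX] by blast
    qed
  qed
  from this[OF P_chain[OF l]] M(2) Ml
  obtain h where "A.lin (P l) X h" "\<forall>x\<in>carrier (P l). \<phi> (h x) = f x" by auto
  then show "f x \<in> \<phi> ` carrier X" using M(3) Ml A.lin_closed by (metis image_eqI)
qed

text \<open>Exactness of \<open>Hom(D m, X) \<rightarrow> Hom(D m, Y) \<rightarrow> Ext\<^sup>1(D m, ker \<phi>) \<rightarrow> Ext\<^sup>1(D m, X)\<close>.\<close>

lemma ext_vanishes_kernel:
  assumes m: "m \<in> \<Lambda>" and ext: "ext_vanishes m X" and X: "A.lmod X" and Y: "A.lmod Y" and \<phi>: "A.lin X Y \<phi>"
    and lift: "\<And>f. A.lin (D m) Y f \<Longrightarrow> \<exists>h. A.lin (D m) X h \<and> (\<forall>x\<in>carrier (D m). \<phi> (h x) = f x)"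
  shows "ext_vanishes m (X \<restriction> {x \<in> carrier X. \<phi> x = \<zero>\<^bsub>Y\<^esub>})"
  unfolding ext_vanishes_def
proof (intro allI impI)
  let ?Z = "{x \<in> carrier X. \<phi> x = \<zero>\<^bsub>Y\<^esub>}"
  fix h assume h: "A.lin (P m \<restriction> K m) (X \<restriction> ?Z) h"
  have "A.lin (P m \<restriction> K m) X h" by (rule A.lin_restr_cod[OF h]) auto
  from ext_vanishesE[OF ext this] obtain q where q: "A.lin (P m) X q" "\<And>x. x \<in> K m \<Longrightarrow> q x = h x" by blast
  have hz: "\<phi> (h x) = \<zero>\<^bsub>Y\<^esub>" if "x \<in> K m" for x using A.lin_closed[OF h] that by simp
  have z: "\<phi> (q x) = \<zero>\<^bsub>Y\<^esub>" if "x \<in> K m" for x using q(2)[OF that] hz[OF that] by simp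
  obtain w where w: "A.lin (D m) Y w" "\<And>x. x \<in> carrier (P m) \<Longrightarrow> w (\<pi> m x) = \<phi> (q x)"
    using factor_\<pi>[OF m Y A.lin_comp[OF q(1) \<phi>] z] by blast
  obtain k where k: "A.lin (D m) X k" "\<forall>x\<in>carrier (D m). \<phi> (k x) = w x" using lift[OF w(1)] by blast
  let ?g = "\<lambda>x. A.dif X (q x) (k (\<pi> m x))"
  have g: "A.lin (P m) X ?g" by (rule A.lin_minus[OF q(1) A.lin_comp[OF \<pi>_lin[OF m] k(1)] X])
  have c: "q x \<in> carrier X" "\<pi> m x \<in> carrier (D m)" "k (\<pi> m x) \<in> carrier X" if "x \<in> carrier (P m)" for x
    using A.lin_closed[OF q(1) that] A.lin_closed[OF \<pi>_lin[OF m] that] A.lin_closed[OF k(1)] by auto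
  have "?g x \<in> ?Z" if x: "x \<in> carrier (P m)" for x
    using A.lin_dif[OF \<phi> X c(1)[OF x] c(3)[OF x]] k(2) c(2)[OF x] w(2)[OF x] Y A.lin_closed[OF \<phi> c(1)[OF x]] A.lin_closed[OF g x] by simp
  then have "A.lin (P m) (X \<restriction> ?Z) ?g" by (rule A.lin_to_restr[OF g])
  moreover have "?g x = h x" if "x \<in> K m" for x
  proof -
    have x: "x \<in> carrier (P m)" "\<pi> m x = \<zero>\<^bsub>D m\<^esub>" using that by (auto simp: K_def)
    then have "?g x = q x" using A.lin_zero[OF k(1) D_lmod[OF m] X] c(1) X by simp
    then show ?thesis using q(2)[OF that] by simp
  qed
  ultimately show "\<exists>g. A.lin (P m) (X \<restriction> ?Z) g \<and> (\<forall>x\<in>K m. g x = h x)" by blast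
qed

end

section \<open>Universal extensions\<close>

context standard_modules
begin

text \<open>The map \<open>i\<close> embeds \<open>M\<close> in a finitely generated module with a cokernel filtered by the standard modules
  with weights in \<open>S\<close>, untwisted.\<close>

definition grows :: "'i set \<Rightarrow> ('a, 'm) module \<Rightarrow> ('m \<Rightarrow> (nat \<Rightarrow> 'a) set) \<Rightarrow> 'a umodule \<Rightarrow> bool" where
  "grows S M i T \<longleftrightarrow> fg_module A T \<and> A.lin M T i \<and> inj_on i (carrier M) \<and>
     A.fchain (D ` S) T (i ` carrier M) (carrier T)"

lemma grows_trans:
  assumes S: "S \<subseteq> \<Lambda>" "S' \<subseteq> \<Lambda>" and M: "A.lmod M" and 1: "grows S M i T" and 2: "grows S' T j T'"
  shows "grows (S \<union> S') M (\<lambda>x. j (i x)) T'"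
proof -
  have T: "A.lmod T" "A.lmod T'" "A.lin M T i" "inj_on i (carrier M)" "A.fchain (D ` S) T (i ` carrier M) (carrier T)"
    "fg_module A T'" "A.lin T T' j" "inj_on j (carrier T)" "A.fchain (D ` S') T' (j ` carrier T) (carrier T')"
    using 1 2 by (auto simp: grows_def)
  have im: "i ` carrier M \<subseteq> carrier T" using A.lin_closed[OF T(3)] by blast
  have sM: "A.subm (i ` carrier M) T" by (rule A.subm_image[OF T(3) M T(1) A.subm_carrier[OF M]])
  have ker: "{x \<in> carrier T. j x = \<zero>\<^bsub>T'\<^esub>} \<subseteq> i ` carrier M"
    using A.lin_inj_iff[OF T(7,1,2)] T(8) A.subm_zero[OF sM] by auto
  have D': "A.lmod X" if "X \<in> D ` S" for X using that S by auto
  have "A.fchain (D ` S) T' (j ` i ` carrier M) (j ` carrier T)"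
    by (rule A.fchain_map[OF T(5,1,2) sM T(7) ker D'])
  then have c1: "A.fchain (D ` (S \<union> S')) T' (j ` i ` carrier M) (j ` carrier T)"
    by (rule A.fchain_mono) auto
  have c2: "A.fchain (D ` (S \<union> S')) T' (j ` carrier T) (carrier T')"
    by (rule A.fchain_mono[OF T(9)]) auto
  have "inj_on (\<lambda>x. j (i x)) (carrier M)"
  proof (rule inj_onI)
    fix x y assume xy: "x \<in> carrier M" "y \<in> carrier M" "j (i x) = j (i y)"
    then have "i x = i y" using im by (intro inj_onD[OF T(8) xy(3)]) auto
    then show "x = y" using inj_onD[OF T(4)] xy by blast
  qed
  then show ?thesis
    using A.fchain_trans[OF c2 c1] A.lin_comp[OF T(3,7)] T(6) by (simp add: grows_def image_image)
qed

lemma grows_refl: "fg_module A T \<Longrightarrow> grows S T (\<lambda>x. x) T"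
  by (simp add: grows_def A.lin_id A.fchain.base)

text \<open>A map from \<open>Z\<close> into a filtered module goes down one step whenever \<open>Hom(Z, _)\<close> vanishes on the
  factor.\<close>

lemma lands_in_bottom:
  assumes ch: "A.fchain (D ` S) T N0 N" and f: "A.lin Z T f"
    and 0: "\<And>m g z. \<lbrakk>m \<in> S; A.lin Z (D m) g; z \<in> carrier Z\<rbrakk> \<Longrightarrow> g z = \<zero>\<^bsub>D m\<^esub>"
    and im: "\<And>z. z \<in> carrier Z \<Longrightarrow> f z \<in> N"
  shows "\<forall>z\<in>carrier Z. f z \<in> N0"
  using ch im
proof induction
  case base then show ?case by blast
next
  case (step N N' X g)
  obtain m where m: "m \<in> S" "X = D m" using step(3) by blast
  have fN: "A.lin Z (T \<restriction> N') f" by (rule A.lin_to_restr[OF f]) (use step.prems in auto)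
  have "g (f z) = \<zero>\<^bsub>D m\<^esub>" if "z \<in> carrier Z" for z
    by (rule 0[OF m(1) _ that]) (use A.lin_comp[OF fN step(4)] m(2) in simp)
  then have "f z \<in> N" if "z \<in> carrier Z" for z
    using step(6) step.prems that m(2) by blast
  then show ?case by (rule step.IH)
qed

text \<open>If the kernel of \<open>P m \<rightarrow> D m\<close> has no maps to the new factors, all its maps into \<open>T\<close> come from \<open>M\<close>, so
  only these must be extended.\<close>

lemma ext_vanishes_grow:
  assumes m: "m \<in> \<Lambda>" and S: "S \<subseteq> \<Lambda>" and M: "A.lmod M" and gr: "grows S M i T"
    and 0: "\<And>s g z. \<lbrakk>s \<in> S; A.lin (P m \<restriction> K m) (D s) g; z \<in> K m\<rbrakk> \<Longrightarrow> g z = \<zero>\<^bsub>D s\<^esub>"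
    and ext: "\<And>h. A.lin (P m \<restriction> K m) M h \<Longrightarrow> \<exists>g. A.lin (P m) T g \<and> (\<forall>x\<in>K m. g x = i (h x))"
  shows "ext_vanishes m T"
  unfolding ext_vanishes_def
proof (intro allI impI)
  fix k assume k: "A.lin (P m \<restriction> K m) T k"
  have T: "A.lmod T" "A.lin M T i" "inj_on i (carrier M)" "A.fchain (D ` S) T (i ` carrier M) (carrier T)"
    using gr by (auto simp: grows_def)
  have sM: "A.subm (i ` carrier M) T" by (rule A.subm_image[OF T(2) M T(1) A.subm_carrier[OF M]])
  have land: "k z \<in> i ` carrier M" if "z \<in> K m" for z
    using lands_in_bottom[OF T(4) k] 0 A.lin_closed[OF k] that by simp
  have il: "A.lin M (T \<restriction> (i ` carrier M)) i" by (rule A.lin_to_restr[OF T(2)]) simp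
  obtain i' where i': "A.lin (T \<restriction> (i ` carrier M)) M i'" "\<forall>x\<in>carrier M. i' (i x) = x"
     "\<forall>y\<in>carrier (T \<restriction> (i ` carrier M)). i (i' y) = y"
    by (rule A.inverse_lin[OF M A.lmod_restr[OF T(1) sM] il]) (use T(3) in \<open>simp add: bij_betw_def\<close>)
  have "A.lin (P m \<restriction> K m) (T \<restriction> (i ` carrier M)) k" by (rule A.lin_to_restr[OF k]) (use land in auto)
  from ext[OF A.lin_comp[OF this i'(1)]]
  obtain g where g: "A.lin (P m) T g" "\<forall>x\<in>K m. g x = i (i' (k x))" by blast
  have "g x = k x" if "x \<in> K m" for x
    using bspec[OF g(2) that] bspec[OF i'(3), of "k x"] land[OF that] by simp
  then show "\<exists>g. A.lin (P m) T g \<and> (\<forall>x\<in>K m. g x = k x)" using g(1) by blast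
qed

lemma extend_one:
  fixes T :: "'a umodule"
  assumes l: "l \<in> \<Lambda>" and T: "fg_module A T" and h: "A.lin (P l \<restriction> K l) T h"
  obtains T' i g where "grows {l} T i T'" "A.lin (P l) T' g" "\<forall>x\<in>K l. g x = i (h x)"
proof -
  have K: "{x \<in> carrier (P l). \<pi> l x = \<zero>\<^bsub>D l\<^esub>} = K l" by (simp add: K_def)
  obtain E :: "'a umodule" and i j g' where E: "fg_module A E" "A.lin T E i" "A.lin (P l) E j"
    "inj_on i (carrier T)" "\<forall>x\<in>K l. j x = i (h x)" "A.lin E (D l) g'" "g' ` carrier E = carrier (D l)"
    "{e \<in> carrier E. g' e = \<zero>\<^bsub>D l\<^esub>} = i ` carrier T"
    by (rule A.pushout_extension[OF P_fg[OF l] T D_lmod[OF l] \<pi>_lin[OF l] \<pi>_surj[OF l] K h])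
  have lE: "A.lmod E" using E(1) by simp
  have "A.fchain (D ` {l}) E (i ` carrier T) (carrier E)"
    by (rule A.fchain.step[OF A.fchain.base A.subm_carrier[OF lE], where X = "D l" and g = g'])
      (use E(6,7,8) in auto)
  then have "grows {l} T i E" using E by (simp add: grows_def)
  then show ?thesis using that E(3,5) by blast
qed

lemma extend_finite:
  fixes T :: "'a umodule"
  assumes l: "l \<in> \<Lambda>" and T: "fg_module A T" and H: "finite H" "\<And>h. h \<in> H \<Longrightarrow> A.lin (P l \<restriction> K l) T h"
  shows "\<exists>T' i. grows {l} T i T' \<and> (\<forall>h\<in>H. \<exists>g. A.lin (P l) T' g \<and> (\<forall>x\<in>K l. g x = i (h x)))"
  using H
proof (induction H)
  case empty then show ?case using grows_refl[OF T] by blast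
next
  case (insert h H)
  have h: "A.lin (P l \<restriction> K l) T h" using insert.prems by blast
  obtain T1 i where 1: "grows {l} T i T1" "\<forall>h\<in>H. \<exists>g. A.lin (P l) T1 g \<and> (\<forall>x\<in>K l. g x = i (h x))"
    using insert by blast
  have T1: "fg_module A T1" "A.lin T T1 i" using 1(1) by (auto simp: grows_def)
  obtain T2 j g where 2: "grows {l} T1 j T2" "A.lin (P l) T2 g" "\<forall>x\<in>K l. g x = j (i (h x))"
    by (rule extend_one[OF l T1(1) A.lin_comp[OF h T1(2)]])
  have jl: "A.lin T1 T2 j" using 2(1) by (simp add: grows_def)
  have "grows ({l} \<union> {l}) T (\<lambda>x. j (i x)) T2"
    by (rule grows_trans[OF _ _ A.fg_lmod[OF T] 1(1) 2(1)]) (use l in auto)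
  moreover have "\<exists>g. A.lin (P l) T2 g \<and> (\<forall>x\<in>K l. g x = j (i (h' x)))" if h': "h' \<in> H" for h'
  proof -
    obtain g' where g': "A.lin (P l) T1 g'" "\<forall>x\<in>K l. g' x = i (h' x)" using 1(2) h' by blast
    show ?thesis using A.lin_comp[OF g'(1) jl] g'(2) by (intro exI[of _ "\<lambda>x. j (g' x)"]) simp
  qed
  ultimately show ?case using 2(2,3) by (intro exI[of _ T2] exI[of _ "\<lambda>x. j (i x)"]) auto
qed

text \<open>The maps that become extendable form an \<open>R\<close>-submodule of the homomorphisms, which are finitely
  generated over \<open>R\<close>; so it is enough to treat generators.\<close>

lemma extend_all:
  fixes T :: "'a umodule"
  assumes l: "l \<in> \<Lambda>" and T: "fg_module A T"
  obtains T' i where "grows {l} T i T'" "\<forall>h. A.lin (P l \<restriction> K l) T h \<longrightarrow> (\<exists>g. A.lin (P l) T' g \<and> (\<forall>x\<in>K l. g x = i (h x)))"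
proof -
  have lT: "A.lmod T" using T by simp
  let ?B = "P l \<restriction> K l"
  have B: "fg_module A ?B" "A.lmod ?B" using fg_restr[OF P_fg[OF l] K_subm[OF l]] by auto
  let ?H = "hom_module A ?B T"
  note H = lmod_hom_module[OF B(2) lT]
  obtain S where S: "S \<subseteq> carrier ?H" "finite S" "\<forall>N. R.subm N ?H \<longrightarrow> S \<subseteq> N \<longrightarrow> N = carrier ?H"
    by (rule R.fgE[OF R.noeth_fg[OF noeth_hom_module[OF B(1) T]]])
  have "\<exists>T' i. grows {l} T i T' \<and> (\<forall>h\<in>S. \<exists>g. A.lin (P l) T' g \<and> (\<forall>x\<in>K l. g x = i (h x)))"
    by (rule extend_finite[OF l T S(2)]) (use S(1) in \<open>auto simp: A.mod_hom_iff\<close>)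
  then obtain T' i where T': "grows {l} T i T'" "\<forall>h\<in>S. \<exists>g. A.lin (P l) T' g \<and> (\<forall>x\<in>K l. g x = i (h x))" by blast
  have lT': "A.lmod T'" and i: "A.lin T T' i" using T'(1) by (auto simp: grows_def)
  define Z where "Z = {h \<in> carrier ?H. \<exists>g. A.lin (P l) T' g \<and> (\<forall>x\<in>K l. g x = i (h x))}"
  have "R.subm Z ?H"
  proof (rule R.submI[OF H])
    show "\<zero>\<^bsub>?H\<^esub> \<in> Z"
      using R.lm_zero[OF H] A.lin_const_zero[OF lT', of "P l"] A.lin_zero[OF i lT lT'] by (auto simp: Z_def)
    show "h \<oplus>\<^bsub>?H\<^esub> h' \<in> Z" if h: "h \<in> Z" "h' \<in> Z" for h h'
    proof -
      obtain g g' where g: "A.lin (P l) T' g" "\<forall>x\<in>K l. g x = i (h x)" "A.lin (P l) T' g'" "\<forall>x\<in>K l. g' x = i (h' x)"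
        using h by (auto simp: Z_def)
      have "h x \<in> carrier T" "h' x \<in> carrier T" if "x \<in> K l" for x
        using h that by (auto simp: Z_def A.mod_hom_iff dest: A.lin_closed)
      then have "\<forall>x\<in>K l. g x \<oplus>\<^bsub>T'\<^esub> g' x = i ((h \<oplus>\<^bsub>?H\<^esub> h') x)" using g by (simp add: A.lin_add[OF i])
      moreover have "h \<oplus>\<^bsub>?H\<^esub> h' \<in> carrier ?H" using h R.lm_add[OF H, of h h'] unfolding Z_def by blast
      ultimately show ?thesis unfolding Z_def using A.lin_plus[OF g(1,3) lT'] by blast
    qed
    show "r \<odot>\<^bsub>?H\<^esub> h \<in> Z" if r: "r \<in> carrier R" and h: "h \<in> Z" for r h
    proof -
      obtain g where g: "A.lin (P l) T' g" "\<forall>x\<in>K l. g x = i (h x)" using h by (auto simp: Z_def)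
      have "h x \<in> carrier T" if "x \<in> K l" for x
        using h that by (auto simp: Z_def A.mod_hom_iff dest: A.lin_closed)
      then have "\<forall>x\<in>K l. scal r \<odot>\<^bsub>T'\<^esub> g x = i ((r \<odot>\<^bsub>?H\<^esub> h) x)" using g r by (simp add: A.lin_smult[OF i])
      moreover have "r \<odot>\<^bsub>?H\<^esub> h \<in> carrier ?H" using h R.lm_smult[OF H r, of h] unfolding Z_def by blast
      ultimately show ?thesis unfolding Z_def using lin_scal[OF g(1) lT' r] by blast
    qed
  qed (auto simp: Z_def)
  moreover have "S \<subseteq> Z" using S(1) T'(2) unfolding Z_def by blast
  ultimately have Z: "Z = carrier ?H" using S(3) by blast
  have "\<exists>g. A.lin (P l) T' g \<and> (\<forall>x\<in>K l. g x = i (h x))" if h: "A.lin ?B T h" for h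
  proof -
    have "restrict h (K l) \<in> Z" unfolding Z using A.restrict_mod_hom[OF B(2) h] by simp
    then show ?thesis by (auto simp: Z_def)
  qed
  then show ?thesis using that T'(1) by blast
qed

lemma K_to_D_vanish:
  assumes "m \<in> \<Lambda>" "l \<in> \<Lambda>" "\<not> m < l" "A.lin (P m \<restriction> K m) (D l) g" "z \<in> K m"
  shows "g z = \<zero>\<^bsub>D l\<^esub>"
proof (rule K_vanish[OF assms(1) D_lmod[OF assms(2)] _ assms(4,5)])
  fix n f x assume n: "n \<in> \<Lambda>" "m < n" "A.lin (D n) (D l) f" "x \<in> carrier (D n)"
  have "\<not> n \<le> l" using n(2) assms(3) by auto
  then show "f x = \<zero>\<^bsub>D l\<^esub>" using D_hom n assms(2) by blast
qed

text \<open>A minimal weight \<open>l\<close> is treated last. The factors \<open>D l\<close> added then receive no maps from the kernels of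
  \<open>P m \<rightarrow> D m\<close> with \<open>m\<close> in \<open>Q\<close>, as \<open>m < l\<close> is excluded, so the extensions killed before stay killed.\<close>

lemma universal_extension:
  fixes T :: "'a umodule"
  assumes "Q \<subseteq> \<Lambda>" "fg_module A T"
  shows "\<exists>T' i. grows Q T i T' \<and> (\<forall>m\<in>Q. ext_vanishes m T')"
  using finite_subset[OF assms(1) finite_\<Lambda>] assms(1)
proof (induction "card Q" arbitrary: Q)
  case 0
  then show ?case using grows_refl[OF assms(2)] by auto
next
  case (Suc n)
  then have "Q \<noteq> {}" by auto
  then obtain l where l: "l \<in> Q" "\<And>m. m \<in> Q \<Longrightarrow> \<not> m < l"
    using finite_has_minimal[OF Suc.prems(1)] by (metis order.strict_iff_order)
  have Q: "Q - {l} \<subseteq> \<Lambda>" "l \<in> \<Lambda>" "insert l (Q - {l}) = Q" using Suc.prems l by auto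
  have "\<exists>T' i. grows (Q - {l}) T i T' \<and> (\<forall>m\<in>Q - {l}. ext_vanishes m T')"
    by (rule Suc.hyps(1)) (use Suc l in auto)
  then obtain T1 i where 1: "grows (Q - {l}) T i T1" "\<forall>m\<in>Q - {l}. ext_vanishes m T1" by blast
  have T1: "fg_module A T1" "A.lmod T1" using 1(1) by (auto simp: grows_def)
  obtain T2 j where 2: "grows {l} T1 j T2"
    "\<forall>h. A.lin (P l \<restriction> K l) T1 h \<longrightarrow> (\<exists>g. A.lin (P l) T2 g \<and> (\<forall>x\<in>K l. g x = j (h x)))"
    by (rule extend_all[OF Q(2) T1(1)])
  have jl: "A.lin T1 T2 j" using 2(1) by (simp add: grows_def)
  have "grows (Q - {l} \<union> {l}) T (\<lambda>x. j (i x)) T2"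
    by (rule grows_trans[OF Q(1) _ A.fg_lmod[OF assms(2)] 1(1) 2(1)]) (use Q in auto)
  then have "grows Q T (\<lambda>x. j (i x)) T2" using Q(3) by simp
  moreover have "ext_vanishes m T2" if m: "m \<in> Q" for m
  proof (rule ext_vanishes_grow[OF _ _ T1(2) 2(1)])
    show "m \<in> \<Lambda>" using m Suc.prems by auto
    show "{l} \<subseteq> \<Lambda>" using Q by simp
    show "g z = \<zero>\<^bsub>D s\<^esub>" if "s \<in> {l}" "A.lin (P m \<restriction> K m) (D s) g" "z \<in> K m" for s g z
      using K_to_D_vanish[of m l g z] that m l(2) Q(2) Suc.prems by auto
    show "\<exists>g. A.lin (P m) T2 g \<and> (\<forall>x\<in>K m. g x = j (h x))" if h: "A.lin (P m \<restriction> K m) T1 h" for h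
    proof (cases "m = l")
      case True then show ?thesis using 2(2) h by blast
    next
      case False
      then have "ext_vanishes m T1" using 1(2) m by blast
      from ext_vanishesE[OF this h] obtain g where g: "A.lin (P m) T1 g" "\<And>x. x \<in> K m \<Longrightarrow> g x = h x" by blast
      show ?thesis using A.lin_comp[OF g(1) jl] g(2) by (intro exI[of _ "\<lambda>x. j (g x)"]) simp
    qed
  qed
  ultimately show ?case by blast
qed

end

section \<open>Projectivity over the base ring\<close>

context ring_modules
begin

text \<open>An extension of projective modules is a direct sum of them, because the sequence splits.\<close>

lemma summand_extension:
  assumes lm: "lmod H0" "lmod H" "lmod H'" and j: "lin H0 H j" "inj_on j (carrier H0)"
    and \<rho>: "lin H H' \<rho>" "\<rho> ` carrier H = carrier H'" and ker: "{x \<in> carrier H. \<rho> x = \<zero>\<^bsub>H'\<^esub>} = j ` carrier H0"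
    and p: "summand {regular_module A} H0" "summand {regular_module A} H'"
  shows "summand {regular_module A} H"
proof -
  obtain s where s: "lin H' H s" "\<And>y. y \<in> carrier H' \<Longrightarrow> \<rho> (s y) = y"
    using projective_lift[OF p(2) lin_id lm(3,2,3) \<rho>(1)] \<rho>(2) by (metis order_refl)
  obtain k where k: "lin H H0 k" "\<forall>x\<in>carrier H0. k (j x) = x" "\<forall>x\<in>carrier H. s (\<rho> x) \<oplus>\<^bsub>H\<^esub> j (k x) = x"
    by (rule complementary_projection[OF lm j \<rho>(1) ker s])
  have 1: "thru {regular_module A} H H (\<lambda>x. s (\<rho> x))"
    using thru_comp_left[OF thru_comp_right[OF p(2)[unfolded summand_def] \<rho>(1)] s(1) lm(2,3,2)] .
  have 2: "thru {regular_module A} H H (\<lambda>x. j (k x))"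
    using thru_comp_left[OF thru_comp_right[OF p(1)[unfolded summand_def] k(1)] j(1) lm(2,1,2)] .
  show ?thesis unfolding summand_def
    by (rule thru.ext[OF thru_plus[OF 2 1 lm(2,2)]]) (use k(3) in auto)
qed

lemma summand_kernel:
  assumes lm: "lmod H0" "lmod H" "lmod H'" and j: "lin H0 H j" "inj_on j (carrier H0)"
    and \<rho>: "lin H H' \<rho>" "\<rho> ` carrier H = carrier H'" and ker: "{x \<in> carrier H. \<rho> x = \<zero>\<^bsub>H'\<^esub>} = j ` carrier H0"
    and p: "summand {regular_module A} H" "summand {regular_module A} H'"
  shows "summand {regular_module A} H0"
proof -
  obtain s where s: "lin H' H s" "\<And>y. y \<in> carrier H' \<Longrightarrow> \<rho> (s y) = y"
    using projective_lift[OF p(2) lin_id lm(3,2,3) \<rho>(1)] \<rho>(2) by (metis order_refl)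
  obtain k where k: "lin H H0 k" "\<forall>x\<in>carrier H0. k (j x) = x" "\<forall>x\<in>carrier H. s (\<rho> x) \<oplus>\<^bsub>H\<^esub> j (k x) = x"
    by (rule complementary_projection[OF lm j \<rho>(1) ker s])
  show ?thesis by (rule summand_retract[OF p(1) j(1) k(1) _ lm(2,1)]) (use k(2) in auto)
qed

end

context algebra_modules
begin

lemma thru_Rs: "A.thru \<M> K L f \<Longrightarrow> R.thru (Rs ` \<M>) (Rs K) (Rs L) f"
proof (induction rule: A.thru.induct)
  case zero
  show ?case using R.thru.zero[of _ "Rs K" "Rs L"] by simp
next
  case (step f M b a)
  show ?case using R.thru.step[OF step.IH imageI[OF step(2)] lin_Rs[OF step(3)] lin_Rs[OF step(4)]] by simp
next
  case (ext f g) show ?case by (rule R.thru.ext[OF ext.IH]) (use ext(2) in simp)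
qed

lemma precomp_lin:
  assumes M: "A.lmod M" "A.lmod N" and T: "A.lmod T" and b: "A.lin M N b"
  shows "R.lin (hom_module A N T) (hom_module A M T) (\<lambda>f. \<lambda>x\<in>carrier M. f (b x))"
  by (rule R.linI)
    (use M T b A.lin_closed[OF b] in \<open>auto simp: A.mod_hom_iff fun_eq_iff intro: A.lin_comp[OF b]\<close>)

lemma thru_precomp:
  assumes K: "A.lmod K" "A.lmod L" "A.lmod T" and \<M>: "\<And>M. M \<in> \<M> \<Longrightarrow> A.lmod M"
    and f: "A.thru \<M> K L f"
  shows "R.thru ((\<lambda>M. hom_module A M T) ` \<M>) (hom_module A L T) (hom_module A K T) (\<lambda>u. \<lambda>x\<in>carrier K. u (f x))"
  using f
proof induction
  case zero
  show ?case
    by (rule R.thru.ext[OF R.thru.zero]) (use A.lin_zero[OF _ K(2,3)] in \<open>auto simp: A.mod_hom_iff fun_eq_iff\<close>)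
next
  case (step f M b a)
  note M = \<M>[OF step(2)]
  have fc: "f x \<in> carrier L" "a (b x) \<in> carrier L" if "x \<in> carrier K" for x
    using that A.lin_closed[OF A.thru_lin[OF step(1) K(1,2)]] A.lin_closed[OF step(3)] A.lin_closed[OF step(4)] by auto
  show ?case
    by (rule R.thru.ext[OF R.thru.step[OF step.IH imageI[OF step(2)] precomp_lin[OF M K(2,3) step(4)] precomp_lin[OF K(1) M K(3) step(3)]]])
      (use fc A.lin_closed[OF step(3)] in \<open>auto simp: fun_eq_iff A.mod_hom_iff A.lin_add\<close>)
next
  case (ext f g)
  show ?case by (rule R.thru.ext[OF ext.IH]) (use ext(2) in \<open>auto simp: fun_eq_iff\<close>)
qed

lemma summand_hom:
  assumes L: "A.lmod L" "A.lmod T" and \<M>: "\<And>M. M \<in> \<M> \<Longrightarrow> A.lmod M" and s: "A.summand \<M> L"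
  shows "R.summand ((\<lambda>M. hom_module A M T) ` \<M>) (hom_module A L T)"
  unfolding R.summand_def
  by (rule R.thru.ext[OF thru_precomp[OF L(1,1,2) \<M> s[unfolded A.summand_def]]])
    (auto simp: A.mod_hom_iff extensional_def fun_eq_iff)

text \<open>If every map from the submodule extends, then \<open>0 \<rightarrow> Hom(X, T) \<rightarrow> Hom(B, T) \<rightarrow> Hom(N, T) \<rightarrow> 0\<close> is exact.\<close>

lemma hom_restriction_exact:
  assumes B: "A.lmod B" and X: "A.lmod X" and T: "A.lmod T" and g: "A.lin B X g" "g ` carrier B = carrier X"
    and N: "{x \<in> carrier B. g x = \<zero>\<^bsub>X\<^esub>} = N"
    and ext: "\<And>h. A.lin (B \<restriction> N) T h \<Longrightarrow> \<exists>F. A.lin B T F \<and> (\<forall>x\<in>N. F x = h x)"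
  defines "\<rho> \<equiv> \<lambda>f. \<lambda>x\<in>carrier (B \<restriction> N). f x" and "j \<equiv> \<lambda>f. \<lambda>x\<in>carrier B. f (g x)"
  shows "R.lin (hom_module A X T) (hom_module A B T) j" "inj_on j (carrier (hom_module A X T))"
    "R.lin (hom_module A B T) (hom_module A (B \<restriction> N) T) \<rho>"
    "\<rho> ` carrier (hom_module A B T) = carrier (hom_module A (B \<restriction> N) T)"
    "{f \<in> carrier (hom_module A B T). \<rho> f = \<zero>\<^bsub>hom_module A (B \<restriction> N) T\<^esub>} = j ` carrier (hom_module A X T)"
proof -
  have NB: "N \<subseteq> carrier B" using N by blast
  have sN: "A.subm N B" unfolding N[symmetric] by (rule A.subm_ker[OF g(1) B X])
  have BN: "A.lmod (B \<restriction> N)" by (rule A.lmod_restr[OF B sN])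
  show jl: "R.lin (hom_module A X T) (hom_module A B T) j"
    unfolding j_def by (rule precomp_lin[OF B X T g(1)])
  show \<rho>l: "R.lin (hom_module A B T) (hom_module A (B \<restriction> N) T) \<rho>"
    unfolding \<rho>_def by (rule precomp_lin[OF BN B T]) (rule A.linI; use NB in auto)
  show "inj_on j (carrier (hom_module A X T))"
  proof (rule inj_onI)
    fix u v assume uv: "u \<in> carrier (hom_module A X T)" "v \<in> carrier (hom_module A X T)" "j u = j v"
    show "u = v"
    proof (rule mod_hom_eqI[of _ X T])
      fix y assume "y \<in> carrier X"
      then obtain x where x: "x \<in> carrier B" "y = g x" using g(2) by auto
      then show "u y = v y" using fun_cong[OF uv(3), of x] by (simp add: j_def)
    qed (use uv in auto)
  qed
  show "\<rho> ` carrier (hom_module A B T) = carrier (hom_module A (B \<restriction> N) T)"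
  proof
    show "\<rho> ` carrier (hom_module A B T) \<subseteq> carrier (hom_module A (B \<restriction> N) T)"
      using R.lin_closed[OF \<rho>l] by blast
    show "carrier (hom_module A (B \<restriction> N) T) \<subseteq> \<rho> ` carrier (hom_module A B T)"
    proof
      fix h assume h: "h \<in> carrier (hom_module A (B \<restriction> N) T)"
      then have "A.lin (B \<restriction> N) T h" by (simp add: A.mod_hom_iff)
      then obtain F where F: "A.lin B T F" "\<forall>x\<in>N. F x = h x" using ext by blast
      have "h = \<rho> (restrict F (carrier B))"
      proof (rule extensionalityI[of _ N])
        show "h \<in> extensional N" using h by (simp add: A.mod_hom_iff)
        show "h x = \<rho> (restrict F (carrier B)) x" if "x \<in> N" for x using F(2) that NB by (auto simp: \<rho>_def)
      qed (use NB in \<open>auto simp: \<rho>_def extensional_def\<close>)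
      moreover have "restrict F (carrier B) \<in> carrier (hom_module A B T)"
        using A.restrict_mod_hom[OF B F(1)] by simp
      ultimately show "h \<in> \<rho> ` carrier (hom_module A B T)" by (rule image_eqI)
    qed
  qed
  show "{f \<in> carrier (hom_module A B T). \<rho> f = \<zero>\<^bsub>hom_module A (B \<restriction> N) T\<^esub>} = j ` carrier (hom_module A X T)"
  proof
    show "j ` carrier (hom_module A X T) \<subseteq> {f \<in> carrier (hom_module A B T). \<rho> f = \<zero>\<^bsub>hom_module A (B \<restriction> N) T\<^esub>}"
    proof
      fix f assume "f \<in> j ` carrier (hom_module A X T)"
      then obtain u where u: "u \<in> carrier (hom_module A X T)" "f = j u" by (rule imageE)
      have "f \<in> carrier (hom_module A B T)" using R.lin_closed[OF jl u(1)] u(2) by simp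
      moreover have "f x = \<zero>\<^bsub>T\<^esub>" if "x \<in> N" for x
        using u N that NB A.lin_zero[OF _ X T] by (auto simp: A.mod_hom_iff j_def)
      ultimately show "f \<in> {f \<in> carrier (hom_module A B T). \<rho> f = \<zero>\<^bsub>hom_module A (B \<restriction> N) T\<^esub>}"
        by (auto simp: fun_eq_iff \<rho>_def)
    qed
    show "{f \<in> carrier (hom_module A B T). \<rho> f = \<zero>\<^bsub>hom_module A (B \<restriction> N) T\<^esub>} \<subseteq> j ` carrier (hom_module A X T)"
    proof
      fix f assume "f \<in> {f \<in> carrier (hom_module A B T). \<rho> f = \<zero>\<^bsub>hom_module A (B \<restriction> N) T\<^esub>}"
      then have f: "A.lin B T f" "f \<in> extensional (carrier B)" and r: "\<rho> f = \<zero>\<^bsub>hom_module A (B \<restriction> N) T\<^esub>"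
        by (auto simp: A.mod_hom_iff)
      have kk: "f x = \<zero>\<^bsub>T\<^esub>" if "x \<in> carrier B" "g x = \<zero>\<^bsub>X\<^esub>" for x
      proof -
        have "x \<in> N" using that N by blast
        then show ?thesis using fun_cong[OF r, of x] by (simp add: \<rho>_def)
      qed
      obtain u where u: "A.lin X T u" "\<And>x. x \<in> carrier B \<Longrightarrow> u (g x) = f x"
        using A.factor_thru[OF B T g f(1) kk X] by blast
      have "f = j (restrict u (carrier X))"
      proof (rule extensionalityI[OF f(2)])
        show "f x = j (restrict u (carrier X)) x" if "x \<in> carrier B" for x
          using u(2)[OF that] that A.lin_closed[OF g(1) that] by (simp add: j_def)
      qed (simp add: j_def)
      moreover have "restrict u (carrier X) \<in> carrier (hom_module A X T)"
        using A.restrict_mod_hom[OF X u(1)] by simp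
      ultimately show "f \<in> j ` carrier (hom_module A X T)" by (rule image_eqI)
    qed
  qed
qed

text \<open>For the regular module evaluation at \<open>1\<close> identifies \<open>Hom(A, T)\<close> with \<open>T\<close>; the functor \<open>Hom(_, T)\<close> takes
  summands to summands.\<close>

lemma Rproj_hom_projective:
  assumes P: "A.lmod P" "A.summand {regular_module A} P" and T: "A.lmod T" "Rproj (Rs T)"
  shows "Rproj (hom_module A P T)"
proof -
  let ?H = "hom_module A (regular_module A) T"
  have H: "R.lmod ?H" using T(1) by simp
  have b: "R.lin ?H (Rs T) (\<lambda>f. f \<one>\<^bsub>A\<^esub>)"
  proof (rule R.linI)
    show "f \<one>\<^bsub>A\<^esub> \<in> carrier (Rs T)" if "f \<in> carrier ?H" for f
      using that A.lin_closed[of "regular_module A" T f "\<one>\<^bsub>A\<^esub>"] by (simp add: A.mod_hom_iff)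
  qed auto
  have a: "R.lin (Rs T) ?H (\<lambda>t. \<lambda>x\<in>carrier A. x \<odot>\<^bsub>T\<^esub> t)"
  proof (rule R.linI)
    fix t assume t: "t \<in> carrier (Rs T)"
    show "(\<lambda>x\<in>carrier A. x \<odot>\<^bsub>T\<^esub> t) \<in> carrier ?H"
      using A.restrict_mod_hom[OF A.lmod_regular A.lin_orbit[OF T(1), of t]] t by simp
  qed (use T(1) in \<open>auto simp: fun_eq_iff A.lm_rdistr scal_central\<close>)
  have ab: "(\<lambda>x\<in>carrier A. x \<odot>\<^bsub>T\<^esub> f \<one>\<^bsub>A\<^esub>) = f" if f: "f \<in> carrier ?H" for f
  proof (rule extensionalityI[of _ "carrier A"])
    show "f \<in> extensional (carrier A)" using f by (simp add: A.mod_hom_iff)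
    show "(\<lambda>x\<in>carrier A. x \<odot>\<^bsub>T\<^esub> f \<one>\<^bsub>A\<^esub>) x = f x" if "x \<in> carrier A" for x
      using A.lin_regular[of T f x] f that by (simp add: A.mod_hom_iff)
  qed simp
  have HR: "Rproj ?H" by (rule R.summand_retract[OF T(2) b a ab lmod_Rs[OF T(1)] H])
  have "R.summand ((\<lambda>M. hom_module A M T) ` {regular_module A}) (hom_module A P T)"
    by (rule summand_hom[OF P(1) T(1) _ P(2)]) auto
  then show ?thesis
    by (rule R.summand_trans) (use HR H P(1) T(1) in auto)
qed

end

context standard_modules
begin

lemma Rproj_filtered:
  assumes ch: "A.fchain (twists R A \<Lambda> D) M {\<zero>\<^bsub>M\<^esub>} N" and M: "A.lmod M"
  shows "Rproj (Rs (M \<restriction> N))"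
  using ch
proof induction
  case base
  show ?case unfolding R.summand_def by (rule R.thru.ext[OF R.thru.zero]) auto
next
  case (step N N' X g)
  obtain m where X: "A.lmod X" "m \<in> \<Lambda>" "A.summand {D m} X" by (rule twist_D[OF subset_refl step(3)])
  have N: "A.subm N M" using A.fchain_subm[OF step(1) A.subm_zero_set[OF M]] by blast
  have NN: "N \<subseteq> N'" using step(6) by auto
  have "R.summand (Rs ` {D m}) (Rs X)"
    using thru_Rs[OF X(3)[unfolded A.summand_def]] by (simp add: R.summand_def)
  then have "Rproj (Rs X)" by (rule R.summand_trans) (use D_proj X in auto)
  show ?case
  proof (rule R.summand_extension[OF _ _ _ _ _ lin_Rs[OF step(4)] _ _ step.IH \<open>Rproj (Rs X)\<close>, where j = "\<lambda>x. x"])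
    show "R.lmod (Rs (M \<restriction> N))" "R.lmod (Rs (M \<restriction> N'))" using lmod_Rs A.lmod_restr[OF M] N step(2) by blast+
    show "R.lin (Rs (M \<restriction> N)) (Rs (M \<restriction> N')) (\<lambda>x. x)"
      by (rule R.linI) (use NN in auto)
  qed (use X step(5,6) in auto)
qed

text \<open>Induction from the larger weights down. The kernel of \<open>P m \<rightarrow> D m\<close> is filtered by twists of larger
  standard modules, so its homomorphisms to \<open>T\<close> form an iterated extension of projective modules. Then
  \<open>Hom(D m, T)\<close> is the kernel of an epimorphism between the projective modules of homomorphisms from
  \<open>P m\<close> and from that kernel.\<close>

lemma Rproj_hom_standard:
  assumes T: "fg_module A T" "Rproj (Rs T)" and ext: "\<And>m. m \<in> \<Lambda> \<Longrightarrow> ext_vanishes m T" and m: "m \<in> \<Lambda>"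
  shows "Rproj (hom_module A (D m) T)"
  using m
proof (induction "card {n \<in> \<Lambda>. m < n}" arbitrary: m rule: less_induct)
  case (less m)
  note m = less.prems
  have lT: "A.lmod T" using T(1) by simp
  have IH: "Rproj (hom_module A (D n) T)" if n: "n \<in> \<Lambda>" "m < n" for n
  proof (rule less.hyps[OF _ n(1)])
    show "card {k \<in> \<Lambda>. n < k} < card {k \<in> \<Lambda>. m < k}"
      by (rule psubset_card_mono) (use finite_\<Lambda> n in auto)
  qed
  have "Rproj (hom_module A (P m \<restriction> N) T)"
    if "A.fchain (twists R A {n \<in> \<Lambda>. m < n} D) (P m) {\<zero>\<^bsub>P m\<^esub>} N" for N
    using that
  proof induction
    case base
    let ?Z = "P m \<restriction> {\<zero>\<^bsub>P m\<^esub>}"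
    have Z: "A.lmod ?Z" using m by simp
    show ?case unfolding R.summand_def
      by (rule R.thru.ext[OF R.thru.zero])
        (use A.lin_zero[OF _ Z lT] in \<open>auto simp: A.mod_hom_iff extensional_def fun_eq_iff\<close>)
  next
    case (step N N' X g)
    obtain n where X: "A.lmod X" "n \<in> {n \<in> \<Lambda>. m < n}" "n \<in> \<Lambda>" "A.summand {D n} X" by (rule twist_D[OF _ step(3)]) auto
    have N: "A.subm N (P m)" using A.fchain_subm[OF step(1)] m by simp
    have NN: "N \<subseteq> N'" using step(6) by auto
    let ?B = "P m \<restriction> N'"
    have B: "fg_module A ?B" "A.lmod ?B" using fg_restr[OF P_fg[OF m] step(2)] by auto
    have B0: "A.lmod (P m \<restriction> N)" using N m by simp
    have gs: "g ` carrier ?B = carrier X" "{x \<in> carrier ?B. g x = \<zero>\<^bsub>X\<^esub>} = N" using step(5,6) by auto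
    have "R.summand ((\<lambda>M. hom_module A M T) ` {D n}) (hom_module A X T)"
      by (rule summand_hom[OF X(1) lT _ X(4)]) (use X(3) in auto)
    then have pX: "Rproj (hom_module A X T)"
      by (rule R.summand_trans) (use IH X lT in auto)
    have "\<exists>F. A.lin ?B T F \<and> (\<forall>x\<in>N. F x = h x)" if h: "A.lin (?B \<restriction> N) T h" for h
    proof -
      obtain F where "A.lin ?B T F" "\<forall>x\<in>N. F x = h x"
        by (rule ext_step[OF X(3) ext[OF X(3)] T(1) B(1) X(1,4) step(4) gs h])
      then show ?thesis by blast
    qed
    note ex = hom_restriction_exact[OF B(2) X(1) lT step(4) gs this]
    have BN: "?B \<restriction> N = P m \<restriction> N" by simp
    show ?case
      by (rule R.summand_extension[OF lmod_hom_module[OF X(1) lT] lmod_hom_module[OF B(2) lT]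
          lmod_hom_module[OF B0 lT] ex[unfolded BN] pX step.IH])
  qed
  note pK = this[OF K_chain[OF m]]
  have pP: "Rproj (hom_module A (P m) T)" by (rule Rproj_hom_projective[OF P_lmod[OF m] P_proj[OF m] lT T(2)])
  let ?K = "P m \<restriction> K m"
  have lK: "A.lmod ?K" using m by simp
  have kd: "{x \<in> carrier (P m). \<pi> m x = \<zero>\<^bsub>D m\<^esub>} = K m" by (simp add: K_def)
  have "\<exists>F. A.lin (P m) T F \<and> (\<forall>x\<in>K m. F x = h x)" if "A.lin ?K T h" for h
    using ext[OF m] that unfolding ext_vanishes_def by blast
  note ex = hom_restriction_exact[OF P_lmod[OF m] D_lmod[OF m] lT \<pi>_lin[OF m] \<pi>_surj[OF m] kd this]
  show ?case
    by (rule R.summand_kernel[OF lmod_hom_module[OF D_lmod[OF m] lT] lmod_hom_module[OF P_lmod[OF m] lT]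
        lmod_hom_module[OF lK lT] ex pP pK])
qed

end

section \<open>Costandard modules\<close>

text \<open>Costandard modules \<open>V\<close> enter through the Ext-orthogonality to the standard modules in degrees \<open>0\<close> and
  \<open>1\<close>. The isomorphism \<open>Hom(D l, V l) \<simeq> R\<close> is given by the generator \<open>\<iota> l\<close> that corresponds to \<open>1\<close>.\<close>

locale costandard_modules = standard_modules R A \<Lambda> D P \<pi>
  for R :: "('r, 'x) ring_scheme" and A :: "('r, 'a) module" and \<Lambda> :: "'i::order set"
    and D :: "'i \<Rightarrow> ('a, 'd) module" and P :: "'i \<Rightarrow> 'a umodule" and \<pi> :: "'i \<Rightarrow> (nat \<Rightarrow> 'a) set \<Rightarrow> 'd" +
  fixes V :: "'i \<Rightarrow> ('a, 'e) module" and \<iota> :: "'i \<Rightarrow> 'd \<Rightarrow> 'e"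
  assumes V_fg: "l \<in> \<Lambda> \<Longrightarrow> fg_module A (V l)"
    and V_hom: "\<lbrakk>l \<in> \<Lambda>; m \<in> \<Lambda>; l \<noteq> m; A.lin (D l) (V m) f; x \<in> carrier (D l)\<rbrakk> \<Longrightarrow> f x = \<zero>\<^bsub>V m\<^esub>"
    and \<iota>_lin: "l \<in> \<Lambda> \<Longrightarrow> A.lin (D l) (V l) (\<iota> l)"
    and \<iota>_gen: "\<lbrakk>l \<in> \<Lambda>; A.lin (D l) (V l) f\<rbrakk> \<Longrightarrow> \<exists>c\<in>carrier R. \<forall>x\<in>carrier (D l). f x = scal c \<odot>\<^bsub>V l\<^esub> \<iota> l x"
    and \<iota>_faithful: "\<lbrakk>l \<in> \<Lambda>; c \<in> carrier R; \<forall>x\<in>carrier (D l). scal c \<odot>\<^bsub>V l\<^esub> \<iota> l x = \<zero>\<^bsub>V l\<^esub>\<rbrakk> \<Longrightarrow> c = \<zero>\<^bsub>R\<^esub>"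
    and V_ext: "\<lbrakk>l \<in> \<Lambda>; m \<in> \<Lambda>\<rbrakk> \<Longrightarrow> ext_vanishes l (V m)"
begin

lemma V_lmod [simp]: "l \<in> \<Lambda> \<Longrightarrow> A.lmod (V l)"
  using V_fg by simp

text \<open>The kernel of \<open>P l \<rightarrow> D l\<close> has factors of larger weights, which have no maps to \<open>V l\<close>.\<close>

lemma P_to_V:
  assumes l: "l \<in> \<Lambda>" and f: "A.lin (P l) (V l) f"
  shows "\<exists>c\<in>carrier R. \<forall>z\<in>carrier (P l). f z = scal c \<odot>\<^bsub>V l\<^esub> \<iota> l (\<pi> l z)"
proof -
  have 0: "f x = \<zero>\<^bsub>V l\<^esub>" if "x \<in> K l" for x
  proof (rule K_vanish[OF l V_lmod[OF l] _ A.lin_restr_dom[OF f K_carrier[OF l]] that])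
    fix m g x assume "m \<in> \<Lambda>" "l < m" "A.lin (D m) (V l) g" "x \<in> carrier (D m)"
    then show "g x = \<zero>\<^bsub>V l\<^esub>" using V_hom[of m l g x] l by auto
  qed
  obtain h where h: "A.lin (D l) (V l) h" "\<And>z. z \<in> carrier (P l) \<Longrightarrow> h (\<pi> l z) = f z"
    using factor_\<pi>[OF l V_lmod[OF l] f 0] by blast
  obtain c where c: "c \<in> carrier R" "\<forall>x\<in>carrier (D l). h x = scal c \<odot>\<^bsub>V l\<^esub> \<iota> l x"
    using \<iota>_gen[OF l h(1)] by blast
  have "f z = scal c \<odot>\<^bsub>V l\<^esub> \<iota> l (\<pi> l z)" if "z \<in> carrier (P l)" for z
    using h(2)[OF that] bspec[OF c(2) A.lin_closed[OF \<pi>_lin[OF l] that]] by simp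
  then show ?thesis using c(1) by blast
qed

lemma P_to_D:
  assumes l: "l \<in> \<Lambda>" and f: "A.lin (P l) (D l) f"
  shows "\<exists>c\<in>carrier R. \<forall>z\<in>carrier (P l). f z = scal c \<odot>\<^bsub>D l\<^esub> \<pi> l z"
proof -
  have 0: "f x = \<zero>\<^bsub>D l\<^esub>" if "x \<in> K l" for x
    by (rule K_to_D_vanish[OF l l _ A.lin_restr_dom[OF f K_carrier[OF l]] that]) simp
  obtain h where h: "A.lin (D l) (D l) h" "\<And>z. z \<in> carrier (P l) \<Longrightarrow> h (\<pi> l z) = f z"
    using factor_\<pi>[OF l D_lmod[OF l] f 0] by blast
  obtain c where c: "c \<in> carrier R" "\<forall>x\<in>carrier (D l). h x = scal c \<odot>\<^bsub>D l\<^esub> x"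
    using D_end[OF l h(1)] by blast
  have "f z = scal c \<odot>\<^bsub>D l\<^esub> \<pi> l z" if "z \<in> carrier (P l)" for z
    using h(2)[OF that] bspec[OF c(2) A.lin_closed[OF \<pi>_lin[OF l] that]] by simp
  then show ?thesis using c(1) by blast
qed

lemma P_to_other_V:
  assumes "l \<in> \<Lambda>" "m \<in> \<Lambda>" "\<not> m \<le> l" "A.lin (P m) (V l) f" "x \<in> carrier (P m)"
  shows "f x = \<zero>\<^bsub>V l\<^esub>"
proof (rule P_vanish[OF assms(2) V_lmod[OF assms(1)] _ assms(4,5)])
  fix n g x assume n: "n \<in> \<Lambda>" "m \<le> n" "A.lin (D n) (V l) g" "x \<in> carrier (D n)"
  have "n \<noteq> l" using n(2) assms(3) by auto
  then show "g x = \<zero>\<^bsub>V l\<^esub>" using V_hom[OF n(1) assms(1) _ n(3,4)] by blast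
qed

lemma P_to_other_D:
  assumes "l \<in> \<Lambda>" "m \<in> \<Lambda>" "\<not> l \<le> m" "A.lin (P l) (D m) f" "x \<in> carrier (P l)"
  shows "f x = \<zero>\<^bsub>D m\<^esub>"
proof (rule P_vanish[OF assms(1) D_lmod[OF assms(2)] _ assms(4,5)])
  fix n g x assume n: "n \<in> \<Lambda>" "l \<le> n" "A.lin (D n) (D m) g" "x \<in> carrier (D n)"
  have "\<not> n \<le> m" using n(2) assms(3) by auto
  then show "g x = \<zero>\<^bsub>D m\<^esub>" using D_hom[OF n(1) assms(2) n(3) _ n(4)] by blast
qed

text \<open>A map \<open>f\<close> into \<open>V l\<close> is tested on the generators \<open>P k\<close>, along their standard filtrations. On a factor of
  a weight other than \<open>l\<close> it vanishes by orthogonality; on a factor of weight \<open>l\<close> it is seen by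
  maps from \<open>P l\<close>, which lift from the factor to the submodule.\<close>

lemma into_V_zero:
  assumes l: "l \<in> \<Lambda>" and X: "A.lmod X" and f: "A.lin X (V l) f"
    and 0: "\<And>p z. \<lbrakk>A.lin (P l) X p; z \<in> carrier (P l)\<rbrakk> \<Longrightarrow> f (p z) = \<zero>\<^bsub>V l\<^esub>" and x: "x \<in> carrier X"
  shows "f x = \<zero>\<^bsub>V l\<^esub>"
proof -
  note lV = V_lmod[OF l]
  have "{x \<in> carrier X. f x = \<zero>\<^bsub>V l\<^esub>} = carrier X"
  proof (rule A.generated_by[OF P_gen X A.subm_ker[OF f X lV]])
    fix M q x assume M: "M \<in> P ` \<Lambda>" "A.lin M X q" "x \<in> carrier M"
    then obtain k where k: "k \<in> \<Lambda>" and Mk: "M = P k" by blast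
    have q: "A.lin (P k) X q" using M(2) Mk by simp
    have "\<forall>x\<in>N. f (q x) = \<zero>\<^bsub>V l\<^esub>" if "A.fchain (twists R A {m \<in> \<Lambda>. k \<le> m} D) (P k) {\<zero>\<^bsub>P k\<^esub>} N" for N
      using that
    proof induction
      case base
      show ?case using A.lin_zero[OF A.lin_comp[OF q f] P_lmod[OF k] lV] by simp
    next
      case (step N N' L g)
      obtain m where L: "A.lmod L" "m \<in> {m \<in> \<Lambda>. k \<le> m}" "m \<in> \<Lambda>" "A.summand {D m} L"
        by (rule twist_D[OF _ step(3)]) auto
      let ?B = "P k \<restriction> N'"
      have N'P: "N' \<subseteq> carrier (P k)" by (rule A.subm_subset[OF step(2)])
      have B: "A.lmod ?B" by (rule A.lmod_restr[OF P_lmod[OF k] step(2)])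
      have gs: "g ` carrier ?B = carrier L" using step(5) by simp
      have qB: "A.lin ?B X q" by (rule A.lin_restr_dom[OF q N'P])
      have kk: "f (q x) = \<zero>\<^bsub>V l\<^esub>" if "x \<in> carrier ?B" "g x = \<zero>\<^bsub>L\<^esub>" for x using that step(6) step.IH by auto
      obtain F where F: "A.lin L (V l) F" "\<And>x. x \<in> carrier ?B \<Longrightarrow> F (g x) = f (q x)"
        using A.factor_thru[OF B lV step(4) gs A.lin_comp[OF qB f] kk L(1)] by blast
      have "\<forall>y\<in>carrier L. F y = \<zero>\<^bsub>V l\<^esub>"
      proof (rule A.thru_vanish_on[OF L(4)[unfolded A.summand_def] F(1) L(1,1) lV])
        fix M a x assume "M \<in> {D m}" and a: "A.lin M L a" and x: "x \<in> carrier M"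
        then have M: "M = D m" by simp
        show "F (a x) = \<zero>\<^bsub>V l\<^esub>"
        proof (cases "m = l")
          case False
          show ?thesis using V_hom[OF L(3) l False A.lin_comp[OF a[unfolded M] F(1)]] x M by simp
        next
          case True
          obtain z where z: "z \<in> carrier (P l)" "x = \<pi> l z" using x M True \<pi>_surj[OF l] by auto
          have "A.lin (P l) L (\<lambda>z. a (\<pi> l z))" using A.lin_comp[OF \<pi>_lin[OF l]] a M True by blast
          then obtain p where p: "A.lin (P l) ?B p" "\<And>z. z \<in> carrier (P l) \<Longrightarrow> g (p z) = a (\<pi> l z)"
            using P_lift[OF l _ B L(1) step(4) gs[THEN equalityD2]] by blast
          have "F (a x) = f (q (p z))" using p(2)[OF z(1)] z(2) F(2)[OF A.lin_closed[OF p(1) z(1)]] by simp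
          also have "\<dots> = \<zero>\<^bsub>V l\<^esub>" by (rule 0[OF A.lin_comp[OF p(1) qB] z(1)])
          finally show ?thesis .
        qed
      qed
      then show ?case using F(2) A.lin_closed[OF step(4)] by auto
    qed
    from this[OF P_chain[OF k]] show "q x \<in> {x \<in> carrier X. f x = \<zero>\<^bsub>V l\<^esub>}"
      using M(3) Mk A.lin_closed[OF q] by auto
  qed
  then show ?thesis using x by blast
qed

end

text \<open>A module \<open>X\<close> that receives no maps from the standard modules of weight above \<open>l\<close>, with the maps
  \<open>D l \<rightarrow> X\<close> parametrised \<open>R\<close>-linearly by \<open>U\<close>. In the application \<open>U\<close> is the module with which
  \<open>V l\<close> is twisted.\<close>

locale coextension = costandard_modules R A \<Lambda> D P \<pi> V \<iota>
  for R :: "('r, 'x) ring_scheme" and A :: "('r, 'a) module" and \<Lambda> :: "'i::order set"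
    and D :: "'i \<Rightarrow> ('a, 'd) module" and P :: "'i \<Rightarrow> 'a umodule" and \<pi> :: "'i \<Rightarrow> (nat \<Rightarrow> 'a) set \<Rightarrow> 'd"
    and V :: "'i \<Rightarrow> ('a, 'e) module" and \<iota> :: "'i \<Rightarrow> 'd \<Rightarrow> 'e" +
  fixes l :: 'i and X :: "('a, 'm) module" and U :: "('r, 'u) module" and \<eta> :: "'u \<Rightarrow> 'd \<Rightarrow> 'm"
  assumes l: "l \<in> \<Lambda>" and X: "A.lmod X" and U: "R.lmod U"
    and X_vanish: "\<lbrakk>m \<in> \<Lambda>; l < m; A.lin (D m) X f; x \<in> carrier (D m)\<rbrakk> \<Longrightarrow> f x = \<zero>\<^bsub>X\<^esub>"
    and \<eta>_lin: "u \<in> carrier U \<Longrightarrow> A.lin (D l) X (\<eta> u)"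
    and \<eta>_onto: "A.lin (D l) X f \<Longrightarrow> \<exists>u\<in>carrier U. \<forall>x\<in>carrier (D l). f x = \<eta> u x"
    and \<eta>_add: "\<lbrakk>u \<in> carrier U; v \<in> carrier U; x \<in> carrier (D l)\<rbrakk> \<Longrightarrow> \<eta> (u \<oplus>\<^bsub>U\<^esub> v) x = \<eta> u x \<oplus>\<^bsub>X\<^esub> \<eta> v x"
    and \<eta>_smult: "\<lbrakk>u \<in> carrier U; r \<in> carrier R; x \<in> carrier (D l)\<rbrakk> \<Longrightarrow> \<eta> (r \<odot>\<^bsub>U\<^esub> u) x = scal r \<odot>\<^bsub>X\<^esub> \<eta> u x"
    and \<eta>_inj: "\<lbrakk>u \<in> carrier U; \<forall>x\<in>carrier (D l). \<eta> u x = \<zero>\<^bsub>X\<^esub>\<rbrakk> \<Longrightarrow> u = \<zero>\<^bsub>U\<^esub>"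
begin

text \<open>As \<open>X\<close> receives no maps from larger standard modules, every map \<open>P l \<rightarrow> X\<close> factors through \<open>D l\<close> and so has
  a unique parameter \<open>u\<close>.\<close>

definition rep :: "((nat \<Rightarrow> 'a) set \<Rightarrow> 'm) \<Rightarrow> 'u \<Rightarrow> bool" where
  "rep f u \<longleftrightarrow> u \<in> carrier U \<and> (\<forall>z\<in>carrier (P l). f z = \<eta> u (\<pi> l z))"

lemma \<pi>_closed: "z \<in> carrier (P l) \<Longrightarrow> \<pi> l z \<in> carrier (D l)"
  by (rule A.lin_closed[OF \<pi>_lin[OF l]])

lemma \<eta>_closed: "\<lbrakk>u \<in> carrier U; x \<in> carrier (D l)\<rbrakk> \<Longrightarrow> \<eta> u x \<in> carrier X"
  by (rule A.lin_closed[OF \<eta>_lin])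

lemma rep_exists:
  assumes f: "A.lin (P l) X f" obtains u where "rep f u"
proof -
  have 0: "f x = \<zero>\<^bsub>X\<^esub>" if "x \<in> K l" for x
    by (rule K_vanish[OF l X _ A.lin_restr_dom[OF f K_carrier[OF l]] that]) (use X_vanish in blast)
  obtain h where h: "A.lin (D l) X h" "\<And>z. z \<in> carrier (P l) \<Longrightarrow> h (\<pi> l z) = f z"
    using factor_\<pi>[OF l X f 0] by blast
  obtain u where u: "u \<in> carrier U" "\<forall>x\<in>carrier (D l). h x = \<eta> u x" using \<eta>_onto[OF h(1)] by blast
  have "f z = \<eta> u (\<pi> l z)" if "z \<in> carrier (P l)" for z
    using h(2)[OF that] bspec[OF u(2) \<pi>_closed[OF that]] by simp
  then have "rep f u" using u(1) by (simp add: rep_def)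
  then show ?thesis by (rule that)
qed

lemma rep_add: "\<lbrakk>rep f u; rep g v\<rbrakk> \<Longrightarrow> rep (\<lambda>z. f z \<oplus>\<^bsub>X\<^esub> g z) (u \<oplus>\<^bsub>U\<^esub> v)"
  using U by (simp add: rep_def \<eta>_add \<pi>_closed)

lemma rep_scal: "\<lbrakk>rep f u; c \<in> carrier R\<rbrakk> \<Longrightarrow> rep (\<lambda>z. scal c \<odot>\<^bsub>X\<^esub> f z) (c \<odot>\<^bsub>U\<^esub> u)"
  using U by (simp add: rep_def \<eta>_smult \<pi>_closed)

lemma rep_cong: "\<lbrakk>rep f u; \<And>z. z \<in> carrier (P l) \<Longrightarrow> g z = f z\<rbrakk> \<Longrightarrow> rep g u"
  by (simp add: rep_def)

lemma \<eta>_zero: "x \<in> carrier (D l) \<Longrightarrow> \<eta> \<zero>\<^bsub>U\<^esub> x = \<zero>\<^bsub>X\<^esub>"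
  using \<eta>_smult[of "\<zero>\<^bsub>U\<^esub>" "\<zero>\<^bsub>R\<^esub>" x] U X \<eta>_closed[of "\<zero>\<^bsub>U\<^esub>" x] by simp

lemma rep_zero: "rep (\<lambda>z. \<zero>\<^bsub>X\<^esub>) \<zero>\<^bsub>U\<^esub>"
  using U by (simp add: rep_def \<eta>_zero \<pi>_closed)

lemma \<eta>_dif:
  assumes "u \<in> carrier U" "v \<in> carrier U" "x \<in> carrier (D l)"
  shows "\<eta> (R.dif U u v) x = A.dif X (\<eta> u x) (\<eta> v x)"
proof -
  have c: "R.dif U u v \<in> carrier U" using assms U by simp
  have "\<eta> u x = \<eta> (R.dif U u v) x \<oplus>\<^bsub>X\<^esub> \<eta> v x" using \<eta>_add[OF c assms(2,3)] assms U by simp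
  then show ?thesis using A.add_dif_cancel[OF X \<eta>_closed[OF c assms(3)] \<eta>_closed[OF assms(2,3)]] by simp
qed

lemma rep_dif: "\<lbrakk>rep f u; rep g v\<rbrakk> \<Longrightarrow> rep (\<lambda>z. A.dif X (f z) (g z)) (R.dif U u v)"
  using U by (simp add: rep_def \<eta>_dif \<pi>_closed)

lemma rep_unique: assumes "rep f u" "rep f v" shows "u = v"
proof -
  have uv: "u \<in> carrier U" "v \<in> carrier U" using assms by (auto simp: rep_def)
  have "\<eta> (R.dif U u v) x = \<zero>\<^bsub>X\<^esub>" if x: "x \<in> carrier (D l)" for x
  proof -
    obtain z where z: "z \<in> carrier (P l)" "x = \<pi> l z" using x \<pi>_surj[OF l] by auto
    have "\<eta> u x = \<eta> v x" using assms z unfolding rep_def by metis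
    then show ?thesis using \<eta>_dif[OF uv x] X \<eta>_closed[OF uv(2) x] by simp
  qed
  then have "R.dif U u v = \<zero>\<^bsub>U\<^esub>" using \<eta>_inj uv U by simp
  then show ?thesis using R.dif_eq_zero[OF U uv] by simp
qed

text \<open>The map \<open>\<theta>\<close> into \<open>V l\<close> is compatible with the functional \<open>\<chi>\<close> on the maps \<open>P l \<rightarrow> B\<close>, where each
  such map is assigned a parameter in \<open>U\<close> by composing with \<open>g\<close>. For \<open>B = X\<close> and \<open>g\<close> the identity, \<open>\<theta>\<close>
  realises \<open>\<chi>\<close>; the other cases serve to build this one.\<close>

definition induces :: "('u \<Rightarrow> 'r) \<Rightarrow> ('a, 'b) module \<Rightarrow> ('b \<Rightarrow> 'm) \<Rightarrow> ('b \<Rightarrow> 'e) \<Rightarrow> bool" where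
  "induces \<chi> B g \<theta> \<longleftrightarrow> (\<forall>p u. A.lin (P l) B p \<longrightarrow> rep (\<lambda>z. g (p z)) u \<longrightarrow>
     (\<forall>z\<in>carrier (P l). \<theta> (p z) = scal (\<chi> u) \<odot>\<^bsub>V l\<^esub> \<iota> l (\<pi> l z)))"

text \<open>The map \<open>P l \<rightarrow> V l\<close> with coordinate \<open>c\<close>; by \<open>P_to_V\<close> there are no others.\<close>

abbreviation e :: "'r \<Rightarrow> (nat \<Rightarrow> 'a) set \<Rightarrow> 'e" where
  "e c z \<equiv> scal c \<odot>\<^bsub>V l\<^esub> \<iota> l (\<pi> l z)"

lemma e_closed: "\<lbrakk>c \<in> carrier R; z \<in> carrier (P l)\<rbrakk> \<Longrightarrow> e c z \<in> carrier (V l)"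
  using A.lin_closed[OF \<iota>_lin[OF l] \<pi>_closed] l by simp

lemma e_add: "\<lbrakk>c \<in> carrier R; d \<in> carrier R; z \<in> carrier (P l)\<rbrakk> \<Longrightarrow> e (c \<oplus>\<^bsub>R\<^esub> d) z = e c z \<oplus>\<^bsub>V l\<^esub> e d z"
  using A.lin_closed[OF \<iota>_lin[OF l] \<pi>_closed] l by (simp add: scal_add A.lm_ldistr)

lemma e_times: "\<lbrakk>c \<in> carrier R; d \<in> carrier R; z \<in> carrier (P l)\<rbrakk> \<Longrightarrow> e (c \<otimes>\<^bsub>R\<^esub> d) z = scal c \<odot>\<^bsub>V l\<^esub> e d z"
  using A.lin_closed[OF \<iota>_lin[OF l] \<pi>_closed] l by (simp add: scal_times A.lm_assoc)

lemma e_dif: "\<lbrakk>c \<in> carrier R; d \<in> carrier R; z \<in> carrier (P l)\<rbrakk>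
    \<Longrightarrow> e (R.dif (regular_module R) c d) z = A.dif (V l) (e c z) (e d z)"
proof -
  assume a: "c \<in> carrier R" "d \<in> carrier R" "z \<in> carrier (P l)"
  have dc: "R.dif (regular_module R) c d \<in> carrier R"
    using R.dif_closed[OF R.lmod_regular, of c d] a by simp
  have "e c z = e (R.dif (regular_module R) c d) z \<oplus>\<^bsub>V l\<^esub> e d z"
    using e_add[OF dc a(2,3)] R.dif_add_cancel(1)[OF R.lmod_regular, of c d] a by simp
  then show ?thesis using A.add_dif_cancel[OF V_lmod[OF l] e_closed[OF dc a(3)] e_closed[OF a(2,3)]] by simp
qed

context
  fixes \<chi> :: "'u \<Rightarrow> 'r"
  assumes \<chi>: "R.lin U (regular_module R) \<chi>"
begin

lemma \<chi>_closed: "u \<in> carrier U \<Longrightarrow> \<chi> u \<in> carrier R"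
  using R.lin_closed[OF \<chi>] by simp

lemma \<chi>_add: "\<lbrakk>u \<in> carrier U; v \<in> carrier U\<rbrakk> \<Longrightarrow> \<chi> (u \<oplus>\<^bsub>U\<^esub> v) = \<chi> u \<oplus>\<^bsub>R\<^esub> \<chi> v"
  using R.lin_add[OF \<chi>] by simp

lemma \<chi>_smult: "\<lbrakk>u \<in> carrier U; r \<in> carrier R\<rbrakk> \<Longrightarrow> \<chi> (r \<odot>\<^bsub>U\<^esub> u) = r \<otimes>\<^bsub>R\<^esub> \<chi> u"
  using R.lin_smult[OF \<chi>] by simp

lemma \<chi>_dif: "\<lbrakk>u \<in> carrier U; v \<in> carrier U\<rbrakk> \<Longrightarrow> \<chi> (R.dif U u v) = R.dif (regular_module R) (\<chi> u) (\<chi> v)"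
  by (rule R.lin_dif[OF \<chi> U])

lemma \<chi>_zero: "\<chi> \<zero>\<^bsub>U\<^esub> = \<zero>\<^bsub>R\<^esub>"
  using R.lin_zero[OF \<chi> U R.lmod_regular] by simp

text \<open>One step along a filtration: \<open>\<theta>\<close> is compatible with \<open>\<chi>\<close> on the submodule \<open>N\<close>, and the quotient \<open>L\<close> is a
  summand of copies of \<open>D m\<close>. Extend \<open>\<theta>\<close> to some \<open>F\<close>, using that first extensions of \<open>V l\<close> vanish. The
  failure of \<open>F\<close> to be compatible depends only on the composite \<open>P l \<rightarrow> B \<rightarrow> L\<close>, since \<open>F\<close> is compatible on
  \<open>N\<close>. So the defect is an \<open>R\<close>-linear map from \<open>Hom(P l, L)\<close> to the base ring, and it suffices to realise
  the defect by a map \<open>\<psi>\<close> from \<open>L\<close> to \<open>V l\<close> and to subtract \<open>\<psi> g\<close>.\<close>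

lemma induces_step:
  assumes B: "fg_module A B" and m: "m \<in> \<Lambda>" and L: "A.lmod L" "A.summand {D m} L"
    and g: "A.lin B L g" "g ` carrier B = carrier L" and N: "{x \<in> carrier B. g x = \<zero>\<^bsub>L\<^esub>} = N"
    and h: "A.lin B X h" and \<theta>: "A.lin (B \<restriction> N) (V l) \<theta>" "induces \<chi> (B \<restriction> N) h \<theta>"
  shows "\<exists>\<theta>'. A.lin B (V l) \<theta>' \<and> induces \<chi> B h \<theta>'"
proof -
  have lB: "A.lmod B" using B by simp
  note lV = V_lmod[OF l]
  have NB: "N \<subseteq> carrier B" using N by blast
  obtain F where F: "A.lin B (V l) F" "\<forall>x\<in>N. F x = \<theta> x"
    by (rule ext_step[OF m V_ext[OF m l] V_fg[OF l] B L g N \<theta>(1)])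
  \<comment> \<open>The defect as a relation: \<open>W r d\<close> holds if \<open>F\<close> misses \<open>\<chi>\<close> by \<open>d\<close> on a lift \<open>p\<close> of \<open>r\<close> to \<open>B\<close>.\<close>
  define W where "W r d \<longleftrightarrow> d \<in> carrier R \<and> (\<exists>p u. A.lin (P l) B p \<and> rep (\<lambda>z. h (p z)) u \<and>
    (\<forall>z\<in>carrier (P l). g (p z) = r z \<and> F (p z) = e (\<chi> u \<oplus>\<^bsub>R\<^esub> d) z))" for r :: "(nat \<Rightarrow> 'a) set \<Rightarrow> _" and d
  have Rop: "a \<oplus>\<^bsub>R\<^esub> (b \<oplus>\<^bsub>R\<^esub> c) = (a \<oplus>\<^bsub>R\<^esub> b) \<oplus>\<^bsub>R\<^esub> c" if "a \<in> carrier R" "b \<in> carrier R" "c \<in> carrier R" for a b c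
    using R.a_assoc[OF that] by simp
  have W_ext: "W r' d" if "W r d" "\<And>z. z \<in> carrier (P l) \<Longrightarrow> r z = r' z" for r r' d
    using that unfolding W_def by auto
  have repU: "u \<in> carrier U" if "rep f u" for f u using that by (simp add: rep_def)
  have W_closed: "d \<in> carrier R" if "W r d" for r d using that by (simp add: W_def)
  have W_add: "W (\<lambda>z. r z \<oplus>\<^bsub>L\<^esub> r' z) (d \<oplus>\<^bsub>R\<^esub> d')" if WW: "W r d" "W r' d'" for r r' d d'
  proof -
    obtain p u where p: "A.lin (P l) B p" "rep (\<lambda>z. h (p z)) u"
      "\<forall>z\<in>carrier (P l). g (p z) = r z \<and> F (p z) = e (\<chi> u \<oplus>\<^bsub>R\<^esub> d) z" and d: "d \<in> carrier R"
      using WW(1) unfolding W_def by blast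
    obtain p' u' where p': "A.lin (P l) B p'" "rep (\<lambda>z. h (p' z)) u'"
      "\<forall>z\<in>carrier (P l). g (p' z) = r' z \<and> F (p' z) = e (\<chi> u' \<oplus>\<^bsub>R\<^esub> d') z" and d': "d' \<in> carrier R"
      using WW(2) unfolding W_def by blast
    have u: "u \<in> carrier U" "u' \<in> carrier U" using repU p(2) p'(2) by auto
    note c = \<chi>_closed[OF u(1)] \<chi>_closed[OF u(2)] d d'
    have pc: "p z \<in> carrier B" "p' z \<in> carrier B" if "z \<in> carrier (P l)" for z
      using A.lin_closed[OF p(1) that] A.lin_closed[OF p'(1) that] by auto
    have eq: "\<chi> (u \<oplus>\<^bsub>U\<^esub> u') \<oplus>\<^bsub>R\<^esub> (d \<oplus>\<^bsub>R\<^esub> d') = (\<chi> u \<oplus>\<^bsub>R\<^esub> d) \<oplus>\<^bsub>R\<^esub> (\<chi> u' \<oplus>\<^bsub>R\<^esub> d')"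
      using c by (simp add: \<chi>_add[OF u] R.a_ac)
    have "rep (\<lambda>z. h (p z \<oplus>\<^bsub>B\<^esub> p' z)) (u \<oplus>\<^bsub>U\<^esub> u')"
      by (rule rep_cong[OF rep_add[OF p(2) p'(2)]]) (simp add: A.lin_add[OF h] pc)
    moreover have "g (p z \<oplus>\<^bsub>B\<^esub> p' z) = r z \<oplus>\<^bsub>L\<^esub> r' z \<and> F (p z \<oplus>\<^bsub>B\<^esub> p' z) = e (\<chi> (u \<oplus>\<^bsub>U\<^esub> u') \<oplus>\<^bsub>R\<^esub> (d \<oplus>\<^bsub>R\<^esub> d')) z"
      if z: "z \<in> carrier (P l)" for z
      unfolding eq e_add[OF R.add.m_closed[OF c(1,3)] R.add.m_closed[OF c(2,4)] z]
      using bspec[OF p(3) z] bspec[OF p'(3) z] by (simp add: A.lin_add[OF g(1) pc[OF z]] A.lin_add[OF F(1) pc[OF z]])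
    ultimately show ?thesis unfolding W_def using A.lin_plus[OF p(1) p'(1) lB] d d' by blast
  qed
  have W_scal: "W (\<lambda>z. scal c \<odot>\<^bsub>L\<^esub> r z) (c \<otimes>\<^bsub>R\<^esub> d)" if WW: "W r d" and c: "c \<in> carrier R" for r d c
  proof -
    obtain p u where p: "A.lin (P l) B p" "rep (\<lambda>z. h (p z)) u"
      "\<forall>z\<in>carrier (P l). g (p z) = r z \<and> F (p z) = e (\<chi> u \<oplus>\<^bsub>R\<^esub> d) z" and d: "d \<in> carrier R"
      using WW(1) unfolding W_def by blast
    have u: "u \<in> carrier U" using repU p(2) by auto
    note \<chi>u = \<chi>_closed[OF u]
    have pc: "p z \<in> carrier B" if "z \<in> carrier (P l)" for z using A.lin_closed[OF p(1) that] .
    have eq: "\<chi> (c \<odot>\<^bsub>U\<^esub> u) \<oplus>\<^bsub>R\<^esub> c \<otimes>\<^bsub>R\<^esub> d = c \<otimes>\<^bsub>R\<^esub> (\<chi> u \<oplus>\<^bsub>R\<^esub> d)"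
      using \<chi>_smult[OF u c] R.r_distr[OF \<chi>u d c] by simp
    have "rep (\<lambda>z. h (scal c \<odot>\<^bsub>B\<^esub> p z)) (c \<odot>\<^bsub>U\<^esub> u)"
      by (rule rep_cong[OF rep_scal[OF p(2) c]]) (simp add: A.lin_smult[OF h scal_closed[OF c]] pc)
    moreover have "g (scal c \<odot>\<^bsub>B\<^esub> p z) = scal c \<odot>\<^bsub>L\<^esub> r z \<and> F (scal c \<odot>\<^bsub>B\<^esub> p z) = e (\<chi> (c \<odot>\<^bsub>U\<^esub> u) \<oplus>\<^bsub>R\<^esub> c \<otimes>\<^bsub>R\<^esub> d) z"
      if z: "z \<in> carrier (P l)" for z
      unfolding eq e_times[OF c R.add.m_closed[OF \<chi>u d] z]
      using bspec[OF p(3) z] by (simp add: A.lin_smult[OF g(1) scal_closed[OF c] pc[OF z]] A.lin_smult[OF F(1) scal_closed[OF c] pc[OF z]])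
    ultimately show ?thesis unfolding W_def using lin_scal[OF p(1) lB c] c d by blast
  qed
  \<comment> \<open>Maps into \<open>N\<close> have no defect, so two lifts of the same map to \<open>L\<close> have the same one.\<close>
  have lands: "\<forall>z\<in>carrier (P l). F (p z) = e (\<chi> u) z"
    if p: "A.lin (P l) B p" "rep (\<lambda>z. h (p z)) u" "\<And>z. z \<in> carrier (P l) \<Longrightarrow> g (p z) = \<zero>\<^bsub>L\<^esub>" for p u
  proof -
    have pN: "p z \<in> N" if "z \<in> carrier (P l)" for z using N p(3)[OF that] A.lin_closed[OF p(1) that] by blast
    have "A.lin (P l) (B \<restriction> N) p" by (rule A.lin_to_restr[OF p(1) pN])
    then show ?thesis using \<theta>(2) p(2) F(2) pN unfolding induces_def by auto
  qed
  have W_unique: "e d z = e d' z" if WW: "W r d" "W r d'" and z: "z \<in> carrier (P l)" for r d d' z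
  proof -
    obtain p u where p: "A.lin (P l) B p" "rep (\<lambda>z. h (p z)) u"
      "\<forall>z\<in>carrier (P l). g (p z) = r z \<and> F (p z) = e (\<chi> u \<oplus>\<^bsub>R\<^esub> d) z" and d: "d \<in> carrier R"
      using WW(1) unfolding W_def by blast
    obtain p' u' where p': "A.lin (P l) B p'" "rep (\<lambda>z. h (p' z)) u'"
      "\<forall>z\<in>carrier (P l). g (p' z) = r z \<and> F (p' z) = e (\<chi> u' \<oplus>\<^bsub>R\<^esub> d') z" and d': "d' \<in> carrier R"
      using WW(2) unfolding W_def by blast
    have u: "u \<in> carrier U" "u' \<in> carrier U" using repU p(2) p'(2) by auto
    note c = \<chi>_closed[OF u(1)] \<chi>_closed[OF u(2)] d d'
    have pc: "p z \<in> carrier B" "p' z \<in> carrier B" if "z \<in> carrier (P l)" for z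
      using A.lin_closed[OF p(1) that] A.lin_closed[OF p'(1) that] by auto
    have "\<forall>z\<in>carrier (P l). F (A.dif B (p z) (p' z)) = e (\<chi> (R.dif U u u')) z"
    proof (rule lands[OF A.lin_minus[OF p(1) p'(1) lB]])
      show "rep (\<lambda>z. h (A.dif B (p z) (p' z))) (R.dif U u u')"
        by (rule rep_cong[OF rep_dif[OF p(2) p'(2)]]) (simp add: A.lin_dif[OF h lB] pc)
      show "g (A.dif B (p z) (p' z)) = \<zero>\<^bsub>L\<^esub>" if z: "z \<in> carrier (P l)" for z
        using bspec[OF p(3) z] bspec[OF p'(3) z] A.lin_dif[OF g(1) lB pc[OF z]] L(1) A.lin_closed[OF g(1) pc(1)[OF z]] by simp
    qed
    from bspec[OF this z]
    have "A.dif (V l) (F (p z)) (F (p' z)) = A.dif (V l) (e (\<chi> u) z) (e (\<chi> u') z)"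
      using A.lin_dif[OF F(1) lB pc[OF z]] \<chi>_dif[OF u] e_dif[OF c(1,2) z] by simp
    then have eq: "A.dif (V l) (e (\<chi> u) z \<oplus>\<^bsub>V l\<^esub> e d z) (e (\<chi> u') z \<oplus>\<^bsub>V l\<^esub> e d' z) = A.dif (V l) (e (\<chi> u) z) (e (\<chi> u') z)"
      using bspec[OF p(3) z] bspec[OF p'(3) z] e_add[OF c(1,3) z] e_add[OF c(2,4) z] by simp
    note ec = e_closed[OF c(1) z] e_closed[OF c(2) z] e_closed[OF c(3) z] e_closed[OF c(4) z]
    have "e (\<chi> u) z \<oplus>\<^bsub>V l\<^esub> e d z = A.dif (V l) (e (\<chi> u) z) (e (\<chi> u') z) \<oplus>\<^bsub>V l\<^esub> (e (\<chi> u') z \<oplus>\<^bsub>V l\<^esub> e d' z)"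
      unfolding eq[symmetric] by (rule A.dif_add_cancel(1)[OF lV, symmetric]) (use ec lV in auto)
    also have "\<dots> = (A.dif (V l) (e (\<chi> u) z) (e (\<chi> u') z) \<oplus>\<^bsub>V l\<^esub> e (\<chi> u') z) \<oplus>\<^bsub>V l\<^esub> e d' z"
      by (rule A.lm_a_assoc[OF lV, symmetric]) (use ec lV in auto)
    also have "\<dots> = e (\<chi> u) z \<oplus>\<^bsub>V l\<^esub> e d' z" using ec lV by simp
    finally show ?thesis using A.lm_cancel[OF lV ec(1,3,4)] by blast
  qed
  have W_exists: "\<exists>d. W r d" if r: "A.lin (P l) L r" for r
  proof -
    obtain p where p: "A.lin (P l) B p" "\<And>z. z \<in> carrier (P l) \<Longrightarrow> g (p z) = r z"
      using P_lift[OF l r lB L(1) g(1) g(2)[THEN equalityD2]] by blast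
    obtain u where u: "rep (\<lambda>z. h (p z)) u" using rep_exists[OF A.lin_comp[OF p(1) h]] by blast
    obtain c where c: "c \<in> carrier R" "\<forall>z\<in>carrier (P l). F (p z) = e c z"
      using P_to_V[OF l A.lin_comp[OF p(1) F(1)]] by blast
    note \<chi>u = \<chi>_closed[OF repU[OF u]]
    have "R.dif (regular_module R) c (\<chi> u) \<in> carrier R"
      using R.dif_closed[OF R.lmod_regular, of c "\<chi> u"] c(1) \<chi>u by simp
    moreover have "\<chi> u \<oplus>\<^bsub>R\<^esub> R.dif (regular_module R) c (\<chi> u) = c"
      using R.dif_add_cancel(2)[OF R.lmod_regular, of c "\<chi> u"] c(1) \<chi>u by simp
    ultimately have "W r (R.dif (regular_module R) c (\<chi> u))"
      unfolding W_def using p u c(2) by (intro conjI exI[of _ p] exI[of _ u]) auto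
    then show ?thesis by blast
  qed
  have V0: "e \<zero>\<^bsub>R\<^esub> z = \<zero>\<^bsub>V l\<^esub>" if "z \<in> carrier (P l)" for z
    using A.lin_closed[OF \<iota>_lin[OF l] \<pi>_closed[OF that]] lV by simp
  have W_zero: "W (\<lambda>z. \<zero>\<^bsub>L\<^esub>) \<zero>\<^bsub>R\<^esub>"
    unfolding W_def
    using A.lin_const_zero[OF lB, of "P l"] A.lin_zero[OF h lB X] A.lin_zero[OF g(1) lB L(1)] A.lin_zero[OF F(1) lB lV]
      rep_zero \<chi>_zero V0 by (intro conjI exI[of _ "\<lambda>z. \<zero>\<^bsub>B\<^esub>"] exI[of _ "\<zero>\<^bsub>U\<^esub>"]) auto
  \<comment> \<open>The defect on maps that pass through one copy of \<open>D m\<close>. For \<open>m = l\<close> these are multiples of one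
      map, so a multiple of \<open>\<iota>\<close> realises it. For \<open>l < m\<close> they lift through \<open>P m\<close>, which maps trivially
      to \<open>X\<close> and to \<open>V l\<close>, so it is zero. In the remaining case \<open>P l\<close> has no maps to \<open>D m\<close>.\<close>
  have W_part: "\<exists>\<kappa>. A.lin L (V l) \<kappa> \<and>
      (\<forall>r. A.lin (P l) L r \<longrightarrow> (\<exists>d. W (\<lambda>z. a (b (r z))) d \<and> (\<forall>z\<in>carrier (P l). \<kappa> (r z) = e d z)))"
    if b: "A.lin L (D m) b" and a: "A.lin (D m) L a" for a b
  proof (cases "m = l")
    case True
    have a\<pi>: "A.lin (P l) L (\<lambda>z. a (\<pi> l z))" using A.lin_comp[OF \<pi>_lin[OF l]] a True by blast
    obtain d0 where d0: "W (\<lambda>z. a (\<pi> l z)) d0" using W_exists[OF a\<pi>] by blast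
    note d0R = W_closed[OF d0]
    let ?\<kappa> = "\<lambda>y. scal d0 \<odot>\<^bsub>V l\<^esub> \<iota> l (b y)"
    have "A.lin L (V l) ?\<kappa>"
      by (rule lin_scal[OF A.lin_comp[OF b[unfolded True] \<iota>_lin[OF l]] lV d0R])
    moreover have "\<exists>d. W (\<lambda>z. a (b (r z))) d \<and> (\<forall>z\<in>carrier (P l). ?\<kappa> (r z) = e d z)" if r: "A.lin (P l) L r" for r
    proof -
      obtain c where c: "c \<in> carrier R" "\<forall>z\<in>carrier (P l). b (r z) = scal c \<odot>\<^bsub>D l\<^esub> \<pi> l z"
        using P_to_D[OF l A.lin_comp[OF r b[unfolded True]]] by blast
      have "W (\<lambda>z. a (b (r z))) (c \<otimes>\<^bsub>R\<^esub> d0)"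
        by (rule W_ext[OF W_scal[OF d0 c(1)]]) (use c A.lin_smult[OF a[unfolded True]] \<pi>_closed in simp)
      moreover have "?\<kappa> (r z) = e (c \<otimes>\<^bsub>R\<^esub> d0) z" if z: "z \<in> carrier (P l)" for z
      proof -
        have "\<iota> l (b (r z)) = scal c \<odot>\<^bsub>V l\<^esub> \<iota> l (\<pi> l z)"
          using c z A.lin_smult[OF \<iota>_lin[OF l] scal_closed[OF c(1)] \<pi>_closed[OF z]] by simp
        then show ?thesis
          unfolding e_times[OF c(1) d0R z]
          using scal_central[OF lV d0R scal_closed[OF c(1)] A.lin_closed[OF \<iota>_lin[OF l] \<pi>_closed[OF z]]] by simp
      qed
      ultimately show ?thesis by blast
    qed
    ultimately show ?thesis by blast
  next
    case False
    have "W (\<lambda>z. a (b (r z))) \<zero>\<^bsub>R\<^esub>" if r: "A.lin (P l) L r" for r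
    proof (cases "l \<le> m")
      case le: False
      show ?thesis
        by (rule W_ext[OF W_zero])
          (use P_to_other_D[OF l m le A.lin_comp[OF r b]] A.lin_zero[OF a D_lmod[OF m] L(1)] in simp)
    next
      case True
      with False have lt: "l < m" by simp
      have ms: "carrier (D m) \<subseteq> \<pi> m ` carrier (P m)" using \<pi>_surj[OF m] by simp
      obtain s where s: "A.lin (P l) (P m) s" "\<And>z. z \<in> carrier (P l) \<Longrightarrow> \<pi> m (s z) = b (r z)"
        using P_lift[OF l A.lin_comp[OF r b] P_lmod[OF m] D_lmod[OF m] \<pi>_lin[OF m] ms] by blast
      obtain t where t: "A.lin (P m) B t" "\<And>z. z \<in> carrier (P m) \<Longrightarrow> g (t z) = a (\<pi> m z)"
        using P_lift[OF m A.lin_comp[OF \<pi>_lin[OF m] a] lB L(1) g(1) g(2)[THEN equalityD2]] by blast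
      have ht: "h (t y) = \<zero>\<^bsub>X\<^esub>" if y: "y \<in> carrier (P m)" for y
      proof (rule P_vanish[OF m X _ A.lin_comp[OF t(1) h] y])
        fix n f x assume n: "n \<in> \<Lambda>" "m \<le> n" "A.lin (D n) X f" "x \<in> carrier (D n)"
        then show "f x = \<zero>\<^bsub>X\<^esub>" using X_vanish[OF n(1) _ n(3,4)] lt by simp
      qed
      have Ft: "F (t y) = \<zero>\<^bsub>V l\<^esub>" if y: "y \<in> carrier (P m)" for y
        by (rule P_to_other_V[OF l m _ A.lin_comp[OF t(1) F(1)] y]) (use lt in simp)
      have sc: "s z \<in> carrier (P m)" if "z \<in> carrier (P l)" for z by (rule A.lin_closed[OF s(1) that])
      have "rep (\<lambda>z. h (t (s z))) \<zero>\<^bsub>U\<^esub>" by (rule rep_cong[OF rep_zero]) (use ht sc in simp)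
      then show ?thesis
        unfolding W_def using A.lin_comp[OF s(1) t(1)] t(2) s(2) sc Ft \<chi>_zero V0
        by (intro conjI exI[of _ "\<lambda>z. t (s z)"] exI[of _ "\<zero>\<^bsub>U\<^esub>"]) auto
    qed
    then show ?thesis using A.lin_const_zero[OF lV, of L] V0
      by (intro exI[of _ "\<lambda>y. \<zero>\<^bsub>V l\<^esub>"] conjI allI impI exI[of _ "\<zero>\<^bsub>R\<^esub>"]) auto
  qed
  \<comment> \<open>The identity of \<open>L\<close> is a sum of maps through \<open>D m\<close>, so the parts add up to the whole defect.\<close>
  have "\<exists>\<psi>. A.lin L (V l) \<psi> \<and> (\<forall>r. A.lin (P l) L r \<longrightarrow>
      (\<exists>d. W (\<lambda>z. \<alpha> (r z)) d \<and> (\<forall>z\<in>carrier (P l). \<psi> (r z) = e d z)))" if "A.thru {D m} L L \<alpha>" for \<alpha>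
    using that
  proof induction
    case zero
    show ?case using A.lin_const_zero[OF lV, of L] V0 W_zero
      by (intro exI[of _ "\<lambda>y. \<zero>\<^bsub>V l\<^esub>"] conjI allI impI exI[of _ "\<zero>\<^bsub>R\<^esub>"]) auto
  next
    case (step \<alpha> M b a)
    have M: "M = D m" using step(2) by simp
    obtain \<psi> where \<psi>: "A.lin L (V l) \<psi>" "\<forall>r. A.lin (P l) L r \<longrightarrow>
      (\<exists>d. W (\<lambda>z. \<alpha> (r z)) d \<and> (\<forall>z\<in>carrier (P l). \<psi> (r z) = e d z))" using step.IH by blast
    obtain \<kappa> where \<kappa>: "A.lin L (V l) \<kappa>" "\<forall>r. A.lin (P l) L r \<longrightarrow>
      (\<exists>d. W (\<lambda>z. a (b (r z))) d \<and> (\<forall>z\<in>carrier (P l). \<kappa> (r z) = e d z))"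
      using W_part[OF step(3)[unfolded M] step(4)[unfolded M]] by blast
    have "\<exists>d. W (\<lambda>z. \<alpha> (r z) \<oplus>\<^bsub>L\<^esub> a (b (r z))) d \<and> (\<forall>z\<in>carrier (P l). \<psi> (r z) \<oplus>\<^bsub>V l\<^esub> \<kappa> (r z) = e d z)"
      if r: "A.lin (P l) L r" for r
    proof -
      obtain d where d: "W (\<lambda>z. \<alpha> (r z)) d" "\<forall>z\<in>carrier (P l). \<psi> (r z) = e d z" using \<psi>(2) r by blast
      obtain d' where d': "W (\<lambda>z. a (b (r z))) d'" "\<forall>z\<in>carrier (P l). \<kappa> (r z) = e d' z" using \<kappa>(2) r by blast
      show ?thesis using W_add[OF d(1) d'(1)] d(2) d'(2) e_add[OF W_closed[OF d(1)] W_closed[OF d'(1)]]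
        by (intro exI[of _ "d \<oplus>\<^bsub>R\<^esub> d'"]) auto
    qed
    then show ?case using A.lin_plus[OF \<psi>(1) \<kappa>(1) lV] by blast
  next
    case (ext \<alpha> \<beta>)
    obtain \<psi> where \<psi>: "A.lin L (V l) \<psi>" "\<forall>r. A.lin (P l) L r \<longrightarrow>
      (\<exists>d. W (\<lambda>z. \<alpha> (r z)) d \<and> (\<forall>z\<in>carrier (P l). \<psi> (r z) = e d z))" using ext.IH by blast
    have "\<exists>d. W (\<lambda>z. \<beta> (r z)) d \<and> (\<forall>z\<in>carrier (P l). \<psi> (r z) = e d z)" if r: "A.lin (P l) L r" for r
    proof -
      obtain d where d: "W (\<lambda>z. \<alpha> (r z)) d" "\<forall>z\<in>carrier (P l). \<psi> (r z) = e d z" using \<psi>(2) r by blast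
      have "W (\<lambda>z. \<beta> (r z)) d" by (rule W_ext[OF d(1)]) (use ext(2) A.lin_closed[OF r] in auto)
      then show ?thesis using d(2) by blast
    qed
    then show ?case using \<psi>(1) by blast
  qed
  from this[OF L(2)[unfolded A.summand_def]]
  obtain \<psi> where \<psi>: "A.lin L (V l) \<psi>" "\<forall>r. A.lin (P l) L r \<longrightarrow>
      (\<exists>d. W (\<lambda>z. r z) d \<and> (\<forall>z\<in>carrier (P l). \<psi> (r z) = e d z))" by blast
  let ?\<theta> = "\<lambda>x. A.dif (V l) (F x) (\<psi> (g x))"
  have \<theta>': "A.lin B (V l) ?\<theta>" by (rule A.lin_minus[OF F(1) A.lin_comp[OF g(1) \<psi>(1)] lV])
  have "induces \<chi> B h ?\<theta>"
    unfolding induces_def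
  proof (intro allI impI ballI)
    fix p u z assume p: "A.lin (P l) B p" and u: "rep (\<lambda>z. h (p z)) u" and z: "z \<in> carrier (P l)"
    note \<chi>u = \<chi>_closed[OF repU[OF u]]
    obtain d where d: "W (\<lambda>z. g (p z)) d" "\<forall>z\<in>carrier (P l). \<psi> (g (p z)) = e d z"
      using \<psi>(2) A.lin_comp[OF p g(1)] by blast
    obtain c where c: "c \<in> carrier R" "\<forall>z\<in>carrier (P l). F (p z) = e c z"
      using P_to_V[OF l A.lin_comp[OF p F(1)]] by blast
    let ?d = "R.dif (regular_module R) c (\<chi> u)"
    have dR: "?d \<in> carrier R" "\<chi> u \<oplus>\<^bsub>R\<^esub> ?d = c"
      using R.dif_closed[OF R.lmod_regular, of c "\<chi> u"] R.dif_add_cancel(2)[OF R.lmod_regular, of c "\<chi> u"] c(1) \<chi>u by auto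
    have "W (\<lambda>z. g (p z)) ?d"
      unfolding W_def using p u c(2) dR by (intro conjI exI[of _ p] exI[of _ u]) auto
    from W_unique[OF d(1) this z] have "\<psi> (g (p z)) = e ?d z" using d(2) z by simp
    moreover have "F (p z) = e (\<chi> u) z \<oplus>\<^bsub>V l\<^esub> e ?d z" using c(2) z e_add[OF \<chi>u dR(1) z] dR(2) by simp
    ultimately show "A.dif (V l) (F (p z)) (\<psi> (g (p z))) = e (\<chi> u) z"
      using A.add_dif_cancel[OF lV e_closed[OF \<chi>u z] e_closed[OF dR(1) z]] by simp
  qed
  then show ?thesis using \<theta>' by blast
qed

end

lemma induces_unique:
  assumes B: "A.lmod B" and h: "A.lin B X h" and \<theta>: "A.lin B (V l) \<theta>" "A.lin B (V l) \<theta>'"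
    and ind: "induces \<chi> B h \<theta>" "induces \<chi> B h \<theta>'" and \<chi>: "R.lin U (regular_module R) \<chi>" and b: "b \<in> carrier B"
  shows "\<theta> b = \<theta>' b"
proof -
  note lV = V_lmod[OF l]
  have "A.dif (V l) (\<theta> b) (\<theta>' b) = \<zero>\<^bsub>V l\<^esub>"
  proof (rule into_V_zero[OF l B A.lin_minus[OF \<theta> lV] _ b])
    fix p z assume p: "A.lin (P l) B p" "z \<in> carrier (P l)"
    obtain u where u: "rep (\<lambda>z. h (p z)) u" using rep_exists[OF A.lin_comp[OF p(1) h]] by blast
    have uU: "u \<in> carrier U" using u by (simp add: rep_def)
    have "\<theta> (p z) = e (\<chi> u) z" "\<theta>' (p z) = e (\<chi> u) z" using ind u p unfolding induces_def by blast+
    then show "A.dif (V l) (\<theta> (p z)) (\<theta>' (p z)) = \<zero>\<^bsub>V l\<^esub>"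
      using lV e_closed[OF \<chi>_closed[OF \<chi> uU] p(2)] by simp
  qed
  then show ?thesis using A.dif_eq_zero[OF lV A.lin_closed[OF \<theta>(1) b] A.lin_closed[OF \<theta>(2) b]] by simp
qed

lemma induces_projective:
  assumes \<chi>: "R.lin U (regular_module R) \<chi>" and m: "m \<in> \<Lambda>" and h: "A.lin (P m) X h"
  shows "\<exists>\<theta>. A.lin (P m) (V l) \<theta> \<and> induces \<chi> (P m) h \<theta>"
proof -
  note lV = V_lmod[OF l]
  have "\<exists>\<theta>. A.lin (P m \<restriction> N) (V l) \<theta> \<and> induces \<chi> (P m \<restriction> N) h \<theta>"
    if "A.fchain (twists R A {k \<in> \<Lambda>. m \<le> k} D) (P m) {\<zero>\<^bsub>P m\<^esub>} N" for N
    using that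
  proof induction
    case base
    have "induces \<chi> (P m \<restriction> {\<zero>\<^bsub>P m\<^esub>}) h (\<lambda>x. \<zero>\<^bsub>V l\<^esub>)"
      unfolding induces_def
    proof (intro allI impI ballI)
      fix p u z assume p: "A.lin (P l) (P m \<restriction> {\<zero>\<^bsub>P m\<^esub>}) p" and u: "rep (\<lambda>z. h (p z)) u" and z: "z \<in> carrier (P l)"
      have "h (p z) = \<zero>\<^bsub>X\<^esub>" if "z \<in> carrier (P l)" for z
        using A.lin_closed[OF p that] A.lin_zero[OF h P_lmod[OF m] X] by simp
      then have "rep (\<lambda>z. \<zero>\<^bsub>X\<^esub>) u" by (intro rep_cong[OF u]) simp
      then have "u = \<zero>\<^bsub>U\<^esub>" by (rule rep_unique[OF _ rep_zero])
      then show "\<zero>\<^bsub>V l\<^esub> = e (\<chi> u) z"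
        using \<chi>_zero[OF \<chi>] A.lin_closed[OF \<iota>_lin[OF l] \<pi>_closed[OF z]] lV by simp
    qed
    then show ?case using A.lin_const_zero[OF lV] by blast
  next
    case (step N N' L g)
    obtain k where L: "A.lmod L" "k \<in> {k \<in> \<Lambda>. m \<le> k}" "k \<in> \<Lambda>" "A.summand {D k} L"
      by (rule twist_D[OF _ step(3)]) auto
    let ?B = "P m \<restriction> N'"
    have B: "fg_module A ?B" by (rule fg_restr[OF P_fg[OF m] step(2)])
    have gs: "g ` carrier ?B = carrier L" "{x \<in> carrier ?B. g x = \<zero>\<^bsub>L\<^esub>} = N" using step(5,6) by auto
    have hB: "A.lin ?B X h" by (rule A.lin_restr_dom[OF h A.subm_subset[OF step(2)]])
    have BN: "?B \<restriction> N = P m \<restriction> N" by simp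
    obtain \<theta> where \<theta>: "A.lin (?B \<restriction> N) (V l) \<theta>" "induces \<chi> (?B \<restriction> N) h \<theta>" unfolding BN using step.IH by blast
    show ?case by (rule induces_step[OF \<chi> B L(3,1,4) step(4) gs hB \<theta>])
  qed
  from this[OF P_chain[OF m]] show ?thesis by simp
qed

text \<open>For the orbit map of an element \<open>x\<close> of \<open>X\<close>. The regular module is a summand of a sum of modules
  \<open>P m\<close>, and compatible maps add up along the decomposition of its identity.\<close>

lemma induces_regular:
  assumes \<chi>: "R.lin U (regular_module R) \<chi>" and x: "x \<in> carrier X"
  shows "\<exists>\<theta>. A.lin (regular_module A) (V l) \<theta> \<and> induces \<chi> (regular_module A) (\<lambda>a. a \<odot>\<^bsub>X\<^esub> x) \<theta>"
proof -
  note lV = V_lmod[OF l]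
  note orb = A.lin_orbit[OF X x]
  let ?A = "regular_module A"
  have "\<exists>\<theta>. A.lin ?A (V l) \<theta> \<and> induces \<chi> ?A (\<lambda>a. \<alpha> a \<odot>\<^bsub>X\<^esub> x) \<theta>" if "A.thru (P ` \<Lambda>) ?A ?A \<alpha>" for \<alpha>
    using that
  proof induction
    case zero
    have "induces \<chi> ?A (\<lambda>a. \<zero>\<^bsub>?A\<^esub> \<odot>\<^bsub>X\<^esub> x) (\<lambda>a. \<zero>\<^bsub>V l\<^esub>)"
      unfolding induces_def
    proof (intro allI impI ballI)
      fix p u z assume u: "rep (\<lambda>z. \<zero>\<^bsub>?A\<^esub> \<odot>\<^bsub>X\<^esub> x) u" and z: "z \<in> carrier (P l)"
      have "rep (\<lambda>z. \<zero>\<^bsub>X\<^esub>) u" by (rule rep_cong[OF u]) (use X x in simp)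
      then have "u = \<zero>\<^bsub>U\<^esub>" by (rule rep_unique[OF _ rep_zero])
      then show "\<zero>\<^bsub>V l\<^esub> = e (\<chi> u) z"
        using \<chi>_zero[OF \<chi>] A.lin_closed[OF \<iota>_lin[OF l] \<pi>_closed[OF z]] lV by simp
    qed
    then show ?case using A.lin_const_zero[OF lV] by blast
  next
    case (step \<alpha> M b a)
    obtain m where m: "m \<in> \<Lambda>" and M: "M = P m" using step(2) by blast
    note b = step(3)[unfolded M] and a = step(4)[unfolded M]
    have \<alpha>: "A.lin ?A ?A \<alpha>" by (rule A.thru_lin[OF step(1)]) auto
    obtain \<theta> where \<theta>: "A.lin ?A (V l) \<theta>" "induces \<chi> ?A (\<lambda>a. \<alpha> a \<odot>\<^bsub>X\<^esub> x) \<theta>" using step.IH by blast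
    obtain \<theta>' where \<theta>': "A.lin (P m) (V l) \<theta>'" "induces \<chi> (P m) (\<lambda>y. a y \<odot>\<^bsub>X\<^esub> x) \<theta>'"
      using induces_projective[OF \<chi> m A.lin_comp[OF a orb]] by blast
    have "induces \<chi> ?A (\<lambda>s. (\<alpha> s \<oplus>\<^bsub>?A\<^esub> a (b s)) \<odot>\<^bsub>X\<^esub> x) (\<lambda>s. \<theta> s \<oplus>\<^bsub>V l\<^esub> \<theta>' (b s))"
      unfolding induces_def
    proof (intro allI impI ballI)
      fix p u z assume p: "A.lin (P l) ?A p" and u: "rep (\<lambda>z. (\<alpha> (p z) \<oplus>\<^bsub>?A\<^esub> a (b (p z))) \<odot>\<^bsub>X\<^esub> x) u"
        and z: "z \<in> carrier (P l)"
      obtain v where v: "rep (\<lambda>z. \<alpha> (p z) \<odot>\<^bsub>X\<^esub> x) v"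
        using rep_exists[OF A.lin_comp[OF A.lin_comp[OF p \<alpha>] orb]] by blast
      obtain w where w: "rep (\<lambda>z. a (b (p z)) \<odot>\<^bsub>X\<^esub> x) w"
        using rep_exists[OF A.lin_comp[OF A.lin_comp[OF A.lin_comp[OF p b] a] orb]] by blast
      have vw: "v \<in> carrier U" "w \<in> carrier U" using v w by (auto simp: rep_def)
      have "rep (\<lambda>z. (\<alpha> (p z) \<oplus>\<^bsub>?A\<^esub> a (b (p z))) \<odot>\<^bsub>X\<^esub> x) (v \<oplus>\<^bsub>U\<^esub> w)"
      proof (rule rep_cong[OF rep_add[OF v w]])
        fix z assume z: "z \<in> carrier (P l)"
        have "\<alpha> (p z) \<in> carrier A" "a (b (p z)) \<in> carrier A"
          using A.lin_closed[OF A.lin_comp[OF p \<alpha>] z] A.lin_closed[OF A.lin_comp[OF A.lin_comp[OF p b] a] z] by auto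
        then show "(\<alpha> (p z) \<oplus>\<^bsub>?A\<^esub> a (b (p z))) \<odot>\<^bsub>X\<^esub> x = \<alpha> (p z) \<odot>\<^bsub>X\<^esub> x \<oplus>\<^bsub>X\<^esub> a (b (p z)) \<odot>\<^bsub>X\<^esub> x"
          using X x by (simp add: A.lm_ldistr)
      qed
      then have uvw: "u = v \<oplus>\<^bsub>U\<^esub> w" by (rule rep_unique[OF u])
      have "\<theta> (p z) = e (\<chi> v) z" using \<theta>(2) p v z unfolding induces_def by blast
      moreover have "\<theta>' (b (p z)) = e (\<chi> w) z" using \<theta>'(2) A.lin_comp[OF p b] w z unfolding induces_def by blast
      ultimately show "\<theta> (p z) \<oplus>\<^bsub>V l\<^esub> \<theta>' (b (p z)) = e (\<chi> u) z"
        unfolding uvw \<chi>_add[OF \<chi> vw] using e_add[OF \<chi>_closed[OF \<chi> vw(1)] \<chi>_closed[OF \<chi> vw(2)] z] by simp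
    qed
    then show ?case using A.lin_plus[OF \<theta>(1) A.lin_comp[OF b \<theta>'(1)] lV] by blast
  next
    case (ext \<alpha> \<beta>)
    obtain \<theta> where \<theta>: "A.lin ?A (V l) \<theta>" "induces \<chi> ?A (\<lambda>a. \<alpha> a \<odot>\<^bsub>X\<^esub> x) \<theta>" using ext.IH by blast
    have "induces \<chi> ?A (\<lambda>a. \<beta> a \<odot>\<^bsub>X\<^esub> x) \<theta>"
      unfolding induces_def
    proof (intro allI impI ballI)
      fix p u z assume p: "A.lin (P l) ?A p" and u: "rep (\<lambda>z. \<beta> (p z) \<odot>\<^bsub>X\<^esub> x) u" and z: "z \<in> carrier (P l)"
      have "rep (\<lambda>z. \<alpha> (p z) \<odot>\<^bsub>X\<^esub> x) u" by (rule rep_cong[OF u]) (use ext(2) A.lin_closed[OF p] in auto)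
      then show "\<theta> (p z) = e (\<chi> u) z" using \<theta>(2) p z unfolding induces_def by blast
    qed
    then show ?case using \<theta>(1) by blast
  qed
  from this[OF P_gen[unfolded A.summand_def]] show ?thesis .
qed

text \<open>The value of the wanted map at \<open>x\<close> is the value at \<open>1\<close> of the compatible map attached to the orbit map of
  \<open>x\<close>. Linearity in \<open>x\<close> follows from uniqueness of compatible maps, as does the formula for \<open>\<eta> u y\<close>, where a
  compatible map can be written down.\<close>

theorem coextend:
  assumes \<chi>: "R.lin U (regular_module R) \<chi>"
  obtains f where "A.lin X (V l) f" "\<forall>u\<in>carrier U. \<forall>y\<in>carrier (D l). f (\<eta> u y) = scal (\<chi> u) \<odot>\<^bsub>V l\<^esub> \<iota> l y"
proof -
  note lV = V_lmod[OF l]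
  let ?A = "regular_module A"
  define \<Theta> where "\<Theta> x = (SOME \<theta>. A.lin ?A (V l) \<theta> \<and> induces \<chi> ?A (\<lambda>a. a \<odot>\<^bsub>X\<^esub> x) \<theta>)" for x
  have \<Theta>: "A.lin ?A (V l) (\<Theta> x)" "induces \<chi> ?A (\<lambda>a. a \<odot>\<^bsub>X\<^esub> x) (\<Theta> x)" if "x \<in> carrier X" for x
    using someI_ex[OF induces_regular[OF \<chi> that]] by (auto simp: \<Theta>_def)
  have eq: "\<Theta> x a = \<theta> a" if "x \<in> carrier X" "A.lin ?A (V l) \<theta>" "induces \<chi> ?A (\<lambda>a. a \<odot>\<^bsub>X\<^esub> x) \<theta>" "a \<in> carrier A" for x \<theta> a
    using induces_unique[OF A.lmod_regular A.lin_orbit[OF X that(1)] \<Theta>(1)[OF that(1)] that(2) \<Theta>(2)[OF that(1)] that(3) \<chi>] that(4)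
    by simp
  define f where "f x = \<Theta> x \<one>\<^bsub>A\<^esub>" for x
  have f: "A.lin X (V l) f"
  proof (rule A.linI)
    show "f x \<in> carrier (V l)" if "x \<in> carrier X" for x
      using A.lin_closed[OF \<Theta>(1)[OF that]] by (simp add: f_def)
  next
    fix x y assume xy: "x \<in> carrier X" "y \<in> carrier X"
    have "induces \<chi> ?A (\<lambda>a. a \<odot>\<^bsub>X\<^esub> (x \<oplus>\<^bsub>X\<^esub> y)) (\<lambda>a. \<Theta> x a \<oplus>\<^bsub>V l\<^esub> \<Theta> y a)"
      unfolding induces_def
    proof (intro allI impI ballI)
      fix p u z assume p: "A.lin (P l) ?A p" and u: "rep (\<lambda>z. p z \<odot>\<^bsub>X\<^esub> (x \<oplus>\<^bsub>X\<^esub> y)) u" and z: "z \<in> carrier (P l)"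
      obtain v where v: "rep (\<lambda>z. p z \<odot>\<^bsub>X\<^esub> x) v"
        using rep_exists[OF A.lin_comp[OF p A.lin_orbit[OF X xy(1)]]] by blast
      obtain w where w: "rep (\<lambda>z. p z \<odot>\<^bsub>X\<^esub> y) w"
        using rep_exists[OF A.lin_comp[OF p A.lin_orbit[OF X xy(2)]]] by blast
      have vw: "v \<in> carrier U" "w \<in> carrier U" using v w by (auto simp: rep_def)
      have "rep (\<lambda>z. p z \<odot>\<^bsub>X\<^esub> (x \<oplus>\<^bsub>X\<^esub> y)) (v \<oplus>\<^bsub>U\<^esub> w)"
        by (rule rep_cong[OF rep_add[OF v w]]) (use A.lin_closed[OF p] X xy in \<open>simp add: A.lm_rdistr\<close>)
      then have uvw: "u = v \<oplus>\<^bsub>U\<^esub> w" by (rule rep_unique[OF u])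
      have "\<Theta> x (p z) = e (\<chi> v) z" "\<Theta> y (p z) = e (\<chi> w) z"
        using \<Theta>(2)[OF xy(1)] \<Theta>(2)[OF xy(2)] p v w z unfolding induces_def by blast+
      then show "\<Theta> x (p z) \<oplus>\<^bsub>V l\<^esub> \<Theta> y (p z) = e (\<chi> u) z"
        unfolding uvw \<chi>_add[OF \<chi> vw] using e_add[OF \<chi>_closed[OF \<chi> vw(1)] \<chi>_closed[OF \<chi> vw(2)] z] by simp
    qed
    from eq[OF A.lm_add[OF X xy] A.lin_plus[OF \<Theta>(1)[OF xy(1)] \<Theta>(1)[OF xy(2)] lV] this A.one_closed]
    show "f (x \<oplus>\<^bsub>X\<^esub> y) = f x \<oplus>\<^bsub>V l\<^esub> f y" unfolding f_def .
  next
    fix b x assume b: "b \<in> carrier A" and x: "x \<in> carrier X"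
    have rb: "A.lin ?A ?A (\<lambda>a. a \<otimes>\<^bsub>A\<^esub> b)" using A.lin_orbit[OF A.lmod_regular, of b] b by simp
    have "induces \<chi> ?A (\<lambda>a. a \<odot>\<^bsub>X\<^esub> (b \<odot>\<^bsub>X\<^esub> x)) (\<lambda>a. \<Theta> x (a \<otimes>\<^bsub>A\<^esub> b))"
      unfolding induces_def
    proof (intro allI impI ballI)
      fix p u z assume p: "A.lin (P l) ?A p" and u: "rep (\<lambda>z. p z \<odot>\<^bsub>X\<^esub> (b \<odot>\<^bsub>X\<^esub> x)) u" and z: "z \<in> carrier (P l)"
      have "rep (\<lambda>z. (p z \<otimes>\<^bsub>A\<^esub> b) \<odot>\<^bsub>X\<^esub> x) u"
        by (rule rep_cong[OF u]) (use A.lin_closed[OF p] X x b in \<open>simp add: A.lm_assoc\<close>)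
      with A.lin_comp[OF p rb] \<Theta>(2)[OF x, unfolded induces_def]
      have "\<forall>z\<in>carrier (P l). \<Theta> x (p z \<otimes>\<^bsub>A\<^esub> b) = e (\<chi> u) z" by (elim allE impE) assumption+
      then show "\<Theta> x (p z \<otimes>\<^bsub>A\<^esub> b) = e (\<chi> u) z" using z by blast
    qed
    from eq[OF A.lm_smult[OF X b x] A.lin_comp[OF rb \<Theta>(1)[OF x]] this A.one_closed]
    have "f (b \<odot>\<^bsub>X\<^esub> x) = \<Theta> x b" using b by (simp add: f_def)
    also have "\<dots> = b \<odot>\<^bsub>V l\<^esub> f x" using A.lin_regular[OF \<Theta>(1)[OF x] b] by (simp add: f_def)
    finally show "f (b \<odot>\<^bsub>X\<^esub> x) = b \<odot>\<^bsub>V l\<^esub> f x" .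
  qed
  have "f (\<eta> u y) = scal (\<chi> u) \<odot>\<^bsub>V l\<^esub> \<iota> l y" if u: "u \<in> carrier U" and y: "y \<in> carrier (D l)" for u y
  proof -
    obtain z0 where z0: "z0 \<in> carrier (P l)" "y = \<pi> l z0" using y \<pi>_surj[OF l] by auto
    note orb = A.lin_orbit[OF P_lmod[OF l] z0(1)]
    have \<eta>y: "\<eta> u y \<in> carrier X" by (rule \<eta>_closed[OF u y])
    note \<chi>u = \<chi>_closed[OF \<chi> u]
    let ?\<theta> = "\<lambda>a. scal (\<chi> u) \<odot>\<^bsub>V l\<^esub> \<iota> l (\<pi> l (a \<odot>\<^bsub>P l\<^esub> z0))"
    have \<theta>: "A.lin ?A (V l) ?\<theta>"
      by (rule lin_scal[OF A.lin_comp[OF A.lin_comp[OF orb \<pi>_lin[OF l]] \<iota>_lin[OF l]] lV \<chi>u])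
    have "induces \<chi> ?A (\<lambda>a. a \<odot>\<^bsub>X\<^esub> \<eta> u y) ?\<theta>"
      unfolding induces_def
    proof (intro allI impI ballI)
      fix p v z assume p: "A.lin (P l) ?A p" and v: "rep (\<lambda>z. p z \<odot>\<^bsub>X\<^esub> \<eta> u y) v" and z: "z \<in> carrier (P l)"
      obtain c where c: "c \<in> carrier R" "\<forall>z\<in>carrier (P l). \<pi> l (p z \<odot>\<^bsub>P l\<^esub> z0) = scal c \<odot>\<^bsub>D l\<^esub> \<pi> l z"
        using P_to_D[OF l A.lin_comp[OF A.lin_comp[OF p orb] \<pi>_lin[OF l]]] by blast
      have "rep (\<lambda>z. p z \<odot>\<^bsub>X\<^esub> \<eta> u y) (c \<odot>\<^bsub>U\<^esub> u)"
        unfolding rep_def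
      proof (intro conjI ballI)
        fix z assume z: "z \<in> carrier (P l)"
        have pz: "p z \<in> carrier A" using A.lin_closed[OF p z] by simp
        have "p z \<odot>\<^bsub>X\<^esub> \<eta> u y = \<eta> u (p z \<odot>\<^bsub>D l\<^esub> \<pi> l z0)"
          using A.lin_smult[OF \<eta>_lin[OF u] pz y] z0(2) by simp
        also have "p z \<odot>\<^bsub>D l\<^esub> \<pi> l z0 = scal c \<odot>\<^bsub>D l\<^esub> \<pi> l z"
          using A.lin_smult[OF \<pi>_lin[OF l] pz z0(1)] c(2) z by simp
        also have "\<eta> u (scal c \<odot>\<^bsub>D l\<^esub> \<pi> l z) = \<eta> (c \<odot>\<^bsub>U\<^esub> u) (\<pi> l z)"
          using A.lin_smult[OF \<eta>_lin[OF u] scal_closed[OF c(1)] \<pi>_closed[OF z]] \<eta>_smult[OF u c(1) \<pi>_closed[OF z]] by simp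
        finally show "p z \<odot>\<^bsub>X\<^esub> \<eta> u y = \<eta> (c \<odot>\<^bsub>U\<^esub> u) (\<pi> l z)" .
      qed (use U c u in simp)
      then have "v = c \<odot>\<^bsub>U\<^esub> u" by (rule rep_unique[OF v])
      then have "e (\<chi> v) z = scal c \<odot>\<^bsub>V l\<^esub> e (\<chi> u) z" using \<chi>_smult[OF \<chi> u c(1)] e_times[OF c(1) \<chi>u z] by simp
      also have "\<dots> = scal (\<chi> u) \<odot>\<^bsub>V l\<^esub> (scal c \<odot>\<^bsub>V l\<^esub> \<iota> l (\<pi> l z))"
        using scal_central[OF lV \<chi>u scal_closed[OF c(1)] A.lin_closed[OF \<iota>_lin[OF l] \<pi>_closed[OF z]]] by simp
      also have "\<dots> = ?\<theta> (p z)"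
        using c(2) z A.lin_smult[OF \<iota>_lin[OF l] scal_closed[OF c(1)] \<pi>_closed[OF z]] by simp
      finally show "?\<theta> (p z) = e (\<chi> v) z" by simp
    qed
    from eq[OF \<eta>y \<theta> this, of "\<one>\<^bsub>A\<^esub>"] show ?thesis using z0 l by (simp add: f_def)
  qed
  then show ?thesis using that f by blast
qed

end

section \<open>Costandard filtrations\<close>

context costandard_modules
begin

text \<open>With \<open>U \<simeq> Hom(D l, X)\<close> projective, write the identity of \<open>U\<close> as \<open>\<Sum> v\<^sub>i \<chi>\<^sub>i\<close> and realise each
  functional \<open>\<chi>\<^sub>i\<close> by a map \<open>f\<^sub>i\<close> from \<open>X\<close> to \<open>V l\<close>. Then \<open>\<phi> = \<Sum> f\<^sub>i \<otimes> v\<^sub>i\<close> sends the map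
  \<open>D l \<rightarrow> X\<close> with parameter \<open>u\<close> to \<open>\<iota> \<otimes> u\<close>. So all maps from \<open>D l\<close> to \<open>V l \<otimes> U\<close> lift, and other standard
  modules have none; this gives surjectivity and the vanishing of extensions of the kernel. As \<open>\<iota>\<close> is
  faithful and functionals separate the elements of \<open>U\<close>, no nonzero map from \<open>D l\<close> is killed.\<close>

lemma costandard_quotient:
  assumes l: "l \<in> \<Lambda>" and fgX: "fg_module A X" and ext': "\<forall>m\<in>\<Lambda>. ext_vanishes m X"
    and vanish': "\<forall>m\<in>\<Lambda>. l < m \<longrightarrow> (\<forall>f. A.lin (D m) X f \<longrightarrow> (\<forall>x\<in>carrier (D m). f x = \<zero>\<^bsub>X\<^esub>))"
    and proj: "Rproj (hom_module A (D l) X)"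
  obtains U :: "'r umodule" and q \<phi> where "fg_projective R U"
    "R.lin (hom_module A (D l) X) U q" "bij_betw q (mod_hom A (D l) X) (carrier U)"
    "A.lin X (tensor_module R A (V l) U) \<phi>" "\<phi> ` carrier X = carrier (tensor_module R A (V l) U)"
    "\<forall>w. A.lin (D l) X w \<longrightarrow> (\<forall>y\<in>carrier (D l). \<phi> (w y) = \<zero>\<^bsub>tensor_module R A (V l) U\<^esub>)
      \<longrightarrow> (\<forall>y\<in>carrier (D l). w y = \<zero>\<^bsub>X\<^esub>)"
    "\<forall>m\<in>\<Lambda>. m \<noteq> l \<longrightarrow> (\<forall>w. A.lin (D m) (tensor_module R A (V l) U) w
      \<longrightarrow> (\<forall>y\<in>carrier (D m). w y = \<zero>\<^bsub>tensor_module R A (V l) U\<^esub>))"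
    "\<forall>m\<in>\<Lambda>. ext_vanishes m (X \<restriction> {x \<in> carrier X. \<phi> x = \<zero>\<^bsub>tensor_module R A (V l) U\<^esub>})"
proof -
  have X: "A.lmod X" using fgX by simp
  note ext = bspec[OF ext'] and vanish = vanish'[rule_format]
  note lD = D_lmod[OF l] and lV = V_lmod[OF l]
  let ?H = "hom_module A (D l) X"
  note H = lmod_hom_module[OF lD X]
  obtain U :: "'r umodule" and q where U: "fg_projective R U" "R.lin ?H U q" "bij_betw q (carrier ?H) (carrier U)"
    using realize_Rproj[OF H proj] by metis
  have lU: "R.lmod U" "Rproj U" using R.fg_projective_summand[OF U(1)] by auto
  obtain \<eta> where \<eta>: "R.lin U ?H \<eta>" "\<forall>f\<in>carrier ?H. \<eta> (q f) = f" "\<forall>u\<in>carrier U. q (\<eta> u) = u"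
    by (rule R.inverse_lin[OF H lU(1) U(2,3)])
  have \<eta>H: "\<eta> u \<in> mod_hom A (D l) X" if "u \<in> carrier U" for u using R.lin_closed[OF \<eta>(1) that] by simp
  interpret C: coextension R A \<Lambda> D P \<pi> V \<iota> l X U \<eta>
  proof (rule coextension.intro[OF costandard_modules_axioms], rule coextension_axioms.intro)
    show "A.lin (D l) X (\<eta> u)" if "u \<in> carrier U" for u using \<eta>H[OF that] by (simp add: A.mod_hom_iff)
    show "\<exists>u\<in>carrier U. \<forall>x\<in>carrier (D l). f x = \<eta> u x" if f: "A.lin (D l) X f" for f
    proof -
      have r: "restrict f (carrier (D l)) \<in> carrier ?H" using A.restrict_mod_hom[OF lD f] by simp
      show ?thesis
        using bspec[OF \<eta>(2) r] R.lin_closed[OF U(2) r] by (intro bexI[of _ "q (restrict f (carrier (D l)))"]) auto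
    qed
    show "\<eta> (u \<oplus>\<^bsub>U\<^esub> v) x = \<eta> u x \<oplus>\<^bsub>X\<^esub> \<eta> v x" if "u \<in> carrier U" "v \<in> carrier U" "x \<in> carrier (D l)" for u v x
      using R.lin_add[OF \<eta>(1) that(1,2)] that(3) by simp
    show "\<eta> (r \<odot>\<^bsub>U\<^esub> u) x = scal r \<odot>\<^bsub>X\<^esub> \<eta> u x" if "u \<in> carrier U" "r \<in> carrier R" "x \<in> carrier (D l)" for u r x
      using R.lin_smult[OF \<eta>(1) that(2,1)] that(3) by simp
    show "u = \<zero>\<^bsub>U\<^esub>" if u: "u \<in> carrier U" "\<forall>x\<in>carrier (D l). \<eta> u x = \<zero>\<^bsub>X\<^esub>" for u
    proof -
      have "\<eta> u = \<zero>\<^bsub>?H\<^esub>" by (rule mod_hom_eqI[OF \<eta>H[OF u(1)]]) (use R.lm_zero[OF H] u(2) in auto)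
      then have "q (\<eta> u) = \<zero>\<^bsub>U\<^esub>" using R.lin_zero[OF U(2) H lU(1)] by simp
      then show ?thesis using bspec[OF \<eta>(3) u(1)] by simp
    qed
  qed (use l X lU vanish in auto)
  let ?T = "tensor_module R A (V l) U"
  note T = lmod_tensor[OF lV lU(1)]
  have \<iota>c: "\<iota> l y \<in> carrier (V l)" if "y \<in> carrier (D l)" for y by (rule A.lin_closed[OF \<iota>_lin[OF l] that])
  have "\<exists>\<phi>. A.lin X ?T \<phi> \<and> (\<forall>u\<in>carrier U. \<forall>y\<in>carrier (D l). \<phi> (\<eta> u y) = tens (V l) U (\<iota> l y) (\<alpha> u))"
    if "R.thru {regular_module R} U U \<alpha>" for \<alpha>
    using that
  proof induction
    case zero
    show ?case
      using A.lin_const_zero[OF T, of X] tens_zero_right[OF lV lU(1) \<iota>c] by (intro exI[of _ "\<lambda>x. \<zero>\<^bsub>?T\<^esub>"]) auto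
  next
    case (step \<alpha> M b a)
    have M: "M = regular_module R" using step(2) by simp
    note b = step(3)[unfolded M] and a = step(4)[unfolded M]
    obtain \<phi> where \<phi>: "A.lin X ?T \<phi>" "\<forall>u\<in>carrier U. \<forall>y\<in>carrier (D l). \<phi> (\<eta> u y) = tens (V l) U (\<iota> l y) (\<alpha> u)"
      using step.IH by blast
    obtain f where f: "A.lin X (V l) f" "\<forall>u\<in>carrier U. \<forall>y\<in>carrier (D l). f (\<eta> u y) = scal (b u) \<odot>\<^bsub>V l\<^esub> \<iota> l y"
      by (rule C.coextend[OF b])
    have \<alpha>: "R.lin U U \<alpha>" by (rule R.thru_lin[OF step(1) lU(1) lU(1)])
    define v where "v = a \<one>\<^bsub>R\<^esub>"
    have v: "v \<in> carrier U" using R.lin_closed[OF a] by (simp add: v_def)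
    have "\<phi> (\<eta> u y) \<oplus>\<^bsub>?T\<^esub> tens (V l) U (f (\<eta> u y)) v = tens (V l) U (\<iota> l y) (\<alpha> u \<oplus>\<^bsub>U\<^esub> a (b u))"
      if u: "u \<in> carrier U" and y: "y \<in> carrier (D l)" for u y
    proof -
      have bu: "b u \<in> carrier R" using R.lin_closed[OF b u] by simp
      have "a (b u) = b u \<odot>\<^bsub>U\<^esub> v" using R.lin_regular[OF a bu] by (simp add: v_def)
      moreover have "tens (V l) U (f (\<eta> u y)) v = tens (V l) U (\<iota> l y) (b u \<odot>\<^bsub>U\<^esub> v)"
        using f(2) u y tens_balanced[OF lV lU(1) \<iota>c[OF y] v bu] by simp
      ultimately show ?thesis
        using \<phi>(2) u y tens_add_right[OF lV lU(1) \<iota>c[OF y] R.lin_closed[OF \<alpha> u], of "b u \<odot>\<^bsub>U\<^esub> v"] bu v lU(1) by simp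
    qed
    then show ?case
      using A.lin_plus[OF \<phi>(1) A.lin_comp[OF f(1) tens_lin[OF lV lU(1) v]] T]
      by (intro exI[of _ "\<lambda>x. \<phi> x \<oplus>\<^bsub>?T\<^esub> tens (V l) U (f x) v"]) auto
  next
    case (ext \<alpha> \<beta>)
    then show ?case by auto
  qed
  from this[OF lU(2)[unfolded R.summand_def]]
  obtain \<phi> where \<phi>: "A.lin X ?T \<phi>" "\<forall>u\<in>carrier U. \<forall>y\<in>carrier (D l). \<phi> (\<eta> u y) = tens (V l) U (\<iota> l y) u"
    by blast
  have other: "w y = \<zero>\<^bsub>?T\<^esub>" if "m \<in> \<Lambda>" "m \<noteq> l" "A.lin (D m) ?T w" "y \<in> carrier (D m)" for m w y
  proof (rule A.summand_vanish_into[OF summand_tensor[OF lV lU] that(3) T D_lmod[OF that(1)] _ _ that(4)])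
    show "A.lmod M" if "M \<in> {V l}" for M using that lV by simp
    show "b x = \<zero>\<^bsub>M\<^esub>" if "M \<in> {V l}" "A.lin (D m) M b" "x \<in> carrier (D m)" for M b x
      using V_hom[OF \<open>m \<in> \<Lambda>\<close> l \<open>m \<noteq> l\<close>] that by auto
  qed
  have lift: "\<exists>h. A.lin (D m) X h \<and> (\<forall>x\<in>carrier (D m). \<phi> (h x) = w x)" if m: "m \<in> \<Lambda>" and w: "A.lin (D m) ?T w" for m w
  proof (cases "m = l")
    case False
    then show ?thesis
      using other[OF m False w] A.lin_const_zero[OF X] A.lin_zero[OF \<phi>(1) X T] by (intro exI[of _ "\<lambda>x. \<zero>\<^bsub>X\<^esub>"]) auto
  next
    case True
    obtain u where "u \<in> carrier U" "\<forall>x\<in>carrier (D l). w x = tens (V l) U (\<iota> l x) u"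
      using lin_into_tensor[OF lV lU lD \<iota>_lin[OF l] \<iota>_gen[OF l]] w True by blast
    then show ?thesis using \<phi>(2) C.\<eta>_lin True by (intro exI[of _ "\<eta> u"]) auto
  qed
  have "\<phi> ` carrier X = carrier ?T" by (rule surj_from_standard[OF fgX T \<phi>(1) ext lift])
  moreover have "w y = \<zero>\<^bsub>X\<^esub>" if w: "A.lin (D l) X w" "\<forall>y\<in>carrier (D l). \<phi> (w y) = \<zero>\<^bsub>?T\<^esub>" and y: "y \<in> carrier (D l)" for w y
  proof -
    obtain u where u: "u \<in> carrier U" "\<forall>x\<in>carrier (D l). w x = \<eta> u x" using C.\<eta>_onto[OF w(1)] by blast
    have "u = \<zero>\<^bsub>U\<^esub>"
    proof (rule Rproj_functionals[OF lU u(1)])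
      fix \<chi> assume \<chi>: "R.lin U (regular_module R) \<chi>"
      obtain \<beta> where \<beta>: "A.lin ?T (V l) \<beta>" "\<And>m u. \<lbrakk>m \<in> carrier (V l); u \<in> carrier U\<rbrakk> \<Longrightarrow> \<beta> (tens (V l) U m u) = scal (\<chi> u) \<odot>\<^bsub>V l\<^esub> m"
        using tensor_contraction[OF lV lU(1) \<chi>] by metis
      have "\<forall>x\<in>carrier (D l). scal (\<chi> u) \<odot>\<^bsub>V l\<^esub> \<iota> l x = \<zero>\<^bsub>V l\<^esub>"
      proof
        fix x assume x: "x \<in> carrier (D l)"
        have "tens (V l) U (\<iota> l x) u = \<zero>\<^bsub>?T\<^esub>" using \<phi>(2) u w(2) x by auto
        then show "scal (\<chi> u) \<odot>\<^bsub>V l\<^esub> \<iota> l x = \<zero>\<^bsub>V l\<^esub>"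
          using \<beta>(2)[OF \<iota>c[OF x] u(1)] A.lin_zero[OF \<beta>(1) T lV] by simp
      qed
      then show "\<chi> u = \<zero>\<^bsub>R\<^esub>" using \<iota>_faithful[OF l] R.lin_closed[OF \<chi> u(1)] by simp
    qed
    then show ?thesis using u(2) y C.\<eta>_zero[OF y] by simp
  qed
  moreover have "ext_vanishes m (X \<restriction> {x \<in> carrier X. \<phi> x = \<zero>\<^bsub>?T\<^esub>})" if m: "m \<in> \<Lambda>" for m
    by (rule ext_vanishes_kernel[OF m ext[OF m] X T \<phi>(1) lift[OF m]])
  ultimately show ?thesis using that[OF U(1,2) _ \<phi>(1)] U(3) other by auto
qed

text \<open>Induction on the set \<open>Q\<close> of weights whose standard modules may map to \<open>N\<close>, removing a maximal
  weight \<open>l\<close> by passing to the kernel of the quotient above. The last hypothesis, preserved because other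
  standard modules have no maps to \<open>V l \<otimes> U\<close>, identifies \<open>Hom(D m, N)\<close> with \<open>Hom(D m, T)\<close> for \<open>m\<close> in \<open>Q\<close>, so
  that projectivity over \<open>R\<close> has to be known for \<open>T\<close> only. When \<open>Q\<close> is empty, the generators \<open>P k\<close> have
  no maps to \<open>N\<close>.\<close>

lemma costandard_chain:
  assumes T: "fg_module A T" and proj: "\<And>m. m \<in> \<Lambda> \<Longrightarrow> Rproj (hom_module A (D m) T)"
    and Q: "Q \<subseteq> \<Lambda>" and N: "A.subm N T" and ext: "\<And>m. m \<in> \<Lambda> \<Longrightarrow> ext_vanishes m (T \<restriction> N)"
    and out: "\<And>m w y. \<lbrakk>m \<in> \<Lambda> - Q; A.lin (D m) (T \<restriction> N) w; y \<in> carrier (D m)\<rbrakk> \<Longrightarrow> w y = \<zero>\<^bsub>T\<^esub>"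
    and ins: "\<And>m w y. \<lbrakk>m \<in> Q; A.lin (D m) T w; y \<in> carrier (D m)\<rbrakk> \<Longrightarrow> w y \<in> N"
  shows "A.fchain (twists R A Q V) T {\<zero>\<^bsub>T\<^esub>} N"
  using Q N ext out ins
proof (induction "card Q" arbitrary: Q N)
  case 0
  then have Q: "Q = {}" using finite_subset[OF 0(2) finite_\<Lambda>] by simp
  have lT: "A.lmod T" using T by simp
  have TN: "A.lmod (T \<restriction> N)" by (rule A.lmod_restr[OF lT 0(3)])
  have "{\<zero>\<^bsub>T\<^esub>} = carrier (T \<restriction> N)"
  proof (rule A.generated_by[OF P_gen TN])
    show "A.subm {\<zero>\<^bsub>T\<^esub>} (T \<restriction> N)" using A.subm_zero_set[OF TN] by simp
    fix M f x assume M: "M \<in> P ` \<Lambda>" "A.lin M (T \<restriction> N) f" "x \<in> carrier M"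
    then obtain k where k: "k \<in> \<Lambda>" "M = P k" by blast
    have "f x = \<zero>\<^bsub>T \<restriction> N\<^esub>"
      by (rule P_vanish[OF k(1) TN _ M(2)[unfolded k(2)] M(3)[unfolded k(2)]]) (use 0(5) Q in simp)
    then show "f x \<in> {\<zero>\<^bsub>T\<^esub>}" by simp
  qed
  then have "N = {\<zero>\<^bsub>T\<^esub>}" by simp
  then show ?case by (simp add: A.fchain.base)
next
  case (Suc n)
  note N = Suc.prems(2) and Q = Suc.prems(1)
  have lT: "A.lmod T" using T by simp
  have "Q \<noteq> {}" using Suc(2) by auto
  then obtain l where lQ: "l \<in> Q" and max: "\<And>m. m \<in> Q \<Longrightarrow> \<not> l < m"
    using finite_has_maximal[OF finite_subset[OF Q finite_\<Lambda>]] by (metis order.strict_iff_order)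
  have l: "l \<in> \<Lambda>" using lQ Q by auto
  let ?X = "T \<restriction> N"
  have X: "fg_module A ?X" by (rule fg_restr[OF T N])
  have "mod_hom A (D l) ?X = mod_hom A (D l) T"
  proof (intro equalityI subsetI)
    fix w assume "w \<in> mod_hom A (D l) ?X"
    then show "w \<in> mod_hom A (D l) T" using A.lin_restr_cod[where M = "D l" and N = T and K = N and f = w] A.subm_subset[OF N] by (simp add: A.mod_hom_iff)
  next
    fix w assume w: "w \<in> mod_hom A (D l) T"
    then show "w \<in> mod_hom A (D l) ?X"
      using A.lin_to_restr[of "D l" T w N] Suc.prems(5)[OF lQ] by (simp add: A.mod_hom_iff)
  qed
  then have "hom_module A (D l) ?X = hom_module A (D l) T" by (simp add: hom_module_def)
  then have pX: "Rproj (hom_module A (D l) ?X)" using proj[OF l] by simp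
  have vX: "\<forall>m\<in>\<Lambda>. l < m \<longrightarrow> (\<forall>f. A.lin (D m) ?X f \<longrightarrow> (\<forall>x\<in>carrier (D m). f x = \<zero>\<^bsub>?X\<^esub>))"
    using Suc.prems(4) max by auto
  have eX: "\<forall>m\<in>\<Lambda>. ext_vanishes m ?X" using Suc.prems(3) by blast
  obtain U :: "'r umodule" and q \<phi> where U: "fg_projective R U"
    and \<phi>: "A.lin ?X (tensor_module R A (V l) U) \<phi>" "\<phi> ` carrier ?X = carrier (tensor_module R A (V l) U)"
    and own: "\<forall>w. A.lin (D l) ?X w \<longrightarrow> (\<forall>y\<in>carrier (D l). \<phi> (w y) = \<zero>\<^bsub>tensor_module R A (V l) U\<^esub>)
      \<longrightarrow> (\<forall>y\<in>carrier (D l). w y = \<zero>\<^bsub>?X\<^esub>)"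
    and other: "\<forall>m\<in>\<Lambda>. m \<noteq> l \<longrightarrow> (\<forall>w. A.lin (D m) (tensor_module R A (V l) U) w
      \<longrightarrow> (\<forall>y\<in>carrier (D m). w y = \<zero>\<^bsub>tensor_module R A (V l) U\<^esub>))"
    and ext': "\<forall>m\<in>\<Lambda>. ext_vanishes m (?X \<restriction> {x \<in> carrier ?X. \<phi> x = \<zero>\<^bsub>tensor_module R A (V l) U\<^esub>})"
    by (rule costandard_quotient[OF l X eX vX pX])
  let ?T = "tensor_module R A (V l) U"
  have lU: "A.lmod ?T" by (rule lmod_tensor[OF V_lmod[OF l] R.fg_projective_summand(1)[OF U]])
  define N' where "N' = {x \<in> N. \<phi> x = \<zero>\<^bsub>?T\<^esub>}"
  have N'e: "{x \<in> carrier ?X. \<phi> x = \<zero>\<^bsub>?T\<^esub>} = N'" by (simp add: N'_def)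
  have "A.subm N' ?X" unfolding N'e[symmetric] by (rule A.subm_ker[OF \<phi>(1) A.fg_lmod[OF X] lU])
  then have N': "A.subm N' T" "N' \<subseteq> N" using A.subm_restr[OF lT N] by auto
  have restr_eq: "?X \<restriction> N' = T \<restriction> N'" by simp
  have "A.fchain (twists R A (Q - {l}) V) T {\<zero>\<^bsub>T\<^esub>} N'"
  proof (rule Suc.hyps(1))
    show "n = card (Q - {l})" using Suc(2) lQ finite_subset[OF Q finite_\<Lambda>] by simp
    show "Q - {l} \<subseteq> \<Lambda>" using Q by auto
    show "A.subm N' T" by (rule N'(1))
    show "ext_vanishes m (T \<restriction> N')" if "m \<in> \<Lambda>" for m using ext' that unfolding N'e restr_eq by blast
    show "w y = \<zero>\<^bsub>T\<^esub>" if m: "m \<in> \<Lambda> - (Q - {l})" and w: "A.lin (D m) (T \<restriction> N') w" and y: "y \<in> carrier (D m)" for m w y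
    proof -
      have wX: "A.lin (D m) ?X w" using A.lin_restr_cod[where M = "D m" and N = ?X and K = N' and f = w] w N'(2) by simp
      show ?thesis
      proof (cases "m = l")
        case True
        have "\<forall>y\<in>carrier (D l). \<phi> (w y) = \<zero>\<^bsub>?T\<^esub>" using A.lin_closed[OF w] True by (auto simp: N'_def)
        then show ?thesis using own wX True y by auto
      next
        case False
        then show ?thesis using Suc.prems(4)[OF _ wX y] m by auto
      qed
    qed
    show "w y \<in> N'" if m: "m \<in> Q - {l}" and w: "A.lin (D m) T w" and y: "y \<in> carrier (D m)" for m w y
    proof -
      have wN: "w y \<in> N" if "y \<in> carrier (D m)" for y using Suc.prems(5)[OF _ w that] m by blast
      have wX: "A.lin (D m) ?X w" by (rule A.lin_to_restr[OF w wN])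
      have "\<phi> (w y) = \<zero>\<^bsub>?T\<^esub>" using other A.lin_comp[OF wX \<phi>(1)] m y Q by blast
      then show ?thesis using wN[OF y] by (simp add: N'_def)
    qed
  qed
  then have "A.fchain (twists R A Q V) T {\<zero>\<^bsub>T\<^esub>} N'"
    by (rule A.fchain_mono) (auto simp: twists_def)
  moreover have "?T \<in> twists R A Q V" using U lQ unfolding twists_def by blast
  ultimately show ?case
    by (rule A.fchain.step[OF _ N _ \<phi>(1)]) (use \<phi>(2) in \<open>auto simp: N'_def\<close>)
qed

end

context ring_modules
begin

lemma fchain_restr:
  assumes "fchain \<theta> M N0 N" "lmod M" "subm K M" "N \<subseteq> K" shows "fchain \<theta> (M \<restriction> K) N0 N"
  using assms(1,4)
proof induction
  case base show ?case by (rule fchain.base)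
next
  case (step N N' X g)
  have "N \<subseteq> N'" using step(6) by auto
  then have ch: "fchain \<theta> (M \<restriction> K) N0 N" using step.IH step.prems by blast
  have sub: "subm N' (M \<restriction> K)" using subm_restr[OF assms(2,3)] step(2) step.prems by blast
  show ?case
    by (rule fchain.step[OF ch sub step(3) _ step(5,6)]) (use step(4) in simp)
qed

lemma short_exactI:
  assumes "lmod L" "lmod M" "lin L M f" "lin M N g" "inj_on f (carrier L)"
    "f ` carrier L = {x \<in> carrier M. g x = \<zero>\<^bsub>N\<^esub>}" "g ` carrier M = carrier N"
  shows "short_exact A L (restrict f (carrier L)) M (restrict g (carrier M)) N"
proof -
  have "mod_ker M N (restrict g (carrier M)) = {x \<in> carrier M. g x = \<zero>\<^bsub>N\<^esub>}" by (auto simp: mod_ker_def)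
  then show ?thesis
    unfolding short_exact_def using assms restrict_mod_hom[OF assms(1,3)] restrict_mod_hom[OF assms(2,4)] by simp
qed

end

section \<open>Tilting modules\<close>

context costandard_modules
begin

lemma twist_lmod:
  "X \<in> twists R A \<Lambda> D \<Longrightarrow> A.lmod X" "S \<subseteq> \<Lambda> \<Longrightarrow> Y \<in> twists R A S V \<Longrightarrow> A.lmod Y"
proof -
  show "A.lmod X" if "X \<in> twists R A \<Lambda> D" for X by (rule twist_facts[OF D_lmod that])
  show "A.lmod Y" if "S \<subseteq> \<Lambda>" "Y \<in> twists R A S V" for S Y
    by (rule twist_facts[OF V_lmod that(2)]) (use that(1) in auto)
qed

lemma tilting_criterion:
  assumes T: "fg_module A T" and ch: "A.fchain (twists R A \<Lambda> D) T {\<zero>\<^bsub>T\<^esub>} (carrier T)"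
    and ext: "\<And>m. m \<in> \<Lambda> \<Longrightarrow> ext_vanishes m T"
  shows "partial_tilting R A \<Lambda> D V T"
    and "\<And>m. m \<in> \<Lambda> \<Longrightarrow> Rproj (hom_module A (D m) T)"
proof -
  have lT: "A.lmod T" using T by simp
  have Rp: "Rproj (Rs T)" using Rproj_filtered[OF ch lT] by simp
  show pr: "Rproj (hom_module A (D m) T)" if "m \<in> \<Lambda>" for m by (rule Rproj_hom_standard[OF T Rp ext that])
  have "A.fchain (twists R A \<Lambda> V) T {\<zero>\<^bsub>T\<^esub>} (carrier T)"
    by (rule costandard_chain[OF T pr]) (use lT ext A.lin_closed in auto)
  then show "partial_tilting R A \<Lambda> D V T"
    using T ch A.filt_iff_fchain[of "twists R A \<Lambda> D" T] A.filt_iff_fchain[of "twists R A \<Lambda> V" T] twist_lmod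
    by (auto simp: partial_tilting_def)
qed

lemma grows_chain:
  assumes M: "A.lmod M" and ch: "A.fchain (twists R A \<Lambda> D) M {\<zero>\<^bsub>M\<^esub>} (carrier M)"
    and Q: "Q \<subseteq> \<Lambda>" and gr: "grows Q M i T"
  shows "A.fchain (twists R A \<Lambda> D) T {\<zero>\<^bsub>T\<^esub>} (carrier T)"
proof -
  have T: "A.lmod T" "A.lin M T i" "inj_on i (carrier M)" "A.fchain (D ` Q) T (i ` carrier M) (carrier T)"
    using gr by (auto simp: grows_def)
  have sM: "A.subm (i ` carrier M) T" by (rule A.subm_image[OF T(2) M T(1) A.subm_carrier[OF M]])
  have ker: "{x \<in> carrier M. i x = \<zero>\<^bsub>T\<^esub>} \<subseteq> {\<zero>\<^bsub>M\<^esub>}"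
    using A.lin_inj_iff[OF T(2) M T(1)] T(3) by auto
  have "A.fchain (twists R A \<Lambda> D) T (i ` {\<zero>\<^bsub>M\<^esub>}) (i ` carrier M)"
    by (rule A.fchain_map[OF ch M T(1) A.subm_zero_set[OF M] T(2) ker twist_lmod(1)])
  then have 1: "A.fchain (twists R A \<Lambda> D) T {\<zero>\<^bsub>T\<^esub>} (i ` carrier M)"
    using A.lin_zero[OF T(2) M T(1)] by simp
  have "A.fchain (twists R A Q D) T (i ` carrier M) (carrier T)"
    by (rule fchain_self_to_twists[OF T(4,1) sM]) (use Q in auto)
  then have "A.fchain (twists R A \<Lambda> D) T (i ` carrier M) (carrier T)"
    by (rule A.fchain_mono) (use Q in \<open>auto simp: twists_def\<close>)
  then show ?thesis using 1 by (rule A.fchain_trans)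
qed

lemma cokernel_chain:
  assumes M: "A.lmod M" and Q: "Q \<subseteq> \<Lambda>" and gr: "grows Q M i T"
    and q: "A.lin T W q" "q ` carrier T = carrier W" "{x \<in> carrier T. q x = \<zero>\<^bsub>W\<^esub>} = i ` carrier M" and W: "A.lmod W"
  shows "W \<in> filt A (D ` Q)"
proof -
  have T: "fg_module A T" "A.lmod T" "A.lin M T i" "A.fchain (D ` Q) T (i ` carrier M) (carrier T)"
    using gr by (auto simp: grows_def)
  have sM: "A.subm (i ` carrier M) T" by (rule A.subm_image[OF T(3) M T(2) A.subm_carrier[OF M]])
  have D': "A.lmod X" if "X \<in> D ` Q" for X using that Q by auto
  have "A.fchain (D ` Q) W (q ` i ` carrier M) (q ` carrier T)"
    by (rule A.fchain_map[OF T(4,2) W sM q(1) _ D']) (use q(3) in auto)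
  moreover have "q ` i ` carrier M = {\<zero>\<^bsub>W\<^esub>}"
    unfolding q(3)[symmetric] using A.lin_zero[OF q(1) T(2) W] A.lm_zero[OF T(2)] by (auto simp: image_iff)
  ultimately show ?thesis
    using A.filt_iff_fchain[of "D ` Q" W, OF D'] A.fg_image[OF T(1) W q(1,2)] q(2) by simp
qed

theorem tilting_embedding:
  fixes M :: "('a, 'm) module"
  assumes M: "M \<in> filt A (twists R A \<Lambda> D)"
  shows "\<exists>(T :: 'a umodule) i. partial_tilting R A \<Lambda> D V T \<and> i \<in> mod_hom A M T \<and> inj_on i (carrier M) \<and>
    quotient_module T (i ` carrier M) \<in> filt A (D ` \<Lambda>)"
proof -
  have fg: "fg_module A M" and ch: "A.fchain (twists R A \<Lambda> D) M {\<zero>\<^bsub>M\<^esub>} (carrier M)"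
    using M A.filt_iff_fchain[OF twist_lmod(1)] by auto
  have lM: "A.lmod M" using fg by simp
  obtain T0 :: "'a umodule" and q where T0: "fg_module A T0" "A.lin M T0 q" "bij_betw q (carrier M) (carrier T0)"
    using A.realize[OF fg] by metis
  have lT0: "A.lmod T0" using T0(1) by simp
  have q: "q ` carrier M = carrier T0" "inj_on q (carrier M)" using T0(3) by (auto simp: bij_betw_def)
  have "grows {} M q T0" using T0 q by (simp add: grows_def A.fchain.base)
  obtain T i where T: "grows \<Lambda> T0 i T" "\<forall>m\<in>\<Lambda>. ext_vanishes m T" using universal_extension[OF subset_refl T0(1)] by blast
  have gr: "grows \<Lambda> M (\<lambda>x. i (q x)) T"
    using grows_trans[OF _ subset_refl lM \<open>grows {} M q T0\<close> T(1)] by simp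
  have lT: "A.lmod T" "fg_module A T" and i: "A.lin M T (\<lambda>x. i (q x))" "inj_on (\<lambda>x. i (q x)) (carrier M)"
    using gr by (auto simp: grows_def)
  have tilt: "partial_tilting R A \<Lambda> D V T"
    by (rule tilting_criterion(1)[OF lT(2) grows_chain[OF lM ch subset_refl gr]]) (use T(2) in blast)
  let ?i = "restrict (\<lambda>x. i (q x)) (carrier M)"
  have im: "?i ` carrier M = (\<lambda>x. i (q x)) ` carrier M" by simp
  have sM: "A.subm (?i ` carrier M) T" unfolding im by (rule A.subm_image[OF i(1) lM lT(1) A.subm_carrier[OF lM]])
  have "quotient_module T (?i ` carrier M) \<in> filt A (D ` \<Lambda>)"
    by (rule cokernel_chain[OF lM subset_refl gr A.lin_quotient[OF lT(1) sM] A.quotient_surj[OF lT(1) sM] _ A.lmod_quotient[OF lT(1) sM]])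
      (use A.quotient_eq_zero[OF lT(1) sM] A.subm_subset[OF sM] im in auto)
  moreover have "?i \<in> mod_hom A M T" by (rule A.restrict_mod_hom[OF lM i(1)])
  moreover have "inj_on ?i (carrier M)" using i(2) by (simp add: inj_on_def)
  ultimately show ?thesis using tilt by blast
qed

text \<open>All weights of \<open>T\<close> are at most \<open>l\<close>, and \<open>D l\<close> occurs only once, at the bottom. Hence maps \<open>D m \<rightarrow> T\<close> vanish
  unless \<open>m \<le> l\<close>, which gives the vanishing of the extensions that were not killed, and maps
  \<open>D l \<rightarrow> T\<close> are multiples of the inclusion. So the costandard quotient for \<open>l\<close> is \<open>V l \<otimes> R\<close>, and its
  kernel is filtered by the remaining weights.\<close>

theorem tilting_of_weight:
  assumes l: "l \<in> \<Lambda>"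
  shows "\<exists>(T :: 'a umodule) (X :: 'a umodule) (Y :: 'a umodule) f g h k.
    partial_tilting R A \<Lambda> D V T \<and> short_exact A (D l) f T g X \<and> short_exact A Y h T k (V l) \<and>
    X \<in> filt A (D ` {m \<in> \<Lambda>. m < l}) \<and> Y \<in> filt A (twists R A {m \<in> \<Lambda>. m < l} V)"
proof -
  let ?Q = "{m \<in> \<Lambda>. m < l}"
  have Q: "?Q \<subseteq> \<Lambda>" by auto
  note lD = D_lmod[OF l] and lV = V_lmod[OF l]
  obtain T0 :: "'a umodule" and q where T0: "fg_module A T0" "A.lin (D l) T0 q" "bij_betw q (carrier (D l)) (carrier T0)"
    using A.realize[OF D_fg[OF l]] by metis
  have q: "q ` carrier (D l) = carrier T0" "inj_on q (carrier (D l))" using T0(3) by (auto simp: bij_betw_def)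
  have gr0: "grows {} (D l) q T0" using T0 q by (simp add: grows_def A.fchain.base)
  obtain T j where T: "grows ?Q T0 j T" "\<forall>m\<in>?Q. ext_vanishes m T" using universal_extension[OF Q T0(1)] by blast
  define f where "f = (\<lambda>x. j (q x))"
  have gr: "grows ?Q (D l) f T"
    unfolding f_def using grows_trans[OF _ Q lD gr0 T(1)] by simp
  have fgT: "fg_module A T" and lT: "A.lmod T" and f: "A.lin (D l) T f" "inj_on f (carrier (D l))"
    and chD: "A.fchain (D ` ?Q) T (f ` carrier (D l)) (carrier T)"
    using gr by (auto simp: grows_def)
  have sD: "A.subm (f ` carrier (D l)) T" by (rule A.subm_image[OF f(1) lD lT A.subm_carrier[OF lD]])
  have f0: "x = \<zero>\<^bsub>D l\<^esub>" if "x \<in> carrier (D l)" "f x = \<zero>\<^bsub>T\<^esub>" for x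
    using A.lin_inj_iff[OF f(1) lD lT] f(2) that by blast
  have fl: "A.lin (D l) (T \<restriction> (f ` carrier (D l))) f" by (rule A.lin_to_restr[OF f(1)]) simp
  obtain f' where f': "A.lin (T \<restriction> (f ` carrier (D l))) (D l) f'" "\<forall>x\<in>carrier (D l). f' (f x) = x"
    "\<forall>y\<in>carrier (T \<restriction> (f ` carrier (D l))). f (f' y) = y"
    by (rule A.inverse_lin[OF lD A.lmod_restr[OF lT sD] fl]) (use f(2) in \<open>simp add: bij_betw_def\<close>)
  have lands_D: "\<forall>z\<in>carrier (D m). w z \<in> f ` carrier (D l)"
    if m: "m \<in> \<Lambda>" "\<not> m < l" and w: "A.lin (D m) T w" for m w
  proof (rule lands_in_bottom[OF chD w])
    fix n g z assume n: "n \<in> ?Q" "A.lin (D m) (D n) g" "z \<in> carrier (D m)"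
    have "\<not> m \<le> n" using n(1) m(2) by auto
    then show "g z = \<zero>\<^bsub>D n\<^esub>" using D_hom[OF m(1) _ n(2) _ n(3)] n(1) by blast
  qed (use A.lin_closed[OF w] in auto)
  have vanish: "w z = \<zero>\<^bsub>T\<^esub>" if m: "m \<in> \<Lambda>" "\<not> m \<le> l" and w: "A.lin (D m) T w" and z: "z \<in> carrier (D m)" for m w z
  proof -
    have wz: "w z \<in> f ` carrier (D l)" if "z \<in> carrier (D m)" for z using lands_D[OF m(1) _ w] m(2) that by auto
    have "A.lin (D m) (T \<restriction> (f ` carrier (D l))) w" by (rule A.lin_to_restr[OF w wz])
    from D_hom[OF m(1) l A.lin_comp[OF this f'(1)] m(2) z] have "f' (w z) = \<zero>\<^bsub>D l\<^esub>" .
    then show ?thesis using bspec[OF f'(3), of "w z"] wz[OF z] A.lin_zero[OF f(1) lD lT] by simp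
  qed
  have ext: "ext_vanishes m T" if m: "m \<in> \<Lambda>" for m
  proof (cases "m < l")
    case True then show ?thesis using T(2) m by blast
  next
    case False
    have "h x = \<zero>\<^bsub>T\<^esub>" if h: "A.lin (P m \<restriction> K m) T h" and x: "x \<in> K m" for h x
      by (rule K_vanish[OF m lT _ h x]) (use vanish False in auto)
    then show ?thesis unfolding ext_vanishes_def using A.lin_const_zero[OF lT, of "P m"] by (intro allI impI exI[of _ "\<lambda>x. \<zero>\<^bsub>T\<^esub>"]) auto
  qed
  have chl: "A.fchain (twists R A \<Lambda> D) (D l) {\<zero>\<^bsub>D l\<^esub>} (carrier (D l))"
  proof (rule fchain_self_to_twists[OF _ lD A.subm_zero_set[OF lD] D_lmod])
    show "A.fchain (D ` \<Lambda>) (D l) {\<zero>\<^bsub>D l\<^esub>} (carrier (D l))"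
      by (rule A.fchain.step[OF A.fchain.base A.subm_carrier[OF lD], where X = "D l" and g = "\<lambda>x. x"])
        (use l lD in \<open>auto simp: A.lin_def\<close>)
  qed
  note chT = grows_chain[OF lD chl Q gr]
  have tilt: "partial_tilting R A \<Lambda> D V T" "\<And>m. m \<in> \<Lambda> \<Longrightarrow> Rproj (hom_module A (D m) T)"
    using tilting_criterion[OF fgT chT] ext by blast+
  obtain X :: "'a umodule" and p where X: "fg_module A X" "A.lin T X p" "p ` carrier T = carrier X"
    "\<And>x. x \<in> carrier T \<Longrightarrow> p x = \<zero>\<^bsub>X\<^esub> \<longleftrightarrow> x \<in> f ` carrier (D l)"
    using A.realize_quotient[OF fgT sD] by metis
  have kp: "{x \<in> carrier T. p x = \<zero>\<^bsub>X\<^esub>} = f ` carrier (D l)" using X(4) A.subm_subset[OF sD] by auto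
  have Xf: "X \<in> filt A (D ` ?Q)" by (rule cokernel_chain[OF lD Q gr X(2,3) kp A.fg_lmod[OF X(1)]])
  have se1: "short_exact A (D l) (restrict f (carrier (D l))) T (restrict p (carrier T)) X"
    by (rule A.short_exactI[OF lD lT f(1) X(2) f(2) kp[symmetric] X(3)])
  have v: "\<forall>m\<in>\<Lambda>. l < m \<longrightarrow> (\<forall>f. A.lin (D m) T f \<longrightarrow> (\<forall>x\<in>carrier (D m). f x = \<zero>\<^bsub>T\<^esub>))"
  proof (intro ballI allI impI)
    fix m w x assume a: "m \<in> \<Lambda>" "l < m" "A.lin (D m) T w" "x \<in> carrier (D m)"
    then show "w x = \<zero>\<^bsub>T\<^esub>" by (intro vanish[OF a(1) _ a(3,4)]) auto
  qed
  obtain U :: "'r umodule" and s \<phi> where U: "fg_projective R U"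
    and s: "R.lin (hom_module A (D l) T) U s" "bij_betw s (mod_hom A (D l) T) (carrier U)"
    and \<phi>: "A.lin T (tensor_module R A (V l) U) \<phi>" "\<phi> ` carrier T = carrier (tensor_module R A (V l) U)"
    and own: "\<forall>w. A.lin (D l) T w \<longrightarrow> (\<forall>y\<in>carrier (D l). \<phi> (w y) = \<zero>\<^bsub>tensor_module R A (V l) U\<^esub>)
      \<longrightarrow> (\<forall>y\<in>carrier (D l). w y = \<zero>\<^bsub>T\<^esub>)"
    and other: "\<forall>m\<in>\<Lambda>. m \<noteq> l \<longrightarrow> (\<forall>w. A.lin (D m) (tensor_module R A (V l) U) w
      \<longrightarrow> (\<forall>y\<in>carrier (D m). w y = \<zero>\<^bsub>tensor_module R A (V l) U\<^esub>))"
    and ext': "\<forall>m\<in>\<Lambda>. ext_vanishes m (T \<restriction> {x \<in> carrier T. \<phi> x = \<zero>\<^bsub>tensor_module R A (V l) U\<^esub>})"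
    by (rule costandard_quotient[OF l fgT _ v tilt(2)[OF l]]) (use ext in blast)
  let ?W = "tensor_module R A (V l) U"
  have lU: "R.lmod U" by (rule R.fg_projective_summand(1)[OF U])
  have W: "A.lmod ?W" by (rule lmod_tensor[OF lV lU])
  let ?H = "hom_module A (D l) T"
  note H = lmod_hom_module[OF lD lT]
  \<comment> \<open>The isomorphism of \<open>R\<close> with \<open>Hom(D l, T)\<close> by multiples of the inclusion.\<close>
  let ?\<psi> = "\<lambda>r. \<lambda>x\<in>carrier (D l). scal r \<odot>\<^bsub>T\<^esub> f x"
  have fc: "f x \<in> carrier T" if "x \<in> carrier (D l)" for x by (rule A.lin_closed[OF f(1) that])
  have \<psi>: "R.lin (regular_module R) ?H ?\<psi>"
  proof (rule R.linI)
    show "?\<psi> r \<in> carrier ?H" if "r \<in> carrier (regular_module R)" for r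
      using A.restrict_mod_hom[OF lD lin_scal[OF f(1) lT, of r]] that by simp
  qed (use fc lT in \<open>auto simp: fun_eq_iff scal_add scal_times A.lm_ldistr A.lm_assoc\<close>)
  have \<psi>0: "\<forall>r\<in>carrier (regular_module R). ?\<psi> r = \<zero>\<^bsub>?H\<^esub> \<longrightarrow> r = \<zero>\<^bsub>regular_module R\<^esub>"
  proof (intro ballI impI)
    fix r assume r: "r \<in> carrier (regular_module R)" "?\<psi> r = \<zero>\<^bsub>?H\<^esub>"
    have rR: "r \<in> carrier R" using r(1) by simp
    have "scal r \<odot>\<^bsub>V l\<^esub> \<iota> l x = \<zero>\<^bsub>V l\<^esub>" if x: "x \<in> carrier (D l)" for x
    proof -
      have "f (scal r \<odot>\<^bsub>D l\<^esub> x) = \<zero>\<^bsub>T\<^esub>"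
        using fun_cong[OF r(2), of x] x A.lin_smult[OF f(1) scal_closed[OF rR] x] by simp
      then have "scal r \<odot>\<^bsub>D l\<^esub> x = \<zero>\<^bsub>D l\<^esub>" using f0 lD rR x by simp
      then show ?thesis
        using A.lin_smult[OF \<iota>_lin[OF l] scal_closed[OF rR] x] A.lin_zero[OF \<iota>_lin[OF l] lD lV] by simp
    qed
    then show "r = \<zero>\<^bsub>regular_module R\<^esub>" using \<iota>_faithful[OF l rR] by simp
  qed
  have \<psi>s: "?\<psi> ` carrier (regular_module R) = carrier ?H"
  proof
    show "?\<psi> ` carrier (regular_module R) \<subseteq> carrier ?H" using R.lin_closed[OF \<psi>] by blast
    show "carrier ?H \<subseteq> ?\<psi> ` carrier (regular_module R)"
    proof
      fix w assume "w \<in> carrier ?H"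
      then have w: "A.lin (D l) T w" "w \<in> extensional (carrier (D l))" by (auto simp: A.mod_hom_iff)
      have wz: "w z \<in> f ` carrier (D l)" if "z \<in> carrier (D l)" for z using lands_D[OF l _ w(1)] that by auto
      have "A.lin (D l) (T \<restriction> (f ` carrier (D l))) w" by (rule A.lin_to_restr[OF w(1) wz])
      then obtain c where c: "c \<in> carrier R" "\<forall>x\<in>carrier (D l). f' (w x) = scal c \<odot>\<^bsub>D l\<^esub> x"
        using D_end[OF l A.lin_comp[OF _ f'(1)]] by blast
      have "w = ?\<psi> c"
      proof (rule extensionalityI[OF w(2)])
        fix x assume x: "x \<in> carrier (D l)"
        have "w x = f (f' (w x))" using bspec[OF f'(3), of "w x"] wz[OF x] by simp
        then show "w x = ?\<psi> c x" using c x A.lin_smult[OF f(1) scal_closed[OF c(1)] x] by simp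
      qed simp
      then show "w \<in> ?\<psi> ` carrier (regular_module R)" using c(1) by auto
    qed
  qed
  have "inj_on ?\<psi> (carrier (regular_module R))"
    unfolding R.lin_inj_iff[OF \<psi> R.lmod_regular H] by (rule \<psi>0)
  then have "bij_betw ?\<psi> (carrier (regular_module R)) (mod_hom A (D l) T)" using \<psi>s by (simp add: bij_betw_def)
  then have b: "bij_betw (s \<circ> ?\<psi>) (carrier (regular_module R)) (carrier U)" using s(2) by (rule bij_betw_trans)
  have sl: "R.lin (regular_module R) U (s \<circ> ?\<psi>)" using R.lin_comp[OF \<psi> s(1)] by (simp add: o_def)
  obtain \<chi> where \<chi>: "R.lin U (regular_module R) \<chi>" "\<forall>x\<in>carrier (regular_module R). \<chi> ((s \<circ> ?\<psi>) x) = x"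
    "\<forall>y\<in>carrier U. (s \<circ> ?\<psi>) (\<chi> y) = y"
    by (rule R.inverse_lin[OF R.lmod_regular lU sl b])
  have \<chi>b: "bij_betw \<chi> (carrier U) (carrier R)"
    by (rule bij_betw_byWitness[where f' = "s \<circ> ?\<psi>"])
      (use \<chi> R.lin_closed[OF sl] R.lin_closed[OF \<chi>(1)] in auto)
  obtain \<beta> where \<beta>: "A.lin ?W (V l) \<beta>" "bij_betw \<beta> (carrier ?W) (carrier (V l))"
    using tensor_unit[OF lV lU \<chi>(1) \<chi>b] by metis
  have \<beta>0: "\<beta> y = \<zero>\<^bsub>V l\<^esub> \<longleftrightarrow> y = \<zero>\<^bsub>?W\<^esub>" if "y \<in> carrier ?W" for y
    using A.lin_inj_iff[OF \<beta>(1) W lV] \<beta>(2) that A.lin_zero[OF \<beta>(1) W lV] by (auto simp: bij_betw_def)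
  define N where "N = {x \<in> carrier T. \<phi> x = \<zero>\<^bsub>?W\<^esub>}"
  have N: "A.subm N T" unfolding N_def by (rule A.subm_ker[OF \<phi>(1) lT W])
  have chV: "A.fchain (twists R A ?Q V) T {\<zero>\<^bsub>T\<^esub>} N"
  proof (rule costandard_chain[OF fgT tilt(2) Q N])
    show "ext_vanishes m (T \<restriction> N)" if "m \<in> \<Lambda>" for m using ext' that unfolding N_def by blast
    show "w y = \<zero>\<^bsub>T\<^esub>" if m: "m \<in> \<Lambda> - ?Q" and w: "A.lin (D m) (T \<restriction> N) w" and y: "y \<in> carrier (D m)" for m w y
    proof -
      have wT: "A.lin (D m) T w" by (rule A.lin_restr_cod[OF w A.subm_subset[OF N]])
      show ?thesis
      proof (cases "m = l")
        case True
        have "\<forall>y\<in>carrier (D l). \<phi> (w y) = \<zero>\<^bsub>?W\<^esub>" using A.lin_closed[OF w] True by (auto simp: N_def)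
        then show ?thesis using own wT True y by auto
      next
        case False
        then have "\<not> m \<le> l" using m by auto
        then show ?thesis using vanish[OF _ _ wT y] m by blast
      qed
    qed
    show "w y \<in> N" if m: "m \<in> ?Q" and w: "A.lin (D m) T w" and y: "y \<in> carrier (D m)" for m w y
      using other A.lin_comp[OF w \<phi>(1)] m y A.lin_closed[OF w y] by (auto simp: N_def)
  qed
  have fgN: "fg_module A (T \<restriction> N)" by (rule fg_restr[OF fgT N])
  have "A.fchain (twists R A ?Q V) (T \<restriction> N) {\<zero>\<^bsub>T\<^esub>} N"
    by (rule A.fchain_restr[OF chV lT N subset_refl])
  then have YN: "T \<restriction> N \<in> filt A (twists R A ?Q V)"
    using A.filt_iff_fchain[of "twists R A ?Q V" "T \<restriction> N", OF twist_lmod(2)[OF Q]] fgN by simp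
  have ks: "(\<lambda>x. \<beta> (\<phi> x)) ` carrier T = carrier (V l)"
    using \<phi>(2) bij_betw_imp_surj_on[OF \<beta>(2)] by (metis image_image)
  have kk: "{x \<in> carrier T. \<beta> (\<phi> x) = \<zero>\<^bsub>V l\<^esub>} = N" using \<beta>0 A.lin_closed[OF \<phi>(1)] by (auto simp: N_def)
  have iN: "A.lin (T \<restriction> N) T (\<lambda>x. x)" by (rule A.lin_restr_dom[OF A.lin_id A.subm_subset[OF N]])
  have inN: "inj_on (\<lambda>x. x) (carrier (T \<restriction> N))" "(\<lambda>x. x) ` carrier (T \<restriction> N) = {x \<in> carrier T. \<beta> (\<phi> x) = \<zero>\<^bsub>V l\<^esub>}"
    using kk by (auto simp: inj_on_def)
  note se2 = A.short_exactI[OF A.lmod_restr[OF lT N] lT iN A.lin_comp[OF \<phi>(1) \<beta>(1)] inN ks]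
  show ?thesis using tilt(1) se1 se2 Xf YN by blast
qed

end

section \<open>Extension groups by free resolutions\<close>

context algebra_modules
begin

text \<open>Kernels of maps between free modules of finite rank are finitely generated, so the resolution can be
  continued.\<close>

lemma free_resolution_exists:
  assumes M: "fg_module A M" shows "\<exists>n d e. free_resolution A M n d e"
proof -
  have cover: "\<exists>m f. f \<in> mod_hom A (free_module A m) N \<and> f ` carrier (free_module A m) = Z"
    if N: "fg_module A N" and Z: "A.subm Z N" for N :: "('a, 'm) module" and Z
  proof -
    obtain m f where f: "A.lin (free_module A m) (N \<restriction> Z) f" "f ` carrier (free_module A m) = carrier (N \<restriction> Z)"
      by (rule A.fg_from_free[OF fg_restr[OF N Z]])
    have "A.lin (free_module A m) N f" by (rule A.lin_restr_cod[OF f(1) A.subm_subset[OF Z]])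
    then show ?thesis using A.restrict_mod_hom[OF A.lmod_free] f(2)
      by (intro exI[of _ m] exI[of _ "restrict f (carrier (free_module A m))"]) auto
  qed
  have cover': "\<exists>m f. f \<in> mod_hom A (free_module A m) (free_module A k) \<and> f ` carrier (free_module A m) = Z"
    if Z: "A.subm Z (free_module A k)" for k Z
  proof -
    obtain m f where f: "A.lin (free_module A m) (free_module A k \<restriction> Z) f" "f ` carrier (free_module A m) = carrier (free_module A k \<restriction> Z)"
      by (rule A.fg_from_free[OF fg_restr[OF A.fg_free Z]])
    have "A.lin (free_module A m) (free_module A k) f" by (rule A.lin_restr_cod[OF f(1) A.subm_subset[OF Z]])
    then show ?thesis using A.restrict_mod_hom[OF A.lmod_free] f(2)
      by (intro exI[of _ m] exI[of _ "restrict f (carrier (free_module A m))"]) auto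
  qed
  have lM: "A.lmod M" using M by simp
  obtain n0 e where e: "e \<in> mod_hom A (free_module A n0) M" "e ` carrier (free_module A n0) = carrier M"
    using cover[OF M A.subm_carrier[OF lM]] by blast
  have ker: "A.subm (mod_ker (free_module A a) N d) (free_module A a)"
    if "d \<in> mod_hom A (free_module A a) N" "A.lmod N" for a N and d :: "_ \<Rightarrow> 'z"
    unfolding mod_ker_def using that by (intro A.subm_ker) (auto simp: A.mod_hom_iff)
  \<comment> \<open>A state of the construction is a triple of two consecutive ranks and the differential between them.\<close>
  define \<Phi> where "\<Phi> i x \<longleftrightarrow> snd (snd x) \<in> mod_hom A (free_module A (fst (snd x))) (free_module A (fst x)) \<and>
    (i = (0::nat) \<longrightarrow> fst x = n0 \<and> snd (snd x) ` carrier (free_module A (fst (snd x))) = mod_ker (free_module A n0) M e)"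
    for i and x :: "nat \<times> nat \<times> ((nat \<Rightarrow> 'a) \<Rightarrow> nat \<Rightarrow> 'a)"
  define \<Psi> where "\<Psi> (i::nat) x y \<longleftrightarrow> fst y = fst (snd x) \<and>
    snd (snd y) ` carrier (free_module A (fst (snd y))) =
      mod_ker (free_module A (fst (snd x))) (free_module A (fst x)) (snd (snd x))"
    for i and x y :: "nat \<times> nat \<times> ((nat \<Rightarrow> 'a) \<Rightarrow> nat \<Rightarrow> 'a)"
  have "\<exists>s. \<forall>i. \<Phi> i (s i) \<and> \<Psi> i (s i) (s (Suc i))"
  proof (rule dependent_nat_choice)
    obtain m d where "d \<in> mod_hom A (free_module A m) (free_module A n0)"
      "d ` carrier (free_module A m) = mod_ker (free_module A n0) M e"
      using cover'[OF ker[OF e(1) lM]] by blast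
    then have "\<Phi> 0 (n0, m, d)" by (simp add: \<Phi>_def)
    then show "\<exists>x. \<Phi> 0 x" by blast
  next
    fix x i assume "\<Phi> i x"
    then have x: "snd (snd x) \<in> mod_hom A (free_module A (fst (snd x))) (free_module A (fst x))" by (simp add: \<Phi>_def)
    obtain m d' where "d' \<in> mod_hom A (free_module A m) (free_module A (fst (snd x)))"
      "d' ` carrier (free_module A m) = mod_ker (free_module A (fst (snd x))) (free_module A (fst x)) (snd (snd x))"
      using cover'[OF ker[OF x A.lmod_free]] by blast
    then have "\<Phi> (Suc i) (fst (snd x), m, d') \<and> \<Psi> i x (fst (snd x), m, d')" by (simp add: \<Phi>_def \<Psi>_def)
    then show "\<exists>y. \<Phi> (Suc i) y \<and> \<Psi> i x y" by blast
  qed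
  then obtain s where s: "\<forall>i. \<Phi> i (s i) \<and> \<Psi> i (s i) (s (Suc i))" by (rule exE)
  define n where "n i = fst (s i)" for i
  define d where "d i = snd (snd (s i))" for i
  have m: "fst (snd (s i)) = n (Suc i)" for i
    using spec[OF s, of i] by (simp add: \<Psi>_def n_def)
  have "\<forall>i. d i \<in> mod_hom A (free_module A (n (Suc i))) (free_module A (n i))"
    using s unfolding \<Phi>_def m n_def[symmetric] d_def[symmetric] by blast
  moreover have "n 0 = n0" "d 0 ` carrier (free_module A (n (Suc 0))) = mod_ker (free_module A n0) M e"
    using spec[OF s, of 0] unfolding \<Phi>_def m n_def[symmetric] d_def[symmetric] by auto
  moreover have "\<forall>i. d (Suc i) ` carrier (free_module A (n (Suc (Suc i)))) = mod_ker (free_module A (n (Suc i))) (free_module A (n i)) (d i)"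
    using s unfolding \<Psi>_def m n_def[symmetric] d_def[symmetric] by blast
  ultimately have "free_resolution A M n d e" unfolding free_resolution_def using e by simp
  then show ?thesis by blast
qed

text \<open>The Ext modules are defined with a chosen resolution, which exists; the same choice serves all
  degrees.\<close>

lemma Ext_resolution:
  assumes M: "fg_module A M"
  obtains n d e where "free_resolution A M n d e" "\<forall>i. Ext A i M N = hom_cohomology A n d N i"
proof -
  let ?t = "SOME (n, d, e). free_resolution A M n d e"
  have "\<exists>t. case t of (n, d, e) \<Rightarrow> free_resolution A M n d e" using free_resolution_exists[OF M] by auto
  then have t: "case ?t of (n, d, e) \<Rightarrow> free_resolution A M n d e" by (rule someI_ex)
  obtain n d e where nde: "?t = (n, d, e)" by (cases ?t)
  have "free_resolution A M n d e" using t nde by simp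
  moreover have "\<forall>i. Ext A i M N = hom_cohomology A n d N i" unfolding Ext_def nde by simp
  ultimately show ?thesis by (rule that)
qed

text \<open>What the Ext modules say in degrees \<open>0\<close> and \<open>1\<close>. Cocycles of degree \<open>0\<close> are the maps from the first free
  module that vanish on the kernel of the augmentation, hence maps from \<open>M\<close>. A map from that kernel,
  composed with the first differential, is a cocycle of degree \<open>1\<close>; it is a coboundary exactly if the
  map extends.\<close>

lemma
  fixes N :: "('a, 'n) module"
  assumes M: "fg_module A M" and N: "A.lmod N"
  shows Ext0_zero: "carrier (Ext A 0 M N) = {\<zero>\<^bsub>Ext A 0 M N\<^esub>} \<Longrightarrow> A.lin M N f \<Longrightarrow> x \<in> carrier M \<Longrightarrow> f x = \<zero>\<^bsub>N\<^esub>"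
    and Ext0_unit: "mod_iso R (Ext A 0 M N) (regular_module R) \<Longrightarrow> \<exists>\<iota>. A.lin M N \<iota> \<and>
      (\<forall>f. A.lin M N f \<longrightarrow> (\<exists>c\<in>carrier R. \<forall>x\<in>carrier M. f x = scal c \<odot>\<^bsub>N\<^esub> \<iota> x)) \<and>
      (\<forall>c\<in>carrier R. (\<forall>x\<in>carrier M. scal c \<odot>\<^bsub>N\<^esub> \<iota> x = \<zero>\<^bsub>N\<^esub>) \<longrightarrow> c = \<zero>\<^bsub>R\<^esub>)"
    and Ext1_zero: "carrier (Ext A 1 M N) = {\<zero>\<^bsub>Ext A 1 M N\<^esub>} \<Longrightarrow> \<exists>n e. A.lin (free_module A n) M e \<and>
      e ` carrier (free_module A n) = carrier M \<and>
      (\<forall>h. A.lin (free_module A n \<restriction> {x \<in> carrier (free_module A n). e x = \<zero>\<^bsub>M\<^esub>}) N h \<longrightarrow>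
        (\<exists>g. A.lin (free_module A n) N g \<and> (\<forall>x\<in>carrier (free_module A n). e x = \<zero>\<^bsub>M\<^esub> \<longrightarrow> g x = h x)))"
proof -
  have lM: "A.lmod M" using M by simp
  obtain n d e where res: "free_resolution A M n d e" and E': "\<forall>i. Ext A i M N = hom_cohomology A n d N i"
    by (rule Ext_resolution[OF M])
  note E = spec[OF E']
  define F where "F i = free_module A (n i)" for i
  have F: "A.lmod (F i)" for i by (simp add: F_def)
  have d: "A.lin (F (Suc i)) (F i) (d i)" for i using res by (simp add: free_resolution_def F_def A.mod_hom_iff)
  have e: "A.lin (F 0) M e" "e ` carrier (F 0) = carrier M" using res by (simp_all add: free_resolution_def F_def A.mod_hom_iff)
  have d0: "d 0 ` carrier (F (Suc 0)) = {x \<in> carrier (F 0). e x = \<zero>\<^bsub>M\<^esub>}"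
    using res by (simp add: free_resolution_def F_def mod_ker_def)
  have d1: "d (Suc 0) ` carrier (F (Suc (Suc 0))) = {x \<in> carrier (F (Suc 0)). d 0 x = \<zero>\<^bsub>F 0\<^esub>}"
    using res by (simp add: free_resolution_def F_def mod_ker_def)
  define H where "H i = hom_module A (F i) N" for i
  have H: "R.lmod (H i)" for i using F N by (simp add: H_def)
  define \<delta> where "\<delta> i f = compose (carrier (F (Suc i))) f (d i)" for i and f :: "(nat \<Rightarrow> 'a) \<Rightarrow> 'n"
  have \<delta>: "R.lin (H i) (H (Suc i)) (\<delta> i)" for i
  proof -
    have "\<delta> i = (\<lambda>f. \<lambda>x\<in>carrier (F (Suc i)). f (d i x))" by (simp add: \<delta>_def compose_def fun_eq_iff)
    then show ?thesis using precomp_lin[OF F F N d[of i]] by (simp only: H_def)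
  qed
  define Z where "Z i = {f \<in> carrier (H i). \<delta> i f = \<zero>\<^bsub>H (Suc i)\<^esub>}" for i
  have Z: "R.subm (Z i) (H i)" for i unfolding Z_def by (rule R.subm_ker[OF \<delta> H H])
  have ZH: "R.lmod (H i \<restriction> Z i)" for i by (rule R.lmod_restr[OF H Z])
  have H0: "\<zero>\<^bsub>H i\<^esub> x = \<zero>\<^bsub>N\<^esub>" if "x \<in> carrier (F i)" for i x using that by (simp add: H_def)
  have Z_iff: "f \<in> Z i \<longleftrightarrow> f \<in> mod_hom A (F i) N \<and> (\<forall>x\<in>carrier (F (Suc i)). f (d i x) = \<zero>\<^bsub>N\<^esub>)" for f i
    by (auto simp: Z_def H_def \<delta>_def compose_def fun_eq_iff)
  have pull: "(\<lambda>x\<in>carrier (F 0). f (e x)) \<in> Z 0" if f: "A.lin M N f" for f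
  proof -
    have "e (d 0 x) = \<zero>\<^bsub>M\<^esub>" "d 0 x \<in> carrier (F 0)" if "x \<in> carrier (F (Suc 0))" for x using d0 that by blast+
    then show ?thesis
      unfolding Z_iff using A.restrict_mod_hom[OF F A.lin_comp[OF e(1) f]] A.lin_zero[OF f lM N] by simp
  qed
  have E0: "Ext A 0 M N = quotient_module (H 0 \<restriction> Z 0) {\<zero>\<^bsub>H 0\<^esub>}"
    unfolding E hom_cohomology_def Let_def mod_ker_def F_def[symmetric] H_def[symmetric] \<delta>_def[symmetric] Z_def by simp
  have z0: "R.subm {\<zero>\<^bsub>H 0\<^esub>} (H 0 \<restriction> Z 0)" using R.subm_zero_set[OF ZH[of 0]] by simp
  note q0 = R.lmod_quotient[OF ZH z0] R.lin_quotient[OF ZH z0] R.quotient_surj[OF ZH z0] R.quotient_eq_zero[OF ZH z0]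
  note q0 = q0[folded E0]
  show "f x = \<zero>\<^bsub>N\<^esub>" if c: "carrier (Ext A 0 M N) = {\<zero>\<^bsub>Ext A 0 M N\<^esub>}" and f: "A.lin M N f" and x: "x \<in> carrier M"
  proof -
    let ?f = "\<lambda>x\<in>carrier (F 0). f (e x)"
    have "?f \<in> carrier (H 0 \<restriction> Z 0)" using pull[OF f] by simp
    then have ff: "?f = \<zero>\<^bsub>H 0\<^esub>" using q0(4) R.lin_closed[OF q0(2)] c by blast
    obtain y where y: "y \<in> carrier (F 0)" "x = e y" using x e(2) by auto
    show ?thesis using fun_cong[OF ff, of y] H0[OF y(1)] y by simp
  qed
  show "\<exists>\<iota>. A.lin M N \<iota> \<and>
      (\<forall>f. A.lin M N f \<longrightarrow> (\<exists>c\<in>carrier R. \<forall>x\<in>carrier M. f x = scal c \<odot>\<^bsub>N\<^esub> \<iota> x)) \<and>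
      (\<forall>c\<in>carrier R. (\<forall>x\<in>carrier M. scal c \<odot>\<^bsub>N\<^esub> \<iota> x = \<zero>\<^bsub>N\<^esub>) \<longrightarrow> c = \<zero>\<^bsub>R\<^esub>)"
    if iso: "mod_iso R (Ext A 0 M N) (regular_module R)"
  proof -
    obtain j where j: "R.lin (Ext A 0 M N) (regular_module R) j" "bij_betw j (carrier (Ext A 0 M N)) (carrier (regular_module R))"
      using iso unfolding R.mod_iso_iff[OF q0(1)] by blast
    define c where "c z = j ({\<zero>\<^bsub>H 0\<^esub>} +>\<^bsub>H 0 \<restriction> Z 0\<^esub> z)" for z
    have c: "R.lin (H 0 \<restriction> Z 0) (regular_module R) c" unfolding c_def by (rule R.lin_comp[OF q0(2) j(1)])
    have j0: "y = \<zero>\<^bsub>Ext A 0 M N\<^esub>" if "y \<in> carrier (Ext A 0 M N)" "j y = \<zero>\<^bsub>regular_module R\<^esub>" for y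
      using R.lin_inj_iff[OF j(1) q0(1) R.lmod_regular] bij_betw_imp_inj_on[OF j(2)] that by blast
    have cinj: "inj_on c (carrier (H 0 \<restriction> Z 0))"
      unfolding R.lin_inj_iff[OF c ZH R.lmod_regular]
    proof (intro ballI impI)
      fix z assume z: "z \<in> carrier (H 0 \<restriction> Z 0)" "c z = \<zero>\<^bsub>regular_module R\<^esub>"
      have "{\<zero>\<^bsub>H 0\<^esub>} +>\<^bsub>H 0 \<restriction> Z 0\<^esub> z = \<zero>\<^bsub>Ext A 0 M N\<^esub>"
        by (rule j0[OF R.lin_closed[OF q0(2) z(1)] z(2)[unfolded c_def]])
      then show "z = \<zero>\<^bsub>H 0 \<restriction> Z 0\<^esub>" using q0(4)[OF z(1)] by simp
    qed
    have "c ` carrier (H 0 \<restriction> Z 0) = carrier (regular_module R)"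
      using q0(3) bij_betw_imp_surj_on[OF j(2)] unfolding c_def by (metis image_image)
    then have "\<one>\<^bsub>R\<^esub> \<in> c ` carrier (H 0 \<restriction> Z 0)" by simp
    then obtain z1 where z1: "z1 \<in> Z 0" "c z1 = \<one>\<^bsub>R\<^esub>" by auto
    have z1l: "A.lin (F 0) N z1" using z1(1) by (simp add: Z_iff A.mod_hom_iff)
    have kk: "z1 x = \<zero>\<^bsub>N\<^esub>" if "x \<in> carrier (F 0)" "e x = \<zero>\<^bsub>M\<^esub>" for x
    proof -
      have "x \<in> d 0 ` carrier (F (Suc 0))" unfolding d0 using that by simp
      then show ?thesis using z1(1) by (auto simp: Z_iff)
    qed
    obtain \<iota> where \<iota>: "A.lin M N \<iota>" "\<And>x. x \<in> carrier (F 0) \<Longrightarrow> \<iota> (e x) = z1 x"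
      using A.factor_thru[OF F N e z1l kk lM] by blast
    have cr: "c (r \<odot>\<^bsub>H 0\<^esub> z1) = r" "r \<odot>\<^bsub>H 0\<^esub> z1 \<in> carrier (H 0 \<restriction> Z 0)" if "r \<in> carrier R" for r
      using R.lin_smult[OF c that, of z1] z1 that R.subm_smult[OF Z that, of z1 0] by auto
    have rz: "(r \<odot>\<^bsub>H 0\<^esub> z1) x = scal r \<odot>\<^bsub>N\<^esub> z1 x" if "x \<in> carrier (F 0)" for r x using that by (simp add: H_def)
    have "\<exists>r\<in>carrier R. \<forall>x\<in>carrier M. f x = scal r \<odot>\<^bsub>N\<^esub> \<iota> x" if f: "A.lin M N f" for f
    proof -
      let ?f = "\<lambda>x\<in>carrier (F 0). f (e x)"
      have fZ: "?f \<in> carrier (H 0 \<restriction> Z 0)" using pull[OF f] by simp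
      have r: "c ?f \<in> carrier R" using R.lin_closed[OF c fZ] by simp
      have eq: "?f = c ?f \<odot>\<^bsub>H 0\<^esub> z1" by (rule inj_onD[OF cinj _ fZ cr(2)[OF r]]) (simp only: cr(1)[OF r])
      have "f x = scal (c ?f) \<odot>\<^bsub>N\<^esub> \<iota> x" if "x \<in> carrier M" for x
      proof -
        have "x \<in> e ` carrier (F 0)" using that e(2) by simp
        then obtain y where y: "y \<in> carrier (F 0)" "x = e y" by (rule imageE)
        have "f x = ?f y" using y by simp
        also have "\<dots> = (c ?f \<odot>\<^bsub>H 0\<^esub> z1) y" by (rule fun_cong[OF eq])
        also have "\<dots> = scal (c ?f) \<odot>\<^bsub>N\<^esub> \<iota> x" unfolding rz[OF y(1)] y(2) \<iota>(2)[OF y(1)] ..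
        finally show ?thesis .
      qed
      then show ?thesis using r by blast
    qed
    moreover have "r = \<zero>\<^bsub>R\<^esub>" if r: "r \<in> carrier R" and 0: "\<forall>x\<in>carrier M. scal r \<odot>\<^bsub>N\<^esub> \<iota> x = \<zero>\<^bsub>N\<^esub>" for r
    proof -
      have "r \<odot>\<^bsub>H 0\<^esub> z1 = \<zero>\<^bsub>H 0\<^esub>"
      proof (rule mod_hom_eqI[of _ "F 0" N])
        show "r \<odot>\<^bsub>H 0\<^esub> z1 \<in> mod_hom A (F 0) N" using cr(2)[OF r] by (simp add: Z_iff)
        show "\<zero>\<^bsub>H 0\<^esub> \<in> mod_hom A (F 0) N" using R.lm_zero[OF H[of 0]] by (simp add: H_def)
        show "(r \<odot>\<^bsub>H 0\<^esub> z1) x = \<zero>\<^bsub>H 0\<^esub> x" if x: "x \<in> carrier (F 0)" for x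
          unfolding rz[OF x] H0[OF x] \<iota>(2)[OF x, symmetric] using 0 A.lin_closed[OF e(1) x] by blast
      qed
      then have "r = c \<zero>\<^bsub>H 0\<^esub>" using cr(1)[OF r] by simp
      then show ?thesis using R.lin_zero[OF c ZH R.lmod_regular] by simp
    qed
    ultimately show ?thesis using \<iota>(1) by blast
  qed
  show "\<exists>n e. A.lin (free_module A n) M e \<and> e ` carrier (free_module A n) = carrier M \<and>
      (\<forall>h. A.lin (free_module A n \<restriction> {x \<in> carrier (free_module A n). e x = \<zero>\<^bsub>M\<^esub>}) N h \<longrightarrow>
        (\<exists>g. A.lin (free_module A n) N g \<and> (\<forall>x\<in>carrier (free_module A n). e x = \<zero>\<^bsub>M\<^esub> \<longrightarrow> g x = h x)))"
    if c: "carrier (Ext A 1 M N) = {\<zero>\<^bsub>Ext A 1 M N\<^esub>}"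
  proof -
    define B where "B = \<delta> 0 ` carrier (H 0)"
    have E1: "Ext A 1 M N = quotient_module (H 1 \<restriction> Z 1) B"
      unfolding E hom_cohomology_def Let_def mod_ker_def F_def[symmetric] H_def[symmetric] \<delta>_def[symmetric] Z_def B_def by simp
    have BZ: "B \<subseteq> Z 1"
    proof
      fix g assume "g \<in> B"
      then obtain f where f: "f \<in> carrier (H 0)" "g = \<delta> 0 f" unfolding B_def by blast
      have "g \<in> mod_hom A (F 1) N" using R.lin_closed[OF \<delta> f(1)] f(2) by (simp add: H_def)
      moreover have "g (d 1 x) = \<zero>\<^bsub>N\<^esub>" if x: "x \<in> carrier (F (Suc 1))" for x
      proof -
        have "d 1 x \<in> carrier (F (Suc 0))" "d 0 (d 1 x) = \<zero>\<^bsub>F 0\<^esub>" using d1 x by auto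
        moreover have "f \<zero>\<^bsub>F 0\<^esub> = \<zero>\<^bsub>N\<^esub>" by (rule A.lin_zero[OF _ F N]) (use f(1) in \<open>simp add: H_def A.mod_hom_iff\<close>)
        ultimately show ?thesis using f(2) by (simp add: \<delta>_def compose_def)
      qed
      ultimately show "g \<in> Z 1" by (simp add: Z_iff)
    qed
    have "R.subm B (H 1)" unfolding B_def using R.subm_image[OF \<delta>[of 0] H H R.subm_carrier[OF H]] by simp
    then have B: "R.subm B (H 1 \<restriction> Z 1)" using R.subm_restr[OF H Z] BZ by blast
    note q1 = R.lin_quotient[OF ZH B, folded E1] R.quotient_eq_zero[OF ZH B, folded E1]
    have ZB: "z \<in> B" if "z \<in> Z 1" for z
      using q1(2)[of z] R.lin_closed[OF q1(1), of z] that c by auto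
    have "\<exists>g. A.lin (F 0) N g \<and> (\<forall>x\<in>carrier (F 0). e x = \<zero>\<^bsub>M\<^esub> \<longrightarrow> g x = h x)"
      if h: "A.lin (F 0 \<restriction> {x \<in> carrier (F 0). e x = \<zero>\<^bsub>M\<^esub>}) N h" for h
    proof -
      let ?z = "\<lambda>x\<in>carrier (F (Suc 0)). h (d 0 x)"
      have dl: "A.lin (F (Suc 0)) (F 0 \<restriction> {x \<in> carrier (F 0). e x = \<zero>\<^bsub>M\<^esub>}) (d 0)"
        by (rule A.lin_to_restr[OF d]) (use d0 in blast)
      have h0: "h \<zero>\<^bsub>F 0\<^esub> = \<zero>\<^bsub>N\<^esub>"
        using A.lin_zero[OF h A.lmod_restr[OF F A.subm_ker[OF e(1) F lM]] N] by simp
      have "?z \<in> mod_hom A (F 1) N" using A.restrict_mod_hom[OF F A.lin_comp[OF dl h]] by simp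
      moreover have "?z (d 1 x) = \<zero>\<^bsub>N\<^esub>" if x: "x \<in> carrier (F (Suc 1))" for x
      proof -
        have "d 1 x \<in> carrier (F (Suc 0))" "d 0 (d 1 x) = \<zero>\<^bsub>F 0\<^esub>" using d1 x by auto
        then show ?thesis using h0 by simp
      qed
      ultimately have "?z \<in> B" by (intro ZB) (simp add: Z_iff)
      then obtain g where g: "g \<in> carrier (H 0)" "?z = \<delta> 0 g" unfolding B_def by blast
      have "g x = h x" if x: "x \<in> carrier (F 0)" "e x = \<zero>\<^bsub>M\<^esub>" for x
      proof -
        have "x \<in> d 0 ` carrier (F (Suc 0))" unfolding d0 using x by simp
        then obtain y where y: "y \<in> carrier (F (Suc 0))" "x = d 0 y" by (rule imageE)
        then show ?thesis using fun_cong[OF g(2), of y] by (simp add: \<delta>_def compose_def)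
      qed
      then show ?thesis using g(1) by (auto simp: H_def A.mod_hom_iff)
    qed
    then show ?thesis using e unfolding F_def by blast
  qed
qed

text \<open>The comparison behind Schanuel's lemma: with maps \<open>s\<close> and \<open>t\<close> between the two presentations over \<open>D\<close>, the
  difference of the identity and \<open>s t\<close> takes values in the kernel, where \<open>h\<close> is defined, and \<open>h s\<close> extends by
  assumption.\<close>

lemma extension_independent:
  assumes D: "A.lmod D" and X: "A.lmod X"
    and F: "A.lmod F" "A.summand {regular_module A} F" "A.lin F D e" "e ` carrier F = carrier D"
    and P: "A.lmod P" "A.summand {regular_module A} P" "A.lin P D \<pi>" "\<pi> ` carrier P = carrier D"
    and ext: "\<forall>h. A.lin (F \<restriction> {x \<in> carrier F. e x = \<zero>\<^bsub>D\<^esub>}) X h \<longrightarrow>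
        (\<exists>g. A.lin F X g \<and> (\<forall>x\<in>carrier F. e x = \<zero>\<^bsub>D\<^esub> \<longrightarrow> g x = h x))"
    and h: "A.lin (P \<restriction> {x \<in> carrier P. \<pi> x = \<zero>\<^bsub>D\<^esub>}) X h"
  shows "\<exists>g. A.lin P X g \<and> (\<forall>x\<in>carrier P. \<pi> x = \<zero>\<^bsub>D\<^esub> \<longrightarrow> g x = h x)"
proof -
  let ?KF = "{x \<in> carrier F. e x = \<zero>\<^bsub>D\<^esub>}" and ?KP = "{x \<in> carrier P. \<pi> x = \<zero>\<^bsub>D\<^esub>}"
  obtain s where s: "A.lin F P s" "\<And>x. x \<in> carrier F \<Longrightarrow> \<pi> (s x) = e x"
    using A.projective_lift[OF F(2,3,1) P(1) D P(3)] P(4) by blast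
  obtain t where t: "A.lin P F t" "\<And>x. x \<in> carrier P \<Longrightarrow> e (t x) = \<pi> x"
    using A.projective_lift[OF P(2,3,1) F(1) D F(3)] F(4) by blast
  have "A.lin (F \<restriction> ?KF) (P \<restriction> ?KP) s"
    by (rule A.lin_to_restr[OF A.lin_restr_dom[OF s(1)]]) (use s A.lin_closed[OF s(1)] in auto)
  from A.lin_comp[OF this h] obtain g where g: "A.lin F X g" "\<forall>x\<in>carrier F. e x = \<zero>\<^bsub>D\<^esub> \<longrightarrow> g x = h (s x)"
    using ext by blast
  let ?d = "\<lambda>x. A.dif P x (s (t x))"
  have d: "A.lin P P ?d" by (rule A.lin_minus[OF A.lin_id A.lin_comp[OF t(1) s(1)] P(1)])
  have tc: "t x \<in> carrier F" "s (t x) \<in> carrier P" if "x \<in> carrier P" for x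
    using A.lin_closed[OF t(1) that] A.lin_closed[OF s(1)] by auto
  have dK: "?d x \<in> ?KP" if x: "x \<in> carrier P" for x
    using A.lin_dif[OF P(3,1) x tc(2)[OF x]] s(2)[OF tc(1)[OF x]] t(2)[OF x] D A.lin_closed[OF P(3) x] A.lin_closed[OF d x] by simp
  have dl: "A.lin P (P \<restriction> ?KP) ?d" by (rule A.lin_to_restr[OF d dK])
  let ?g = "\<lambda>x. g (t x) \<oplus>\<^bsub>X\<^esub> h (?d x)"
  have gl: "A.lin P X ?g" by (rule A.lin_plus[OF A.lin_comp[OF t(1) g(1)] A.lin_comp[OF dl h] X])
  have "?g x = h x" if x: "x \<in> carrier P" "\<pi> x = \<zero>\<^bsub>D\<^esub>" for x
  proof -
    have st: "s (t x) \<in> ?KP" using tc[OF x(1)] s(2)[OF tc(1)[OF x(1)]] t(2)[OF x(1)] x(2) by simp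
    have "g (t x) = h (s (t x))" using g(2) tc(1)[OF x(1)] t(2)[OF x(1)] x(2) by simp
    then have "?g x = h (s (t x) \<oplus>\<^bsub>P\<^esub> ?d x)" using A.lin_add[OF h, of "s (t x)" "?d x"] st dK[OF x(1)] by simp
    then show ?thesis using x tc[OF x(1)] P(1) by simp
  qed
  then show ?thesis using gl by blast
qed

end

section \<open>Split quasi-hereditary algebras\<close>

context ring_modules
begin

text \<open>The regular module is projective, so an isomorphic copy of it is a summand of a power of
  \<open>\<Oplus> P(l)\<close>.\<close>

lemma generators_of_add_cat:
  fixes P :: "'i \<Rightarrow> 'a umodule"
  assumes fin: "finite \<Lambda>" and P: "\<And>l. l \<in> \<Lambda> \<Longrightarrow> lmod (P l)"
    and add: "{X :: 'a umodule. fg_projective A X} \<subseteq> add_cat A (dsum \<Lambda> P)"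
  shows "summand (P ` \<Lambda>) (regular_module A)"
proof -
  let ?A = "regular_module A"
  obtain Q :: "'a umodule" and q where Q: "fg_module A Q" "lin ?A Q q" "bij_betw q (carrier ?A) (carrier Q)"
    using realize[OF fg_regular] by metis
  have lQ: "lmod Q" using Q(1) by simp
  obtain r where r: "lin Q ?A r" "\<forall>x\<in>carrier ?A. r (q x) = x" "\<forall>y\<in>carrier Q. q (r y) = y"
    by (rule inverse_lin[OF lmod_regular lQ Q(2,3)])
  have "summand {?A} Q"
    by (rule summand_retract[OF summand_self[OF _ lmod_regular] r(1) Q(2) _ lmod_regular lQ]) (use r(3) in auto)
  then have "Q \<in> add_cat A (dsum \<Lambda> P)" using fg_projectiveI[OF lQ] add by blast
  then obtain n where ds: "direct_summand A Q (module_power (dsum \<Lambda> P) n)" by (auto simp: add_cat_def)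
  have lD: "lmod (dsum \<Lambda> P)" by (rule lmod_dsum[OF P])
  have lp: "lmod (module_power (dsum \<Lambda> P) n)" unfolding module_power_def by (rule lmod_dsum[OF lD])
  obtain a b where ab: "lin Q (module_power (dsum \<Lambda> P) n) b" "lin (module_power (dsum \<Lambda> P) n) Q a"
    "\<And>x. x \<in> carrier Q \<Longrightarrow> a (b x) = x" using direct_summand_retract[OF ds lQ lp] by metis
  have "summand {dsum \<Lambda> P} Q" by (rule summand_retract[OF summand_power[OF lD] ab lp lQ])
  then have "summand (P ` \<Lambda>) Q"
    by (rule summand_trans) (use summand_dsum[OF fin P] lD lQ in auto)
  then show ?thesis by (rule summand_retract[OF _ Q(2) r(1) _ lQ lmod_regular]) (use r(2) in auto)
qed

end

lemma projective_noetherian_algebra_modules: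
  assumes "projective_noetherian_algebra R A" shows "algebra_modules R A"
proof -
  have a: "cring R" "noetherian_ring R" "r_algebra R A" "fg_module R A"
    using assms by (auto simp: projective_noetherian_algebra_def fg_projective_def)
  have r: "ring R" "ring A" using cring.axioms(1)[OF a(1)] r_algebra.axioms(2)[OF a(3)] by auto
  show ?thesis
    by (intro algebra_modules.intro ring_modules.intro algebra_modules_axioms.intro r a)
qed

context algebra_modules
begin

text \<open>An isomorphism of algebras sends \<open>1\<close> to the identity, so by \<open>R\<close>-linearity it sends \<open>c\<close> to multiplication by
  \<open>c\<close>.\<close>

lemma scalar_endomorphisms:
  assumes M: "A.lmod M" and iso: "end_iso_base R A M" and f: "A.lin M M f"
  shows "\<exists>c\<in>carrier R. \<forall>x\<in>carrier M. f x = scal c \<odot>\<^bsub>M\<^esub> x"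
proof -
  obtain \<phi> where \<phi>: "\<phi> \<in> ring_iso R (end_algebra A M)"
    "\<forall>r\<in>carrier R. \<forall>s\<in>carrier R. \<phi> (r \<otimes>\<^bsub>R\<^esub> s) = r \<odot>\<^bsub>end_algebra A M\<^esub> \<phi> s"
    using iso by (auto simp: end_iso_base_def)
  have one: "\<phi> \<one>\<^bsub>R\<^esub> = (\<lambda>x\<in>carrier M. x)"
    using \<phi>(1) by (auto simp: ring_iso_def ring_hom_def end_algebra_def)
  have "\<phi> ` carrier R = mod_hom A M M"
    using \<phi>(1) by (simp add: ring_iso_def bij_betw_def end_algebra_def)
  moreover have "restrict f (carrier M) \<in> mod_hom A M M" by (rule A.restrict_mod_hom[OF M f])
  ultimately have "restrict f (carrier M) \<in> \<phi> ` carrier R" by simp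
  then obtain c where c: "c \<in> carrier R" "restrict f (carrier M) = \<phi> c" by auto
  have "\<phi> c = c \<odot>\<^bsub>end_algebra A M\<^esub> \<phi> \<one>\<^bsub>R\<^esub>"
    using bspec[OF bspec[OF \<phi>(2) c(1)], of "\<one>\<^bsub>R\<^esub>"] c(1) by simp
  also have "\<dots> = (\<lambda>x\<in>carrier M. scal c \<odot>\<^bsub>M\<^esub> x)"
    unfolding one by (auto simp: end_algebra_def fun_eq_iff)
  finally have eq: "restrict f (carrier M) = (\<lambda>x\<in>carrier M. scal c \<odot>\<^bsub>M\<^esub> x)" using c(2) by simp
  have "f x = scal c \<odot>\<^bsub>M\<^esub> x" if "x \<in> carrier M" for x using fun_cong[OF eq, of x] that by simp
  then show ?thesis using c(1) by blast
qed

lemma trivial_hom_module: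
  assumes "A.lmod M" "carrier (hom_module A M N) = {\<zero>\<^bsub>hom_module A M N\<^esub>}" "A.lin M N f" "x \<in> carrier M"
  shows "f x = \<zero>\<^bsub>N\<^esub>"
proof -
  have "restrict f (carrier M) = (\<lambda>x\<in>carrier M. \<zero>\<^bsub>N\<^esub>)"
    using A.restrict_mod_hom[OF assms(1,3)] assms(2) by simp
  from fun_cong[OF this, of x] show ?thesis using assms(4) by simp
qed

end

lemma standard_modules_exist:
  fixes \<Lambda> :: "'i::order set" and \<Delta> :: "'i \<Rightarrow> ('a, 'd) module" and R :: "('r, 'x) ring_scheme"
  assumes sqh: "split_quasi_hereditary R A \<Lambda> \<Delta>"
  shows "\<exists>P \<pi>. standard_modules R A \<Lambda> \<Delta> P \<pi>"
proof -
  interpret algebra_modules R A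
    by (rule projective_noetherian_algebra_modules) (use sqh in \<open>simp add: split_quasi_hereditary_def\<close>)
  have fin: "finite \<Lambda>" and fg: "\<And>l. l \<in> \<Lambda> \<Longrightarrow> fg_module A (\<Delta> l)"
    and proj: "\<And>l. l \<in> \<Lambda> \<Longrightarrow> fg_projective R (Rs (\<Delta> l))"
    and hom: "\<And>l m. \<lbrakk>l \<in> \<Lambda>; m \<in> \<Lambda>; \<not> l \<le> m\<rbrakk> \<Longrightarrow> carrier (hom_module A (\<Delta> l) (\<Delta> m)) = {\<zero>\<^bsub>hom_module A (\<Delta> l) (\<Delta> m)\<^esub>}"
    and endo: "\<And>l. l \<in> \<Lambda> \<Longrightarrow> end_iso_base R A (\<Delta> l)"
    using sqh unfolding split_quasi_hereditary_def by blast+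
  have lD: "A.lmod (\<Delta> l)" if "l \<in> \<Lambda>" for l using fg[OF that] by simp
  obtain P :: "'i \<Rightarrow> 'a umodule" where P: "\<forall>l\<in>\<Lambda>. fg_projective A (P l) \<and>
           (\<exists>(C :: 'a umodule) f g. short_exact A C f (P l) g (\<Delta> l) \<and>
              C \<in> filt A (twists R A {m \<in> \<Lambda>. l < m} \<Delta>))"
    and add: "add_cat A (dsum \<Lambda> P) = {X :: 'a umodule. fg_projective A X}"
    using sqh unfolding split_quasi_hereditary_def by blast
  have Pf: "A.lmod (P l)" "fg_module A (P l)" "A.summand {regular_module A} (P l)" if "l \<in> \<Lambda>" for l
    using A.fg_projective_summand[of "P l"] P that by auto
  have "\<exists>g. A.lin (P l) (\<Delta> l) g \<and> g ` carrier (P l) = carrier (\<Delta> l) \<and>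
      A.fchain (twists R A {m \<in> \<Lambda>. l < m} \<Delta>) (P l) {\<zero>\<^bsub>P l\<^esub>} {z \<in> carrier (P l). g z = \<zero>\<^bsub>\<Delta> l\<^esub>}"
    if l: "l \<in> \<Lambda>" for l
  proof -
    obtain C :: "'a umodule" and f g where se: "short_exact A C f (P l) g (\<Delta> l)"
      and C: "C \<in> filt A (twists R A {m \<in> \<Lambda>. l < m} \<Delta>)" using P l by blast
    have se': "A.lin C (P l) f" "A.lin (P l) (\<Delta> l) g" "inj_on f (carrier C)"
      "f ` carrier C = {z \<in> carrier (P l). g z = \<zero>\<^bsub>\<Delta> l\<^esub>}" "g ` carrier (P l) = carrier (\<Delta> l)"
      using se by (auto simp: short_exact_def A.mod_hom_iff mod_ker_def)
    have tw: "A.lmod X" if "X \<in> twists R A {m \<in> \<Lambda>. l < m} \<Delta>" for X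
      by (rule twist_facts[OF _ that]) (use lD in auto)
    have ch: "fg_module A C" "A.fchain (twists R A {m \<in> \<Lambda>. l < m} \<Delta>) C {\<zero>\<^bsub>C\<^esub>} (carrier C)"
      using C A.filt_iff_fchain[of "twists R A {m \<in> \<Lambda>. l < m} \<Delta>" C, OF tw] by auto
    have lC: "A.lmod C" using ch(1) by simp
    have ker: "{x \<in> carrier C. f x = \<zero>\<^bsub>P l\<^esub>} \<subseteq> {\<zero>\<^bsub>C\<^esub>}"
      using A.lin_inj_iff[OF se'(1) lC Pf(1)[OF l]] se'(3) by auto
    have "A.fchain (twists R A {m \<in> \<Lambda>. l < m} \<Delta>) (P l) (f ` {\<zero>\<^bsub>C\<^esub>}) (f ` carrier C)"
      by (rule A.fchain_map[OF ch(2) lC Pf(1)[OF l] A.subm_zero_set[OF lC] se'(1) ker tw])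
    then show ?thesis using se' A.lin_zero[OF se'(1) lC Pf(1)[OF l]] by auto
  qed
  then obtain \<pi> where \<pi>: "\<forall>l\<in>\<Lambda>. A.lin (P l) (\<Delta> l) (\<pi> l) \<and> \<pi> l ` carrier (P l) = carrier (\<Delta> l) \<and>
      A.fchain (twists R A {m \<in> \<Lambda>. l < m} \<Delta>) (P l) {\<zero>\<^bsub>P l\<^esub>} {z \<in> carrier (P l). \<pi> l z = \<zero>\<^bsub>\<Delta> l\<^esub>}"
    using bchoice[of \<Lambda> "\<lambda>l g. A.lin (P l) (\<Delta> l) g \<and> g ` carrier (P l) = carrier (\<Delta> l) \<and>
      A.fchain (twists R A {m \<in> \<Lambda>. l < m} \<Delta>) (P l) {\<zero>\<^bsub>P l\<^esub>} {z \<in> carrier (P l). g z = \<zero>\<^bsub>\<Delta> l\<^esub>}"] by blast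
  have "standard_modules R A \<Lambda> \<Delta> P \<pi>"
  proof (rule standard_modules.intro[OF algebra_modules_axioms], rule standard_modules_axioms.intro)
    show "finite \<Lambda>" by (rule fin)
    show "fg_module A (\<Delta> l)" if "l \<in> \<Lambda>" for l by (rule fg[OF that])
    show "Rproj (Rs (\<Delta> l))" if "l \<in> \<Lambda>" for l by (rule R.fg_projective_summand(3)[OF proj[OF that]])
    show "f x = \<zero>\<^bsub>\<Delta> m\<^esub>" if "l \<in> \<Lambda>" "m \<in> \<Lambda>" "A.lin (\<Delta> l) (\<Delta> m) f" "\<not> l \<le> m" "x \<in> carrier (\<Delta> l)" for l m f x
      by (rule trivial_hom_module[OF lD[OF that(1)] hom[OF that(1,2,4)] that(3,5)])
    show "\<exists>c\<in>carrier R. \<forall>x\<in>carrier (\<Delta> l). f x = scal c \<odot>\<^bsub>\<Delta> l\<^esub> x" if "l \<in> \<Lambda>" "A.lin (\<Delta> l) (\<Delta> l) f" for l f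
      by (rule scalar_endomorphisms[OF lD[OF that(1)] endo[OF that(1)] that(2)])
    show "fg_module A (P l)" "A.summand {regular_module A} (P l)" if "l \<in> \<Lambda>" for l using Pf[OF that] by auto
    show "A.lin (P l) (\<Delta> l) (\<pi> l)" "\<pi> l ` carrier (P l) = carrier (\<Delta> l)"
      "A.fchain (twists R A {m \<in> \<Lambda>. l < m} \<Delta>) (P l) {\<zero>\<^bsub>P l\<^esub>} {z \<in> carrier (P l). \<pi> l z = \<zero>\<^bsub>\<Delta> l\<^esub>}"
      if "l \<in> \<Lambda>" for l using \<pi> that by blast+
    show "A.summand (P ` \<Lambda>) (regular_module A)"
      by (rule A.generators_of_add_cat[OF fin Pf(1) eq_refl[OF add[symmetric]]])
  qed
  then show ?thesis by blast
qed

text \<open>The vanishing of \<open>Ext\<^sup>1\<close> is known for a presentation by a free module and is carried over to the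
  presentation by \<open>P l\<close>.\<close>

lemma (in standard_modules) costandard_modules_exist:
  fixes nabla :: "'i \<Rightarrow> ('a, 'e) module"
  assumes cs: "costandard R A \<Lambda> D nabla"
  shows "\<exists>\<iota>. costandard_modules R A \<Lambda> D P \<pi> nabla \<iota>"
proof -
  have fg: "\<And>l. l \<in> \<Lambda> \<Longrightarrow> fg_module A (nabla l)"
    and e: "\<And>l b i. \<lbrakk>l \<in> \<Lambda>; b \<in> \<Lambda>\<rbrakk> \<Longrightarrow> if i = 0 \<and> l = b then mod_iso R (Ext A i (D l) (nabla b)) (regular_module R)
        else carrier (Ext A i (D l) (nabla b)) = {\<zero>\<^bsub>Ext A i (D l) (nabla b)\<^esub>}"
    using cs unfolding costandard_def by blast+
  have lV: "A.lmod (nabla l)" if "l \<in> \<Lambda>" for l using fg[OF that] by simp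
  have E0: "mod_iso R (Ext A 0 (D l) (nabla l)) (regular_module R)" if "l \<in> \<Lambda>" for l using e[OF that that, of 0] by simp
  have E0': "carrier (Ext A 0 (D l) (nabla b)) = {\<zero>\<^bsub>Ext A 0 (D l) (nabla b)\<^esub>}" if "l \<in> \<Lambda>" "b \<in> \<Lambda>" "l \<noteq> b" for l b
    using e[OF that(1,2), of 0] that(3) by simp
  have E1: "carrier (Ext A 1 (D l) (nabla b)) = {\<zero>\<^bsub>Ext A 1 (D l) (nabla b)\<^esub>}" if "l \<in> \<Lambda>" "b \<in> \<Lambda>" for l b
    using e[OF that, of 1] by simp
  have "\<forall>l\<in>\<Lambda>. \<exists>\<iota>. A.lin (D l) (nabla l) \<iota> \<and>
      (\<forall>f. A.lin (D l) (nabla l) f \<longrightarrow> (\<exists>c\<in>carrier R. \<forall>x\<in>carrier (D l). f x = scal c \<odot>\<^bsub>nabla l\<^esub> \<iota> x)) \<and>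
      (\<forall>c\<in>carrier R. (\<forall>x\<in>carrier (D l). scal c \<odot>\<^bsub>nabla l\<^esub> \<iota> x = \<zero>\<^bsub>nabla l\<^esub>) \<longrightarrow> c = \<zero>\<^bsub>R\<^esub>)"
    using Ext0_unit[OF D_fg lV E0] by simp
  from bchoice[OF this] obtain \<iota> where \<iota>: "\<forall>l\<in>\<Lambda>. A.lin (D l) (nabla l) (\<iota> l) \<and>
      (\<forall>f. A.lin (D l) (nabla l) f \<longrightarrow> (\<exists>c\<in>carrier R. \<forall>x\<in>carrier (D l). f x = scal c \<odot>\<^bsub>nabla l\<^esub> \<iota> l x)) \<and>
      (\<forall>c\<in>carrier R. (\<forall>x\<in>carrier (D l). scal c \<odot>\<^bsub>nabla l\<^esub> \<iota> l x = \<zero>\<^bsub>nabla l\<^esub>) \<longrightarrow> c = \<zero>\<^bsub>R\<^esub>)" by (rule exE)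
  have "costandard_modules R A \<Lambda> D P \<pi> nabla \<iota>"
  proof (rule costandard_modules.intro[OF standard_modules_axioms], rule costandard_modules_axioms.intro)
    show "fg_module A (nabla l)" if "l \<in> \<Lambda>" for l by (rule fg[OF that])
    show "f x = \<zero>\<^bsub>nabla m\<^esub>" if "l \<in> \<Lambda>" "m \<in> \<Lambda>" "l \<noteq> m" "A.lin (D l) (nabla m) f" "x \<in> carrier (D l)" for l m f x
      by (rule Ext0_zero[OF D_fg[OF that(1)] lV[OF that(2)] E0'[OF that(1-3)] that(4,5)])
    show "A.lin (D l) (nabla l) (\<iota> l)" if "l \<in> \<Lambda>" for l using \<iota> that by blast
    show "\<exists>c\<in>carrier R. \<forall>x\<in>carrier (D l). f x = scal c \<odot>\<^bsub>nabla l\<^esub> \<iota> l x" if "l \<in> \<Lambda>" "A.lin (D l) (nabla l) f" for l f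
      using \<iota> that by blast
    show "c = \<zero>\<^bsub>R\<^esub>" if "l \<in> \<Lambda>" "c \<in> carrier R" "\<forall>x\<in>carrier (D l). scal c \<odot>\<^bsub>nabla l\<^esub> \<iota> l x = \<zero>\<^bsub>nabla l\<^esub>" for l c
      using \<iota> that by blast
    show "ext_vanishes l (nabla m)" if l: "l \<in> \<Lambda>" and m: "m \<in> \<Lambda>" for l m
    proof -
      obtain n e where F: "A.lin (free_module A n) (D l) e" "e ` carrier (free_module A n) = carrier (D l)"
        "\<forall>h. A.lin (free_module A n \<restriction> {x \<in> carrier (free_module A n). e x = \<zero>\<^bsub>D l\<^esub>}) (nabla m) h \<longrightarrow>
        (\<exists>g. A.lin (free_module A n) (nabla m) g \<and> (\<forall>x\<in>carrier (free_module A n). e x = \<zero>\<^bsub>D l\<^esub> \<longrightarrow> g x = h x))"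
        using Ext1_zero[OF D_fg[OF l] lV[OF m] E1[OF l m]] by blast
      have "\<exists>g. A.lin (P l) (nabla m) g \<and> (\<forall>x\<in>carrier (P l). \<pi> l x = \<zero>\<^bsub>D l\<^esub> \<longrightarrow> g x = h x)"
        if "A.lin (P l \<restriction> K l) (nabla m) h" for h
        by (rule extension_independent[OF D_lmod[OF l] lV[OF m] A.lmod_free A.summand_power[OF A.lmod_regular] F(1,2)
              P_lmod[OF l] P_proj[OF l] \<pi>_lin[OF l] \<pi>_surj[OF l] F(3)]) (use that in \<open>simp add: K_def\<close>)
      then show ?thesis unfolding ext_vanishes_def by (simp add: K_def) blast
    qed
  qed
  then show ?thesis by blast
qed

theorem proposition4p5:
  fixes R :: "('r, 'x) ring_scheme"
    and A :: "('r, 'a) module"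
    and \<Lambda> :: "'i::order set"
    and \<Delta> :: "'i \<Rightarrow> ('a, 'd) module"
    and nabla :: "'i \<Rightarrow> ('a, 'e) module"
  assumes "cring R"
    and "noetherian_ring R"
    and "split_quasi_hereditary R A \<Lambda> \<Delta>"
    and "costandard R A \<Lambda> \<Delta> nabla"
  shows "(\<forall>M :: ('a, 'm) module. M \<in> filt A (twists R A \<Lambda> \<Delta>) \<longrightarrow>
            (\<exists>(T :: 'a umodule) i.
               partial_tilting R A \<Lambda> \<Delta> nabla T \<and>
               i \<in> mod_hom A M T \<and> inj_on i (carrier M) \<and>
               quotient_module T (i ` carrier M) \<in> filt A (\<Delta> ` \<Lambda>)))
       \<and> (\<forall>l\<in>\<Lambda>. \<exists>(T :: 'a umodule) (X :: 'a umodule) (Y :: 'a umodule) f g h k.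
            partial_tilting R A \<Lambda> \<Delta> nabla T \<and>
            short_exact A (\<Delta> l) f T g X \<and>
            short_exact A Y h T k (nabla l) \<and>
            X \<in> filt A (\<Delta> ` {m \<in> \<Lambda>. m < l}) \<and>
            Y \<in> filt A (twists R A {m \<in> \<Lambda>. m < l} nabla))"
proof -
  obtain P \<pi> where "standard_modules R A \<Lambda> \<Delta> P \<pi>"
    using standard_modules_exist[OF assms(3)] by blast
  then obtain \<iota> where "costandard_modules R A \<Lambda> \<Delta> P \<pi> nabla \<iota>"
    using standard_modules.costandard_modules_exist[OF _ assms(4)] by blast
  then interpret costandard_modules R A \<Lambda> \<Delta> P \<pi> nabla \<iota> .
  show ?thesis using tilting_embedding tilting_of_weight by blast
qed

end
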